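(* Let $(W,S)$ be an irreducible Coxeter group of finite rank. Then all irreducible complex representations of $W$ are of finite dimension if and only if $W$ is a finite group or an affine Weyl group.
   Context: For a Coxeter group $(W,S)$ and $s,t\in S$, $m_{st}\in\mathbb{Z}_{\ge 1}\cup\{\infty\}$ denotes the order of $st$. The Coxeter graph has vertex set $S$ and an edge $\{s,t\}$ (labelled by $m_{st}$) whenever $m_{st}\ge 3$. $(W,S)$ is irreducible of finite rank if its Coxeter graph is connected and $|S|<\infty$. A representation of $W$ is a complex vector space (possibly infinite dimensional) with a linear action of the abstract group $W$; it is irreducible if it is nonzero and has no subrepresentations other than $0$ and itself. *)

theory Defs
  imports
    Complex_Main
    "HOL-Algebra.Bij"
    "HOL-Algebra.Multiplicative_Group"
    "HOL-Algebra.Generated_Groups"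
    "HOL-Library.Extended_Nat"
    "Jordan_Normal_Form.VS_Connect"
begin

section \<open>Coxeter groups\<close>

(* group.ord is 0 for an element of infinite order. *)
definition coxeter_m :: "('w, 'b) monoid_scheme \<Rightarrow> 'w \<Rightarrow> 'w \<Rightarrow> enat" where
  "coxeter_m W s t =
     (let k = group.ord W (s \<otimes>\<^bsub>W\<^esub> t) in if k = 0 then \<infinity> else enat k)"

(* The congruence on the free monoid of words over S generated by (st)^m(s,t) = 1, for all
   s, t in S with m(s,t) finite.  For involutions s the case s = t is the relation ss = 1, so
   the quotient is the group presented by these relations: each letter is its own inverse. *)
inductive coxeter_eq :: "('w, 'b) monoid_scheme \<Rightarrow> 'w set \<Rightarrow> 'w list \<Rightarrow> 'w list \<Rightarrow> bool"
  for W S where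
  refl: "w \<in> lists S \<Longrightarrow> coxeter_eq W S w w"
| sym: "coxeter_eq W S v w \<Longrightarrow> coxeter_eq W S w v"
| trans: "coxeter_eq W S u v \<Longrightarrow> coxeter_eq W S v w \<Longrightarrow> coxeter_eq W S u w"
| rel: "u \<in> lists S \<Longrightarrow> v \<in> lists S \<Longrightarrow> s \<in> S \<Longrightarrow> t \<in> S \<Longrightarrow> coxeter_m W s t = enat k
    \<Longrightarrow> coxeter_eq W S (u @ concat (replicate k [s, t]) @ v) (u @ v)"

definition word_prod :: "('w, 'b) monoid_scheme \<Rightarrow> 'w list \<Rightarrow> 'w" where
  "word_prod W w = foldr (\<lambda>x y. x \<otimes>\<^bsub>W\<^esub> y) w \<one>\<^bsub>W\<^esub>"

(* W is generated by the set S of involutions, and is presented on S by the relations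
   (st)^m(s,t) = 1: every word that is trivial in W is trivial modulo these relations. *)
definition coxeter_group :: "('w, 'b) monoid_scheme \<Rightarrow> 'w set \<Rightarrow> bool" where
  "coxeter_group W S \<longleftrightarrow>
     group W \<and> S \<subseteq> carrier W \<and> generate W S = carrier W \<and>
     (\<forall>s\<in>S. s \<noteq> \<one>\<^bsub>W\<^esub> \<and> s \<otimes>\<^bsub>W\<^esub> s = \<one>\<^bsub>W\<^esub>) \<and>
     (\<forall>w\<in>lists S. word_prod W w = \<one>\<^bsub>W\<^esub> \<longrightarrow> coxeter_eq W S w [])"

definition coxeter_edges :: "('w, 'b) monoid_scheme \<Rightarrow> 'w set \<Rightarrow> ('w \<times> 'w) set" where
  "coxeter_edges W S = {(s, t). s \<in> S \<and> t \<in> S \<and> s \<noteq> t \<and> 3 \<le> coxeter_m W s t}"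

definition irreducible_finite_rank :: "('w, 'b) monoid_scheme \<Rightarrow> 'w set \<Rightarrow> bool" where
  "irreducible_finite_rank W S \<longleftrightarrow>
     finite S \<and> (\<forall>s\<in>S. \<forall>t\<in>S. (s, t) \<in> (coxeter_edges W S)\<^sup>*)"

section \<open>Affine Weyl groups\<close>

(* The reflection of R^n in the affine hyperplane (x, a) = k.  It is extensional, so that it is
   an element of BijGroup (carrier_vec n). *)
definition aff_refl :: "nat \<Rightarrow> real vec \<Rightarrow> int \<Rightarrow> real vec \<Rightarrow> real vec" where
  "aff_refl n a k =
     (\<lambda>x\<in>carrier_vec n. x - (2 * (x \<bullet> a - of_int k) / (a \<bullet> a)) \<cdot>\<^sub>v a)"

(* A reduced crystallographic root system spanning the Euclidean space R^n. *)
definition root_system :: "nat \<Rightarrow> real vec set \<Rightarrow> bool" where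
  "root_system n R \<longleftrightarrow>
     finite R \<and> R \<subseteq> carrier_vec n \<and> 0\<^sub>v n \<notin> R \<and>
     LinearCombinations.module.span class_ring (module_vec TYPE(real) n) R = carrier_vec n \<and>
     (\<forall>a\<in>R. \<forall>c. c \<cdot>\<^sub>v a \<in> R \<longleftrightarrow> c = 1 \<or> c = - 1) \<and>
     (\<forall>a\<in>R. \<forall>b\<in>R. aff_refl n a 0 b \<in> R) \<and>
     (\<forall>a\<in>R. \<forall>b\<in>R. 2 * (b \<bullet> a) / (a \<bullet> a) \<in> \<int>)"

definition irreducible_root_system :: "nat \<Rightarrow> real vec set \<Rightarrow> bool" where
  "irreducible_root_system n R \<longleftrightarrow>
     root_system n R \<and> R \<noteq> {} \<and>
     \<not> (\<exists>A B. A \<noteq> {} \<and> B \<noteq> {} \<and> A \<union> B = R \<and> (\<forall>a\<in>A. \<forall>b\<in>B. a \<bullet> b = 0))"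

definition simple_roots :: "nat \<Rightarrow> real vec set \<Rightarrow> real vec set \<Rightarrow> bool" where
  "simple_roots n R D \<longleftrightarrow>
     D \<subseteq> R \<and> vectorspace.basis class_ring (module_vec TYPE(real) n) D \<and>
     (\<forall>b\<in>R. \<exists>c :: real vec \<Rightarrow> int.
        ((\<forall>a\<in>D. 0 \<le> c a) \<or> (\<forall>a\<in>D. c a \<le> 0)) \<and>
        b = LinearCombinations.module.lincomb (module_vec TYPE(real) n) (\<lambda>a. of_int (c a)) D)"

definition highest_root :: "nat \<Rightarrow> real vec set \<Rightarrow> real vec set \<Rightarrow> real vec \<Rightarrow> bool" where
  "highest_root n R D h \<longleftrightarrow>
     h \<in> R \<and>
     (\<forall>b\<in>R. \<exists>c :: real vec \<Rightarrow> nat.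
        h - b = LinearCombinations.module.lincomb (module_vec TYPE(real) n) (\<lambda>a. of_nat (c a)) D)"

definition affine_weyl_group_of ::
  "nat \<Rightarrow> real vec set \<Rightarrow> (real vec \<Rightarrow> real vec) monoid" where
  "affine_weyl_group_of n R =
     (BijGroup (carrier_vec n))
       \<lparr>carrier := generate (BijGroup (carrier_vec n)) {aff_refl n a k | a k. a \<in> R}\<rparr>"

(* The reflections in the walls of the fundamental alcove
   {x. (x, a) > 0 for a in D, and (x, h) < 1}, where h is the highest root. *)
definition affine_simple_reflections ::
  "nat \<Rightarrow> real vec set \<Rightarrow> real vec \<Rightarrow> (real vec \<Rightarrow> real vec) set" where
  "affine_simple_reflections n D h = insert (aff_refl n h 1) ((\<lambda>a. aff_refl n a 0) ` D)"

(* The pair (W, S) is, up to isomorphism of Coxeter groups, the affine Weyl group of an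
   irreducible root system with its standard Coxeter generators. *)
definition affine_weyl :: "('w, 'b) monoid_scheme \<Rightarrow> 'w set \<Rightarrow> bool" where
  "affine_weyl W S \<longleftrightarrow>
     (\<exists>n R D h. irreducible_root_system n R \<and> simple_roots n R D \<and> highest_root n R D h \<and>
        (\<exists>f \<in> iso W (affine_weyl_group_of n R). f ` S = affine_simple_reflections n D h))"

section \<open>Complex representations\<close>

(* HOL cannot quantify over all complex vector spaces inside a formula.  The spaces considered
   below are the subspaces V (finite or infinite dimensional, V = UNIV included) of a complex
   vector space, given by its scalar multiplication on the type 'v.  In a statement that is
   polymorphic in 'v and in the scalar multiplication and only requires the space on 'v to be
   infinite dimensional, no representation is lost: an infinite-dimensional space can itself be
   taken as the space on 'v; and an irreducible representation of a finitely generated group is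
   spanned by the orbit of one vector, so it has countable dimension and is isomorphic to one on
   a subspace of any given infinite-dimensional space. *)

definition finite_dim :: "(complex \<Rightarrow> 'v::ab_group_add \<Rightarrow> 'v) \<Rightarrow> 'v set \<Rightarrow> bool" where
  "finite_dim scale V \<longleftrightarrow> (\<exists>B. finite B \<and> Modules.module.span scale B = V)"

definition representation ::
  "('w, 'b) monoid_scheme \<Rightarrow> (complex \<Rightarrow> 'v::ab_group_add \<Rightarrow> 'v) \<Rightarrow> 'v set
    \<Rightarrow> ('w \<Rightarrow> 'v \<Rightarrow> 'v) \<Rightarrow> bool" where
  "representation W scale V \<rho> \<longleftrightarrow>
     Modules.module.subspace scale V \<and>
     (\<forall>g\<in>carrier W. \<forall>x\<in>V. \<rho> g x \<in> V) \<and>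
     (\<forall>g\<in>carrier W. \<forall>x\<in>V. \<forall>y\<in>V. \<rho> g (x + y) = \<rho> g x + \<rho> g y) \<and>
     (\<forall>g\<in>carrier W. \<forall>c. \<forall>x\<in>V. \<rho> g (scale c x) = scale c (\<rho> g x)) \<and>
     (\<forall>x\<in>V. \<rho> \<one>\<^bsub>W\<^esub> x = x) \<and>
     (\<forall>g\<in>carrier W. \<forall>h\<in>carrier W. \<forall>x\<in>V. \<rho> (g \<otimes>\<^bsub>W\<^esub> h) x = \<rho> g (\<rho> h x))"

definition irreducible_representation ::
  "('w, 'b) monoid_scheme \<Rightarrow> (complex \<Rightarrow> 'v::ab_group_add \<Rightarrow> 'v) \<Rightarrow> 'v set
    \<Rightarrow> ('w \<Rightarrow> 'v \<Rightarrow> 'v) \<Rightarrow> bool" where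
  "irreducible_representation W scale V \<rho> \<longleftrightarrow>
     representation W scale V \<rho> \<and> V \<noteq> {0} \<and>
     (\<forall>U. U \<subseteq> V \<longrightarrow> Modules.module.subspace scale U \<longrightarrow> (\<forall>g\<in>carrier W. \<forall>x\<in>U. \<rho> g x \<in> U)
        \<longrightarrow> U = {0} \<or> U = V)"

end

(* W acts on V = R^S by reflections that preserve a bilinear form B.  By Perron-Frobenius the
   lowest eigenvalue m of the Gram matrix has a positive eigenvector.

   m > 0: the form is positive definite, there are finitely many roots and W is finite.
   m = 0: the eigenvector d spans the radical of B, the roots are translates of finitely many
   directions by multiples of d, and after rescaling W is an affine Weyl group.  It is virtually
   abelian, and by Dixmier's form of Schur's lemma commuting operators on an irreducible module of
   countable dimension have an eigenvector, so all irreducible representations are finite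
   dimensional.
   m < 0: there is a hyperbolic element, and from it three roots with pairwise products below -1.
   By ping-pong the reflections in these roots generate a free product of three groups of order
   two.  A matrix coefficient of an infinite-dimensional irreducible representation of this
   subgroup, extended by zero to W, defines a cyclic module over the group algebra of W, every
   irreducible quotient of which is infinite dimensional. *)
theory Submission
  imports
    Defs
    "HOL-Analysis.Function_Topology"
    "HOL-Library.Function_Algebras"
    "HOL-Computational_Algebra.Fundamental_Theorem_Algebra"
    "HOL-Analysis.Continuum_Not_Denumerable"
begin

section \<open>The geometric representation\<close>

text \<open>No classification of Coxeter graphs enters; the engine is the sign rule for roots. As
  the coordinates of a root share one sign, an element that moves each simple root by less than 1 in
  its own coordinate is the identity. Hence a bounded set of roots is finite, and this discreteness
  is used for every sign of \<open>m\<close>.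

  Roots of the geometric representation have length one, and no lattice is given with them. In the
  affine case the roots parallel to a root \<open>b\<close> are evenly spaced along the radical, and
  dividing \<open>b\<close> by its spacing is what makes the Cartan numbers integral. The standard
  generators also require a node with coefficient one in the rescaled radical vector; it is found
  from a point that lies on reflection hyperplanes of every direction.

  In the indefinite case the free product may have infinite index, and an induced representation
  need not be irreducible. Therefore only a few relations of one cyclic vector are kept: an
  involution negates it and fixes suitable translates of it. They pass to every quotient in which
  the vector survives, and they force infinitely many translates to be independent.\<close>

instantiation "fun" :: (type, real_vector) real_vector
begin
definition "scaleR_fun c f = (\<lambda>x. c *\<^sub>R f x)"
instance by standard (simp_all add: scaleR_fun_def fun_eq_iff algebra_simps)
end

lemma scaleR_fun_apply [simp]: "(c *\<^sub>R f) x = c *\<^sub>R f x"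
  by (simp add: scaleR_fun_def)

text \<open>\<open>cheb c n\<close> is the Chebyshev polynomial of the second kind of degree
  \<open>n - 1\<close> at \<open>c\<close>. With \<open>c = - bcoef s t\<close> its values are the
  coordinates of roots in the plane of \<open>\<alpha> s\<close> and \<open>\<alpha> t\<close>. The
  recurrence also covers \<open>c = 1\<close>, where the quotient of sines degenerates.\<close>

fun cheb :: "real \<Rightarrow> nat \<Rightarrow> real" where
  "cheb c 0 = 0"
| "cheb c (Suc 0) = 1"
| "cheb c (Suc (Suc n)) = 2 * c * cheb c (Suc n) - cheb c n"

lemma cheb_one: "cheb 1 n = real n"
  by (induction "1::real" n rule: cheb.induct) auto

lemma sin_cheb: "sin \<theta> * cheb (cos \<theta>) n = sin (real n * \<theta>)"
proof (induction "cos \<theta>" n rule: cheb.induct)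
  case (3 n)
  have "sin (real (Suc (Suc n)) * \<theta>) + sin (real n * \<theta>) = 2 * cos \<theta> * sin (real (Suc n) * \<theta>)"
  proof -
    have 1: "real (Suc (Suc n)) * \<theta> = real (Suc n) * \<theta> + \<theta>" "real n * \<theta> = real (Suc n) * \<theta> - \<theta>"
      by (simp_all add: algebra_simps)
    show ?thesis unfolding 1 sin_add sin_diff by (simp add: algebra_simps)
  qed
  then show ?case using 3 by (simp add: algebra_simps)
qed auto

text \<open>Described from the right end because the last letter of a word acts first; a nonempty
  word of this kind ends in \<open>t\<close>.\<close>

fun alt_word :: "nat \<Rightarrow> 'a \<Rightarrow> 'a \<Rightarrow> 'a list" where
  "alt_word 0 s t = []"
| "alt_word (Suc k) s t = alt_word k t s @ [t]"

lemma length_alt_word [simp]: "length (alt_word k s t) = k"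
  by (induction k s t rule: alt_word.induct) auto

lemma set_alt_word: "set (alt_word k s t) \<subseteq> {s, t}"
  by (induction k s t rule: alt_word.induct) auto

lemma alt_word_double: "alt_word (2 * m) s t = concat (replicate m [s, t])"
proof (induction m)
  case (Suc m)
  have "concat (replicate (Suc m) [s, t]) = concat (replicate m [s, t] @ [[s, t]])"
    by (simp only: replicate_append_same[symmetric] replicate_Suc)
  then show ?case using Suc by simp
qed simp

lemma alt_word_add: "alt_word (j + k) s t = (if even k then alt_word j s t else alt_word j t s) @ alt_word k s t"
  by (induction k arbitrary: s t) auto

lemma eq_alt_word:
  assumes "set w \<subseteq> {s, t}" "s \<noteq> t" "w \<noteq> [] \<Longrightarrow> last w = t"
    and "\<And>u x v. w \<noteq> u @ [x, x] @ v"
  shows "w = alt_word (length w) s t"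
  using assms
proof (induction w arbitrary: s t rule: rev_induct)
  case (snoc x w)
  have x: "x = t" using snoc.prems(3) by simp
  have "last w = s" if "w \<noteq> []"
  proof -
    have "last w \<in> {s, t}" using snoc.prems(1) last_in_set[OF that] by auto
    moreover have "last w \<noteq> t"
    proof
      assume "last w = t"
      then have "w @ [x] = butlast w @ [t, t] @ []" using x that append_butlast_last_id[OF that] by simp
      then show False using snoc.prems(4) by blast
    qed
    ultimately show ?thesis by blast
  qed
  moreover have "w \<noteq> u @ [y, y] @ v" for u y v
    using snoc.prems(4)[of u y "v @ [x]"] by auto
  ultimately have "w = alt_word (length w) t s"
    using snoc.IH[of t s] snoc.prems(1,2) by auto
  then show ?case using x by simp
qed auto

locale coxeter_system =
  fixes W :: "('w, 'b) monoid_scheme" (structure) and S :: "'w set"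
  assumes coxeter: "coxeter_group W S" and finite_S: "finite S"
begin

sublocale group W using coxeter unfolding coxeter_group_def by blast

lemma S_carrier: "s \<in> S \<Longrightarrow> s \<in> carrier W"
  using coxeter unfolding coxeter_group_def by blast

lemma S_square: "s \<in> S \<Longrightarrow> s \<otimes> s = \<one>" and S_not_one: "s \<in> S \<Longrightarrow> s \<noteq> \<one>"
  using coxeter unfolding coxeter_group_def by blast+

lemma S_inv: "s \<in> S \<Longrightarrow> inv s = s"
  using S_square S_carrier inv_equality by blast

lemma word_prod_Nil [simp]: "word_prod W [] = \<one>"
  and word_prod_Cons [simp]: "word_prod W (s # w) = s \<otimes> word_prod W w"
  by (simp_all add: word_prod_def)

lemma word_prod_closed [simp]: "w \<in> lists S \<Longrightarrow> word_prod W w \<in> carrier W"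
  by (induction w) (auto simp: S_carrier)

lemma word_prod_append: "u \<in> lists S \<Longrightarrow> v \<in> lists S \<Longrightarrow>
    word_prod W (u @ v) = word_prod W u \<otimes> word_prod W v"
  by (induction u) (auto simp: S_carrier m_assoc)

lemma word_prod_rev: "w \<in> lists S \<Longrightarrow> word_prod W (rev w) = inv (word_prod W w)"
  by (induction w) (auto simp: word_prod_append inv_mult_group S_inv S_carrier lists_eq_set)

lemma ex_word:
  assumes "g \<in> carrier W"
  shows "\<exists>w\<in>lists S. word_prod W w = g"
proof -
  have "g \<in> generate W S" using assms coxeter unfolding coxeter_group_def by blast
  then show ?thesis
  proof induction
    case one then show ?case by (intro bexI[of _ "[]"]) auto
  next
    case (incl h) then show ?case by (intro bexI[of _ "[h]"]) (auto simp: S_carrier)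
  next
    case (inv h) then show ?case by (intro bexI[of _ "[h]"]) (auto simp: S_carrier S_inv)
  next
    case (eng h1 h2)
    then obtain u v where "u \<in> lists S" "v \<in> lists S" "word_prod W u = h1" "word_prod W v = h2" by blast
    then show ?case by (intro bexI[of _ "u @ v"]) (auto simp: word_prod_append)
  qed
qed

lemma m_sym: "s \<in> S \<Longrightarrow> t \<in> S \<Longrightarrow> coxeter_m W s t = coxeter_m W t s"
proof -
  assume a: "s \<in> S" "t \<in> S"
  then have "inv (s \<otimes> t) = t \<otimes> s" by (simp add: inv_mult_group S_inv S_carrier)
  then have "ord (s \<otimes> t) = ord (t \<otimes> s)" using ord_inv[of "s \<otimes> t"] a by (simp add: S_carrier)
  then show ?thesis by (simp add: coxeter_m_def)
qed

lemma m_refl: "s \<in> S \<Longrightarrow> coxeter_m W s s = 1"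
  by (simp add: coxeter_m_def S_square one_enat_def)

lemma m_eq_enat: "coxeter_m W s t = enat k \<Longrightarrow> k \<noteq> 0 \<and> ord (s \<otimes> t) = k"
  by (auto simp: coxeter_m_def Let_def split: if_splits)

lemma m_ge_2:
  assumes "s \<in> S" "t \<in> S" "s \<noteq> t" "coxeter_m W s t = enat k"
  shows "2 \<le> k"
proof (rule ccontr)
  assume "\<not> 2 \<le> k"
  then have "ord (s \<otimes> t) = 1" using m_eq_enat[OF assms(4)] by linarith
  then have "s \<otimes> t = \<one>" using ord_eq_1 assms by (auto simp: S_carrier)
  then have "s = inv t" using assms inv_equality S_carrier by metis
  then show False using assms S_inv by simp
qed

lemma pow_concat: "s \<in> S \<Longrightarrow> t \<in> S \<Longrightarrow> word_prod W (concat (replicate k [s, t])) = (s \<otimes> t) [^] k"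
proof (induction k)
  case (Suc k)
  then have "(s \<otimes> t) [^] Suc k = (s \<otimes> t) \<otimes> (s \<otimes> t) [^] k"
    by (metis S_carrier m_closed nat_pow_Suc2)
  then show ?case using Suc by (simp add: m_assoc S_carrier)
qed simp

text \<open>The braid relation: \<open>(st)^k = 1\<close> is cut in the middle into two alternating
  words of length \<open>k\<close>, so one half inverts the other, and reversing a half inverts it
  as well.\<close>

lemma word_prod_alt:
  assumes "s \<in> S" "t \<in> S" "coxeter_m W s t = enat k"
  shows "word_prod W (alt_word k s t) = word_prod W (alt_word k t s)"
proof -
  have l: "alt_word j s t \<in> lists S" "alt_word j t s \<in> lists S" for j
    using set_alt_word[of j s t] set_alt_word[of j t s] assms by auto
  have rev_alt: "word_prod W (alt_word j t s) = inv (word_prod W (if even j then alt_word j s t else alt_word j t s))"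
    if "s \<in> S" "t \<in> S" for j and s t :: 'w
  proof -
    have "rev (alt_word j t s) = (if even j then alt_word j s t else alt_word j t s)" for j and s t :: 'w
    proof (induction j arbitrary: s t)
      case (Suc j)
      have "alt_word (1 + j) t s = (if even j then alt_word 1 t s else alt_word 1 s t) @ alt_word j t s"
        by (rule alt_word_add)
      moreover have "alt_word (1 + j) s t = (if even j then alt_word 1 s t else alt_word 1 t s) @ alt_word j s t"
        by (rule alt_word_add)
      ultimately show ?case using Suc.IH[of t s] Suc.IH[of s t] by auto
    qed simp
    then have "alt_word j t s = rev (if even j then alt_word j s t else alt_word j t s)"
      by (metis rev_rev_ident)
    moreover have "(if even j then alt_word j s t else alt_word j t s) \<in> lists S"
      using set_alt_word[of j s t] set_alt_word[of j t s] that by auto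
    ultimately show ?thesis by (metis word_prod_rev)
  qed
  have "\<one> = word_prod W (alt_word (2 * k) s t)"
    using assms m_eq_enat by (metis alt_word_double pow_concat pow_ord_eq_1 S_carrier m_closed)
  also have "\<dots> = word_prod W (if even k then alt_word k s t else alt_word k t s) \<otimes> word_prod W (alt_word k s t)"
    using l by (auto simp: mult_2 alt_word_add word_prod_append)
  finally have *: "inv (word_prod W (alt_word k s t)) = word_prod W (if even k then alt_word k s t else alt_word k t s)"
    using l by (intro inv_equality) auto
  show ?thesis
  proof (cases "even k")
    case True
    show ?thesis using * rev_alt[OF assms(1,2), of k] unfolding if_P[OF True] by argo
  next
    case False
    have "word_prod W (alt_word k t s) = inv (inv (word_prod W (alt_word k s t)))"
      using * rev_alt[OF assms(1,2), of k] unfolding if_not_P[OF False] by argo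
    then show ?thesis using l inv_inv word_prod_closed by metis
  qed
qed

section \<open>The geometric representation\<close>

text \<open>The Gram matrix of the Tits form, chosen so that two walls meet at the angle
  \<open>pi / m\<close>; the value -1 for infinite order is the limit of
  \<open>- cos (pi / m)\<close>.\<close>

definition bcoef :: "'w \<Rightarrow> 'w \<Rightarrow> real" where
  "bcoef s t = (case coxeter_m W s t of enat m \<Rightarrow> - cos (pi / real m) | \<infinity> \<Rightarrow> - 1)"

definition B :: "('w \<Rightarrow> real) \<Rightarrow> ('w \<Rightarrow> real) \<Rightarrow> real" where
  "B x y = (\<Sum>s\<in>S. \<Sum>t\<in>S. x s * y t * bcoef s t)"

definition \<alpha> :: "'w \<Rightarrow> 'w \<Rightarrow> real" where
  "\<alpha> s = (\<lambda>t. if t = s then 1 else 0)"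

text \<open>A reflection only when \<open>B b b = 1\<close>. No division by \<open>B b b\<close>
  appears because the vectors reflected in are roots, which have length one.\<close>

definition refl :: "('w \<Rightarrow> real) \<Rightarrow> ('w \<Rightarrow> real) \<Rightarrow> ('w \<Rightarrow> real)" where
  "refl b x = x - (2 * B x b) *\<^sub>R b"

definition V :: "('w \<Rightarrow> real) set" where
  "V = {x. \<forall>s. s \<notin> S \<longrightarrow> x s = 0}"

lemma bcoef_sym: "s \<in> S \<Longrightarrow> t \<in> S \<Longrightarrow> bcoef s t = bcoef t s"
  by (simp add: bcoef_def m_sym)

lemma bcoef_refl: "s \<in> S \<Longrightarrow> bcoef s s = 1"
  by (simp add: bcoef_def m_refl one_enat_def)

lemma bcoef_bounds: "s \<in> S \<Longrightarrow> t \<in> S \<Longrightarrow> s \<noteq> t \<Longrightarrow> - 1 \<le> bcoef s t \<and> bcoef s t \<le> 0"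
proof -
  assume a: "s \<in> S" "t \<in> S" "s \<noteq> t"
  have "0 \<le> cos (pi / real m)" if "coxeter_m W s t = enat m" for m
  proof (rule cos_ge_zero)
    show "pi / real m \<le> pi / 2" using m_ge_2[OF a that] by (intro divide_left_mono) auto
    have "0 \<le> pi / real m" by simp
    then show "- (pi / 2) \<le> pi / real m" using pi_ge_zero by linarith
  qed
  then show ?thesis by (auto simp: bcoef_def split: enat.splits)
qed

lemma B_add_left [simp]: "B (x + y) z = B x z + B y z"
  and B_add_right [simp]: "B z (x + y) = B z x + B z y"
  and B_scale_left [simp]: "B (c *\<^sub>R x) z = c * B x z"
  and B_scale_right [simp]: "B z (c *\<^sub>R x) = c * B z x"
  by (simp_all add: B_def algebra_simps sum.distrib sum_distrib_left)

lemma B_diff_left [simp]: "B (x - y) z = B x z - B y z"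
  and B_diff_right [simp]: "B z (x - y) = B z x - B z y"
  and B_minus_left [simp]: "B (- x) z = - B x z"
  and B_minus_right [simp]: "B z (- x) = - B z x"
  and B_zero_left [simp]: "B 0 z = 0"
  and B_zero_right [simp]: "B z 0 = 0"
  by (simp_all add: B_def algebra_simps sum_subtractf sum_negf)

lemma B_sym: "B x y = B y x"
proof -
  have "B x y = (\<Sum>s\<in>S. \<Sum>t\<in>S. y t * x s * bcoef t s)"
    unfolding B_def by (intro sum.cong) (auto simp: bcoef_sym)
  also have "\<dots> = B y x" unfolding B_def by (rule sum.swap)
  finally show ?thesis .
qed

lemma B_alpha_right: "t \<in> S \<Longrightarrow> B x (\<alpha> t) = (\<Sum>s\<in>S. x s * bcoef s t)"
proof -
  assume t: "t \<in> S"
  have "(\<Sum>t'\<in>S. x s * \<alpha> t t' * bcoef s t') = x s * bcoef s t" for s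
  proof -
    have "(\<Sum>t'\<in>S. x s * \<alpha> t t' * bcoef s t') = (\<Sum>t'\<in>S. if t' = t then x s * bcoef s t else 0)"
      by (intro sum.cong) (auto simp: \<alpha>_def)
    then show ?thesis using t finite_S by simp
  qed
  then show ?thesis by (simp add: B_def)
qed

lemma B_alpha: "s \<in> S \<Longrightarrow> t \<in> S \<Longrightarrow> B (\<alpha> s) (\<alpha> t) = bcoef s t"
proof -
  assume a: "s \<in> S" "t \<in> S"
  then have "B (\<alpha> s) (\<alpha> t) = (\<Sum>s'\<in>S. if s' = s then bcoef s t else 0)"
    unfolding B_alpha_right[OF a(2)] by (intro sum.cong) (auto simp: \<alpha>_def)
  then show ?thesis using a finite_S by simp
qed

lemma B_sum_left: "B (sum f A) y = (\<Sum>i\<in>A. B (f i) y)"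
proof (induction A rule: infinite_finite_induct)
  case (insert i A)
  have "B (sum f (insert i A)) y = (\<Sum>i\<in>insert i A. B (f i) y)" using insert by simp
  then show ?case .
next
  case (infinite A)
  then have "B (sum f A) y = (\<Sum>i\<in>A. B (f i) y)" by simp
  then show ?case .
next
  case empty
  have "B (sum f {}) y = (\<Sum>i\<in>{}. B (f i) y)" by simp
  then show ?case .
qed

lemma B_sum_right: "B y (sum f A) = (\<Sum>i\<in>A. B y (f i))"
  using B_sum_left[of f A y] by (simp add: B_sym[of y])

lemma V_expand: "x \<in> V \<Longrightarrow> x = (\<Sum>s\<in>S. x s *\<^sub>R \<alpha> s)"
proof
  fix t assume x: "x \<in> V"
  have "(\<Sum>s\<in>A. x s *\<^sub>R \<alpha> s) t = (\<Sum>s\<in>A. if s = t then x s else 0)" if "finite A" for A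
    using that by (induction A rule: finite_induct) (auto simp: \<alpha>_def)
  then show "x t = (\<Sum>s\<in>S. x s *\<^sub>R \<alpha> s) t" using x finite_S by (auto simp: V_def)
qed

lemma B_expand_right: "B x y = (\<Sum>t\<in>S. y t * B x (\<alpha> t))"
proof -
  have "B x y = (\<Sum>t\<in>S. \<Sum>s\<in>S. x s * y t * bcoef s t)"
    unfolding B_def by (rule sum.swap)
  also have "\<dots> = (\<Sum>t\<in>S. y t * B x (\<alpha> t))"
    by (intro sum.cong) (auto simp: B_alpha_right sum_distrib_left algebra_simps)
  finally show ?thesis .
qed

lemma B_expand_left: "B x y = (\<Sum>t\<in>S. x t * B (\<alpha> t) y)"
  using B_expand_right[of y x] by (simp add: B_sym)

lemma alpha_V: "s \<in> S \<Longrightarrow> \<alpha> s \<in> V"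
  by (auto simp: V_def \<alpha>_def)

lemma V_add: "x \<in> V \<Longrightarrow> y \<in> V \<Longrightarrow> x + y \<in> V"
  and V_diff: "x \<in> V \<Longrightarrow> y \<in> V \<Longrightarrow> x - y \<in> V"
  and V_scale: "x \<in> V \<Longrightarrow> c *\<^sub>R x \<in> V"
  by (auto simp: V_def)

lemma refl_add: "refl b (x + y) = refl b x + refl b y"
  and refl_diff: "refl b (x - y) = refl b x - refl b y"
  and refl_scale: "refl b (c *\<^sub>R x) = c *\<^sub>R refl b x"
  and refl_minus: "refl b (- x) = - refl b x"
  by (simp_all add: refl_def algebra_simps)

lemma refl_V: "b \<in> V \<Longrightarrow> x \<in> V \<Longrightarrow> refl b x \<in> V"
  by (simp add: refl_def V_diff V_scale)

lemma refl_self: "B b b = 1 \<Longrightarrow> refl b b = - b"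
  by (simp add: refl_def scaleR_2)

lemma refl_refl: "B b b = 1 \<Longrightarrow> refl b (refl b x) = x"
  by (simp add: refl_def algebra_simps)

lemma B_refl: "B b b = 1 \<Longrightarrow> B (refl b x) (refl b y) = B x y"
  by (simp add: refl_def B_sym[of b y] algebra_simps)

lemma B_alpha_self: "s \<in> S \<Longrightarrow> B (\<alpha> s) (\<alpha> s) = 1"
  by (simp add: B_alpha bcoef_refl)

fun act :: "'w list \<Rightarrow> ('w \<Rightarrow> real) \<Rightarrow> ('w \<Rightarrow> real)" where
  "act [] x = x"
| "act (s # w) x = refl (\<alpha> s) (act w x)"

lemma act_append: "act (u @ v) x = act u (act v x)"
  by (induction u) auto

lemma act_add: "act w (x + y) = act w x + act w y"
  and act_diff: "act w (x - y) = act w x - act w y"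
  and act_scale: "act w (c *\<^sub>R x) = c *\<^sub>R act w x"
  and act_minus: "act w (- x) = - act w x"
  by (induction w) (auto simp: refl_add refl_diff refl_scale refl_minus)

text \<open>By the three-term recurrence each reflection replaces the older of two consecutive
  Chebyshev values by the next one. The free start index \<open>j\<close> keeps the induction going
  while \<open>s\<close> and \<open>t\<close> exchange roles.\<close>

lemma act_cheb:
  assumes "s \<in> S" "t \<in> S"
  defines "p \<equiv> cheb (- bcoef s t)"
  shows "act (alt_word k s t) (p (Suc j) *\<^sub>R \<alpha> s + p j *\<^sub>R \<alpha> t) =
    (if even k then p (Suc (j + k)) *\<^sub>R \<alpha> s + p (j + k) *\<^sub>R \<alpha> t
     else p (j + k) *\<^sub>R \<alpha> s + p (Suc (j + k)) *\<^sub>R \<alpha> t)"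
  using assms(1,2) unfolding p_def
proof (induction k arbitrary: s t j)
  case (Suc k)
  define p where "p = cheb (- bcoef s t)"
  have pp: "p = cheb (- bcoef t s)" using Suc.prems bcoef_sym by (simp add: p_def)
  have rec: "p (Suc (Suc j)) = - 2 * bcoef s t * p (Suc j) - p j" by (simp add: p_def)
  have "refl (\<alpha> t) (p (Suc j) *\<^sub>R \<alpha> s + p j *\<^sub>R \<alpha> t) = p (Suc (Suc j)) *\<^sub>R \<alpha> t + p (Suc j) *\<^sub>R \<alpha> s"
    using Suc.prems unfolding rec
    by (simp add: refl_def B_alpha bcoef_refl algebra_simps flip: scaleR_add_left)
  then have "act (alt_word (Suc k) s t) (p (Suc j) *\<^sub>R \<alpha> s + p j *\<^sub>R \<alpha> t) =
     act (alt_word k t s) (p (Suc (Suc j)) *\<^sub>R \<alpha> t + p (Suc j) *\<^sub>R \<alpha> s)"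
    by (simp add: act_append)
  also have "\<dots> = (if even k then p (Suc (Suc j + k)) *\<^sub>R \<alpha> t + p (Suc j + k) *\<^sub>R \<alpha> s
     else p (Suc j + k) *\<^sub>R \<alpha> t + p (Suc (Suc j + k)) *\<^sub>R \<alpha> s)"
    using Suc.IH[of t s "Suc j"] Suc.prems unfolding pp by blast
  also have "\<dots> = (if even (Suc k) then p (Suc (j + Suc k)) *\<^sub>R \<alpha> s + p (j + Suc k) *\<^sub>R \<alpha> t
     else p (j + Suc k) *\<^sub>R \<alpha> s + p (Suc (j + Suc k)) *\<^sub>R \<alpha> t)"
    by (simp add: add.commute)
  finally show ?case unfolding p_def .
qed simp

text \<open>For distinct \<open>s\<close> and \<open>t\<close> the form is nondegenerate on the
  plane of the two simple roots, so \<open>x\<close> splits into a part in the plane and a part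
  orthogonal to it. The word fixes the orthogonal part letter by letter, and the plane by the
  periodicity of the sine.\<close>

lemma act_relation:
  assumes s: "s \<in> S" and t: "t \<in> S" and m: "coxeter_m W s t = enat k"
  shows "act (concat (replicate k [s, t])) x = x"
proof (cases "s = t")
  case True
  then have "k = 1" using m m_refl[OF s] by (simp add: one_enat_def)
  then show ?thesis using True refl_refl B_alpha_self s by simp
next
  case False
  define \<theta> where "\<theta> = pi / real k"
  define c where "c = - bcoef s t"
  have k2: "2 \<le> k" using m_ge_2[OF s t False m] .
  have c: "c = cos \<theta>" using m by (simp add: c_def bcoef_def \<theta>_def)
  have "0 < \<theta>" "\<theta> < pi" using k2 by (auto simp: \<theta>_def field_simps)
  then have sin: "sin \<theta> \<noteq> 0" using sin_gt_zero by fastforce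
  \<comment> \<open>A full turn: the product of the two reflections rotates by
    \<open>2 * \<theta>\<close>, and it is applied \<open>k\<close> times.\<close>
  have kt: "real (2 * k) * \<theta> = 2 * pi" using k2 by (simp add: \<theta>_def)
  have "sin (real (2 * k) * \<theta>) = 0" unfolding kt by simp
  then have p0: "cheb c (2 * k) = 0" using sin_cheb[of \<theta> "2 * k"] sin c by simp
  have "real (Suc (2 * k)) * \<theta> = \<theta> + 2 * pi" using kt by (simp add: algebra_simps)
  then have "sin (real (Suc (2 * k)) * \<theta>) = sin \<theta>" by simp
  then have p1: "cheb c (Suc (2 * k)) = 1"
    using sin_cheb[of \<theta> "Suc (2 * k)"] sin unfolding c by (metis mult_cancel_left1 mult.commute)
  then have p2: "cheb c (2 * k - 1) = - 1"
    using p0 k2 cheb.simps(3)[of c "2 * k - 1"] by (simp add: Suc_diff_Suc numeral_2_eq_2)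
  let ?w = "concat (replicate k [s, t])"
  have as: "act ?w (\<alpha> s) = \<alpha> s"
    using act_cheb[OF s t, of "2 * k" 0] p0 p1 by (simp add: alt_word_double c_def)
  have "Suc (2 * k - 1) = 2 * k" using k2 by simp
  \<comment> \<open>The last letter negates \<open>\<alpha> t\<close>, which leaves an odd word to
    which \<open>act_cheb\<close> applies with \<open>s\<close> and \<open>t\<close>
    exchanged.\<close>
  then have "?w = alt_word (2 * k - 1) t s @ [t]"
    unfolding alt_word_double[symmetric] by (metis alt_word.simps(2))
  then have "act ?w (\<alpha> t) = - act (alt_word (2 * k - 1) t s) (\<alpha> t)"
    by (simp add: act_append refl_self B_alpha_self t act_minus)
  moreover have "cheb (- bcoef t s) = cheb c" using bcoef_sym s t by (simp add: c_def)
  moreover have "odd (2 * k - 1)" using k2 by simp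
  ultimately have at: "act ?w (\<alpha> t) = \<alpha> t"
    using act_cheb[OF t s, of "2 * k - 1" 0] p0 p2 k2 by simp
  have perp: "act w y = y" if "set w \<subseteq> {s, t}" "B y (\<alpha> s) = 0" "B y (\<alpha> t) = 0" for w y
    using that by (induction w) (auto simp: refl_def)
  have d: "1 - c\<^sup>2 \<noteq> 0" using sin sin_squared_eq[of \<theta>] c by (metis zero_eq_power2)
  \<comment> \<open>The solution of the two linear equations that make \<open>y\<close> orthogonal
    to both simple roots; their determinant is \<open>1 - c\<^sup>2\<close>.\<close>
  define a b where "a = (B x (\<alpha> s) + c * B x (\<alpha> t)) / (1 - c\<^sup>2)"
    and "b = (B x (\<alpha> t) + c * B x (\<alpha> s)) / (1 - c\<^sup>2)"
  define y where "y = x - a *\<^sub>R \<alpha> s - b *\<^sub>R \<alpha> t"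
  have ab: "a * (1 - c\<^sup>2) = B x (\<alpha> s) + c * B x (\<alpha> t)" "b * (1 - c\<^sup>2) = B x (\<alpha> t) + c * B x (\<alpha> s)"
    using d by (simp_all add: a_def b_def)
  have "(a - c * b) * (1 - c\<^sup>2) = B x (\<alpha> s) * (1 - c\<^sup>2)" "(b - c * a) * (1 - c\<^sup>2) = B x (\<alpha> t) * (1 - c\<^sup>2)"
    unfolding left_diff_distrib mult.assoc ab by (simp_all add: algebra_simps power2_eq_square)
  then have "a - c * b = B x (\<alpha> s)" "b - c * a = B x (\<alpha> t)" using d by simp_all
  then have "B y (\<alpha> s) = 0" "B y (\<alpha> t) = 0"
    using s t bcoef_sym[OF s t] by (auto simp: y_def B_alpha bcoef_refl c_def algebra_simps)
  moreover have "set ?w \<subseteq> {s, t}" by (auto split: if_splits)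
  ultimately have "act ?w y = y" using perp by blast
  moreover have "x = y + a *\<^sub>R \<alpha> s + b *\<^sub>R \<alpha> t" by (simp add: y_def)
  ultimately show ?thesis using as at by (metis act_add act_scale)
qed

lemma act_coxeter_eq: "coxeter_eq W S u v \<Longrightarrow> act u x = act v x"
proof (induction arbitrary: x rule: coxeter_eq.induct)
  case (rel u v s t k)
  then show ?case by (simp add: act_append act_relation del: concat_replicate_trivial)
qed auto

lemma act_rev: "w \<in> lists S \<Longrightarrow> act (rev w) (act w x) = x"
  by (induction w) (auto simp: act_append refl_refl B_alpha_self)

text \<open>Here the presentation enters: a word with product one reduces to the empty word by
  relations that act trivially.\<close>

lemma act_cong:
  assumes "u \<in> lists S" "v \<in> lists S" "word_prod W u = word_prod W v"
  shows "act u x = act v x"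
proof -
  have "word_prod W (rev v @ u) = \<one>"
    using assms by (simp add: word_prod_append word_prod_rev lists_eq_set)
  moreover have "rev v @ u \<in> lists S" using assms by (auto simp: lists_eq_set)
  ultimately have "coxeter_eq W S (rev v @ u) []"
    using coxeter unfolding coxeter_group_def by blast
  then have "act (rev v) (act u x) = x" using act_coxeter_eq by (fastforce simp: act_append)
  then have "act v (act (rev v) (act u x)) = act v x" by simp
  moreover have "act v (act (rev v) (act u x)) = act u x"
    using act_rev[of "rev v"] assms by (simp add: lists_eq_set)
  ultimately show ?thesis by simp
qed

definition gact :: "'w \<Rightarrow> ('w \<Rightarrow> real) \<Rightarrow> ('w \<Rightarrow> real)" where
  "gact g = act (SOME w. w \<in> lists S \<and> word_prod W w = g)"

lemma gact_word: "w \<in> lists S \<Longrightarrow> gact (word_prod W w) = act w"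
proof -
  assume w: "w \<in> lists S"
  let ?P = "\<lambda>u. u \<in> lists S \<and> word_prod W u = word_prod W w"
  have "?P (SOME u. ?P u)" by (rule someI[of ?P w]) (use w in auto)
  then show ?thesis using w act_cong unfolding gact_def by blast
qed

lemma gact_one [simp]: "gact \<one> x = x"
  using gact_word[of "[]"] by simp

lemma gact_mult: "g \<in> carrier W \<Longrightarrow> h \<in> carrier W \<Longrightarrow> gact (g \<otimes> h) x = gact g (gact h x)"
  by (metis ex_word gact_word word_prod_append act_append append_in_lists_conv)

lemma gact_S: "s \<in> S \<Longrightarrow> gact s x = refl (\<alpha> s) x"
  using gact_word[of "[s]"] by (simp add: S_carrier)

lemma gact_add: "gact g (x + y) = gact g x + gact g y"
  and gact_diff: "gact g (x - y) = gact g x - gact g y"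
  and gact_scale: "gact g (c *\<^sub>R x) = c *\<^sub>R gact g x"
  and gact_minus: "gact g (- x) = - gact g x"
  by (simp_all add: gact_def act_add act_diff act_scale act_minus)

lemma gact_zero [simp]: "gact g 0 = 0"
  using gact_scale[of g 0 0] by simp

lemma gact_sum: "gact g (sum f A) = (\<Sum>i\<in>A. gact g (f i))"
proof (induction A rule: infinite_finite_induct)
  case (insert i A)
  have "gact g (sum f (insert i A)) = (\<Sum>i\<in>insert i A. gact g (f i))"
    using insert by (simp add: gact_add)
  then show ?case .
next
  case (infinite A)
  then have "gact g (sum f A) = (\<Sum>i\<in>A. gact g (f i))" by simp
  then show ?case .
next
  case empty
  have "gact g (sum f {}) = (\<Sum>i\<in>{}. gact g (f i))" by simp
  then show ?case .
qed

lemma B_gact: "g \<in> carrier W \<Longrightarrow> B (gact g x) (gact g y) = B x y"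
proof -
  assume "g \<in> carrier W"
  then obtain w where w: "w \<in> lists S" "word_prod W w = g" using ex_word by blast
  have "B (act w x) (act w y) = B x y" using w(1)
    by (induction w) (auto simp: B_refl B_alpha_self)
  then show ?thesis using gact_word w by metis
qed

lemma gact_V: "g \<in> carrier W \<Longrightarrow> x \<in> V \<Longrightarrow> gact g x \<in> V"
proof -
  assume "g \<in> carrier W" and x: "x \<in> V"
  then obtain w where w: "w \<in> lists S" "word_prod W w = g" using ex_word by blast
  have "act w x \<in> V" using w(1) x by (induction w) (auto simp: refl_V alpha_V)
  then show ?thesis using gact_word w by metis
qed

lemma gact_inv: "g \<in> carrier W \<Longrightarrow> gact (inv g) (gact g x) = x" "g \<in> carrier W \<Longrightarrow> gact g (gact (inv g) x) = x"
  by (simp_all add: gact_mult[symmetric])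

lemma B_gact_left: "g \<in> carrier W \<Longrightarrow> B (gact g x) y = B x (gact (inv g) y)"
  using B_gact[of g x "gact (inv g) y"] by (simp add: gact_inv)

end

text \<open>The first-order condition at a minimum: near 0 a nonzero linear term would win.\<close>

lemma quadratic_nonneg_imp_zero:
  fixes p q :: real
  assumes "\<And>t. 0 \<le> 2 * t * p + t\<^sup>2 * q"
  shows "p = 0"
proof (rule ccontr)
  assume p: "p \<noteq> 0"
  \<comment> \<open>Makes \<open>k\<close> positive and larger than \<open>q / 2\<close>, so that
    the value at \<open>- p / k\<close> is negative.\<close>
  define k where "k = \<bar>q\<bar> + 1"
  have k: "0 < k" "q - 2 * k < 0" by (auto simp: k_def)
  have "2 * (- p / k) * p + (- p / k)\<^sup>2 * q = p\<^sup>2 * (q - 2 * k) / k\<^sup>2"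
    using k by (simp add: field_simps power2_eq_square)
  also have "\<dots> < 0" using p k by (intro divide_neg_pos mult_pos_neg) auto
  finally show False using assms[of "- p / k"] by linarith
qed

text \<open>Pigeonhole: the box is cut into finitely many cubes of side \<open>e\<close>, so two
  points share a cube.\<close>

lemma infinite_bounded_close:
  fixes X :: "('a \<Rightarrow> real) set"
  assumes "finite S" "infinite X" "\<And>x s. x \<in> X \<Longrightarrow> s \<in> S \<Longrightarrow> \<bar>x s\<bar> \<le> M" "0 < e"
  shows "\<exists>x\<in>X. \<exists>y\<in>X. x \<noteq> y \<and> (\<forall>s\<in>S. \<bar>x s - y s\<bar> < e)"
proof -
  define q where "q x = restrict (\<lambda>s. \<lfloor>x s / e\<rfloor>) S" for x :: "'a \<Rightarrow> real"
  have "q ` X \<subseteq> S \<rightarrow>\<^sub>E {\<lfloor>- M / e\<rfloor>..\<lfloor>M / e\<rfloor>}"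
  proof (intro image_subsetI PiE_I)
    fix x s assume "x \<in> X" "s \<in> S"
    then have "\<bar>x s\<bar> \<le> M" using assms(3) by blast
    then have "- M / e \<le> x s / e" "x s / e \<le> M / e"
      using assms(4) by (auto simp: field_simps)
    then show "q x s \<in> {\<lfloor>- M / e\<rfloor>..\<lfloor>M / e\<rfloor>}" using \<open>s \<in> S\<close> by (auto simp: q_def intro!: floor_mono)
  qed (auto simp: q_def)
  then have "finite (q ` X)" using assms(1) by (meson finite_PiE finite_atLeastAtMost_int finite_subset)
  then have "\<not> inj_on q X" using assms(2) finite_imageD by blast
  then obtain x y where xy: "x \<in> X" "y \<in> X" "x \<noteq> y" "q x = q y" by (auto simp: inj_on_def)
  have "\<bar>x s - y s\<bar> < e" if "s \<in> S" for s
  proof -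
    have "\<lfloor>x s / e\<rfloor> = \<lfloor>y s / e\<rfloor>" using fun_cong[OF xy(4), of s] that by (simp add: q_def)
    then have "\<bar>x s / e - y s / e\<bar> < 1" by linarith
    then show ?thesis using assms(4) by (simp add: diff_divide_distrib[symmetric] abs_divide)
  qed
  then show ?thesis using xy by blast
qed

section \<open>Length, signs of roots, and discreteness of the root set\<close>

context coxeter_system
begin

definition len :: "'w \<Rightarrow> nat" where
  "len g = (LEAST n. \<exists>w\<in>lists S. length w = n \<and> word_prod W w = g)"

definition nonneg :: "('w \<Rightarrow> real) \<Rightarrow> bool" where
  "nonneg x \<longleftrightarrow> (\<forall>s. 0 \<le> x s)"

definition root :: "('w \<Rightarrow> real) \<Rightarrow> bool" where
  "root b \<longleftrightarrow> (\<exists>g\<in>carrier W. \<exists>s\<in>S. b = gact g (\<alpha> s))"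

lemma len_word: "g \<in> carrier W \<Longrightarrow> \<exists>w\<in>lists S. length w = len g \<and> word_prod W w = g"
  unfolding len_def
  by (rule LeastI_ex[of "\<lambda>n. \<exists>w\<in>lists S. length w = n \<and> word_prod W w = g"]) (use ex_word[of g] in blast)

lemma len_le: "w \<in> lists S \<Longrightarrow> len (word_prod W w) \<le> length w"
  unfolding len_def by (rule Least_le) blast

lemma len_mult_word:
  assumes "g \<in> carrier W" "u \<in> lists S"
  shows "len (g \<otimes> word_prod W u) \<le> len g + length u"
proof -
  obtain w where w: "w \<in> lists S" "length w = len g" "word_prod W w = g" using len_word assms by blast
  then have "len (word_prod W (w @ u)) \<le> length (w @ u)" using assms by (intro len_le) auto
  then show ?thesis using w assms by (simp add: word_prod_append)
qed

lemma len_mult_S: "g \<in> carrier W \<Longrightarrow> s \<in> S \<Longrightarrow> len (g \<otimes> s) \<le> len g + 1"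
  using len_mult_word[of g "[s]"] by (simp add: S_carrier)

lemma mult_S_S: "g \<in> carrier W \<Longrightarrow> s \<in> S \<Longrightarrow> g \<otimes> s \<otimes> s = g"
  by (simp add: m_assoc S_carrier S_square)

lemma ex_descent:
  assumes "g \<in> carrier W" "g \<noteq> \<one>"
  shows "\<exists>t\<in>S. len (g \<otimes> t) < len g"
proof -
  obtain w where w: "w \<in> lists S" "length w = len g" "word_prod W w = g" using len_word assms by blast
  then have "w \<noteq> []" using assms by auto
  then obtain u t where u: "w = u @ [t]" using rev_exhaust by blast
  then have "g \<otimes> t = word_prod W u" using w mult_S_S[of "word_prod W u" t]
    by (auto simp: word_prod_append S_carrier)
  then show ?thesis using len_le[of u] u w by (intro bexI[of _ t]) auto
qed

text \<open>Tits' theorem by induction on the length. Write \<open>g\<close> as \<open>v\<close>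
  times a word \<open>u\<close> in \<open>s\<close> and a descent \<open>t\<close>, with lengths
  adding and \<open>u\<close> as long as possible. Then \<open>v\<close> sends both simple roots to
  nonnegative vectors, and \<open>u\<close> sends \<open>\<alpha> s\<close> to a nonnegative
  combination of the two.\<close>

lemma nonneg_gact:
  assumes "g \<in> carrier W" "s \<in> S" "len g \<le> len (g \<otimes> s)"
  shows "nonneg (gact g (\<alpha> s))"
  using assms
proof (induction "len g" arbitrary: g s rule: less_induct)
  case less
  note g = less.prems(1) and s = less.prems(2) and le = less.prems(3)
  show ?case
  proof (cases "g = \<one>")
    case True
    then show ?thesis by (simp add: nonneg_def \<alpha>_def)
  next
    case False
    obtain t where t: "t \<in> S" "len (g \<otimes> t) < len g" using ex_descent[OF g False] by blast
    then have st: "s \<noteq> t" using le by auto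
    define Q where "Q n \<longleftrightarrow> (\<exists>v\<in>carrier W. \<exists>u\<in>lists {s, t}. length u = n \<and> g = v \<otimes> word_prod W u
      \<and> len g = len v + n)" for n
    have "len g \<le> len (g \<otimes> t) + 1" using len_mult_S[of "g \<otimes> t" t] t g by (simp add: S_carrier mult_S_S)
    then have Q1: "Q 1" unfolding Q_def
      using t g by (intro bexI[of _ "g \<otimes> t"] bexI[of _ "[t]"]) (auto simp: S_carrier mult_S_S)
    have bound: "\<And>n. Q n \<Longrightarrow> n \<le> len g" by (auto simp: Q_def)
    \<comment> \<open>Maximality prevents \<open>s\<close> and \<open>t\<close> from being descents
      of \<open>v\<close>, which is what the induction hypothesis asks for.\<close>
    define n where "n = Greatest Q"
    have "Q n" unfolding n_def using GreatestI_nat[of Q, OF Q1 bound] .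
    have n1: "1 \<le> n" unfolding n_def using Greatest_le_nat[of Q, OF Q1 bound] .
    have Qmax: "\<not> Q (Suc n)" using Greatest_le_nat[of Q "Suc n", OF _ bound] n_def by fastforce
    obtain v u where v: "v \<in> carrier W" and u: "u \<in> lists {s, t}" "length u = n"
      and gvu: "g = v \<otimes> word_prod W u" and lg: "len g = len v + n"
      using \<open>Q n\<close> unfolding Q_def by blast
    have uS: "u \<in> lists S" using u s t by auto
    have IH: "nonneg (gact v (\<alpha> x))" if "x \<in> {s, t}" for x
    proof (rule less.hyps)
      have xS: "x \<in> S" using that s t by auto
      show "len v < len g" using lg n1 by simp
      show "v \<in> carrier W" "x \<in> S" by fact+
      show "len v \<le> len (v \<otimes> x)"
      proof (rule ccontr)
        assume *: "\<not> len v \<le> len (v \<otimes> x)"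
        have "len v \<le> len (v \<otimes> x) + 1"
          using len_mult_S[of "v \<otimes> x" x] v xS by (simp add: S_carrier mult_S_S)
        then have "len v = len (v \<otimes> x) + 1" using * by simp
        moreover have "g = (v \<otimes> x) \<otimes> word_prod W (x # u)"
          using v xS uS gvu by (simp add: m_assoc[symmetric] S_carrier mult_S_S)
        ultimately have "Q (Suc n)" unfolding Q_def
          using v xS u lg that by (intro bexI[of _ "v \<otimes> x"] bexI[of _ "x # u"]) (auto simp: S_carrier)
        then show False using Qmax by blast
      qed
    qed
    have short: "len (v \<otimes> word_prod W x) \<le> len v + length x" if "x \<in> lists S" for x
      using len_mult_word v that by blast
    \<comment> \<open>Otherwise \<open>g \<otimes> s\<close> would be shorter than \<open>g\<close>.
      This excludes words \<open>u\<close> ending in \<open>s\<close>, and further down words long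
      enough to be rewritten so.\<close>
    have no_s: "word_prod W u \<noteq> word_prod W (x @ [s])" if "x \<in> lists S" "length x < n" for x
    proof
      assume "word_prod W u = word_prod W (x @ [s])"
      then have "g \<otimes> s = v \<otimes> word_prod W x"
        using gvu that s v by (simp add: word_prod_append m_assoc S_carrier S_square)
      then show False using short[of x] that le lg by simp
    qed
    have "u = alt_word (length u) s t"
    proof (rule eq_alt_word)
      show "set u \<subseteq> {s, t}" "s \<noteq> t" using u st by auto
      show "last u = t" if "u \<noteq> []"
      proof (rule ccontr)
        assume "last u \<noteq> t"
        then have "last u = s" using u last_in_set[OF that] by auto
        then have "u = butlast u @ [s]" using that by (metis append_butlast_last_id)
        moreover have "butlast u \<in> lists S" using uS in_set_butlastD by (fastforce simp: lists_eq_set)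
        moreover have "length (butlast u) < n" using u n1 by simp
        ultimately show False using no_s by metis
      qed
      show "u \<noteq> p @ [x, x] @ q" for p x q
      proof
        assume eq: "u = p @ [x, x] @ q"
        then have "word_prod W u = word_prod W (p @ q)" using uS
          by (simp add: word_prod_append m_assoc[symmetric] S_carrier S_square)
        then have "len g \<le> len v + length (p @ q)" using short[of "p @ q"] gvu uS eq by simp
        then show False using lg u eq by simp
      qed
    qed
    then have u_alt: "u = alt_word n s t" using u by simp
    \<comment> \<open>With at least \<open>k\<close> letters the braid relation could be applied to
      the end of \<open>u\<close> and make it end in \<open>s\<close>.\<close>
    have lt: "n < k" if k: "coxeter_m W s t = enat k" for k
    proof (rule ccontr)
      assume "\<not> n < k"
      then have nk: "(n - k) + k = n" by simp
      have k2: "2 \<le> k" using m_ge_2 s t st k by blast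
      have altS: "alt_word j s t \<in> lists S" "alt_word j t s \<in> lists S" for j
        using set_alt_word[of j s t] set_alt_word[of j t s] s t by auto
      obtain x where x: "x \<in> lists S" "length x = n - k" "u = x @ alt_word k s t"
        using alt_word_add[of "n - k" k s t] nk altS u_alt by (metis length_alt_word)
      have "alt_word k t s = alt_word (k - 1) s t @ [s]"
        using k2 by (metis alt_word.simps(2) Suc_diff_1 not_numeral_le_zero gr0I)
      then have "word_prod W u = word_prod W ((x @ alt_word (k - 1) s t) @ [s])"
        using x altS word_prod_alt[OF s t(1) k] s by (simp add: word_prod_append m_assoc S_carrier)
      moreover have "length (x @ alt_word (k - 1) s t) < n" using x nk k2 by simp
      ultimately show False using no_s[of "x @ alt_word (k - 1) s t"] x altS by simp
    qed
    define p where "p = cheb (- bcoef s t)"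
    \<comment> \<open>Up to the index \<open>Suc n \<le> k\<close> the angle
      \<open>j * \<theta>\<close> does not exceed \<open>pi\<close>, so the sine is
      nonnegative.\<close>
    have p: "0 \<le> p j" if "j \<le> Suc n" for j
    proof (cases "coxeter_m W s t")
      case infinity
      then show ?thesis by (simp add: p_def bcoef_def cheb_one)
    next
      case (enat k)
      define \<theta> where "\<theta> = pi / real k"
      have jk: "j \<le> k" and k2: "2 \<le> k" using lt[OF enat] that m_ge_2[OF s t(1) st enat] by auto
      have "0 < \<theta>" "\<theta> < pi" using k2 by (auto simp: \<theta>_def field_simps)
      then have sin: "0 < sin \<theta>" using sin_gt_zero by blast
      have "real j * \<theta> \<le> real k * \<theta>" using jk \<open>0 < \<theta>\<close> by (intro mult_right_mono) auto
      then have "real j * \<theta> \<le> pi" using k2 by (simp add: \<theta>_def)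
      then have "0 \<le> sin \<theta> * p j"
        using \<open>0 < \<theta>\<close> by (simp add: p_def bcoef_def enat \<theta>_def[symmetric] sin_cheb sin_ge_zero)
      then show ?thesis using sin by (simp add: zero_le_mult_iff)
    qed
    have "gact g (\<alpha> s) = gact v (act u (\<alpha> s))"
      using gvu v uS by (simp add: gact_mult gact_word)
    moreover have "\<exists>a b. 0 \<le> a \<and> 0 \<le> b \<and> act u (\<alpha> s) = a *\<^sub>R \<alpha> s + b *\<^sub>R \<alpha> t"
      using act_cheb[OF s t(1), of n 0] p[of n] p[of "Suc n"] u_alt unfolding p_def
      by (cases "even n") auto
    ultimately obtain a b where ab: "0 \<le> a" "0 \<le> b"
      "gact g (\<alpha> s) = a *\<^sub>R gact v (\<alpha> s) + b *\<^sub>R gact v (\<alpha> t)"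
      by (auto simp: gact_add gact_scale)
    then show ?thesis using IH[of s] IH[of t] unfolding nonneg_def ab(3) by simp
  qed
qed

lemma nonpos_gact:
  assumes "g \<in> carrier W" "s \<in> S" "len (g \<otimes> s) < len g"
  shows "nonneg (- gact g (\<alpha> s))"
proof -
  have "nonneg (gact (g \<otimes> s) (\<alpha> s))"
    using assms by (intro nonneg_gact) (auto simp: S_carrier mult_S_S)
  then show ?thesis using assms
    by (simp add: gact_mult S_carrier gact_S refl_self B_alpha_self gact_minus)
qed

lemma root_sign: "root b \<Longrightarrow> nonneg b \<or> nonneg (- b)"
proof -
  assume "root b"
  then obtain g s where gs: "g \<in> carrier W" "s \<in> S" "b = gact g (\<alpha> s)" unfolding root_def by blast
  show ?thesis
  proof (cases "len g \<le> len (g \<otimes> s)")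
    case True then show ?thesis using nonneg_gact gs by blast
  next
    case False then show ?thesis using nonpos_gact[of g s] gs by simp
  qed
qed

lemma root_norm: "root b \<Longrightarrow> B b b = 1"
  unfolding root_def by (auto simp: B_gact B_alpha_self)

lemma root_V: "root b \<Longrightarrow> b \<in> V"
  unfolding root_def using gact_V alpha_V by blast

lemma root_alpha: "s \<in> S \<Longrightarrow> root (\<alpha> s)"
  unfolding root_def by (intro bexI[of _ \<one>] bexI[of _ s]) auto

lemma root_gact: "root b \<Longrightarrow> g \<in> carrier W \<Longrightarrow> root (gact g b)"
  unfolding root_def using gact_mult m_closed by metis

lemma root_nonzero: "root b \<Longrightarrow> b \<noteq> 0"
  using root_norm by fastforce

lemma root_reflection:
  assumes "root b"
  shows "\<exists>r\<in>carrier W. \<forall>x. gact r x = refl b x"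
proof -
  obtain g s where g: "g \<in> carrier W" "s \<in> S" "b = gact g (\<alpha> s)" using assms root_def by blast
  have "gact (g \<otimes> s \<otimes> inv g) x = refl b x" for x
  proof -
    have "B (gact (inv g) x) (\<alpha> s) = B x b" using g by (simp add: B_gact_left)
    then show ?thesis using g
      by (simp add: gact_mult S_carrier gact_S refl_def gact_diff gact_scale gact_inv)
  qed
  then show ?thesis using g by (intro bexI[of _ "g \<otimes> s \<otimes> inv g"]) (auto simp: S_carrier)
qed

lemma root_refl: "root b \<Longrightarrow> root c \<Longrightarrow> root (refl b c)"
  using root_reflection root_gact by metis

lemma root_minus: "root b \<Longrightarrow> root (- b)"
  using root_refl[of b b] refl_self root_norm by metis

text \<open>A nontrivial \<open>g\<close> has a descent \<open>t\<close>, and the image of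
  \<open>\<alpha> t\<close> would then be both nonnegative and nonpositive, hence zero.\<close>

lemma gact_nonneg_imp_one:
  assumes "g \<in> carrier W" "\<And>s. s \<in> S \<Longrightarrow> nonneg (gact g (\<alpha> s))"
  shows "g = \<one>"
proof (rule ccontr)
  assume "g \<noteq> \<one>"
  then obtain t where t: "t \<in> S" "len (g \<otimes> t) < len g" using ex_descent assms by blast
  then have "nonneg (gact g (\<alpha> t))" "nonneg (- gact g (\<alpha> t))" using assms nonpos_gact by auto
  then have "gact g (\<alpha> t) = 0" by (auto simp: nonneg_def fun_eq_iff antisym)
  then show False using root_nonzero root_gact root_alpha t assms by metis
qed

text \<open>One positive coordinate decides the sign of a root. An element that merely comes close
  to fixing the simple roots is therefore the identity, which is the source of discreteness.\<close>

lemma gact_pos_coeff_imp_one: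
  assumes "g \<in> carrier W" "\<And>s. s \<in> S \<Longrightarrow> 0 < gact g (\<alpha> s) s"
  shows "g = \<one>"
proof (rule gact_nonneg_imp_one[OF assms(1)])
  fix s assume s: "s \<in> S"
  then have "root (gact g (\<alpha> s))" using root_gact root_alpha assms by blast
  moreover have "\<not> nonneg (- gact g (\<alpha> s))"
    using assms(2)[OF s] unfolding nonneg_def by (auto intro!: exI[of _ s])
  ultimately show "nonneg (gact g (\<alpha> s))" using root_sign by blast
qed

lemma gact_faithful:
  assumes "g \<in> carrier W" "h \<in> carrier W" "\<And>s. s \<in> S \<Longrightarrow> gact g (\<alpha> s) = gact h (\<alpha> s)"
  shows "g = h"
proof -
  have "inv h \<otimes> g = \<one>"
  proof (rule gact_nonneg_imp_one)
    fix s assume "s \<in> S"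
    then have "gact (inv h \<otimes> g) (\<alpha> s) = \<alpha> s" using assms by (simp add: gact_mult gact_inv)
    then show "nonneg (gact (inv h \<otimes> g) (\<alpha> s))" by (simp add: nonneg_def \<alpha>_def)
  qed (use assms in auto)
  then show ?thesis using assms
    by (metis inv_closed inv_equality inv_inv)
qed

lemma finite_roots_imp_finite:
  assumes "finite {b. root b}"
  shows "finite (carrier W)"
proof -
  define q where "q g = restrict (\<lambda>s. gact g (\<alpha> s)) S" for g
  have "q ` carrier W \<subseteq> S \<rightarrow>\<^sub>E {b. root b}"
    by (auto simp: q_def root_gact root_alpha)
  then have "finite (q ` carrier W)" using assms finite_S by (meson finite_PiE finite_subset)
  moreover have "inj_on q (carrier W)"
  proof (rule inj_onI)
    fix g h assume gh: "g \<in> carrier W" "h \<in> carrier W" "q g = q h"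
    have "gact g (\<alpha> s) = gact h (\<alpha> s)" if "s \<in> S" for s
      using fun_cong[OF gh(3), of s] that by (simp add: q_def)
    then show "g = h" using gact_faithful gh by blast
  qed
  ultimately show ?thesis using finite_imageD by blast
qed

lemma bcoef_abs: "s \<in> S \<Longrightarrow> t \<in> S \<Longrightarrow> \<bar>bcoef s t\<bar> \<le> 1"
  using bcoef_bounds[of s t] bcoef_refl[of s] by (cases "s = t") auto

lemma B_bound:
  assumes "\<And>s. s \<in> S \<Longrightarrow> \<bar>x s\<bar> \<le> a" "\<And>s. s \<in> S \<Longrightarrow> \<bar>y s\<bar> \<le> b" "0 \<le> a"
  shows "\<bar>B x y\<bar> \<le> (real (card S))\<^sup>2 * (a * b)"
proof -
  have "\<bar>x s * y t * bcoef s t\<bar> \<le> a * b * 1" if "s \<in> S" "t \<in> S" for s t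
    unfolding abs_mult using that assms bcoef_abs[of s t] by (intro mult_mono) force+
  then have 1: "\<bar>x s * y t * bcoef s t\<bar> \<le> a * b" if "s \<in> S" "t \<in> S" for s t
    using that by simp
  have "\<bar>B x y\<bar> \<le> (\<Sum>s\<in>S. \<bar>\<Sum>t\<in>S. x s * y t * bcoef s t\<bar>)" unfolding B_def by (rule sum_abs)
  also have "\<dots> \<le> (\<Sum>s\<in>S. \<Sum>t\<in>S. \<bar>x s * y t * bcoef s t\<bar>)" by (intro sum_mono sum_abs)
  also have "\<dots> \<le> (\<Sum>s\<in>S. \<Sum>t\<in>S. a * b)" by (intro sum_mono 1)
  finally show ?thesis by (simp add: power2_eq_square)
qed

text \<open>Among infinitely many bounded roots two are so close that the product of their
  reflections nearly fixes every simple root. By \<open>gact_pos_coeff_imp_one\<close> it is the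
  identity, so the two roots agree up to sign; they are distinct by choice, and too close to be
  opposite.\<close>

lemma finite_bounded_roots: "finite {b. root b \<and> (\<forall>s\<in>S. \<bar>b s\<bar> \<le> M)}"
proof (rule ccontr)
  let ?X = "{b. root b \<and> (\<forall>s\<in>S. \<bar>b s\<bar> \<le> M)}"
  assume inf: "infinite ?X"
  define M' where "M' = max M 1"
  define K where "K = (real (card S))\<^sup>2"
  \<comment> \<open>The middle summand bounds the displacement \<open>refl b z\<close> in units of
    \<open>e\<close>; the summand \<open>K\<close> serves the case \<open>c = - b\<close> at the
    end.\<close>
  define C where "C = 1 + 4 * K * M' * (1 + 2 * K * M'\<^sup>2) + K"
  have M': "1 \<le> M'" "M \<le> M'" by (auto simp: M'_def)
  have K: "0 \<le> K" by (simp add: K_def)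
  have C: "1 \<le> C" using M' K by (simp add: C_def)
  define e where "e = 1 / C"
  have e: "0 < e" using C by (simp add: e_def)
  have "\<exists>b\<in>?X. \<exists>c\<in>?X. b \<noteq> c \<and> (\<forall>s\<in>S. \<bar>b s - c s\<bar> < e)"
    by (rule infinite_bounded_close[OF finite_S inf _ e]) auto
  then obtain b c where b: "b \<in> ?X" and c: "c \<in> ?X" and ne: "b \<noteq> c"
    and close: "\<forall>s\<in>S. \<bar>b s - c s\<bar> < e" by blast
  have bM: "\<forall>s\<in>S. \<bar>b s\<bar> \<le> M'" "\<forall>s\<in>S. \<bar>c s\<bar> \<le> M'" using b c M'(2) order_trans by blast+
  have bc: "root b" "root c" "\<forall>s\<in>S. \<bar>b s\<bar> \<le> M'" "\<forall>s\<in>S. \<bar>c s\<bar> \<le> M'" "b \<noteq> c"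
    "\<forall>s\<in>S. \<bar>b s - c s\<bar> < e"
    using b c ne close bM by simp_all
  obtain r where r: "r \<in> carrier W" "\<And>x. gact r x = refl b x" using root_reflection bc by blast
  obtain r' where r': "r' \<in> carrier W" "\<And>x. gact r' x = refl c x" using root_reflection bc by blast
  define d where "d = c - b"
  have d: "\<bar>d s\<bar> \<le> e" if "s \<in> S" for s
    using bc(6) that unfolding d_def by (auto simp: abs_minus_commute less_imp_le)
  have "r \<otimes> r' = \<one>"
  proof (rule gact_pos_coeff_imp_one)
    fix s assume s: "s \<in> S"
    define z where "z = refl c (\<alpha> s) - refl b (\<alpha> s)"
    have z_eq: "z = - ((2 * B (\<alpha> s) d) *\<^sub>R c + (2 * B (\<alpha> s) b) *\<^sub>R d)"
      by (simp add: z_def refl_def d_def algebra_simps)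
    have as: "\<bar>\<alpha> s t\<bar> \<le> 1" for t by (simp add: \<alpha>_def)
    have z: "\<bar>z t\<bar> \<le> 4 * K * M' * e" if t: "t \<in> S" for t
    proof -
      have "\<bar>B (\<alpha> s) d\<bar> \<le> K * (1 * e)" unfolding K_def using as d by (intro B_bound) auto
      then have "\<bar>B (\<alpha> s) d * c t\<bar> \<le> K * e * M'"
        unfolding abs_mult using bc t e K by (intro mult_mono) auto
      moreover have "\<bar>B (\<alpha> s) b\<bar> \<le> K * (1 * M')" unfolding K_def using as bc by (intro B_bound) auto
      then have "\<bar>B (\<alpha> s) b * d t\<bar> \<le> K * M' * e"
        unfolding abs_mult using d t e K M' by (intro mult_mono) auto
      moreover have "z t = - (2 * (B (\<alpha> s) d * c t) + 2 * (B (\<alpha> s) b * d t))" by (simp add: z_eq)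
      ultimately have "\<bar>z t\<bar> \<le> 2 * (K * e * M') + 2 * (K * M' * e)" by linarith
      also have "\<dots> = 4 * K * M' * e" by simp
      finally show ?thesis .
    qed
    have "\<bar>refl b z s\<bar> \<le> 4 * K * M' * e * (1 + 2 * K * M'\<^sup>2)"
    proof -
      have "\<bar>B z b\<bar> \<le> K * (4 * K * M' * e * M')"
        unfolding K_def using z bc K e M' by (intro B_bound) (auto simp: K_def)
      then have "\<bar>B z b * b s\<bar> \<le> K * (4 * K * M' * e * M') * M'"
        unfolding abs_mult using bc s e K M' by (intro mult_mono) auto
      moreover have "refl b z s = z s - 2 * (B z b * b s)" by (simp add: refl_def)
      ultimately have "\<bar>refl b z s\<bar> \<le> 4 * K * M' * e + 2 * (K * (4 * K * M' * e * M') * M')"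
        using z[OF s] by linarith
      also have "\<dots> = 4 * K * M' * e * (1 + 2 * K * M'\<^sup>2)"
        unfolding power2_eq_square distrib_left by (simp only: mult_ac mult_1_right)
      finally show ?thesis .
    qed
    also have "\<dots> = 4 * K * M' * (1 + 2 * K * M'\<^sup>2) / C" by (simp add: e_def)
    also have "\<dots> < 1" using C K by (simp add: C_def)
    finally have "\<bar>refl b z s\<bar> < 1" .
    moreover have "gact (r \<otimes> r') (\<alpha> s) = \<alpha> s + refl b z"
    proof -
      have "refl c (\<alpha> s) = refl b (\<alpha> s) + z" by (simp add: z_def)
      then show ?thesis using r r' bc(1)
        by (simp add: gact_mult refl_add refl_refl root_norm)
    qed
    ultimately show "0 < gact (r \<otimes> r') (\<alpha> s) s" by (simp add: \<alpha>_def abs_less_iff)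
  qed (use r r' in auto)
  then have "refl b (refl c b) = b" using r r' by (metis gact_mult gact_one)
  then have "refl b b = refl c b" using refl_refl root_norm bc by metis
  then have eq: "b = B b c *\<^sub>R c"
  proof -
    have "- b = b - (2 * B b c) *\<^sub>R c"
      using \<open>refl b b = refl c b\<close> refl_self[OF root_norm[OF bc(1)]] by (simp add: refl_def)
    then have "2 *\<^sub>R b = 2 *\<^sub>R (B b c *\<^sub>R c)" by (simp add: scaleR_2 algebra_simps)
    then show ?thesis by (simp del: scaleR_scaleR)
  qed
  have "B b b = B b c * B b c" using arg_cong[OF eq, of "B b"] by simp
  then have "B b c * B b c = 1" using root_norm bc by simp
  then have "B b c = 1 \<or> B b c = - 1" using square_eq_1_iff by (simp add: power2_eq_square[symmetric] power2_eq_1_iff)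
  then show False
  proof
    assume "B b c = 1"
    then show False using eq bc by simp
  next
    assume "B b c = - 1"
    then have "c = - b" using eq by simp
    then have "\<bar>b s\<bar> \<le> e" if "s \<in> S" for s using bc(6) that e by fastforce
    then have "\<bar>B b b\<bar> \<le> K * (e * e)" unfolding K_def using e by (intro B_bound) auto
    then have "1 \<le> K * (e * e)" using root_norm bc by simp
    moreover have "e \<le> 1" using C by (simp add: e_def)
    then have "K * (e * e) \<le> K * (e * 1)" using e K by (intro mult_left_mono) auto
    moreover have "0 \<le> 4 * K * M' * (1 + 2 * K * M'\<^sup>2)" using K M' by simp
    then have "K < C" unfolding C_def by linarith
    then have "K * e < 1" using C by (simp add: e_def)
    ultimately show False by linarith
  qed
qed

end

section \<open>The sign of the bilinear form\<close>

context coxeter_system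
begin

definition N :: "('w \<Rightarrow> real) \<Rightarrow> real" where
  "N x = (\<Sum>s\<in>S. (x s)\<^sup>2)"

definition supp_on :: "'w set \<Rightarrow> ('w \<Rightarrow> real) set" where
  "supp_on I = {x. \<forall>s. s \<notin> I \<longrightarrow> x s = 0}"

lemma V_supp_on: "V = supp_on S"
  by (simp add: V_def supp_on_def)

lemma N_nonneg: "0 \<le> N x"
  by (simp add: N_def sum_nonneg)

lemma N_scale: "N (c *\<^sub>R x) = c\<^sup>2 * N x"
  by (simp add: N_def sum_distrib_left power_mult_distrib)

lemma N_eq_0: "x \<in> V \<Longrightarrow> N x = 0 \<longleftrightarrow> x = 0"
  using finite_S by (auto simp: N_def V_def sum_nonneg_eq_0_iff fun_eq_iff)

lemma N_coord: "s \<in> S \<Longrightarrow> (x s)\<^sup>2 \<le> N x"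
  unfolding N_def using finite_S by (intro member_le_sum) auto

lemma continuous_coord: "continuous_on A (\<lambda>x. x s :: real)"
  by (rule continuous_on_subset[OF continuous_on_product_coordinates subset_UNIV])

text \<open>Vectors are functions on the whole type, so compactness comes from a product of
  intervals over \<open>I\<close> and single points elsewhere, in the product topology.\<close>

lemma compact_sphere:
  assumes "I \<subseteq> S"
  shows "compact (supp_on I \<inter> {x. N x = 1})"
proof -
  define K where "K = PiE UNIV (\<lambda>s. if s \<in> I then {-1..1::real} else {0})"
  have "compactin (product_topology (\<lambda>s. euclidean) UNIV) K"
    unfolding K_def compactin_PiE by auto
  then have "compact K" by (simp add: euclidean_product_topology)
  moreover have "closed {x. N x = 1}"
    unfolding N_def by (intro closed_Collect_eq continuous_intros continuous_coord)
  ultimately have "compact (K \<inter> {x. N x = 1})" by (rule compact_Int_closed)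
  moreover have "K \<inter> {x. N x = 1} = supp_on I \<inter> {x. N x = 1}"
  proof -
    have "x \<in> K" if "x \<in> supp_on I" "N x = 1" for x
    proof -
      have "\<bar>x s\<bar> \<le> 1" if "s \<in> I" for s
        using N_coord[of s x] that assms \<open>N x = 1\<close> abs_square_le_1 by auto
      then show ?thesis using that unfolding K_def supp_on_def by (auto simp: abs_le_iff)
    qed
    moreover have "x \<in> supp_on I" if "x \<in> K" for x
      using that unfolding K_def supp_on_def by (auto simp: PiE_iff) (metis singletonD)
    ultimately show ?thesis by auto
  qed
  ultimately show ?thesis by simp
qed

text \<open>\<open>B x0 x0\<close> is the minimum of the Rayleigh quotient, that is the lowest
  eigenvalue of the form on \<open>supp_on I\<close>.\<close>

lemma min_on_sphere:
  assumes "I \<subseteq> S" "I \<noteq> {}"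
  obtains x0 where "x0 \<in> supp_on I" "N x0 = 1" "\<And>x. x \<in> supp_on I \<Longrightarrow> B x0 x0 * N x \<le> B x x"
proof -
  let ?Sph = "supp_on I \<inter> {x. N x = 1}"
  obtain s where s: "s \<in> I" using assms by blast
  have "\<alpha> s \<in> ?Sph"
  proof -
    have "N (\<alpha> s) = (\<Sum>t\<in>S. if t = s then 1 else 0)"
      unfolding N_def by (intro sum.cong) (auto simp: \<alpha>_def)
    then show ?thesis using s assms finite_S by (auto simp: supp_on_def \<alpha>_def)
  qed
  then have "?Sph \<noteq> {}" by blast
  moreover have "continuous_on ?Sph (\<lambda>x. B x x)"
    unfolding B_def by (intro continuous_intros continuous_coord)
  ultimately obtain x0 where x0: "x0 \<in> ?Sph" "\<And>y. y \<in> ?Sph \<Longrightarrow> B x0 x0 \<le> B y y"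
    using continuous_attains_inf[OF compact_sphere[OF assms(1)]] by blast
  have "B x0 x0 * N x \<le> B x x" if x: "x \<in> supp_on I" for x
  proof (cases "N x = 0")
    case True
    have "x \<in> V" using x assms by (auto simp: V_supp_on supp_on_def)
    then have "x = 0" using True N_eq_0 by blast
    then show ?thesis using True by simp
  next
    case False
    then have pos: "0 < N x" using N_nonneg[of x] by simp
    define y where "y = (1 / sqrt (N x)) *\<^sub>R x"
    have "y \<in> ?Sph" using x pos by (auto simp: y_def N_scale power_divide supp_on_def)
    then have "B x0 x0 \<le> B y y" using x0 by blast
    also have "B y y = B x x / N x" using pos by (simp add: y_def)
    finally show ?thesis using pos by (simp add: field_simps)
  qed
  then show ?thesis using that x0 by blast
qed

lemma coercive:
  assumes "I \<subseteq> S" "\<And>x. x \<in> supp_on I \<Longrightarrow> x \<noteq> 0 \<Longrightarrow> 0 < B x x"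
  obtains c where "0 < c" "\<And>x. x \<in> supp_on I \<Longrightarrow> c * N x \<le> B x x"
proof (cases "I = {}")
  case True
  have "x = 0" if "x \<in> supp_on I" for x using that True by (auto simp: supp_on_def fun_eq_iff)
  moreover have "N 0 = 0" by (simp add: N_def)
  ultimately have "1 * N x \<le> B x x" if "x \<in> supp_on I" for x using that by fastforce
  then show ?thesis using that[of 1] by simp
next
  case False
  show ?thesis
  proof (rule min_on_sphere[OF assms(1) False])
    fix x0 assume x0: "x0 \<in> supp_on I" "N x0 = 1" "\<And>x. x \<in> supp_on I \<Longrightarrow> B x0 x0 * N x \<le> B x x"
    have "N 0 = 0" by (simp add: N_def)
    then have "x0 \<noteq> 0" using x0(2) by auto
    then have "0 < B x0 x0" using assms(2) x0(1) by blast
    then show thesis using that[of "B x0 x0"] x0(3) by blast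
  qed
qed

text \<open>Coercivity turns \<open>B b b = 1\<close> into a bound on the coordinates.\<close>

lemma finite_roots_supp_on:
  assumes "I \<subseteq> S" "\<And>x. x \<in> supp_on I \<Longrightarrow> x \<noteq> 0 \<Longrightarrow> 0 < B x x"
  shows "finite {b. root b \<and> b \<in> supp_on I}"
proof -
  obtain c where c: "0 < c" "\<And>x. x \<in> supp_on I \<Longrightarrow> c * N x \<le> B x x" using coercive assms by blast
  have "\<bar>b s\<bar> \<le> sqrt (1 / c)" if "root b" "b \<in> supp_on I" "s \<in> S" for b s
  proof -
    have "c * N b \<le> 1" using c that root_norm by metis
    then have "N b \<le> 1 / c" using c by (simp add: field_simps)
    then have "(b s)\<^sup>2 \<le> 1 / c" using N_coord[OF that(3)] order_trans by blast
    then show ?thesis by (metis real_sqrt_abs real_sqrt_le_iff)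
  qed
  then have "{b. root b \<and> b \<in> supp_on I} \<subseteq> {b. root b \<and> (\<forall>s\<in>S. \<bar>b s\<bar> \<le> sqrt (1 / c))}" by blast
  then show ?thesis using finite_bounded_roots finite_subset by blast
qed

end

section \<open>Perron-Frobenius theory for the Gram matrix\<close>

locale irreducible_coxeter = coxeter_system +
  assumes irred: "irreducible_finite_rank W S"
begin

lemma bcoef_edge: "(s, t) \<in> coxeter_edges W S \<Longrightarrow> bcoef s t < 0"
proof -
  assume "(s, t) \<in> coxeter_edges W S"
  then have m: "3 \<le> coxeter_m W s t" by (simp add: coxeter_edges_def)
  show ?thesis
  proof (cases "coxeter_m W s t")
    case (enat k)
    then have k: "3 \<le> k" using m by (simp add: numeral_eq_enat)
    then have "0 < pi / real k" "pi / real k < pi / 2" by (auto simp: divide_simps)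
    then have "0 < cos (pi / real k)" using cos_gt_zero by blast
    then show ?thesis using enat by (simp add: bcoef_def)
  qed (simp add: bcoef_def)
qed

lemma connected_induct:
  assumes "s \<in> S" "P s" "t \<in> S"
    and step: "\<And>a b. a \<in> S \<Longrightarrow> b \<in> S \<Longrightarrow> a \<noteq> b \<Longrightarrow> bcoef a b < 0 \<Longrightarrow> P a \<Longrightarrow> P b"
  shows "P t"
proof -
  have "(s, t) \<in> (coxeter_edges W S)\<^sup>*" using irred assms unfolding irreducible_finite_rank_def by blast
  then show ?thesis
  proof (induction rule: rtrancl_induct)
    case (step y z)
    then have "y \<in> S" "z \<in> S" "y \<noteq> z" by (auto simp: coxeter_edges_def)
    then show ?case using step bcoef_edge assms(4)[of y z] by blast
  qed (rule assms(2))
qed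

text \<open>First variation, in the direction \<open>\<alpha> s\<close>, of the nonnegative form
  \<open>B - \<mu> * N\<close> at one of its zeros.\<close>

lemma min_imp_eigenvector:
  assumes min: "\<forall>y\<in>V. \<mu> * N y \<le> B y y" and x: "x \<in> V" "B x x = \<mu> * N x" and s: "s \<in> S"
  shows "B x (\<alpha> s) = \<mu> * x s"
proof -
  have "B x (\<alpha> s) - \<mu> * x s = 0"
  proof (rule quadratic_nonneg_imp_zero)
    fix t :: real
    have "N (x + t *\<^sub>R \<alpha> s) = N x + 2 * t * x s + t\<^sup>2"
    proof -
      have "N (x + t *\<^sub>R \<alpha> s) = (\<Sum>u\<in>S. (x u)\<^sup>2 + (if u = s then 2 * t * x s + t\<^sup>2 else 0))"
        unfolding N_def by (intro sum.cong) (auto simp: \<alpha>_def power2_eq_square algebra_simps)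
      then show ?thesis using s finite_S by (simp add: sum.distrib N_def)
    qed
    moreover have "\<mu> * N (x + t *\<^sub>R \<alpha> s) \<le> B (x + t *\<^sub>R \<alpha> s) (x + t *\<^sub>R \<alpha> s)"
      using x s by (intro min[rule_format] V_add V_scale alpha_V)
    moreover have "B (x + t *\<^sub>R \<alpha> s) (x + t *\<^sub>R \<alpha> s) = B x x + 2 * t * B x (\<alpha> s) + t\<^sup>2"
      using s by (simp add: B_alpha_self B_sym[of "\<alpha> s" x] algebra_simps power2_eq_square)
    ultimately have "\<mu> * (N x + 2 * t * x s + t\<^sup>2) \<le> \<mu> * N x + 2 * t * B x (\<alpha> s) + t\<^sup>2"
      using x by simp
    then show "0 \<le> 2 * t * (B x (\<alpha> s) - \<mu> * x s) + t\<^sup>2 * (1 - \<mu>)" by (simp add: algebra_simps)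
  qed
  then show ?thesis by simp
qed

text \<open>The entries off the diagonal are at most 0, so absolute values do not raise
  \<open>B\<close>, and \<open>a\<close> is again a minimiser and an eigenvector. At a zero
  coordinate the eigenvector equation is a vanishing sum of terms of one sign; it kills all
  neighbours and, by connectedness, everything.\<close>

lemma min_abs_positive:
  assumes min: "\<forall>y\<in>V. \<mu> * N y \<le> B y y" and x: "x \<in> V" "B x x = \<mu> * N x" "x \<noteq> 0"
  defines "a \<equiv> \<lambda>s. \<bar>x s\<bar>"
  shows "a \<in> V" "B a a = \<mu> * N a" "s \<in> S \<Longrightarrow> 0 < a s"
proof -
  show aV: "a \<in> V" using x by (simp add: a_def V_def)
  have Na: "N a = N x" by (simp add: N_def a_def)
  have "B a a \<le> B x x" unfolding B_def
  proof (intro sum_mono)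
    fix s t assume st: "s \<in> S" "t \<in> S"
    show "a s * a t * bcoef s t \<le> x s * x t * bcoef s t"
    proof (cases "s = t")
      case False
      then have "bcoef s t \<le> 0" using bcoef_bounds st by blast
      moreover have "x s * x t \<le> a s * a t" unfolding a_def abs_mult[symmetric] by simp
      ultimately show ?thesis by (rule mult_right_mono_neg[rotated])
    qed (simp add: a_def)
  qed
  then show Ba: "B a a = \<mu> * N a" using bspec[OF min aV] Na x by simp
  show "0 < a s" if "s \<in> S" for s
  proof (rule ccontr)
    assume "\<not> 0 < a s"
    then have "a s = 0" by (simp add: a_def)
    have "a t = 0" if "t \<in> S" for t
    proof (rule connected_induct[of s "\<lambda>s. a s = 0"])
      show "s \<in> S" "a s = 0" "t \<in> S" by fact+
      fix u v assume uv: "u \<in> S" "v \<in> S" "u \<noteq> v" "bcoef u v < 0" "a u = 0"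
      have "B a (\<alpha> u) = 0" using min_imp_eigenvector[OF min aV Ba uv(1)] uv by simp
      then have 0: "(\<Sum>w\<in>S. - (a w * bcoef w u)) = 0" using uv by (simp add: B_alpha_right sum_negf)
      have "0 \<le> - (a w * bcoef w u)" if "w \<in> S" for w
      proof (cases "w = u")
        case False
        then have "bcoef w u \<le> 0" using bcoef_bounds that uv by blast
        then show ?thesis by (simp add: a_def mult_nonneg_nonpos)
      qed (simp add: uv)
      then have "- (a v * bcoef v u) = 0" using 0 uv finite_S sum_nonneg_eq_0_iff by (metis (no_types, lifting))
      then show "a v = 0" using uv bcoef_sym[of u v] by simp
    qed
    then have "x = 0" using x by (auto simp: a_def V_def fun_eq_iff)
    then show False using x by blast
  qed
qed

lemma perron_frobenius:
  assumes "S \<noteq> {}"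
  obtains \<mu> v where "v \<in> V" "\<And>s. s \<in> S \<Longrightarrow> 0 < v s" "\<And>s. s \<in> S \<Longrightarrow> B v (\<alpha> s) = \<mu> * v s"
    "\<And>x. x \<in> V \<Longrightarrow> \<mu> * N x \<le> B x x"
    "\<And>x. x \<in> V \<Longrightarrow> B x x = \<mu> * N x \<Longrightarrow> \<exists>c. x = c *\<^sub>R v"
proof -
  obtain x0 where x0: "x0 \<in> V" "N x0 = 1" and min: "\<And>x. x \<in> V \<Longrightarrow> B x0 x0 * N x \<le> B x x"
    using min_on_sphere[of S] assms unfolding V_supp_on by auto
  define \<mu> where "\<mu> = B x0 x0"
  define v where "v = (\<lambda>s. \<bar>x0 s\<bar>)"
  have min: "\<forall>x\<in>V. \<mu> * N x \<le> B x x" using min by (simp add: \<mu>_def)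
  have "N 0 = 0" by (simp add: N_def)
  then have x0': "B x0 x0 = \<mu> * N x0" "x0 \<noteq> 0" using x0 by (auto simp: \<mu>_def)
  note v = min_abs_positive[OF min x0(1) x0', folded v_def]
  have eig: "B v (\<alpha> s) = \<mu> * v s" if "s \<in> S" for s
    using min_imp_eigenvector[OF min v(1,2) that] .
  have mult: "\<exists>c. x = c *\<^sub>R v" if x: "x \<in> V" "B x x = \<mu> * N x" for x
  proof -
    obtain s where s: "s \<in> S" using assms by blast
    \<comment> \<open>Simplicity of the eigenvalue: \<open>y\<close> is again a minimiser, but it
      vanishes at \<open>s\<close>, so it is zero by \<open>min_abs_positive\<close>.\<close>
    define c where "c = x s / v s"
    define y where "y = x - c *\<^sub>R v"
    have yV: "y \<in> V" using x v by (simp add: y_def V_diff V_scale)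
    have "B y (\<alpha> t) = \<mu> * y t" if "t \<in> S" for t
      using eig[OF that] min_imp_eigenvector[OF min x that] by (simp add: y_def algebra_simps)
    then have By: "B y y = \<mu> * N y"
      unfolding B_expand_right[of y y] N_def by (simp add: sum_distrib_left power2_eq_square algebra_simps)
    have "v s \<noteq> 0" using v(3)[OF s] by (simp add: v_def)
    then have "y s = 0" by (simp add: y_def c_def)
    then have "y = 0" using min_abs_positive(3)[OF min yV By _ s] by fastforce
    then show ?thesis by (auto simp: y_def)
  qed
  have vpos: "0 < v s" if "s \<in> S" for s using v(3)[OF that] by (simp add: v_def)
  show ?thesis
  proof (rule that[of v \<mu>])
    show "v \<in> V" by (rule v(1))
    show "\<mu> * N x \<le> B x x" if "x \<in> V" for x using min that by blast
  qed (fact vpos eig mult)+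
qed

lemma finite_if_positive_definite:
  assumes "\<And>x. x \<in> V \<Longrightarrow> x \<noteq> 0 \<Longrightarrow> 0 < B x x"
  shows "finite (carrier W)"
proof (rule finite_roots_imp_finite)
  have "finite {b. root b \<and> b \<in> supp_on S}"
    using finite_roots_supp_on[of S] assms unfolding V_supp_on by blast
  moreover have "{b. root b \<and> b \<in> supp_on S} = {b. root b}" using root_V V_supp_on by blast
  ultimately show "finite {b. root b}" by simp
qed

end

section \<open>Indefinite type: three roots facing away from each other\<close>

text \<open>Products of vectors moved by powers of a hyperbolic element are Laurent polynomials of
  this shape in \<open>l ^ n\<close>, and the top coefficient decides their sign for large
  \<open>n\<close>.\<close>

lemma laurent_quadratic_at_bot:
  fixes l X :: real
  assumes "1 < l" "X < 0"
  shows "\<exists>n0. \<forall>n\<ge>n0. X * (l ^ n)\<^sup>2 + Y * l ^ n + Z + Y' / l ^ n + Z' / (l ^ n)\<^sup>2 < C"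
proof -
  define K where "K = \<bar>Y\<bar> + \<bar>Z\<bar> + \<bar>Y'\<bar> + \<bar>Z'\<bar> + \<bar>C\<bar> + 1"
  obtain n0 where n0: "K / (- X) < l ^ n0" using real_arch_pow[OF assms(1)] by blast
  have "X * (l ^ n)\<^sup>2 + Y * l ^ n + Z + Y' / l ^ n + Z' / (l ^ n)\<^sup>2 < C" if "n0 \<le> n" for n
  proof -
    define L where "L = l ^ n"
    have "l ^ n0 \<le> L" unfolding L_def using assms that by (intro power_increasing) auto
    then have "K / (- X) < L" using n0 by linarith
    then have XL: "K < - X * L" using assms by (simp add: field_simps)
    have L: "1 \<le> L" unfolding L_def using assms by (simp add: one_le_power)
    then have L2: "1 \<le> L\<^sup>2" by (simp add: one_le_power)
    have "Y * L \<le> \<bar>Y\<bar> * L" using L by (intro mult_right_mono) auto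
    moreover have "a \<le> \<bar>a\<bar> * L" for a :: real
      using mult_left_mono[OF L, of "\<bar>a\<bar>"] by simp
    then have "Z \<le> \<bar>Z\<bar> * L" "- C \<le> \<bar>C\<bar> * L" using abs_minus_cancel by metis+
    moreover have "Y' / L \<le> \<bar>Y'\<bar> * L"
    proof -
      have "Y' / L \<le> \<bar>Y'\<bar> / L" using L by (intro divide_right_mono) auto
      also have "\<dots> \<le> \<bar>Y'\<bar> / 1" using L by (intro divide_left_mono) auto
      also have "\<dots> \<le> \<bar>Y'\<bar> * L" using mult_left_mono[OF L, of "\<bar>Y'\<bar>"] by simp
      finally show ?thesis .
    qed
    moreover have "Z' / L\<^sup>2 \<le> \<bar>Z'\<bar> * L"
    proof -
      have "Z' / L\<^sup>2 \<le> \<bar>Z'\<bar> / L\<^sup>2" by (intro divide_right_mono) auto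
      also have "\<dots> \<le> \<bar>Z'\<bar> / 1" using L2 by (intro divide_left_mono) auto
      also have "\<dots> \<le> \<bar>Z'\<bar> * L" using mult_left_mono[OF L, of "\<bar>Z'\<bar>"] by simp
      finally show ?thesis .
    qed
    ultimately have "X * L\<^sup>2 + Y * L + Z + Y' / L + Z' / L\<^sup>2 - C
      \<le> X * L\<^sup>2 + (\<bar>Y\<bar> * L + \<bar>Z\<bar> * L + \<bar>Y'\<bar> * L + \<bar>Z'\<bar> * L + \<bar>C\<bar> * L)" by linarith
    also have "\<dots> = (X * L + (K - 1)) * L"
      unfolding K_def power2_eq_square by (simp add: algebra_simps)
    also have "\<dots> < 0" using XL L by (intro mult_neg_pos) auto
    finally show ?thesis unfolding L_def by simp
  qed
  then show ?thesis by blast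
qed

lemma laurent_quadratic_nonpos:
  fixes l X :: real
  assumes "1 < l" "\<And>n. X * (l ^ n)\<^sup>2 + Y * l ^ n + Z + Y' / l ^ n + Z' / (l ^ n)\<^sup>2 \<le> 0"
  shows "X \<le> 0"
proof (rule ccontr)
  assume "\<not> X \<le> 0"
  then have "- X < 0" by simp
  from laurent_quadratic_at_bot[OF assms(1) this, of "- Y" "- Z" "- Y'" "- Z'" 0]
  obtain n where "- X * (l ^ n)\<^sup>2 + - Y * l ^ n + - Z + - Y' / l ^ n + - Z' / (l ^ n)\<^sup>2 < 0" by blast
  then show False using assms(2)[of n] by simp
qed

text \<open>With positive coordinates and negative products with all simple roots, \<open>v\<close>
  is a point of the imaginary cone and serves as a time-like base point.\<close>

locale indefinite_coxeter = irreducible_coxeter +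
  fixes \<mu> :: real and v :: "'a \<Rightarrow> real"
  assumes v_V: "v \<in> V" and v_pos: "\<And>s. s \<in> S \<Longrightarrow> 0 < v s"
    and v_eigen: "\<And>s. s \<in> S \<Longrightarrow> B v (\<alpha> s) = \<mu> * v s" and mu_neg: "\<mu> < 0"
    and infinite_W: "infinite (carrier W)"
begin

lemma B_v: "B v x = \<mu> * (\<Sum>s\<in>S. v s * x s)"
  by (subst B_expand_right) (simp add: v_eigen sum_distrib_left algebra_simps)

text \<open>\<open>B v b\<close> is \<open>\<mu>\<close> times a sum whose terms share one sign, so
  nothing cancels and \<open>B v\<close> measures the size of a root.\<close>

lemma B_v_root:
  assumes "root b" "s \<in> S"
  shows "- \<mu> * v s * \<bar>b s\<bar> \<le> \<bar>B v b\<bar>"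
proof -
  have *: "v s * x s \<le> (\<Sum>s\<in>S. v s * x s)" if "nonneg x" for x
  proof (rule member_le_sum[OF assms(2)])
    show "0 \<le> v t * x t" if "t \<in> S - {s}" for t
      using v_pos[of t] that \<open>nonneg x\<close> by (simp add: nonneg_def)
  qed (rule finite_S)
  have "v s * \<bar>b s\<bar> \<le> \<bar>\<Sum>s\<in>S. v s * b s\<bar>"
    using root_sign[OF assms(1)]
  proof
    assume "nonneg b"
    then show ?thesis using *[of b] by (simp add: nonneg_def)
  next
    assume n: "nonneg (- b)"
    then have "b s \<le> 0" by (simp add: nonneg_def)
    then show ?thesis using *[OF n] by (simp add: sum_negf)
  qed
  then have "- \<mu> * (v s * \<bar>b s\<bar>) \<le> - \<mu> * \<bar>\<Sum>s\<in>S. v s * b s\<bar>"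
    using mu_neg by (intro mult_left_mono) auto
  then show ?thesis unfolding B_v using mu_neg by (simp add: abs_mult)
qed

text \<open>Passing from \<open>g \<otimes> t\<close> to \<open>g\<close>, for a descent
  \<open>t\<close> of \<open>g\<close>, adds a nonnegative multiple of a positive root to the orbit
  point.\<close>

lemma v_le_orbit: "g \<in> carrier W \<Longrightarrow> v s \<le> gact g v s"
proof (induction "len g" arbitrary: g rule: less_induct)
  case less
  show ?case
  proof (cases "g = \<one>")
    case False
    then obtain t where t: "t \<in> S" "len (g \<otimes> t) < len g" using ex_descent less by blast
    let ?h = "g \<otimes> t"
    have h: "?h \<in> carrier W" "?h \<otimes> t = g" using t less by (auto simp: S_carrier mult_S_S)
    have "gact g v = gact ?h (gact t v)" using h t by (metis gact_mult S_carrier)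
    also have "gact t v = v + (- 2 * \<mu> * v t) *\<^sub>R \<alpha> t"
      using t by (simp add: gact_S refl_def v_eigen)
    finally have "gact g v = gact ?h v + (- 2 * \<mu> * v t) *\<^sub>R gact ?h (\<alpha> t)"
      by (simp only: gact_add gact_scale)
    then have "gact g v s = gact ?h v s + (- 2 * \<mu> * v t) * gact ?h (\<alpha> t) s" by simp
    moreover have "0 \<le> gact ?h (\<alpha> t) s"
      using nonneg_gact[OF h(1) t(1)] t h unfolding nonneg_def by simp
    moreover have "v s \<le> gact ?h v s" using less.hyps[of ?h] t h by blast
    moreover have "0 \<le> - 2 * \<mu> * v t" using mu_neg v_pos[OF t(1)] by (simp add: mult_nonpos_nonneg)
    ultimately show ?thesis using mult_nonneg_nonneg by (metis add_increasing2)
  qed simp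
qed

lemma S_nonempty: "S \<noteq> {}"
proof
  assume "S = {}"
  then have "g = \<one>" if "g \<in> carrier W" for g using ex_descent[OF that] by blast
  then have "carrier W \<subseteq> {\<one>}" by blast
  then show False using infinite_W finite_subset by blast
qed

text \<open>The orbit of \<open>v\<close> stays in one half of the cone where \<open>B\<close> is
  negative. The signs of the products between the limit directions \<open>p\<close>,
  \<open>q\<close> and their images are drawn from this.\<close>

lemma B_orbit_neg:
  assumes "g \<in> carrier W" "h \<in> carrier W"
  shows "B (gact g v) (gact h v) < 0"
proof -
  have "B (gact g v) (gact h v) = B v (gact (inv g \<otimes> h) v)"
    using assms by (simp add: B_gact_left gact_mult)
  also have "\<dots> = \<mu> * (\<Sum>s\<in>S. v s * gact (inv g \<otimes> h) v s)" by (rule B_v)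
  also have "\<dots> < 0"
  proof (rule mult_neg_pos[OF mu_neg])
    show "0 < (\<Sum>s\<in>S. v s * gact (inv g \<otimes> h) v s)"
    proof (rule sum_pos[OF finite_S S_nonempty])
      fix s assume s: "s \<in> S"
      have "v s \<le> gact (inv g \<otimes> h) v s" using assms by (intro v_le_orbit) auto
      then show "0 < v s * gact (inv g \<otimes> h) v s" using v_pos[OF s] by simp
    qed
  qed
  finally show ?thesis .
qed

text \<open>Infinitely many roots cannot be bounded, so \<open>B v b\<close> exceeds in absolute
  value the sum \<open>T\<close> of the coordinates of \<open>v\<close> for some root
  \<open>b\<close>. Since \<open>v\<close> combines the simple roots with these coordinates, one
  simple root has a product with \<open>b\<close> beyond 1 in absolute value.\<close>

lemma ex_hyperbolic_pair: "\<exists>a b. root a \<and> root b \<and> B a b < - 1"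
proof -
  define T where "T = (\<Sum>s\<in>S. v s)"
  have "\<exists>b. root b \<and> T < \<bar>B v b\<bar>"
  proof (rule ccontr)
    assume "\<not> ?thesis"
    then have le: "\<bar>B v b\<bar> \<le> T" if "root b" for b using that by (meson not_le)
    define M where "M = (\<Sum>s\<in>S. T / (- \<mu> * v s))"
    have T: "0 \<le> T" unfolding T_def using v_pos by (intro sum_nonneg) (simp add: less_imp_le)
    have "\<bar>b s\<bar> \<le> M" if "root b" "s \<in> S" for b s
    proof -
      have pos: "0 < - \<mu> * v t" if "t \<in> S" for t using mu_neg v_pos[OF that] by (simp add: mult_neg_pos)
      have "- \<mu> * v s * \<bar>b s\<bar> \<le> T" using B_v_root[OF that] le[OF that(1)] by linarith
      then have "\<bar>b s\<bar> \<le> T / (- \<mu> * v s)" using pos_le_divide_eq[OF pos[OF that(2)]] by (simp only: mult.commute)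
      also have "\<dots> \<le> M" unfolding M_def
      proof (rule member_le_sum[OF that(2) _ finite_S])
        show "0 \<le> T / (- \<mu> * v t)" if "t \<in> S - {s}" for t
          using T pos[of t] that by (intro divide_nonneg_pos) auto
      qed
      finally show ?thesis .
    qed
    then have "{b. root b} \<subseteq> {b. root b \<and> (\<forall>s\<in>S. \<bar>b s\<bar> \<le> M)}" by blast
    then have "finite {b. root b}" using finite_bounded_roots finite_subset by blast
    then show False using finite_roots_imp_finite infinite_W by blast
  qed
  then obtain b where b: "root b" "T < \<bar>B v b\<bar>" by blast
  have "\<exists>s\<in>S. 1 < \<bar>B (\<alpha> s) b\<bar>"
  proof (rule ccontr)
    assume "\<not> ?thesis"
    then have le: "\<bar>B (\<alpha> s) b\<bar> \<le> 1" if "s \<in> S" for s using that by (meson not_le)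
    have "\<bar>B v b\<bar> \<le> (\<Sum>s\<in>S. \<bar>v s * B (\<alpha> s) b\<bar>)"
      unfolding B_expand_left[of v b] by (rule sum_abs)
    also have "\<dots> \<le> T" unfolding T_def
    proof (rule sum_mono)
      fix s assume s: "s \<in> S"
      have "v s * \<bar>B (\<alpha> s) b\<bar> \<le> v s * 1"
        using le[OF s] v_pos[OF s] by (intro mult_left_mono) auto
      then show "\<bar>v s * B (\<alpha> s) b\<bar> \<le> v s" using v_pos[OF s] by (simp add: abs_mult)
    qed
    finally show False using b by simp
  qed
  then obtain s where s: "s \<in> S" "1 < \<bar>B (\<alpha> s) b\<bar>" by blast
  show ?thesis
  proof (cases "B (\<alpha> s) b < 0")
    case True
    then show ?thesis using s b root_alpha by (intro exI[of _ "\<alpha> s"] exI[of _ b]) auto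
  next
    case False
    then show ?thesis using s b root_alpha root_minus
      by (intro exI[of _ "\<alpha> s"] exI[of _ "- b"]) auto
  qed
qed

end

text \<open>The model is the product of the reflections in two roots with product below -1. The
  isotropic vectors \<open>p\<close>, which is contracted, and \<open>q\<close>, which is expanded,
  are the ends of its axis. The root \<open>\<beta>\<close> is carried along because its translates
  by powers of \<open>t\<close> are roots that approach the directions of both ends.\<close>

locale hyperbolic_axis = indefinite_coxeter +
  fixes t :: 'a and p q \<beta> :: "'a \<Rightarrow> real" and l \<kappa> d :: real
  assumes t: "t \<in> carrier W" and l: "1 < l" and kappa: "0 < \<kappa>" and d: "d \<noteq> 0"
    and pp: "B p p = 0" and qq: "B q q = 0" and pq: "B p q = - \<kappa>"
    and tp: "gact t p = (1 / l) *\<^sub>R p" and tq: "gact t q = l *\<^sub>R q"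
    and t_fix: "\<And>x. B x p = 0 \<Longrightarrow> B x q = 0 \<Longrightarrow> gact t x = x"
    and beta: "root \<beta>" and beta_eq: "\<beta> = d *\<^sub>R (p - q)" and p_V: "p \<in> V" and q_V: "q \<in> V"
begin

lemma qp: "B q p = - \<kappa>"
  using pq B_sym by metis

lemma inv_t_eq: "gact t x = y \<Longrightarrow> gact (inv t) y = x"
  using gact_inv(1)[OF t] by blast

text \<open>Inverting \<open>t\<close> exchanges the ends, so each statement about \<open>q\<close>
  yields one about \<open>p\<close>.\<close>

lemma flip: "hyperbolic_axis W S \<mu> v (inv t) q p \<beta> l \<kappa> (- d)"
proof unfold_locales
  show "inv t \<in> carrier W" using t by simp
  show "gact (inv t) q = (1 / l) *\<^sub>R q"
  proof (rule inv_t_eq)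
    show "gact t ((1 / l) *\<^sub>R q) = q" using l tq by (simp add: gact_scale)
  qed
  show "gact (inv t) p = l *\<^sub>R p"
  proof (rule inv_t_eq)
    show "gact t (l *\<^sub>R p) = p" using l tp by (simp add: gact_scale)
  qed
  show "gact (inv t) x = x" if "B x q = 0" "B x p = 0" for x
    using inv_t_eq t_fix that by blast
  show "\<beta> = - d *\<^sub>R (q - p)" using beta_eq by (simp add: algebra_simps)
qed (use l kappa d pp qq qp beta p_V q_V in simp_all)

definition tn :: "nat \<Rightarrow> 'a" where "tn n = t [^] n"

lemma tn: "tn n \<in> carrier W"
  using t by (simp add: tn_def)

lemma tn_Suc: "gact (tn (Suc n)) x = gact (tn n) (gact t x)"
  using t by (simp add: tn_def gact_mult)

lemma tn_p: "gact (tn n) p = (1 / l ^ n) *\<^sub>R p"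
proof (induction n)
  case (Suc n)
  then show ?case by (simp only: tn_Suc tp gact_scale) (simp add: mult.commute)
qed (simp add: tn_def)

lemma tn_q: "gact (tn n) q = l ^ n *\<^sub>R q"
proof (induction n)
  case (Suc n)
  then show ?case by (simp only: tn_Suc tq gact_scale) (simp only: scaleR_scaleR power_Suc)
qed (simp add: tn_def)

lemma tn_fix: "B x p = 0 \<Longrightarrow> B x q = 0 \<Longrightarrow> gact (tn n) x = x"
proof (induction n)
  case (Suc n)
  then show ?case by (simp only: tn_Suc t_fix)
qed (simp add: tn_def)

lemma inv_tn_eq: "gact (tn n) x = y \<Longrightarrow> gact (inv (tn n)) y = x"
  using gact_inv(1)[OF tn] by blast

lemma ln: "0 < l ^ n" "l \<noteq> 0"
  using l by auto

lemma abs_div_ln_le: "\<bar>x / l ^ n\<bar> \<le> \<bar>x\<bar>" for x :: real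
proof -
  have "1 \<le> l ^ n" using l by (simp add: one_le_power)
  then have "\<bar>x\<bar> / l ^ n \<le> \<bar>x\<bar> / 1" by (intro divide_left_mono) auto
  then show ?thesis using l by (simp add: abs_divide)
qed

lemma inv_tn_p: "gact (inv (tn n)) p = l ^ n *\<^sub>R p"
proof (rule inv_tn_eq)
  show "gact (tn n) (l ^ n *\<^sub>R p) = p" using ln(2) by (simp add: gact_scale tn_p)
qed

lemma inv_tn_q: "gact (inv (tn n)) q = (1 / l ^ n) *\<^sub>R q"
proof (rule inv_tn_eq)
  show "gact (tn n) ((1 / l ^ n) *\<^sub>R q) = q" using ln(2) by (simp add: gact_scale tn_q)
qed

lemma inv_tn_fix: "B x p = 0 \<Longrightarrow> B x q = 0 \<Longrightarrow> gact (inv (tn n)) x = x"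
  using inv_tn_eq tn_fix by blast

text \<open>Projection along the plane of \<open>p\<close> and \<open>q\<close> onto its orthogonal
  complement; the plus signs come from \<open>B p q = - \<kappa>\<close>.\<close>

definition perp :: "('a \<Rightarrow> real) \<Rightarrow> ('a \<Rightarrow> real)" where
  "perp x = x + (B x q / \<kappa>) *\<^sub>R p + (B x p / \<kappa>) *\<^sub>R q"

lemma perp: "B (perp x) p = 0" "B (perp x) q = 0"
  using kappa pp qq pq qp by (simp_all add: perp_def)

lemma decomp: "x = perp x - (B x q / \<kappa>) *\<^sub>R p - (B x p / \<kappa>) *\<^sub>R q"
  by (simp add: perp_def)

lemma tn_decomp: "gact (tn n) x = perp x - (B x q / \<kappa> / l ^ n) *\<^sub>R p - (B x p / \<kappa> * l ^ n) *\<^sub>R q"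
  by (subst decomp) (simp add: gact_diff gact_scale tn_p tn_q tn_fix perp)

lemma inv_tn_decomp:
  "gact (inv (tn n)) x = perp x - (B x q / \<kappa> * l ^ n) *\<^sub>R p - (B x p / \<kappa> / l ^ n) *\<^sub>R q"
  by (subst decomp) (simp add: gact_diff gact_scale inv_tn_p inv_tn_q inv_tn_fix perp)

text \<open>If \<open>B v q\<close> were 0, then \<open>B v\<close> would stay bounded on the
  translates of \<open>\<beta>\<close> by powers of \<open>t\<close>, while their coordinates grow
  like \<open>l ^ n\<close> times those of \<open>q\<close>. By \<open>B_v_root\<close> this forces
  \<open>q = 0\<close>.\<close>

lemma B_v_q_nonzero: "B v q \<noteq> 0"
proof
  assume z: "B v q = 0"
  have "q s = 0" if s: "s \<in> S" for s
  proof -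
    define c where "c = - \<mu> * v s"
    have c: "0 < c" using mu_neg v_pos[OF s] by (simp add: c_def mult_neg_pos)
    have "c * \<bar>p s / l ^ n - l ^ n * q s\<bar> \<le> \<bar>B v p\<bar>" for n
    proof -
      have eq: "gact (tn n) \<beta> = d *\<^sub>R ((1 / l ^ n) *\<^sub>R p - l ^ n *\<^sub>R q)"
        unfolding beta_eq by (simp only: gact_scale gact_diff tn_p tn_q)
      have "c * \<bar>gact (tn n) \<beta> s\<bar> \<le> \<bar>B v (gact (tn n) \<beta>)\<bar>"
        unfolding c_def using B_v_root[OF root_gact[OF beta tn] s] .
      then have "\<bar>d\<bar> * (c * \<bar>p s / l ^ n - l ^ n * q s\<bar>) \<le> \<bar>d\<bar> * \<bar>B v p / l ^ n\<bar>"
        unfolding eq using z by (simp add: abs_mult mult.left_commute)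
      then have "c * \<bar>p s / l ^ n - l ^ n * q s\<bar> \<le> \<bar>B v p / l ^ n\<bar>"
        by (rule mult_left_le_imp_le) (use d in simp)
      then show ?thesis using abs_div_ln_le[of "B v p" n] by linarith
    qed
    then have "\<bar>p s / l ^ n - l ^ n * q s\<bar> \<le> \<bar>B v p\<bar> / c" for n using c by (simp add: field_simps)
    moreover have "\<bar>p s / l ^ n\<bar> \<le> \<bar>p s\<bar>" for n by (rule abs_div_ln_le)
    ultimately have "\<bar>l ^ n * q s\<bar> \<le> \<bar>B v p\<bar> / c + \<bar>p s\<bar>" for n
      by (smt (verit, ccfv_SIG))
    then have le: "l ^ n * \<bar>q s\<bar> \<le> \<bar>B v p\<bar> / c + \<bar>p s\<bar>" for n by (metis abs_mult abs_of_pos ln(1))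
    show ?thesis
    proof (rule ccontr)
      assume "q s \<noteq> 0"
      obtain n where "(\<bar>B v p\<bar> / c + \<bar>p s\<bar>) / \<bar>q s\<bar> < l ^ n" using real_arch_pow[OF l] by blast
      then show False using le[of n] \<open>q s \<noteq> 0\<close> by (simp add: field_simps)
    qed
  qed
  then have "q = 0" using q_V by (auto simp: V_def fun_eq_iff)
  then show False using pq kappa by simp
qed

lemma B_v_p_nonzero: "B v p \<noteq> 0"
  using hyperbolic_axis.B_v_q_nonzero[OF flip] .

text \<open>Up to the positive factor \<open>x\<^sup>2\<close> this number is the top coefficient of
  the product of two orbit points of \<open>v\<close>, and such products are negative.\<close>

lemma imaginary_pp: "g \<in> carrier W \<Longrightarrow> B (gact g p) p \<le> 0"
proof -
  assume g: "g \<in> carrier W"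
  define x y where "x = B v q / \<kappa>" and "y = B v p / \<kappa>"
  define w where "w = perp v"
  have "x\<^sup>2 * B (gact g p) p \<le> 0"
  proof (rule laurent_quadratic_nonpos[OF l])
    fix n
    let ?L = "l ^ n"
    have "gact (inv (tn n)) v = w - (x * ?L) *\<^sub>R p - (y / ?L) *\<^sub>R q"
      unfolding inv_tn_decomp w_def x_def y_def ..
    moreover have "B (gact (g \<otimes> inv (tn n)) v) (gact (inv (tn n)) v) \<le> 0"
      using B_orbit_neg[of "g \<otimes> inv (tn n)" "inv (tn n)"] g tn by (simp add: less_imp_le)
    ultimately have "B (gact g (w - (x * ?L) *\<^sub>R p - (y / ?L) *\<^sub>R q)) (w - (x * ?L) *\<^sub>R p - (y / ?L) *\<^sub>R q) \<le> 0"
      using g tn by (simp add: gact_mult)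
    moreover have "x\<^sup>2 * B (gact g p) p * ?L\<^sup>2 + (- x * (B (gact g w) p + B (gact g p) w)) * ?L
       + (B (gact g w) w + x * y * (B (gact g p) q + B (gact g q) p))
       + (- y * (B (gact g w) q + B (gact g q) w)) / ?L + (y\<^sup>2 * B (gact g q) q) / ?L\<^sup>2
      = B (gact g (w - (x * ?L) *\<^sub>R p - (y / ?L) *\<^sub>R q)) (w - (x * ?L) *\<^sub>R p - (y / ?L) *\<^sub>R q)"
      unfolding gact_diff gact_scale B_diff_left B_diff_right B_scale_left B_scale_right
      using ln(2) by (simp add: power2_eq_square field_simps)
    ultimately show "x\<^sup>2 * B (gact g p) p * ?L\<^sup>2 + (- x * (B (gact g w) p + B (gact g p) w)) * ?L
       + (B (gact g w) w + x * y * (B (gact g p) q + B (gact g q) p))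
       + (- y * (B (gact g w) q + B (gact g q) w)) / ?L + (y\<^sup>2 * B (gact g q) q) / ?L\<^sup>2 \<le> 0" by (simp only:)
  qed
  moreover have "0 < x\<^sup>2" using B_v_q_nonzero kappa by (simp add: x_def)
  ultimately show ?thesis by (simp add: mult_le_0_iff)
qed

lemma imaginary_pq: "g \<in> carrier W \<Longrightarrow> B (gact g p) q \<le> 0"
proof -
  assume g: "g \<in> carrier W"
  define x y where "x = B v q / \<kappa>" and "y = B v p / \<kappa>"
  define w where "w = perp v"
  have main: "x * y * B (gact h p) q \<le> 0" if h: "h \<in> carrier W" for h
  proof (rule laurent_quadratic_nonpos[OF l])
    fix n
    let ?L = "l ^ n"
    have "gact (inv (tn n)) v = w - (x * ?L) *\<^sub>R p - (y / ?L) *\<^sub>R q"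
      unfolding inv_tn_decomp w_def x_def y_def ..
    moreover have "gact (tn n) v = w - (x / ?L) *\<^sub>R p - (y * ?L) *\<^sub>R q"
      unfolding tn_decomp w_def x_def y_def ..
    moreover have "B (gact (h \<otimes> inv (tn n)) v) (gact (tn n) v) \<le> 0"
      using B_orbit_neg[of "h \<otimes> inv (tn n)" "tn n"] h tn by (simp add: less_imp_le)
    ultimately have "B (gact h (w - (x * ?L) *\<^sub>R p - (y / ?L) *\<^sub>R q)) (w - (x / ?L) *\<^sub>R p - (y * ?L) *\<^sub>R q) \<le> 0"
      using h tn by (simp add: gact_mult)
    moreover have "x * y * B (gact h p) q * ?L\<^sup>2 + (- y * B (gact h w) q - x * B (gact h p) w) * ?L
       + (B (gact h w) w + x\<^sup>2 * B (gact h p) p + y\<^sup>2 * B (gact h q) q)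
       + (- x * B (gact h w) p - y * B (gact h q) w) / ?L + (x * y * B (gact h q) p) / ?L\<^sup>2
      = B (gact h (w - (x * ?L) *\<^sub>R p - (y / ?L) *\<^sub>R q)) (w - (x / ?L) *\<^sub>R p - (y * ?L) *\<^sub>R q)"
      unfolding gact_diff gact_scale B_diff_left B_diff_right B_scale_left B_scale_right
      using ln(2) by (simp add: power2_eq_square field_simps)
    ultimately show "x * y * B (gact h p) q * ?L\<^sup>2 + (- y * B (gact h w) q - x * B (gact h p) w) * ?L
       + (B (gact h w) w + x\<^sup>2 * B (gact h p) p + y\<^sup>2 * B (gact h q) q)
       + (- x * B (gact h w) p - y * B (gact h q) w) / ?L + (x * y * B (gact h q) p) / ?L\<^sup>2 \<le> 0" by (simp only:)
  qed
  \<comment> \<open>The identity element, for which \<open>B p q\<close> is known, settles the sign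
    of \<open>x * y\<close>.\<close>
  have "x * y * - \<kappa> \<le> 0" using main[of \<one>] pq by simp
  then have "0 \<le> (x * y) * \<kappa>" by simp
  then have "0 \<le> x * y" using kappa by (simp only: zero_le_mult_iff) linarith
  moreover have "x * y \<noteq> 0" using B_v_q_nonzero B_v_p_nonzero kappa by (simp add: x_def y_def)
  ultimately have "0 < x * y" by linarith
  then show ?thesis using main[OF g] by (meson mult_pos_pos not_le)
qed

text \<open>The roots \<open>a n\<close>, \<open>b n\<close>, \<open>c n\<close> tend to the
  directions of \<open>q\<close>, \<open>p\<close> and \<open>gact g p\<close>. The pairwise
  products of these directions are negative and are the top coefficients of the products of the
  roots.\<close>

lemma facing_triple_if:
  assumes g: "g \<in> carrier W" and "B (gact g p) p \<noteq> 0" "B (gact g p) q \<noteq> 0"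
  shows "\<exists>a b c. root a \<and> root b \<and> root c \<and> B a b < - 1 \<and> B b c < - 1 \<and> B a c < - 1"
proof -
  have neg: "B (gact g p) p < 0" "B (gact g p) q < 0"
    using imaginary_pp[OF g] imaginary_pq[OF g] assms by auto
  define D where "D = d\<^sup>2"
  have D: "0 < D" using d by (simp add: D_def)
  define a where "a n = - gact (tn n) \<beta>" for n
  define b where "b n = gact (inv (tn n)) \<beta>" for n
  define c where "c n = gact g (b n)" for n
  have a_eq: "a n = d *\<^sub>R (l ^ n *\<^sub>R q - (1 / l ^ n) *\<^sub>R p)" for n
    unfolding a_def beta_eq by (simp only: gact_scale gact_diff tn_p tn_q) (simp add: algebra_simps)
  have b_eq: "b n = d *\<^sub>R (l ^ n *\<^sub>R p - (1 / l ^ n) *\<^sub>R q)" for n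
    unfolding b_def beta_eq by (simp only: gact_scale gact_diff inv_tn_p inv_tn_q)
  have c_eq: "c n = d *\<^sub>R (l ^ n *\<^sub>R gact g p - (1 / l ^ n) *\<^sub>R gact g q)" for n
    unfolding c_def b_eq by (simp only: gact_scale gact_diff)
  have ab: "B (a n) (b n) = - \<kappa> * D * (l ^ n)\<^sup>2 + 0 * l ^ n + 0 + 0 / l ^ n + (- \<kappa> * D) / (l ^ n)\<^sup>2" for n
    unfolding a_eq b_eq D_def using ln(2) pp qq pq qp by (simp add: power2_eq_square field_simps)
  have bc: "B (b n) (c n) = (B (gact g p) p * D) * (l ^ n)\<^sup>2 + 0 * l ^ n
     + (- D * (B (gact g p) q + B (gact g q) p)) + 0 / l ^ n + (D * B (gact g q) q) / (l ^ n)\<^sup>2" for n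
    unfolding c_eq b_eq B_sym[of "d *\<^sub>R (l ^ n *\<^sub>R p - (1 / l ^ n) *\<^sub>R q)"] D_def
    using ln(2) by (simp add: power2_eq_square field_simps)
  have ac: "B (a n) (c n) = (B (gact g p) q * D) * (l ^ n)\<^sup>2 + 0 * l ^ n
     + (- D * (B (gact g p) p + B (gact g q) q)) + 0 / l ^ n + (D * B (gact g q) p) / (l ^ n)\<^sup>2" for n
    unfolding c_eq a_eq B_sym[of "d *\<^sub>R (l ^ n *\<^sub>R q - (1 / l ^ n) *\<^sub>R p)"] D_def
    using ln(2) by (simp add: power2_eq_square field_simps)
  have "- \<kappa> * D < 0" "B (gact g p) p * D < 0" "B (gact g p) q * D < 0"
    using D kappa neg by (simp_all add: mult_neg_pos)
  note this[THEN laurent_quadratic_at_bot[OF l]]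
  then obtain n1 n2 n3 where "\<forall>n\<ge>n1. B (a n) (b n) < - 1" "\<forall>n\<ge>n2. B (b n) (c n) < - 1"
    "\<forall>n\<ge>n3. B (a n) (c n) < - 1" unfolding ab bc ac by metis
  then have "B (a n) (b n) < - 1 \<and> B (b n) (c n) < - 1 \<and> B (a n) (c n) < - 1" if "n = n1 + n2 + n3" for n
    using that by simp
  moreover have "root (a n) \<and> root (b n) \<and> root (c n)" for n
    unfolding a_def b_def c_def using root_gact root_minus beta tn g by simp
  ultimately show ?thesis by blast
qed

end

section \<open>Excluding a degenerate axis\<close>

context hyperbolic_axis
begin

text \<open>The hypothesis is applied to the reflection in \<open>c\<close>, which moves
  \<open>p\<close> to a vector whose product with \<open>p\<close> is
  \<open>- 2 * (B c p)\<^sup>2\<close>.\<close>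

lemma root_dichotomy_aux:
  assumes none: "\<And>g. g \<in> carrier W \<Longrightarrow> B (gact g p) p = 0 \<or> B (gact g p) q = 0"
    and c: "root c"
  shows "B c p = 0 \<or> 2 * B c p * B c q = - \<kappa>"
proof -
  obtain r where r: "r \<in> carrier W" "\<And>x. gact r x = refl c x" using root_reflection c by blast
  have "B (gact r p) p = - 2 * (B c p)\<^sup>2"
    by (simp add: r(2) refl_def pp B_sym[of p c] power2_eq_square)
  moreover have "B (gact r p) q = - \<kappa> - 2 * B c p * B c q"
    by (simp add: r(2) refl_def pq B_sym[of p c])
  ultimately show ?thesis using none[OF r(1)] by auto
qed

end

text \<open>What is left over when no \<open>g\<close> meets the conditions of
  \<open>facing_triple_if\<close>, neither for the axis nor for its reversal.\<close>

locale degenerate_axis = hyperbolic_axis +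
  assumes none_p: "\<And>g. g \<in> carrier W \<Longrightarrow> B (gact g p) p = 0 \<or> B (gact g p) q = 0"
    and none_q: "\<And>g. g \<in> carrier W \<Longrightarrow> B (gact g q) q = 0 \<or> B (gact g q) p = 0"
begin

lemma root_dichotomy:
  assumes "root c"
  shows "(B c p = 0 \<and> B c q = 0) \<or> 2 * B c p * B c q = - \<kappa>"
proof -
  have "B c q = 0 \<or> 2 * B c q * B c p = - \<kappa>"
    using hyperbolic_axis.root_dichotomy_aux[OF flip _ assms] none_q by blast
  moreover have "B c p = 0 \<or> 2 * B c p * B c q = - \<kappa>"
    using root_dichotomy_aux[OF none_p assms] .
  ultimately show ?thesis by auto
qed

text \<open>The left side is the product of the parts of \<open>c\<close> and \<open>e\<close>
  orthogonal to the axis plane. If it were nonzero, \<open>root_dichotomy\<close> for the reflection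
  in \<open>c\<close> of a translate of \<open>e\<close> would leave only two values for
  \<open>b n\<close>, although \<open>b n\<close> grows like \<open>l ^ n\<close>.\<close>

lemma transversal_roots:
  assumes c: "root c" and e: "root e"
    and I: "2 * B c p * B c q = - \<kappa>" "2 * B e p * B e q = - \<kappa>"
  shows "B c e + (B c p * B e q + B c q * B e p) / \<kappa> = 0"
proof (rule ccontr)
  define B' where "B' = B c e + (B c p * B e q + B c q * B e p) / \<kappa>"
  assume "B c e + (B c p * B e q + B c q * B e p) / \<kappa> \<noteq> 0"
  then have nz: "B' \<noteq> 0" by (simp add: B'_def)
  define b where "b n = B c (gact (tn n) e)" for n
  have b: "b n = B' - (B c p * B e q / l ^ n + B c q * B e p * l ^ n) / \<kappa>" for n
  proof -
    have "B c (perp e) = B'" using kappa by (simp add: perp_def B'_def field_simps)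
    then show ?thesis using kappa by (simp add: b_def tn_decomp field_simps)
  qed
  have bound: "b n = 0 \<or> b n = - 1 / (4 * B')" for n
  proof -
    let ?L = "l ^ n"
    define f where "f = refl c (gact (tn n) e)"
    have f: "root f" unfolding f_def using root_refl root_gact c e tn by blast
    have "B f p = B (gact (tn n) e) p - 2 * b n * B c p"
      by (simp add: f_def refl_def b_def B_sym[of "gact (tn n) e" c])
    also have "B (gact (tn n) e) p = B e p * ?L"
      using tn by (simp add: B_gact_left inv_tn_p)
    finally have fp: "B f p = B e p * ?L - 2 * b n * B c p" .
    have "B f q = B (gact (tn n) e) q - 2 * b n * B c q"
      by (simp add: f_def refl_def b_def B_sym[of "gact (tn n) e" c])
    also have "B (gact (tn n) e) q = B e q / ?L"
      using tn by (simp add: B_gact_left inv_tn_q)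
    finally have fq: "B f q = B e q / ?L - 2 * b n * B c q" .
    have *: "B c p * B e q / ?L + B c q * B e p * ?L = \<kappa> * (B' - b n)"
      unfolding b using kappa by simp
    have "2 * B f p * B f q = 2 * B e p * B e q - 4 * b n * (B c p * B e q / ?L + B c q * B e p * ?L)
        + 4 * (b n)\<^sup>2 * (2 * B c p * B c q)"
      unfolding fp fq using ln(2) by (simp add: field_simps power2_eq_square)
    also have "\<dots> = 2 * B e p * B e q - 4 * b n * (\<kappa> * (B' - b n)) + 4 * (b n)\<^sup>2 * (2 * B c p * B c q)"
      unfolding * ..
    also have "\<dots> = - \<kappa> - 4 * \<kappa> * b n * B'"
      unfolding I by (simp add: algebra_simps power2_eq_square)
    finally have "2 * B f p * B f q = - \<kappa> - 4 * \<kappa> * b n * B'" .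
    then have "- \<kappa> - 4 * \<kappa> * b n * B' = 0 \<or> - \<kappa> - 4 * \<kappa> * b n * B' = - \<kappa>"
      using root_dichotomy[OF f] by auto
    then have "\<kappa> * (1 + 4 * b n * B') = 0 \<or> \<kappa> * (b n * B') = 0" by (auto simp: algebra_simps)
    then have "b n * (4 * B') = - 1 \<or> b n * B' = 0" using kappa by (auto simp: mult.commute mult.left_commute)
    then show ?thesis
    proof
      assume "b n * (4 * B') = - 1"
      then have "b n = - 1 / (4 * B')" using nz by (subst eq_divide_eq) simp
      then show ?thesis ..
    qed (use nz in simp)
  qed
  define M where "M = \<bar>1 / (4 * B')\<bar> + \<bar>B'\<bar>"
  define A where "A = \<bar>B c q * B e p\<bar> / \<kappa>"
  have "B c q \<noteq> 0" "B e p \<noteq> 0" using I kappa by auto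
  then have A: "0 < A" using kappa by (simp add: A_def)
  have le: "A * l ^ n \<le> M + \<bar>B c p * B e q\<bar> / \<kappa>" for n
  proof -
    have "\<bar>b n\<bar> \<le> \<bar>1 / (4 * B')\<bar>" using bound[of n] by auto
    moreover have "B c q * B e p * l ^ n / \<kappa> = B' - b n - B c p * B e q / l ^ n / \<kappa>"
      unfolding b using kappa by (simp add: field_simps)
    ultimately have "\<bar>B c q * B e p * l ^ n / \<kappa>\<bar> \<le> M + \<bar>B c p * B e q / l ^ n / \<kappa>\<bar>"
      unfolding M_def by linarith
    moreover have "\<bar>B c p * B e q / l ^ n / \<kappa>\<bar> \<le> \<bar>B c p * B e q\<bar> / \<kappa>"
    proof -
      have "1 \<le> l ^ n" using l by (simp add: one_le_power)
      then have "\<bar>B c p * B e q\<bar> / l ^ n \<le> \<bar>B c p * B e q\<bar> / 1" by (intro divide_left_mono) auto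
      then have "\<bar>B c p * B e q\<bar> / l ^ n / \<kappa> \<le> \<bar>B c p * B e q\<bar> / \<kappa>"
        using kappa by (intro divide_right_mono) auto
      then show ?thesis using kappa l by (simp add: abs_divide)
    qed
    moreover have "\<bar>B c q * B e p * l ^ n / \<kappa>\<bar> = A * l ^ n"
      using kappa l by (simp add: A_def abs_mult abs_divide)
    ultimately show ?thesis by linarith
  qed
  obtain n where "(M + \<bar>B c p * B e q\<bar> / \<kappa>) / A < l ^ n" using real_arch_pow[OF l] by blast
  then show False using le[of n] A by (simp add: field_simps)
qed

text \<open>Compare \<open>c\<close> with its reflection in \<open>e\<close>: both have the same
  products with \<open>p\<close> and \<open>q\<close>, and \<open>transversal_roots\<close> becomes
  \<open>1 - 2 * (B c e)\<^sup>2 = 1\<close>.\<close>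

lemma transversal_perp:
  assumes c: "root c" and e: "root e"
    and I: "2 * B c p * B c q = - \<kappa>" "B e p = 0" "B e q = 0"
  shows "B c e = 0"
proof -
  define f where "f = refl e c"
  have f: "root f" using root_refl e c by (simp add: f_def)
  have "B f p = B c p" "B f q = B c q" using I by (simp_all add: f_def refl_def)
  then have "B c f + (B c p * B c q + B c q * B c p) / \<kappa> = 0"
    using transversal_roots[OF c f] I by simp
  moreover have "B c p * B c q + B c q * B c p = - \<kappa>" using I by simp
  moreover have "B c f = 1 - 2 * (B c e)\<^sup>2"
    using root_norm[OF c] by (simp add: f_def refl_def power2_eq_square)
  ultimately show ?thesis using kappa by simp
qed

text \<open>By connectedness no simple root is orthogonal to the axis. Two of them, with products
  \<open>x\<close> and \<open>y\<close> with \<open>p\<close>, have product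
  \<open>(x\<^sup>2 + y\<^sup>2) / (2 * x * y)\<close>, of absolute value at least 1; the bounds on
  \<open>bcoef\<close> force -1 and \<open>x = - y\<close>. Three nonzero numbers are never pairwise
  opposite, and with at most two such simple roots the form cannot have a negative
  eigenvalue.\<close>

lemma degenerate_axis_False: False
proof -
  have all: "2 * B (\<alpha> s) p * B (\<alpha> s) q = - \<kappa>" if s: "s \<in> S" for s
  proof -
    have "\<exists>u\<in>S. B (\<alpha> u) p \<noteq> 0"
    proof (rule ccontr)
      assume "\<not> ?thesis"
      then have "B q p = 0" unfolding B_expand_left[of q p] by simp
      then show False using qp kappa by simp
    qed
    then obtain u where u: "u \<in> S" "B (\<alpha> u) p \<noteq> 0" by blast
    show ?thesis
    proof (rule connected_induct[of u "\<lambda>s. 2 * B (\<alpha> s) p * B (\<alpha> s) q = - \<kappa>"])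
      show "2 * B (\<alpha> u) p * B (\<alpha> u) q = - \<kappa>" using root_dichotomy[OF root_alpha[OF u(1)]] u by blast
      fix a b assume ab: "a \<in> S" "b \<in> S" "bcoef a b < 0" "2 * B (\<alpha> a) p * B (\<alpha> a) q = - \<kappa>"
      have "B (\<alpha> a) (\<alpha> b) \<noteq> 0" using ab by (simp add: B_alpha)
      then have "\<not> (B (\<alpha> b) p = 0 \<and> B (\<alpha> b) q = 0)"
        using transversal_perp[OF root_alpha[OF ab(1)] root_alpha[OF ab(2)] ab(4)] by blast
      then show "2 * B (\<alpha> b) p * B (\<alpha> b) q = - \<kappa>" using root_dichotomy[OF root_alpha[OF ab(2)]] by blast
    qed (use u s in auto)
  qed
  have opp: "B (\<alpha> s) p = - B (\<alpha> u) p \<and> bcoef s u = - 1" if su: "s \<in> S" "u \<in> S" "s \<noteq> u" for s u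
  proof -
    define x y where "x = B (\<alpha> s) p" and "y = B (\<alpha> u) p"
    have nz: "x \<noteq> 0" "y \<noteq> 0" using all[OF su(1)] all[OF su(2)] kappa by (auto simp: x_def y_def)
    have q: "B (\<alpha> s) q = - \<kappa> / (2 * x)" "B (\<alpha> u) q = - \<kappa> / (2 * y)"
      using all[OF su(1)] all[OF su(2)] nz by (auto simp: x_def[symmetric] y_def[symmetric] field_simps)
    have "bcoef s u + (x * (- \<kappa> / (2 * y)) + - \<kappa> / (2 * x) * y) / \<kappa> = 0"
      using transversal_roots[OF root_alpha[OF su(1)] root_alpha[OF su(2)] all[OF su(1)] all[OF su(2)]] su
      unfolding q x_def[symmetric] y_def[symmetric] by (simp add: B_alpha)
    moreover have "(x * (- \<kappa> / (2 * y)) + - \<kappa> / (2 * x) * y) / \<kappa> = - ((x\<^sup>2 + y\<^sup>2) / (2 * x * y))"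
      using nz kappa by (simp add: field_simps power2_eq_square)
    ultimately have bc: "bcoef s u = (x\<^sup>2 + y\<^sup>2) / (2 * x * y)" by linarith
    have bd: "- 1 \<le> bcoef s u" "bcoef s u \<le> 0" using bcoef_bounds su by auto
    have sq: "0 < x\<^sup>2 + y\<^sup>2" using nz by (simp add: sum_power2_gt_zero_iff)
    have "x * y < 0"
    proof (rule ccontr)
      assume "\<not> x * y < 0"
      then have "0 < 2 * x * y" using nz by (simp add: mult.assoc less_le)
      then have "0 < bcoef s u" unfolding bc using sq by (intro divide_pos_pos) 
      then show False using bd by simp
    qed
    then have neg: "2 * x * y < 0" by simp
    have "- 1 * (2 * x * y) \<ge> x\<^sup>2 + y\<^sup>2" using bd(1) neg unfolding bc by (simp add: field_simps)
    then have "(x + y)\<^sup>2 \<le> 0" by (simp add: power2_eq_square algebra_simps)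
    then have "x = - y" by simp
    then have "bcoef s u = - 1" unfolding bc using nz by (simp add: power2_eq_square)
    then show ?thesis using \<open>x = - y\<close> by (simp add: x_def y_def)
  qed
  obtain s where s: "s \<in> S" using S_nonempty by blast
  show False
  proof (cases "S = {s}")
    case True
    have "B v (\<alpha> s) = v s" unfolding B_alpha_right[OF s] using bcoef_refl[OF s] by (subst True) simp
    then have "v s = \<mu> * v s" using v_eigen[OF s] by simp
    then show False using v_pos[OF s] mu_neg mult_neg_pos by fastforce
  next
    case False
    then obtain u where u: "u \<in> S" "u \<noteq> s" using s by blast
    have "w = s \<or> w = u" if "w \<in> S" for w
    proof (rule ccontr)
      assume "\<not> (w = s \<or> w = u)"
      then have "B (\<alpha> s) p = - B (\<alpha> u) p" "B (\<alpha> s) p = - B (\<alpha> w) p" "B (\<alpha> u) p = - B (\<alpha> w) p"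
        using opp[OF s u(1)] opp[OF s that] opp[OF u(1) that] u by auto
      then have "B (\<alpha> s) p = 0" by linarith
      then show False using all[OF s] kappa by simp
    qed
    then have S: "S = {s, u}" using s u by blast
    have st: "bcoef s u = - 1" "bcoef u s = - 1" using opp[OF s u(1)] opp[OF u(1) s] u by auto
    \<comment> \<open>Opposite numbers, although both should have the sign of
      \<open>\<mu>\<close>.\<close>
    have "B v (\<alpha> s) = v s - v u" "B v (\<alpha> u) = v u - v s"
      unfolding B_alpha_right[OF s] B_alpha_right[OF u(1)]
      using bcoef_refl[OF s] bcoef_refl[OF u(1)] st u by (subst S; simp)+
    moreover have "B v (\<alpha> s) < 0" "B v (\<alpha> u) < 0"
      using v_eigen s u v_pos mu_neg by (auto simp: mult_neg_pos)
    ultimately show False by linarith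
  qed
qed

end

context indefinite_coxeter
begin

lemma ex_hyperbolic_axis: "\<exists>t p q \<beta> l \<kappa> d. hyperbolic_axis W S \<mu> v t p q \<beta> l \<kappa> d"
proof -
  obtain a b where ab: "root a" "root b" "B a b < - 1" using ex_hyperbolic_pair by blast
  define k where "k = - B a b"
  have k: "1 < k" using ab by (simp add: k_def)
  define \<sigma> where "\<sigma> = sqrt (k\<^sup>2 - 1)"
  have k2: "1 < k\<^sup>2" using k by (simp add: power2_eq_square less_1_mult)
  have s: "0 < \<sigma>" "\<sigma>\<^sup>2 = k\<^sup>2 - 1" using k2 by (simp_all add: \<sigma>_def)
  \<comment> \<open>\<open>m\<close> and \<open>m'\<close> are the zeros of
    \<open>X\<^sup>2 - 2 * k * X + 1\<close>, the condition for \<open>a + X *\<^sub>R b\<close> to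
    be isotropic. The reflections in \<open>a\<close> and in \<open>b\<close> each swap the two
    isotropic lines, so their product scales both.\<close>
  define m where "m = k + \<sigma>"
  define m' where "m' = k - \<sigma>"
  have mm: "m * m' = 1" using s(2) by (simp add: m_def m'_def algebra_simps power2_eq_square)
  have m: "1 < m" using k s by (simp add: m_def)
  have sq: "m\<^sup>2 = 2 * k * m - 1" "m'\<^sup>2 = 2 * k * m' - 1"
    using s(2) by (simp_all add: m_def m'_def power2_eq_square algebra_simps)
  define p q where "p = a + m *\<^sub>R b" and "q = a + m' *\<^sub>R b"
  have B: "B a a = 1" "B b b = 1" "B a b = - k" "B b a = - k"
    using root_norm ab B_sym by (auto simp: k_def)
  obtain ra where ra: "ra \<in> carrier W" "\<And>x. gact ra x = refl a x" using root_reflection ab by blast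
  obtain rb where rb: "rb \<in> carrier W" "\<And>x. gact rb x = refl b x" using root_reflection ab by blast
  define t where "t = ra \<otimes> rb"
  have t_act: "gact t x = refl a (refl b x)" for x using ra rb by (simp add: t_def gact_mult)
  have bp: "refl b p = q"
    by (rule ext) (simp add: refl_def p_def q_def B algebra_simps m_def m'_def)
  have bq: "refl b q = p"
    using bp refl_refl[OF B(2)] by metis
  have aq: "refl a q = m'\<^sup>2 *\<^sub>R p"
  proof -
    have "refl a q = (2 * k * m' - 1) *\<^sub>R a + m' *\<^sub>R b"
      by (rule ext) (simp add: refl_def q_def B algebra_simps)
    also have "\<dots> = m'\<^sup>2 *\<^sub>R a + (m' * (m * m')) *\<^sub>R b" unfolding sq mm by simp
    also have "\<dots> = m'\<^sup>2 *\<^sub>R p" by (simp add: p_def scaleR_add_right power2_eq_square mult_ac)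
    finally show ?thesis .
  qed
  have ap: "refl a p = m\<^sup>2 *\<^sub>R q"
  proof -
    have "refl a p = (2 * k * m - 1) *\<^sub>R a + m *\<^sub>R b"
      by (rule ext) (simp add: refl_def p_def B algebra_simps)
    also have "\<dots> = m\<^sup>2 *\<^sub>R a + (m * (m * m')) *\<^sub>R b" unfolding sq mm by simp
    also have "\<dots> = m\<^sup>2 *\<^sub>R q" by (simp add: q_def scaleR_add_right power2_eq_square mult_ac)
    finally show ?thesis .
  qed
  have inv: "1 / m\<^sup>2 = m'\<^sup>2"
  proof -
    have "m\<^sup>2 * m'\<^sup>2 = 1" using mm by (metis power_mult_distrib power_one)
    then show ?thesis using m by (simp add: field_simps)
  qed
  have diff: "p - q = (2 * \<sigma>) *\<^sub>R b"
    by (rule ext) (simp add: p_def q_def m_def m'_def algebra_simps)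
  have "hyperbolic_axis W S \<mu> v t p q b (m\<^sup>2) (2 * \<sigma>\<^sup>2) (1 / (2 * \<sigma>))"
  proof unfold_locales
    show "t \<in> carrier W" using ra rb by (simp add: t_def)
    show "1 < m\<^sup>2" using m by (simp add: power2_eq_square less_1_mult)
    show "0 < 2 * \<sigma>\<^sup>2" "1 / (2 * \<sigma>) \<noteq> 0" using s(1) by simp_all
    show "B p p = 0" "B q q = 0"
      using sq by (simp_all add: p_def q_def B algebra_simps power2_eq_square)
    show "B p q = - (2 * \<sigma>\<^sup>2)"
    proof -
      have "B p q = 1 - k * (m + m') + m * m'" by (simp add: p_def q_def B algebra_simps)
      then show ?thesis unfolding mm s(2) by (simp add: m_def m'_def power2_eq_square algebra_simps)
    qed
    show "gact t p = (1 / m\<^sup>2) *\<^sub>R p" unfolding t_act bp aq inv ..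
    show "gact t q = m\<^sup>2 *\<^sub>R q" unfolding t_act bq ap ..
    show "gact t x = x" if "B x p = 0" "B x q = 0" for x
    proof -
      have "B x a + m * B x b = 0" "B x a + m' * B x b = 0" using that by (simp_all add: p_def q_def)
      then have "(m - m') * B x b = 0" unfolding left_diff_distrib by linarith
      moreover have "m - m' = 2 * \<sigma>" by (simp add: m_def m'_def)
      ultimately have "B x b = 0" using s(1) by simp
      moreover then have "B x a = 0" using \<open>B x a + m * B x b = 0\<close> by simp
      ultimately show ?thesis by (simp add: t_act refl_def)
    qed
    show "root b" by fact
    show "b = (1 / (2 * \<sigma>)) *\<^sub>R (p - q)" unfolding diff using s by simp
    show "p \<in> V" "q \<in> V" using ab root_V by (auto simp: p_def q_def intro!: V_add V_scale)
  qed
  then show ?thesis by blast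
qed

lemma ex_facing_triple:
  "\<exists>a b c. root a \<and> root b \<and> root c \<and> B a b < - 1 \<and> B b c < - 1 \<and> B a c < - 1"
proof -
  obtain t p q \<beta> l \<kappa> d where ax: "hyperbolic_axis W S \<mu> v t p q \<beta> l \<kappa> d"
    using ex_hyperbolic_axis by blast
  show ?thesis
  proof (rule ccontr)
    assume no: "\<not> ?thesis"
    have "degenerate_axis W S \<mu> v t p q \<beta> l \<kappa> d"
      using hyperbolic_axis.facing_triple_if[OF ax] no
        hyperbolic_axis.facing_triple_if[OF hyperbolic_axis.flip[OF ax]]
      by (intro degenerate_axis.intro[OF ax] degenerate_axis_axioms.intro) blast+
    then show False by (rule degenerate_axis.degenerate_axis_False)
  qed
qed

end

section \<open>Infinite-dimensional irreducible representations\<close>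

text \<open>Makes room for the group algebra inside the given space: the elements of a countable
  group become independent vectors.\<close>

lemma infinite_dim_independent_family:
  fixes scale :: "complex \<Rightarrow> 'v::ab_group_add \<Rightarrow> 'v" and G :: "'g set"
  assumes vs: "vector_space scale" and inf: "\<not> finite_dim scale UNIV" and G: "countable G"
  obtains b where "inj_on b G" "\<not> Modules.module.dependent scale (b ` G)"
proof -
  interpret V: vector_space scale by (rule vs)
  obtain B where B: "V.independent B" "V.span B = UNIV"
    using V.independent_extend_basis[OF V.independent_empty] V.span_extend_basis[OF V.independent_empty] by blast
  have "infinite B" using inf B unfolding finite_dim_def by blast
  then obtain f :: "nat \<Rightarrow> 'v" where f: "inj f" "range f \<subseteq> B" using infinite_countable_subset by blast
  define b where "b = f \<circ> to_nat_on G"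
  have "inj_on b G" unfolding b_def
    using G f(1) by (intro comp_inj_on inj_on_to_nat_on) (auto intro: inj_on_subset)
  moreover have "b ` G \<subseteq> B" using f(2) by (auto simp: b_def)
  then have "V.independent (b ` G)" using B(1) V.dependent_mono by blast
  ultimately show ?thesis using that by blast
qed

text \<open>The function \<open>\<phi>\<close> plays the role of a matrix coefficient of a cyclic vector.  Any submodule
  of the group algebra that is maximal among those containing the radical of \<open>\<phi>\<close> but not \<open>\<one>\<close>
  has an irreducible quotient.  There \<open>r\<close> negates the image \<open>e\<close> of \<open>\<one>\<close> and fixes the vectors
  \<open>inv d n \<otimes> d m\<close> applied to \<open>e\<close> for \<open>m \<noteq> n\<close>, so the vectors \<open>d n\<close> applied to \<open>e\<close> are independent.\<close>
lemma infinite_dim_irreducible_representation: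
  fixes G (structure) and scale :: "complex \<Rightarrow> 'v::ab_group_add \<Rightarrow> 'v"
    and \<phi> :: "'g \<Rightarrow> complex" and d :: "nat \<Rightarrow> 'g"
  assumes grp: "group G" and count: "countable (carrier G)"
    and vs: "vector_space scale" and inf: "\<not> finite_dim scale UNIV"
    and r: "r \<in> carrier G" and d: "\<And>n. d n \<in> carrier G"
    and phi_one: "\<phi> \<one> = 1"
    and phi_r: "\<And>g. g \<in> carrier G \<Longrightarrow> \<phi> (g \<otimes> r) = - \<phi> g"
    and phi_d: "\<And>g m n. g \<in> carrier G \<Longrightarrow> m \<noteq> n \<Longrightarrow>
      \<phi> (g \<otimes> (r \<otimes> (inv d n \<otimes> d m))) = \<phi> (g \<otimes> (inv d n \<otimes> d m))"
  shows "\<exists>V \<rho>. irreducible_representation G scale V \<rho> \<and> \<not> finite_dim scale V"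
proof -
  interpret group G by (rule grp)
  interpret V: vector_space scale by (rule vs)
  interpret VV: vector_space_pair scale scale by unfold_locales
  interpret C: vector_space "(*) :: complex \<Rightarrow> complex \<Rightarrow> complex"
    by unfold_locales (simp_all add: algebra_simps)
  interpret VC: vector_space_pair scale "(*) :: complex \<Rightarrow> complex \<Rightarrow> complex" by unfold_locales
  obtain b where b: "inj_on b (carrier G)" and indep: "V.independent (b ` carrier G)"
    using infinite_dim_independent_family[OF vs inf count] .
  define Bs where "Bs = b ` carrier G"
  note indep = indep[folded Bs_def]
  define ib where "ib = inv_into (carrier G) b"
  have ib: "ib (b g) = g" if "g \<in> carrier G" for g using b that by (simp add: ib_def)
  have bB: "b g \<in> Bs" if "g \<in> carrier G" for g using that by (simp add: Bs_def)
  \<comment> \<open>\<open>F\<close> is a copy of the group algebra with basis \<open>b g\<close>,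
    and \<open>L\<close> is left multiplication.\<close>
  define F where "F = V.span Bs"
  define L where "L g = VV.construct Bs (\<lambda>x. b (g \<otimes> ib x))" for g
  have L_lin: "Vector_Spaces.linear scale scale (L g)" for g
    unfolding L_def by (rule VV.linear_construct[OF indep])
  have L_b: "L g (b h) = b (g \<otimes> h)" if "h \<in> carrier G" for g h
    unfolding L_def using VV.construct_basis[OF indep bB[OF that]] ib that by simp
  note L_add = VV.linear_add[OF L_lin] and L_scale = VV.linear_scale[OF L_lin]
    and L_sum = VV.linear_sum[OF L_lin] and L_diff = VV.linear_diff[OF L_lin] and L_0 = VV.linear_0[OF L_lin]
  define \<Phi> where "\<Phi> = VC.construct Bs (\<lambda>x. \<phi> (ib x))"
  have Phi_lin: "Vector_Spaces.linear scale (*) \<Phi>" unfolding \<Phi>_def by (rule VC.linear_construct[OF indep])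
  have Phi_b: "\<Phi> (b g) = \<phi> g" if "g \<in> carrier G" for g
    unfolding \<Phi>_def using VC.construct_basis[OF indep bB[OF that]] ib that by simp
  note Phi_add = VC.linear_add[OF Phi_lin] and Phi_scale = VC.linear_scale[OF Phi_lin]
    and Phi_diff = VC.linear_diff[OF Phi_lin] and Phi_0 = VC.linear_0[OF Phi_lin]
  have F_sub: "V.subspace F" by (simp add: F_def)
  have bF: "b g \<in> F" if "g \<in> carrier G" for g using bB[OF that] by (simp add: F_def V.span_base)
  have F_induct: "P x" if "x \<in> F" "P 0" "\<And>c g y. g \<in> carrier G \<Longrightarrow> P y \<Longrightarrow> P (scale c (b g) + y)" for P x
    using that(1) unfolding F_def
  proof (induction rule: V.span_induct_alt)
    case base show ?case by (rule that(2))
  next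
    case (step c x y) then show ?case using that(3) by (auto simp: Bs_def)
  qed
  have L_F: "L g x \<in> F" if g: "g \<in> carrier G" and x: "x \<in> F" for g x
    using x
  proof (rule F_induct)
    show "L g 0 \<in> F" using F_sub by (simp add: L_0 V.subspace_0)
    show "L g (scale c (b h) + y) \<in> F" if "h \<in> carrier G" "L g y \<in> F" for c h y
      using that g F_sub bF by (simp add: L_add L_scale L_b V.subspace_add V.subspace_scale)
  qed
  have L_mult: "L (g \<otimes> h) x = L g (L h x)" if gh: "g \<in> carrier G" "h \<in> carrier G" and x: "x \<in> F" for g h x
    using x
  proof (rule F_induct)
    show "L (g \<otimes> h) 0 = L g (L h 0)" by (simp add: L_0)
    show "L (g \<otimes> h) (scale c (b k) + y) = L g (L h (scale c (b k) + y))"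
      if "k \<in> carrier G" "L (g \<otimes> h) y = L g (L h y)" for c k y
      using that gh by (simp add: L_add L_scale L_b m_assoc)
  qed
  have L_one: "L \<one> x = x" if "x \<in> F" for x
    using that by (rule F_induct) (simp_all add: L_0 L_add L_scale L_b)
  define submod where "submod U \<longleftrightarrow> U \<subseteq> F \<and> V.subspace U \<and> (\<forall>g\<in>carrier G. \<forall>x\<in>U. L g x \<in> U)" for U
  \<comment> \<open>The radical of \<open>\<phi>\<close>: the largest submodule on which
    \<open>\<Phi>\<close> vanishes.\<close>
  define I where "I = {x \<in> F. \<forall>g\<in>carrier G. \<Phi> (L g x) = 0}"
  have I_sub: "submod I"
    unfolding submod_def
  proof (intro conjI ballI)
    show "I \<subseteq> F" by (auto simp: I_def)
    show "V.subspace I"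
      by (rule V.subspaceI)
        (use F_sub in \<open>auto simp: I_def L_0 Phi_0 L_add Phi_add L_scale Phi_scale V.subspace_0 V.subspace_add V.subspace_scale\<close>)
    fix g x assume gx: "g \<in> carrier G" "x \<in> I"
    then have "\<Phi> (L h (L g x)) = 0" if "h \<in> carrier G" for h
      using that L_mult[of h g x, symmetric] by (simp add: I_def)
    then show "L g x \<in> I" using gx L_F by (simp add: I_def)
  qed
  have I_r: "b r + b \<one> \<in> I"
    using r bF F_sub phi_r by (auto simp: I_def L_add L_b Phi_add Phi_b V.subspace_add)
  have I_d: "b (r \<otimes> (inv d n \<otimes> d m)) - b (inv d n \<otimes> d m) \<in> I" if "m \<noteq> n" for m n
  proof -
    have "\<Phi> (L g (b (r \<otimes> (inv d n \<otimes> d m)) - b (inv d n \<otimes> d m))) = 0" if "g \<in> carrier G" for g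
      using that r d phi_d[OF that \<open>m \<noteq> n\<close>] by (simp add: L_diff L_b Phi_diff Phi_b)
    then show ?thesis using r d bF F_sub by (simp add: I_def V.subspace_diff)
  qed
  have I_one: "b \<one> \<notin> I"
    using phi_one by (auto simp: I_def L_b Phi_b intro!: bexI[of _ \<one>])
  \<comment> \<open>Since \<open>b \<one>\<close> generates \<open>F\<close>, omitting it is the
    same as being proper; a maximal member therefore has an irreducible quotient.\<close>
  define A where "A = {U. submod U \<and> I \<subseteq> U \<and> b \<one> \<notin> U}"
  have "\<exists>M\<in>A. \<forall>X\<in>A. M \<subseteq> X \<longrightarrow> X = M"
  proof (rule subset_Zorn_nonempty)
    show "A \<noteq> {}" using I_sub I_one by (auto simp: A_def)
    fix C assume C: "C \<noteq> {}" "subset.chain A C"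
    then have CA: "\<And>U. U \<in> C \<Longrightarrow> submod U \<and> I \<subseteq> U \<and> b \<one> \<notin> U" and
      chain: "\<And>U U'. U \<in> C \<Longrightarrow> U' \<in> C \<Longrightarrow> U \<subseteq> U' \<or> U' \<subseteq> U"
      by (auto simp: A_def subset_chain_def)
    have "V.subspace (\<Union>C)"
    proof (rule V.subspaceI)
      show "0 \<in> \<Union>C" using C(1) CA by (auto simp: submod_def V.subspace_0)
      show "scale c x \<in> \<Union>C" if "x \<in> \<Union>C" for c x
        using that CA unfolding submod_def by (meson UnionE UnionI V.subspace_scale)
      show "x + y \<in> \<Union>C" if xy: "x \<in> \<Union>C" "y \<in> \<Union>C" for x y
      proof -
        obtain U U' where U: "U \<in> C" "U' \<in> C" "x \<in> U" "y \<in> U'" using xy by blast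
        then obtain U'' where "U'' \<in> C" "x \<in> U''" "y \<in> U''" using chain[of U U'] by blast
        then show ?thesis using CA[of U''] by (auto simp: submod_def intro!: bexI[of _ U''] V.subspace_add)
      qed
    qed
    moreover have "\<Union>C \<subseteq> F"
    proof
      fix x assume "x \<in> \<Union>C"
      then obtain U where "U \<in> C" "x \<in> U" by blast
      then show "x \<in> F" using CA[of U] unfolding submod_def by blast
    qed
    moreover have "L g x \<in> \<Union>C" if gx: "g \<in> carrier G" "x \<in> \<Union>C" for g x
    proof -
      obtain U where U: "U \<in> C" "x \<in> U" using gx(2) by blast
      then have "L g x \<in> U" using CA[of U] gx(1) unfolding submod_def by blast
      then show ?thesis using U by blast
    qed
    ultimately have "submod (\<Union>C)" by (simp add: submod_def)
    moreover obtain U where "U \<in> C" using C(1) by blast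
    then have "I \<subseteq> \<Union>C" using CA[of U] by blast
    moreover have "b \<one> \<notin> \<Union>C" using CA by blast
    ultimately show "\<Union>C \<in> A" by (simp add: A_def)
  qed
  then obtain J where J: "J \<in> A" and J_max: "\<And>X. X \<in> A \<Longrightarrow> J \<subseteq> X \<Longrightarrow> X = J" by blast
  have J_sub: "V.subspace J" and J_F: "J \<subseteq> F" and J_L: "\<And>g x. g \<in> carrier G \<Longrightarrow> x \<in> J \<Longrightarrow> L g x \<in> J"
    and I_J: "I \<subseteq> J" and J_one: "b \<one> \<notin> J"
    using J by (auto simp: A_def submod_def)
  obtain BJ where BJ: "BJ \<subseteq> J" "V.independent BJ" "J \<subseteq> V.span BJ"
    using V.maximal_independent_subset[of J] by blast
  have span_BJ: "V.span BJ = J" using BJ J_sub V.span_minimal by blast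
  obtain BF where BF: "BJ \<subseteq> BF" "BF \<subseteq> F" "V.independent BF" "F \<subseteq> V.span BF"
    using V.maximal_independent_subset_extend[of BJ F] BJ J_F by blast
  have span_BF: "V.span BF = F" using BF F_sub V.span_minimal by blast
  \<comment> \<open>Representations are modelled on subspaces, so the quotient by \<open>J\<close>
    is realised on a complement: \<open>p\<close> projects \<open>F\<close> onto it with kernel
    \<open>J\<close>.\<close>
  define p where "p = VV.construct BF (\<lambda>x. if x \<in> BJ then 0 else x)"
  have p_lin: "Vector_Spaces.linear scale scale p" unfolding p_def by (rule VV.linear_construct[OF BF(3)])
  note p_add = VV.linear_add[OF p_lin] and p_scale = VV.linear_scale[OF p_lin]
    and p_sum = VV.linear_sum[OF p_lin] and p_diff = VV.linear_diff[OF p_lin] and p_0 = VV.linear_0[OF p_lin]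
  have p_basis: "p x = (if x \<in> BJ then 0 else x)" if "x \<in> BF" for x
    unfolding p_def by (rule VV.construct_basis[OF BF(3) that])
  have p_J: "p x = 0" if "x \<in> J" for x
    using that unfolding span_BJ[symmetric]
    by (induction rule: V.span_induct_alt) (use BF(1) in \<open>auto simp: p_0 p_add p_scale p_basis\<close>)
  have p_diff_J: "p x - x \<in> J" if "x \<in> F" for x
    using that unfolding span_BF[symmetric]
  proof (induction rule: V.span_induct_alt)
    case base show ?case using J_sub by (simp add: p_0 V.subspace_0)
  next
    case (step c x y)
    have "p x - x \<in> J"
      using p_basis[OF step(1)] BJ(1) J_sub by (auto simp: V.subspace_0 V.subspace_neg)
    then have "scale c (p x - x) + (p y - y) \<in> J"
      using step J_sub by (intro V.subspace_add V.subspace_scale) auto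
    then show ?case by (simp add: p_add p_scale V.scale_right_diff_distrib algebra_simps)
  qed
  have p_F: "p x \<in> F" if "x \<in> F" for x
  proof -
    have "(p x - x) + x \<in> F" using p_diff_J[OF that] J_F that F_sub by (intro V.subspace_add) auto
    then show ?thesis by simp
  qed
  have p_zero: "x \<in> J" if "x \<in> F" "p x = 0" for x
    using p_diff_J[OF that(1)] that(2) V.subspace_neg[OF J_sub] by fastforce
  have p_idem: "p (p x) = p x" if "x \<in> F" for x
    using p_J[OF p_diff_J[OF that]] by (simp add: p_diff)
  have p_L: "p (L g (p x)) = p (L g x)" if "g \<in> carrier G" "x \<in> F" for g x
  proof -
    have "p (L g (p x - x)) = 0" using p_J J_L p_diff_J that by blast
    then show ?thesis by (simp add: L_diff p_diff)
  qed
  define Q where "Q = p ` F"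
  define \<rho> where "\<rho> g x = p (L g x)" for g x
  have Q_F: "Q \<subseteq> F" using p_F by (auto simp: Q_def)
  have p_Q: "p x = x" if "x \<in> Q" for x using that p_idem by (auto simp: Q_def)
  have Q_sub: "V.subspace Q"
  proof (rule V.subspaceI)
    show "0 \<in> Q" unfolding Q_def using V.subspace_0[OF F_sub] p_0 by (metis image_eqI)
    show "x + y \<in> Q" if "x \<in> Q" "y \<in> Q" for x y
      using that Q_F F_sub p_add p_Q V.subspace_add unfolding Q_def by (metis image_eqI subset_iff)
    show "scale c x \<in> Q" if "x \<in> Q" for c x
      using that Q_F F_sub p_scale p_Q V.subspace_scale unfolding Q_def by (metis image_eqI subset_iff)
  qed
  have rep: "representation G scale Q \<rho>"
    unfolding representation_def
  proof (intro conjI ballI allI)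
    show "V.subspace Q" by (rule Q_sub)
    fix g x assume g: "g \<in> carrier G" and x: "x \<in> Q"
    show "\<rho> g x \<in> Q" unfolding \<rho>_def Q_def using L_F g x Q_F by blast
    show "\<rho> g (x + y) = \<rho> g x + \<rho> g y" for y by (simp add: \<rho>_def L_add p_add)
    show "\<rho> g (scale c x) = scale c (\<rho> g x)" for c by (simp add: \<rho>_def L_scale p_scale)
    show "\<rho> (g \<otimes> h) x = \<rho> g (\<rho> h x)" if "h \<in> carrier G" for h
      using p_L[OF g, of "L h x"] L_mult[OF g that, of x] L_F[OF that, of x] x Q_F
      by (auto simp: \<rho>_def)
  next
    show "\<rho> \<one> x = x" if "x \<in> Q" for x using that Q_F L_one p_Q by (auto simp: \<rho>_def)
  qed
  have b1: "p (b \<one>) \<noteq> 0" using p_zero[of "b \<one>"] bF J_one by auto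
  have irr: "irreducible_representation G scale Q \<rho>"
    unfolding irreducible_representation_def
  proof (intro conjI allI impI rep)
    show "Q \<noteq> {0}" using b1 bF[of \<one>] by (auto simp: Q_def)
    fix U assume U: "U \<subseteq> Q" "V.subspace U" "\<forall>g\<in>carrier G. \<forall>x\<in>U. \<rho> g x \<in> U"
    define U' where "U' = {x \<in> F. p x \<in> U}"
    have "submod U'"
      unfolding submod_def
    proof (intro conjI ballI)
      show "U' \<subseteq> F" unfolding U'_def by blast
      show "V.subspace U'"
        by (rule V.subspaceI)
          (use F_sub U(2) in \<open>auto simp: U'_def p_0 p_add p_scale V.subspace_0 V.subspace_add V.subspace_scale\<close>)
      fix g x assume g: "g \<in> carrier G" and x: "x \<in> U'"
      then have "\<rho> g (p x) \<in> U" using U(3) by (auto simp: U'_def)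
      then show "L g x \<in> U'" using g x p_L[OF g, of x] L_F[OF g, of x] by (auto simp: U'_def \<rho>_def)
    qed
    have JU: "J \<subseteq> U'" using J_F p_J V.subspace_0[OF U(2)] by (auto simp: U'_def)
    have "U' = J" if "b \<one> \<notin> U'"
    proof (rule J_max[OF _ JU])
      show "U' \<in> A" using that \<open>submod U'\<close> order_trans[OF I_J JU] by (simp add: A_def)
    qed
    then consider "U' = J" | "b \<one> \<in> U'" by blast
    then show "U = {0} \<or> U = Q"
    proof cases
      case 1
      have "u = 0" if "u \<in> U" for u
      proof -
        have "u \<in> U'" using that U(1) Q_F p_Q by (auto simp: U'_def)
        then have "p u = 0" using 1 p_J by blast
        then show ?thesis using p_Q that U(1) by auto
      qed
      then show ?thesis using V.subspace_0[OF U(2)] by blast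
    next
      case 2
      have "b g \<in> U'" if "g \<in> carrier G" for g
      proof -
        have "L g (b \<one>) \<in> U'" using 2 \<open>submod U'\<close> that unfolding submod_def by blast
        then show ?thesis using L_b[of \<one> g] that by simp
      qed
      then have "Bs \<subseteq> U'" by (auto simp: Bs_def)
      then have "F \<subseteq> U'" using \<open>submod U'\<close> unfolding F_def submod_def by (intro V.span_minimal) auto
      then have "Q \<subseteq> U" by (auto simp: Q_def U'_def)
      then show ?thesis using U(1) by blast
    qed
  qed
  have indep_d: "a n = 0" if a: "(\<Sum>m<N. scale (a m) (p (b (d m)))) = 0" and n: "n < N" for a :: "nat \<Rightarrow> complex" and n N
  proof -
    define x where "x = (\<Sum>m<N. scale (a m) (b (d m)))"
    have "x \<in> F" unfolding x_def using F_sub bF d by (intro V.subspace_sum V.subspace_scale) auto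
    moreover have "p x = 0" using a by (simp add: x_def p_sum p_scale)
    ultimately have xJ: "x \<in> J" by (rule p_zero)
    \<comment> \<open>Translating by \<open>inv d n\<close> moves the \<open>n\<close>-th vector to
      \<open>b \<one>\<close>. Modulo \<open>J\<close> this one is negated by \<open>r\<close> and
      the others are fixed, so \<open>L r y - y\<close> isolates the coefficient
      \<open>a n\<close>.\<close>
    define y where "y = (\<Sum>m<N. scale (a m) (b (inv d n \<otimes> d m)))"
    have y: "y = L (inv d n) x" using d by (simp add: y_def x_def L_sum L_scale L_b)
    then have yJ: "y \<in> J" using J_L xJ d by simp
    then have LyJ: "L r y - y \<in> J" using J_L[OF r] J_sub V.subspace_diff by blast
    define z where "z = (\<Sum>m\<in>{..<N} - {n}. scale (a m) (b (r \<otimes> (inv d n \<otimes> d m)) - b (inv d n \<otimes> d m)))"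
    have "L r y - y = (\<Sum>m<N. scale (a m) (b (r \<otimes> (inv d n \<otimes> d m)) - b (inv d n \<otimes> d m)))"
      using d by (simp add: y_def L_sum L_scale L_b sum_subtractf V.scale_right_diff_distrib)
    also have "\<dots> = scale (a n) (b r - b \<one>) + z"
      unfolding z_def using n r d by (subst sum.remove[of _ n]) auto
    finally have "scale (a n) (b r - b \<one>) = (L r y - y) - z" by simp
    moreover have "z \<in> J" unfolding z_def
    proof (intro V.subspace_sum[OF J_sub] V.subspace_scale[OF J_sub])
      fix m assume "m \<in> {..<N} - {n}"
      then show "b (r \<otimes> (inv d n \<otimes> d m)) - b (inv d n \<otimes> d m) \<in> J" using I_d[of m n] I_J by blast
    qed
    ultimately have "scale (a n) (b r - b \<one>) \<in> J" using V.subspace_diff[OF J_sub LyJ] by simp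
    moreover have "scale (a n) (b r + b \<one>) \<in> J" using I_r I_J J_sub V.subspace_scale by blast
    ultimately have "scale (a n) (b r + b \<one>) - scale (a n) (b r - b \<one>) \<in> J"
      using V.subspace_diff[OF J_sub] by blast
    moreover have "scale (a n) (b r + b \<one>) - scale (a n) (b r - b \<one>) = scale (a n * 2) (b \<one>)"
    proof -
      have "scale (a n) (b r + b \<one>) - scale (a n) (b r - b \<one>) = scale (a n) (b \<one> + b \<one>)"
        by (simp add: V.scale_right_diff_distrib V.scale_right_distrib algebra_simps)
      also have "b \<one> + b \<one> = scale 2 (b \<one>)" using V.scale_left_distrib[of 1 1 "b \<one>"] by simp
      finally show ?thesis by simp
    qed
    ultimately have *: "scale (a n * 2) (b \<one>) \<in> J" by simp
    show "a n = 0"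
    proof (rule ccontr)
      assume "a n \<noteq> 0"
      then have "scale (inverse (a n * 2)) (scale (a n * 2) (b \<one>)) = b \<one>" by simp
      then show False using V.subspace_scale[OF J_sub *, of "inverse (a n * 2)"] J_one by simp
    qed
  qed
  have "\<not> finite_dim scale Q"
  proof
    assume "finite_dim scale Q"
    then obtain T where T: "finite T" "V.span T = Q" unfolding finite_dim_def by blast
    define N where "N = Suc (card T)"
    define y where "y n = p (b (d n))" for n
    have inj: "inj_on y {..<N}"
    proof (rule inj_onI, rule ccontr)
      fix m n assume mn: "m \<in> {..<N}" "n \<in> {..<N}" "y m = y n" "m \<noteq> n"
      define a :: "nat \<Rightarrow> complex" where "a k = (if k = m then 1 else if k = n then - 1 else 0)" for k
      have "(\<Sum>k<N. scale (a k) (y k)) = (\<Sum>k\<in>{m, n}. scale (a k) (y k))"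
        using mn by (intro sum.mono_neutral_right) (auto simp: a_def)
      also have "\<dots> = 0" using mn by (simp add: a_def)
      finally have "a m = 0" using indep_d mn unfolding y_def by blast
      then show False by (simp add: a_def)
    qed
    have "V.independent (y ` {..<N})"
    proof
      assume "V.dependent (y ` {..<N})"
      then obtain u v where u: "v \<in> y ` {..<N}" "u v \<noteq> 0" "(\<Sum>v\<in>y ` {..<N}. scale (u v) v) = 0"
        using V.dependent_finite[of "y ` {..<N}"] by auto
      then have "(\<Sum>k<N. scale (u (y k)) (y k)) = 0" using inj by (simp add: sum.reindex)
      then have "u (y k) = 0" if "k < N" for k
        using indep_d[where a = "\<lambda>k. u (y k)"] that unfolding y_def by blast
      then show False using u(1,2) by auto
    qed
    moreover have "y ` {..<N} \<subseteq> V.span T" unfolding T(2) y_def Q_def using bF d by blast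
    ultimately have "card (y ` {..<N}) \<le> card T" using V.independent_span_bound[OF T(1)] by blast
    then show False using inj by (simp add: card_image N_def)
  qed
  then show ?thesis using irr by blast
qed

section \<open>The half-line module of a free product of three involutions\<close>

lemma not_distinct_adj_split: "\<not> distinct_adj w \<Longrightarrow> \<exists>u x v. w = u @ x # x # v"
proof (induction w)
  case (Cons a w)
  show ?case
  proof (cases w)
    case (Cons b w')
    show ?thesis
    proof (cases "a = b")
      case True
      then show ?thesis using Cons by (intro exI[of _ "[]"]) auto
    next
      case False
      then have "\<not> distinct_adj w" using Cons Cons.prems by auto
      then obtain u x v where "w = u @ x # x # v" using Cons.IH by blast
      then show ?thesis by (intro exI[of _ "a # u"]) auto
    qed
  qed (use Cons.prems in auto)
qed auto

definition path_step :: "nat \<Rightarrow> nat \<Rightarrow> nat" where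
  "path_step i k = (if i = 0 then (if even k then k + 1 else k - 1)
     else if k = 0 then 0 else if odd k then k + 1 else k - 1)"

definition path_op :: "nat \<Rightarrow> (nat \<Rightarrow> complex) \<Rightarrow> nat \<Rightarrow> complex" where
  "path_op i f k = (if i = 2 then (if k = 0 then - f 0 else f k) else f (path_step i k))"

definition path_unit :: "nat \<Rightarrow> nat \<Rightarrow> complex" where
  "path_unit n k = (if k = n then 1 else 0)"

text \<open>Spells the walk from vertex 0 to vertex \<open>n\<close>; the first step is the last
  letter.\<close>

fun path_word :: "nat \<Rightarrow> nat list" where
  "path_word 0 = []"
| "path_word (Suc n) = (if even n then 0 else 1) # path_word n"

lemma path_step_step [simp]: "path_step i (path_step i k) = k"
  by (auto simp: path_step_def elim: oddE)

lemma path_op_op [simp]: "path_op i (path_op i f) = f"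
  by (rule ext) (simp add: path_op_def)

lemma path_op_minus: "path_op i (\<lambda>k. - f k) = (\<lambda>k. - path_op i f k)"
  by (rule ext) (simp add: path_op_def)

lemma path_ops_minus: "foldr path_op w (\<lambda>k. - f k) = (\<lambda>k. - foldr path_op w f k)"
  by (induction w) (simp_all add: path_op_minus)

lemma path_ops_rev [simp]: "foldr path_op w (foldr path_op (rev w) f) = f"
  by (induction w arbitrary: f) auto

lemma path_op_unit: "i \<noteq> 2 \<Longrightarrow> path_op i (path_unit n) = path_unit (path_step i n)"
proof
  fix k assume "i \<noteq> 2"
  moreover have "path_step i k = n \<longleftrightarrow> k = path_step i n" by auto
  ultimately show "path_op i (path_unit n) k = path_unit (path_step i n) k"
    by (simp add: path_op_def path_unit_def)
qed

lemma path_op_2_unit: "path_op 2 (path_unit n) = (if n = 0 then (\<lambda>k. - path_unit 0 k) else path_unit n)"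
  by (rule ext) (auto simp: path_op_def path_unit_def)

lemma path_word_unit: "foldr path_op (path_word n) (path_unit 0) = path_unit n"
  by (induction n) (auto simp: path_op_unit path_step_def)

lemma path_word_set: "set (path_word n) \<subseteq> {0, 1}"
  by (induction n) auto

lemma path_ops_unit: "set w \<subseteq> {0, 1} \<Longrightarrow> \<exists>k. foldr path_op w (path_unit n) = path_unit k"
proof (induction w)
  case (Cons i w)
  then obtain k where "foldr path_op w (path_unit n) = path_unit k" by auto
  then show ?case using Cons.prems by (auto simp: path_op_unit)
qed auto

lemma path_unit_inj: "path_unit m = path_unit n \<Longrightarrow> m = n"
  by (metis path_unit_def zero_neq_one)

text \<open>The common part of both words carries vertex 0 to a vertex other than 0, and the third
  involution changes the sign at vertex 0 only.\<close>

lemma path_word_diff: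
  assumes "m \<noteq> n"
  shows "foldr path_op (rev (path_word n) @ path_word m) (path_unit 0) =
    foldr path_op (2 # rev (path_word n) @ path_word m) (path_unit 0)"
proof -
  have "set (rev (path_word n)) \<subseteq> {0, 1}" using path_word_set by simp
  then obtain k where k: "foldr path_op (rev (path_word n)) (path_unit m) = path_unit k"
    using path_ops_unit by blast
  then have "path_unit m = foldr path_op (path_word n) (path_unit k)" by (metis path_ops_rev)
  then have "k \<noteq> 0" using path_word_unit path_unit_inj assms by metis
  then show ?thesis using k path_word_unit by (simp add: path_op_2_unit)
qed

text \<open>The free product of three groups of order two acts irreducibly on the finitely supported
  functions on the half-line: the first two involutions swap neighbours, hence act transitively
  on the vertices, and the third one is the reflection negating the first basis vector.\<close>
lemma free_involutions_irreducible_representation: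
  fixes G (structure) and scale :: "complex \<Rightarrow> 'v::ab_group_add \<Rightarrow> 'v" and R :: "nat \<Rightarrow> 'g"
  assumes grp: "group G" and count: "countable (carrier G)"
    and vs: "vector_space scale" and inf: "\<not> finite_dim scale UNIV"
    and R: "\<And>i. i < 3 \<Longrightarrow> R i \<in> carrier G" and RR: "\<And>i. i < 3 \<Longrightarrow> R i \<otimes> R i = \<one>"
    and free: "\<And>w. set w \<subseteq> {..<3} \<Longrightarrow> w \<noteq> [] \<Longrightarrow> distinct_adj w \<Longrightarrow> foldr (\<lambda>i x. R i \<otimes> x) w \<one> \<noteq> \<one>"
  shows "\<exists>V \<rho>. irreducible_representation G scale V \<rho> \<and> \<not> finite_dim scale V"
proof -
  interpret group G by (rule grp)
  define pr where "pr w = foldr (\<lambda>i x. R i \<otimes> x) w \<one>" for w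
  have pr_Nil [simp]: "pr [] = \<one>" and pr_Cons [simp]: "pr (i # w) = R i \<otimes> pr w" for i w
    by (simp_all add: pr_def)
  have pr_closed: "pr w \<in> carrier G" if "set w \<subseteq> {..<3}" for w
    using that by (induction w) (auto simp: R)
  have pr_append: "pr (u @ w) = pr u \<otimes> pr w" if "set u \<subseteq> {..<3}" "set w \<subseteq> {..<3}" for u w
    using that by (induction u) (auto simp: R pr_closed m_assoc)
  have pr_rev: "pr (rev w) = inv (pr w)" if "set w \<subseteq> {..<3}" for w
    using that
  proof (induction w)
    case (Cons i w)
    then have "inv (R i) = R i" using R RR inv_equality by simp
    then show ?case using Cons by (simp add: pr_append inv_mult_group R pr_closed)
  qed simp
  \<comment> \<open>Freeness at work: a nonempty word with trivial product repeats a letter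
    somewhere, and cancelling such pairs leads to the empty word.\<close>
  have trivial: "foldr path_op w f = f" if "set w \<subseteq> {..<3}" "pr w = \<one>" for w f
    using that
  proof (induction "length w" arbitrary: w rule: less_induct)
    case less
    show ?case
    proof (cases "w = []")
      case False
      then have "\<not> distinct_adj w" using free[OF less.prems(1)] less.prems(2) by (auto simp: pr_def)
      then obtain u x v where w: "w = u @ x # x # v" using not_distinct_adj_split by blast
      then have sets: "set u \<subseteq> {..<3}" "set v \<subseteq> {..<3}" "x < 3" using less.prems(1) by auto
      have "pr (x # x # v) = pr v" using sets by (simp add: m_assoc[symmetric] R RR pr_closed)
      then have "pr (u @ v) = \<one>" using less.prems(2) sets w by (simp add: pr_append del: pr_Cons)
      then have "foldr path_op (u @ v) f = f" using less.hyps[of "u @ v"] w sets by simp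
      then show ?thesis by (simp add: w)
    qed simp
  qed
  have cong: "foldr path_op u f = foldr path_op w f"
    if "set u \<subseteq> {..<3}" "set w \<subseteq> {..<3}" "pr u = pr w" for u w f
  proof -
    have "pr (rev w @ u) = \<one>" using that by (simp add: pr_append pr_rev pr_closed)
    then have "foldr path_op (rev w) (foldr path_op u f) = f"
      using trivial[of "rev w @ u" f] that by simp
    then show ?thesis by (metis path_ops_rev)
  qed
  define H where "H = pr ` {w. set w \<subseteq> {..<3}}"
  \<comment> \<open>The matrix coefficient at vertex 0; by \<open>cong\<close> the choice of the
    word does not matter.\<close>
  define \<phi> where "\<phi> g = (if g \<in> H then foldr path_op (SOME w. set w \<subseteq> {..<3} \<and> pr w = g) (path_unit 0) 0 else 0)" for g
  have phi_pr: "\<phi> (pr w) = foldr path_op w (path_unit 0) 0" if w: "set w \<subseteq> {..<3}" for w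
  proof -
    let ?P = "\<lambda>u. set u \<subseteq> {..<3} \<and> pr u = pr w"
    have "?P (SOME u. ?P u)" by (rule someI[of ?P w]) (use w in simp)
    then show ?thesis using w cong[of "SOME u. ?P u" w "path_unit 0"] by (auto simp: \<phi>_def H_def)
  qed
  have H_mult: "g \<otimes> pr u \<in> H \<longleftrightarrow> g \<in> H" if g: "g \<in> carrier G" and u: "set u \<subseteq> {..<3}" for g u
  proof
    assume "g \<otimes> pr u \<in> H"
    then obtain w where w: "set w \<subseteq> {..<3}" "g \<otimes> pr u = pr w" by (auto simp: H_def)
    then have "g = pr w \<otimes> inv (pr u)" using g u pr_closed by (metis inv_solve_right)
    then have "g = pr (w @ rev u)" using w u by (simp add: pr_append pr_rev)
    then show "g \<in> H" using w u by (auto simp: H_def)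
  next
    assume "g \<in> H"
    then obtain w where w: "set w \<subseteq> {..<3}" "g = pr w" by (auto simp: H_def)
    then have "g \<otimes> pr u = pr (w @ u)" using u by (simp add: pr_append)
    then show "g \<otimes> pr u \<in> H" using w u by (auto simp: H_def)
  qed
  have phi_mult: "\<phi> (g \<otimes> pr u) = \<phi> (g \<otimes> pr w)"
    if "g \<in> carrier G" "set u \<subseteq> {..<3}" "set w \<subseteq> {..<3}"
      "foldr path_op u (path_unit 0) = foldr path_op w (path_unit 0)" for g u w
  proof (cases "g \<in> H")
    case True
    then obtain x where x: "set x \<subseteq> {..<3}" "g = pr x" by (auto simp: H_def)
    then have "g \<otimes> pr u = pr (x @ u)" "g \<otimes> pr w = pr (x @ w)" using that by (simp_all add: pr_append)
    then show ?thesis using phi_pr[of "x @ u"] phi_pr[of "x @ w"] x that by simp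
  next
    case False
    then show ?thesis using H_mult[of g u] H_mult[of g w] that by (simp add: \<phi>_def)
  qed
  define d where "d n = pr (path_word n)" for n
  have set_path: "set (path_word n) \<subseteq> {..<3}" for n using path_word_set[of n] by auto
  show ?thesis
  proof (rule infinite_dim_irreducible_representation[OF grp count vs inf, of "R 2" d \<phi>])
    show "R 2 \<in> carrier G" by (simp add: R)
    show "d n \<in> carrier G" for n unfolding d_def using set_path by (rule pr_closed)
    show "\<phi> \<one> = 1" using phi_pr[of "[]"] by (simp add: path_unit_def)
    show "\<phi> (g \<otimes> R 2) = - \<phi> g" if g: "g \<in> carrier G" for g
    proof (cases "g \<in> H")
      case True
      then obtain x where x: "set x \<subseteq> {..<3}" "g = pr x" by (auto simp: H_def)
      then have "g \<otimes> R 2 = pr (x @ [2])" by (simp add: pr_append R)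
      then have "\<phi> (g \<otimes> R 2) = foldr path_op (x @ [2]) (path_unit 0) 0"
        using phi_pr[of "x @ [2]"] x by simp
      also have "\<dots> = - foldr path_op x (path_unit 0) 0" by (simp add: path_op_2_unit path_ops_minus)
      finally show ?thesis using phi_pr x by simp
    next
      case False
      then show ?thesis using H_mult[OF g, of "[2]"] by (simp add: \<phi>_def R)
    qed
    show "\<phi> (g \<otimes> (R 2 \<otimes> (inv d n \<otimes> d m))) = \<phi> (g \<otimes> (inv d n \<otimes> d m))"
      if "g \<in> carrier G" "m \<noteq> n" for g m n
    proof -
      have "inv d n \<otimes> d m = pr (rev (path_word n) @ path_word m)"
        using set_path by (simp add: d_def pr_append pr_rev)
      moreover have "\<phi> (g \<otimes> pr (2 # rev (path_word n) @ path_word m)) = \<phi> (g \<otimes> pr (rev (path_word n) @ path_word m))"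
        using that set_path path_word_diff[OF that(2)] by (intro phi_mult) auto
      ultimately show ?thesis by simp
    qed
  qed
qed

section \<open>Ping-pong for three reflections\<close>

context coxeter_system
begin

lemma countable_carrier: "countable (carrier W)"
proof -
  have "carrier W \<subseteq> word_prod W ` lists S" using ex_word by blast
  moreover have "countable (lists S)" using finite_S by (intro countable_lists) (simp add: countable_finite)
  ultimately show ?thesis by (meson countable_image countable_subset)
qed

text \<open>Ping-pong in coefficients: the root belonging to the first letter of a reduced word
  carries the largest coefficient, since a further reflection raises the coefficient of its own root
  to at least the previous maximum. The roots may be dependent, so the contradiction comes from
  products with a test vector and not from comparing coefficients.\<close>

lemma reflections_free:
  fixes b :: "nat \<Rightarrow> 'w \<Rightarrow> real"
  assumes root: "\<And>i. i < 3 \<Longrightarrow> root (b i)" and R: "\<And>i. i < 3 \<Longrightarrow> R i \<in> carrier W"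
    and Rb: "\<And>i x. i < 3 \<Longrightarrow> gact (R i) x = refl (b i) x"
    and facing: "\<And>i j. i < 3 \<Longrightarrow> j < 3 \<Longrightarrow> i \<noteq> j \<Longrightarrow> B (b i) (b j) < - 1"
    and w: "set w \<subseteq> {..<3}" "w \<noteq> []" "distinct_adj w"
  shows "foldr (\<lambda>i x. R i \<otimes> x) w \<one> \<noteq> \<one>"
proof
  define pr where "pr w = foldr (\<lambda>i x. R i \<otimes> x) w \<one>" for w
  have pr_Nil [simp]: "pr [] = \<one>" and pr_Cons [simp]: "pr (i # w) = R i \<otimes> pr w" for i w
    by (simp_all add: pr_def)
  have pr_closed: "pr w \<in> carrier W" if "set w \<subseteq> {..<3}" for w
    using that by (induction w) (auto simp: R)
  have pr_snoc: "pr (u @ [j]) = pr u \<otimes> R j" if "set u \<subseteq> {..<3}" "j < 3" for u j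
    using that by (induction u) (auto simp: R pr_closed m_assoc)
  \<comment> \<open>For the empty word the root \<open>b j\<close> itself dominates, hence the head
    of \<open>u @ [j]\<close>.\<close>
  define dominant where "dominant u j \<longleftrightarrow> (\<exists>c. (\<forall>i<3. 0 \<le> c i \<and> c i \<le> c (hd (u @ [j]))) \<and>
      0 < c (hd (u @ [j])) \<and> gact (pr u) (b j) = (\<Sum>i<3. c i *\<^sub>R b i))" for u j
  have coeffs: "dominant u j" if "set u \<subseteq> {..<3}" "j < 3" "distinct_adj (u @ [j])" for u j
    using that
  proof (induction u)
    case Nil
    have "b j = (\<Sum>i<3. (if i = j then 1 else 0 :: real) *\<^sub>R b i)"
    proof -
      have "(\<Sum>i<3. (if i = j then 1 else 0 :: real) *\<^sub>R b i) = (\<Sum>i<3. if i = j then b i else 0)"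
        by (intro sum.cong) auto
      then show ?thesis using Nil by simp
    qed
    then show ?case unfolding dominant_def by (intro exI[of _ "\<lambda>i. if i = j then 1 else 0"]) simp
  next
    case (Cons i u)
    define h where "h = hd (u @ [j])"
    have h3: "h < 3" using Cons.prems unfolding h_def by (cases u) auto
    have i3: "i < 3" using Cons.prems by simp
    have hi: "h \<noteq> i" using Cons.prems(3) unfolding h_def by (cases u) auto
    have "distinct_adj (u @ [j])" using Cons.prems(3) by (cases u) auto
    then have "dominant u j" using Cons by simp
    then obtain c where c: "\<And>k. k < 3 \<Longrightarrow> 0 \<le> c k \<and> c k \<le> c h" "0 < c h"
      and eq: "gact (pr u) (b j) = (\<Sum>k<3. c k *\<^sub>R b k)"
      unfolding dominant_def h_def by blast
    define x where "x = (\<Sum>k<3. c k *\<^sub>R b k)"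
    define e where "e = c i - 2 * B x (b i)"
    define c' where "c' = c(i := e)"
    have "B x (b i) = (\<Sum>k<3. c k * B (b k) (b i))" by (simp add: x_def B_sum_left)
    also have "\<dots> \<le> (\<Sum>k<3. (if k = i then c i else 0) + (if k = h then - c h else 0))"
    proof (rule sum_mono)
      fix k :: nat assume "k \<in> {..<3}"
      then have k: "k < 3" by simp
      show "c k * B (b k) (b i) \<le> (if k = i then c i else 0) + (if k = h then - c h else 0)"
      proof (cases "k = i")
        case True
        then show ?thesis using root_norm[OF root[OF i3]] hi by simp
      next
        case False
        then have "B (b k) (b i) \<le> - 1" using facing[OF k i3] by simp
        then have "c k * B (b k) (b i) \<le> c k * - 1" using c(1)[OF k] by (intro mult_left_mono) auto
        then show ?thesis using False c(1)[OF k] by auto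
      qed
    qed
    also have "\<dots> = c i - c h" using i3 h3 by (simp add: sum.distrib)
    finally have e: "c h \<le> e" using c(1)[OF i3] by (simp add: e_def)
    have "gact (pr (i # u)) (b j) = refl (b i) x"
      using eq R[OF i3] Cons.prems by (simp add: gact_mult pr_closed Rb[OF i3] x_def)
    also have "\<dots> = (\<Sum>k<3. c' k *\<^sub>R b k)"
    proof -
      have "(\<Sum>k<3. c' k *\<^sub>R b k) = (\<Sum>k<3. c k *\<^sub>R b k + (if k = i then (- 2 * B x (b i)) *\<^sub>R b i else 0))"
        by (intro sum.cong) (auto simp: c'_def e_def scaleR_left_diff_distrib)
      also have "\<dots> = x + (- 2 * B x (b i)) *\<^sub>R b i" using i3 by (simp add: sum.distrib x_def)
      finally show ?thesis by (simp add: refl_def)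
    qed
    finally have "gact (pr (i # u)) (b j) = (\<Sum>k<3. c' k *\<^sub>R b k)" .
    moreover have "\<forall>k<3. 0 \<le> c' k \<and> c' k \<le> c' i" "0 < c' i"
      using less_le_trans[OF c(2) e] order_trans[OF _ e] c(1) by (auto simp: c'_def)
    ultimately show ?case unfolding dominant_def by (intro exI[of _ c']) simp
  qed
  assume "foldr (\<lambda>i x. R i \<otimes> x) w \<one> = \<one>"
  then have one: "pr w = \<one>" by (simp add: pr_def)
  obtain u j where uj: "w = u @ [j]" using w(2) rev_exhaust by blast
  then have u: "set u \<subseteq> {..<3}" "j < 3" using w by auto
  obtain c where c: "\<And>k. k < 3 \<Longrightarrow> 0 \<le> c k" and eq: "gact (pr u) (b j) = (\<Sum>k<3. c k *\<^sub>R b k)"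
    using coeffs[OF u] w(3) uj unfolding dominant_def by blast
  have "b j = gact (pr w) (b j)" using one by simp
  also have "\<dots> = gact (pr u) (- b j)"
    using u by (simp add: uj pr_snoc gact_mult pr_closed R Rb refl_self root_norm root)
  also have "\<dots> = - (\<Sum>k<3. c k *\<^sub>R b k)" by (simp add: gact_minus eq)
  finally have bj: "b j = - (\<Sum>k<3. c k *\<^sub>R b k)" .
  \<comment> \<open>Each root has product below 1 - 1 - 1 = -1 with \<open>s\<close>, so a root is
    never minus a nonnegative combination of the three.\<close>
  define s where "s = b 0 + b 1 + b 2"
  have neg: "B (b k) s < - 1" if "k < 3" for k
  proof -
    have "k = 0 \<or> k = 1 \<or> k = 2" using that by linarith
    then show ?thesis
      using facing[of 0 1] facing[of 0 2] facing[of 1 2] B_sym[of "b 0" "b 1"] B_sym[of "b 0" "b 2"]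
        B_sym[of "b 1" "b 2"] root_norm[OF root[of 0]] root_norm[OF root[of 1]] root_norm[OF root[of 2]]
      unfolding s_def by auto
  qed
  have "B (b j) s = - (c 0 * B (b 0) s + c 1 * B (b 1) s + c 2 * B (b 2) s)"
    unfolding bj by (simp add: numeral_3_eq_3 numeral_2_eq_2)
  moreover have "c k * B (b k) s \<le> 0" if "k < 3" for k
    using neg[OF that] c[OF that] by (intro mult_nonneg_nonpos) auto
  from this[of 0] this[of 1] this[of 2] have "c 0 * B (b 0) s + c 1 * B (b 1) s + c 2 * B (b 2) s \<le> 0" by simp
  ultimately show False using neg[OF u(2)] by linarith
qed

lemma refl_involution:
  assumes "root b" "r \<in> carrier W" "\<And>x. gact r x = refl b x"
  shows "r \<otimes> r = \<one>"
  using assms by (intro gact_faithful) (auto simp: gact_mult refl_refl root_norm)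

lemma facing_triple_irreducible_representation:
  fixes scale :: "complex \<Rightarrow> 'v::ab_group_add \<Rightarrow> 'v"
  assumes "root a" "root b" "root c" "B a b < - 1" "B b c < - 1" "B a c < - 1"
    and "vector_space scale" "\<not> finite_dim scale UNIV"
  shows "\<exists>V \<rho>. irreducible_representation W scale V \<rho> \<and> \<not> finite_dim scale V"
proof -
  define e where "e i = (if i = 0 then a else if i = 1 then b else c)" for i :: nat
  have e: "root (e i)" for i using assms by (simp add: e_def)
  define R where "R i = (SOME r. r \<in> carrier W \<and> (\<forall>x. gact r x = refl (e i) x))" for i
  have R: "R i \<in> carrier W \<and> (\<forall>x. gact (R i) x = refl (e i) x)" for i
  proof -
    have "\<exists>r. r \<in> carrier W \<and> (\<forall>x. gact r x = refl (e i) x)" using root_reflection[OF e] by blast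
    then show ?thesis unfolding R_def by (rule someI_ex)
  qed
  have "B b a < - 1" "B c b < - 1" "B c a < - 1" using assms B_sym by metis+
  then have facing: "B (e i) (e j) < - 1" if "i < 3" "j < 3" "i \<noteq> j" for i j
    using assms that by (auto simp: e_def)
  show ?thesis
  proof (rule free_involutions_irreducible_representation)
    show "R i \<in> carrier W" for i using R by blast
    show "R i \<otimes> R i = \<one>" for i using refl_involution[OF e] R by blast
    show "foldr (\<lambda>i x. R i \<otimes> x) w \<one> \<noteq> \<one>" if "set w \<subseteq> {..<3}" "w \<noteq> []" "distinct_adj w" for w
      by (rule reflections_free[of e]) (use R e facing that in auto)
  qed (use is_group countable_carrier assms in auto)
qed

end

theorem (in indefinite_coxeter) indefinite_irreducible_representation:
  fixes scale :: "complex \<Rightarrow> 'v::ab_group_add \<Rightarrow> 'v"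
  assumes "vector_space scale" "\<not> finite_dim scale UNIV"
  shows "\<exists>V \<rho>. irreducible_representation W scale V \<rho> \<and> \<not> finite_dim scale V"
  using ex_facing_triple facing_triple_irreducible_representation assms by blast

section \<open>Affine type\<close>

text \<open>The least positive element \<open>c\<close> generates: two point reflections give the
  translation by \<open>2 * c\<close>, and the remainder in the interval from 0 to
  \<open>2 * c\<close> must be 0 or \<open>c\<close>.\<close>

lemma reflection_closed_discrete:
  fixes P :: "real set"
  assumes zero: "0 \<in> P" and refl: "\<And>k l. k \<in> P \<Longrightarrow> l \<in> P \<Longrightarrow> 2 * l - k \<in> P"
    and disc: "\<And>M. finite {k \<in> P. \<bar>k\<bar> \<le> M}" and nontriv: "\<exists>k\<in>P. k \<noteq> 0"
  shows "\<exists>c>0. P = {c * of_int m | m. True}"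
proof -
  obtain k0 where k0: "k0 \<in> P" "k0 \<noteq> 0" using nontriv by blast
  define Q where "Q = {k \<in> P. 0 < k \<and> k \<le> \<bar>k0\<bar>}"
  have "finite Q" by (rule finite_subset[OF _ disc[of "\<bar>k0\<bar>"]]) (auto simp: Q_def)
  have "- k0 \<in> P" using refl[OF k0(1) zero] by simp
  then have "\<bar>k0\<bar> \<in> Q" using k0 by (auto simp: Q_def abs_if)
  define c where "c = Min Q"
  have "c \<in> Q" unfolding c_def using \<open>finite Q\<close> \<open>\<bar>k0\<bar> \<in> Q\<close> by (intro Min_in) auto
  then have c: "c \<in> P" "0 < c" by (auto simp: Q_def)
  have min: "c \<le> k" if "k \<in> P" "0 < k" for k
  proof (cases "k \<le> \<bar>k0\<bar>")
    case True
    then show ?thesis using that \<open>finite Q\<close> unfolding c_def by (intro Min_le) (auto simp: Q_def)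
  next
    case False
    then show ?thesis using \<open>c \<in> Q\<close> by (auto simp: Q_def)
  qed
  have up: "k + 2 * c \<in> P" if "k \<in> P" for k using refl[OF refl[OF that zero] c(1)] by (simp add: algebra_simps)
  have dn: "k - 2 * c \<in> P" if "k \<in> P" for k using refl[OF refl[OF that c(1)] zero] by (simp add: algebra_simps)
  have shift: "k + 2 * c * of_int m \<in> P" if "k \<in> P" for k m
  proof (induction m rule: int_induct[where k = 0])
    case (step1 i) then show ?case using up[of "k + 2 * c * of_int i"] by (simp add: algebra_simps)
  next
    case (step2 i) then show ?case using dn[of "k + 2 * c * of_int i"] by (simp add: algebra_simps)
  qed (use that in simp)
  have "c * of_int m \<in> P" for m
  proof (cases "even m")
    case True
    then show ?thesis using shift[OF zero, of "m div 2"] by (auto elim!: evenE simp: mult_ac)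
  next
    case False
    then show ?thesis using shift[OF c(1), of "m div 2"] by (auto elim!: oddE simp: algebra_simps)
  qed
  moreover have "\<exists>m. k = c * of_int m" if k: "k \<in> P" for k
  proof -
    define m where "m = \<lfloor>k / (2 * c)\<rfloor>"
    define l where "l = k + 2 * c * of_int (- m)"
    have lP: "l \<in> P" unfolding l_def by (rule shift[OF k])
    have "of_int m \<le> k / (2 * c)" "k / (2 * c) < of_int m + 1" unfolding m_def by linarith+
    then have l: "0 \<le> l" "l < 2 * c" using c(2) by (auto simp: l_def field_simps)
    \<comment> \<open>An element strictly between \<open>c\<close> and \<open>2 * c\<close> would
      reflect in \<open>c\<close> to a positive one below \<open>c\<close>.\<close>
    have "l = 0 \<or> l = c"
    proof (rule ccontr)
      assume "\<not> (l = 0 \<or> l = c)"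
      then have "c < l" using min[OF lP] l by auto
      then show False using min[OF refl[OF lP c(1)]] l by auto
    qed
    then show ?thesis
    proof
      assume "l = 0"
      then have "k = c * of_int (2 * m)" by (simp add: l_def)
      then show ?thesis by blast
    next
      assume "l = c"
      then have "k = c * of_int (2 * m + 1)" by (simp add: l_def algebra_simps)
      then show ?thesis by blast
    qed
  qed
  ultimately have "P = {c * of_int m | m. True}" by blast
  then show ?thesis using c(2) by blast
qed

locale affine_coxeter = irreducible_coxeter +
  fixes \<delta> :: "'a \<Rightarrow> real"
  assumes delta_V: "\<delta> \<in> V" and delta_pos: "\<And>s. s \<in> S \<Longrightarrow> 0 < \<delta> s"
    and delta_rad: "\<And>s. s \<in> S \<Longrightarrow> B \<delta> (\<alpha> s) = 0"
    and psd: "\<And>x. x \<in> V \<Longrightarrow> 0 \<le> B x x"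
    and kernel: "\<And>x. x \<in> V \<Longrightarrow> B x x = 0 \<Longrightarrow> \<exists>c. x = c *\<^sub>R \<delta>"
    and infinite_W: "infinite (carrier W)"
begin

lemma B_delta [simp]: "B \<delta> x = 0" "B x \<delta> = 0"
proof -
  show "B \<delta> x = 0" by (subst B_expand_right) (simp add: delta_rad)
  then show "B x \<delta> = 0" using B_sym by metis
qed

lemma refl_delta [simp]: "refl b \<delta> = \<delta>"
  by (simp add: refl_def)

lemma gact_delta [simp]: "g \<in> carrier W \<Longrightarrow> gact g \<delta> = \<delta>"
proof -
  assume "g \<in> carrier W"
  then obtain w where w: "w \<in> lists S" "word_prod W w = g" using ex_word by blast
  have "act w \<delta> = \<delta>" by (induction w) auto
  then show ?thesis using gact_word w by metis
qed

text \<open>The radical is spanned by \<open>\<delta>\<close>, all of whose coordinates on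
  \<open>S\<close> are positive, so it contains no nonzero vector with a missing coordinate.\<close>

lemma posdef_supp_on:
  assumes "I \<subset> S" "x \<in> supp_on I" "x \<noteq> 0"
  shows "0 < B x x"
proof -
  have xV: "x \<in> V" using assms by (auto simp: V_def supp_on_def)
  have "B x x \<noteq> 0"
  proof
    assume "B x x = 0"
    then obtain c where c: "x = c *\<^sub>R \<delta>" using kernel xV by blast
    obtain s where "s \<in> S" "s \<notin> I" using assms(1) by blast
    then have "c = 0" using c assms(2) delta_pos[of s] by (auto simp: supp_on_def dest: fun_cong[of _ _ s])
    then show False using c assms(3) by simp
  qed
  then show ?thesis using psd[OF xV] by simp
qed

lemma S_nonempty: "\<exists>s. s \<in> S"
proof (rule ccontr)
  assume "\<not> ?thesis"
  then have "g = \<one>" if "g \<in> carrier W" for g using ex_descent[OF that] by blast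
  then have "carrier W \<subseteq> {\<one>}" by blast
  then show False using infinite_W finite_subset by blast
qed

definition s1 :: 'a where "s1 = (SOME s. s \<in> S)"

lemma s1: "s1 \<in> S"
  unfolding s1_def using S_nonempty by (rule someI_ex)

definition h0 :: "('a \<Rightarrow> real) \<Rightarrow> real" where "h0 x = x s1 / \<delta> s1"

text \<open>The representative modulo \<open>\<delta>\<close> that vanishes at an arbitrary node,
  where the form is positive definite. It ignores integrality, which is why \<open>flat\<close> at a
  special node replaces it later.\<close>

definition hat :: "('a \<Rightarrow> real) \<Rightarrow> ('a \<Rightarrow> real)" where "hat x = x - h0 x *\<^sub>R \<delta>"

lemma h0_delta: "h0 \<delta> = 1"
  using delta_pos[OF s1] by (simp add: h0_def)

lemma h0_add: "h0 (x + y) = h0 x + h0 y" and h0_scale: "h0 (c *\<^sub>R x) = c * h0 x"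
  by (simp_all add: h0_def add_divide_distrib)

lemma hat_supp: "x \<in> V \<Longrightarrow> hat x \<in> supp_on (S - {s1})"
  using delta_pos[OF s1] delta_V by (auto simp: hat_def h0_def supp_on_def V_def)

lemma hat_V: "x \<in> V \<Longrightarrow> hat x \<in> V"
  using delta_V by (auto simp: hat_def V_def)

lemma B_hat [simp]: "B (hat x) y = B x y" "B x (hat y) = B x y"
  by (simp_all add: hat_def)

lemma hat_eq_iff: "hat x = hat y \<longleftrightarrow> (\<exists>k. y = x + k *\<^sub>R \<delta>)"
proof
  assume "hat x = hat y"
  then have "y = x + (h0 y - h0 x) *\<^sub>R \<delta>" by (simp add: hat_def algebra_simps)
  then show "\<exists>k. y = x + k *\<^sub>R \<delta>" by blast
next
  assume "\<exists>k. y = x + k *\<^sub>R \<delta>"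
  then obtain k where "y = x + k *\<^sub>R \<delta>" by blast
  then show "hat x = hat y" by (simp add: hat_def h0_add h0_scale h0_delta algebra_simps)
qed

lemma S1_proper: "S - {s1} \<subset> S"
  using s1 by blast

lemma hat_root_bounded: "\<exists>M>0. \<forall>b. root b \<longrightarrow> (\<forall>s\<in>S. \<bar>hat b s\<bar> \<le> M)"
proof -
  obtain c where c: "0 < c" "\<And>x. x \<in> supp_on (S - {s1}) \<Longrightarrow> c * N x \<le> B x x"
    using coercive[of "S - {s1}"] posdef_supp_on[OF S1_proper] by blast
  have "\<bar>hat b s\<bar> \<le> sqrt (1 / c)" if "root b" "s \<in> S" for b s
  proof -
    have "c * N (hat b) \<le> B (hat b) (hat b)" using c(2) hat_supp root_V that by blast
    then have "c * N (hat b) \<le> 1" using root_norm that by simp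
    then have "N (hat b) \<le> 1 / c" using c by (simp add: field_simps)
    then have "(hat b s)\<^sup>2 \<le> 1 / c" using N_coord[OF that(2)] order_trans by blast
    then show ?thesis by (metis real_sqrt_abs real_sqrt_le_iff)
  qed
  then show ?thesis using c(1) by (intro exI[of _ "sqrt (1 / c)"]) simp
qed

text \<open>Functionals on \<open>V\<close> are stored by their values on the simple roots. Those
  with value 1 at \<open>\<delta>\<close> form the affine space in which the alcoves live.\<close>

definition ev :: "('a \<Rightarrow> real) \<Rightarrow> ('a \<Rightarrow> real) \<Rightarrow> real" where
  "ev \<phi> x = (\<Sum>s\<in>S. \<phi> s * x s)"

lemma ev_add: "ev \<phi> (x + y) = ev \<phi> x + ev \<phi> y" and ev_scale: "ev \<phi> (c *\<^sub>R x) = c * ev \<phi> x"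
  and ev_diff: "ev \<phi> (x - y) = ev \<phi> x - ev \<phi> y" and ev_minus: "ev \<phi> (- x) = - ev \<phi> x"
  by (simp_all add: ev_def sum.distrib sum_subtractf sum_distrib_left sum_negf algebra_simps)

definition pull :: "('a \<Rightarrow> real) \<Rightarrow> 'a \<Rightarrow> ('a \<Rightarrow> real)" where
  "pull \<phi> g = (\<lambda>s. ev \<phi> (gact g (\<alpha> s)))"

lemma ev_sum: "ev \<phi> (sum f A) = (\<Sum>i\<in>A. ev \<phi> (f i))"
proof (induction A rule: infinite_finite_induct)
  case (insert i A)
  have "ev \<phi> (sum f (insert i A)) = (\<Sum>i\<in>insert i A. ev \<phi> (f i))" using insert by (simp add: ev_add)
  then show ?case .
next
  case (infinite A)
  then have "ev \<phi> (sum f A) = (\<Sum>i\<in>A. ev \<phi> (f i))" by (simp add: ev_def)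
  then show ?case .
next
  case empty
  have "ev \<phi> (sum f {}) = (\<Sum>i\<in>{}. ev \<phi> (f i))" by (simp add: ev_def)
  then show ?case .
qed

lemma ev_linear_ext:
  assumes add: "\<And>x y. f (x + y) = f x + f y" and scale: "\<And>c x. f (c *\<^sub>R x) = c * f x" and x: "x \<in> V"
  shows "ev (\<lambda>s. f (\<alpha> s)) x = f x"
proof -
  have f0: "f 0 = 0" using scale[of 0 0] by simp
  have f_sum: "f (\<Sum>s\<in>A. x s *\<^sub>R \<alpha> s) = (\<Sum>s\<in>A. x s * f (\<alpha> s))" if "finite A" for A
    using that
  proof (induction A rule: finite_induct)
    case (insert s A)
    have "f (\<Sum>s\<in>insert s A. x s *\<^sub>R \<alpha> s) = (\<Sum>s\<in>insert s A. x s * f (\<alpha> s))"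
      unfolding sum.insert[OF insert.hyps] add scale insert.IH ..
    then show ?case .
  next
    case empty
    have "f (\<Sum>s\<in>{}. x s *\<^sub>R \<alpha> s) = (\<Sum>s\<in>{}. x s * f (\<alpha> s))" by (simp only: sum.empty f0)
    then show ?case .
  qed
  have "f x = f (\<Sum>s\<in>S. x s *\<^sub>R \<alpha> s)" using V_expand[OF x] by simp
  also have "\<dots> = ev (\<lambda>s. f (\<alpha> s)) x" unfolding f_sum[OF finite_S] ev_def by (simp add: mult.commute)
  finally show ?thesis by simp
qed

lemma ev_pull: "x \<in> V \<Longrightarrow> ev (pull \<phi> g) x = ev \<phi> (gact g x)"
proof -
  assume x: "x \<in> V"
  have "ev \<phi> (gact g (x + y)) = ev \<phi> (gact g x) + ev \<phi> (gact g y)" for x y by (simp add: gact_add ev_add)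
  moreover have "ev \<phi> (gact g (c *\<^sub>R x)) = c * ev \<phi> (gact g x)" for c x by (simp add: gact_scale ev_scale)
  ultimately show ?thesis unfolding pull_def by (rule ev_linear_ext[OF _ _ x])
qed

text \<open>The functional \<open>\<phi>\<close> and the height divided by \<open>D\<close> both
  take the value 1 at \<open>\<delta>\<close>, so their difference depends on \<open>hat b\<close>
  only and is bounded. A negative value at \<open>b\<close> then bounds the height of
  \<open>b\<close>.\<close>

lemma finite_negative_roots:
  assumes "ev \<phi> \<delta> = 1"
  shows "finite {b. root b \<and> nonneg b \<and> ev \<phi> b < 0}"
proof -
  obtain M where M: "0 < M" "\<And>b s. root b \<Longrightarrow> s \<in> S \<Longrightarrow> \<bar>hat b s\<bar> \<le> M" using hat_root_bounded by blast
  define D where "D = (\<Sum>s\<in>S. \<delta> s)"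
  have D: "0 < D" unfolding D_def using S_nonempty finite_S delta_pos by (intro sum_pos) auto
  define K where "K = (\<Sum>s\<in>S. \<bar>\<phi> s - 1 / D\<bar> * M)"
  have "\<bar>b s\<bar> \<le> K * D" if b: "root b" "nonneg b" "ev \<phi> b < 0" and s: "s \<in> S" for b s
  proof -
    define H where "H = (\<Sum>s\<in>S. b s)"
    have "ev (\<lambda>s. \<phi> s - 1 / D) x = ev \<phi> x - (\<Sum>s\<in>S. x s) / D" for x
      by (simp add: ev_def sum_subtractf left_diff_distrib sum_divide_distrib)
    note e = this
    have "ev (\<lambda>s. \<phi> s - 1 / D) \<delta> = 0" unfolding e using assms D by (simp add: D_def)
    then have "ev (\<lambda>s. \<phi> s - 1 / D) (hat b) = ev (\<lambda>s. \<phi> s - 1 / D) b"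
      by (simp add: hat_def ev_diff ev_scale)
    then have eq: "ev \<phi> b - H / D = ev (\<lambda>s. \<phi> s - 1 / D) (hat b)" unfolding e H_def by simp
    have "\<bar>ev (\<lambda>s. \<phi> s - 1 / D) (hat b)\<bar> \<le> (\<Sum>s\<in>S. \<bar>(\<phi> s - 1 / D) * hat b s\<bar>)"
      unfolding ev_def by (rule sum_abs)
    also have "\<dots> \<le> K" unfolding K_def abs_mult
      by (intro sum_mono mult_left_mono M(2) b) auto
    finally have "H / D \<le> K" using eq b(3) by linarith
    then have "H \<le> K * D" using D by (simp add: field_simps)
    moreover have "b s \<le> H" unfolding H_def using s finite_S b(2) by (intro member_le_sum) (auto simp: nonneg_def)
    moreover have "0 \<le> b s" using b(2) by (simp add: nonneg_def)
    ultimately show ?thesis by simp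
  qed
  then have "{b. root b \<and> nonneg b \<and> ev \<phi> b < 0} \<subseteq> {b. root b \<and> (\<forall>s\<in>S. \<bar>b s\<bar> \<le> K * D)}" by blast
  then show ?thesis using finite_bounded_roots finite_subset by blast
qed

text \<open>A positive root other than \<open>\<alpha> s\<close> has a positive coordinate away from
  \<open>s\<close>. The reflection leaves it alone, and it decides the sign of the image.\<close>

lemma simple_refl_nonneg:
  assumes b: "root b" "nonneg b" "b \<noteq> \<alpha> s" and s: "s \<in> S"
  shows "nonneg (refl (\<alpha> s) b)"
proof -
  have "\<exists>t. t \<noteq> s \<and> 0 < b t"
  proof (rule ccontr)
    assume "\<not> ?thesis"
    then have z: "b t = 0" if "t \<noteq> s" for t using that b(2) unfolding nonneg_def by (meson antisym not_le)
    then have eq: "b = b s *\<^sub>R \<alpha> s" by (auto simp: \<alpha>_def fun_eq_iff)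
    have "B b b = b s * b s" using arg_cong2[OF eq eq, of B] s by (simp add: B_alpha_self)
    then have "(b s)\<^sup>2 = 1" using root_norm[OF b(1)] by (simp add: power2_eq_square)
    then have "b s = 1" using b(2) unfolding nonneg_def by (smt (verit) power2_eq_1_iff)
    then show False using eq b(3) by simp
  qed
  then obtain t where t: "t \<noteq> s" "0 < b t" by blast
  then have "0 < refl (\<alpha> s) b t" by (simp add: refl_def \<alpha>_def)
  then have "\<not> nonneg (- refl (\<alpha> s) b)" unfolding nonneg_def by (auto intro!: exI[of _ t])
  then show ?thesis using root_sign[OF root_refl[OF root_alpha[OF s] b(1)]] by blast
qed

text \<open>While a simple root \<open>\<alpha> s\<close> is negative at \<open>\<phi>\<close>,
  reflecting in it lowers the number of positive roots negative there: the other positive roots are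
  permuted and \<open>\<alpha> s\<close> drops out.\<close>

lemma move_into_alcove:
  "ev \<phi> \<delta> = 1 \<Longrightarrow> \<exists>g\<in>carrier W. \<forall>s\<in>S. 0 \<le> ev \<phi> (gact g (\<alpha> s))"
proof (induction "card {b. root b \<and> nonneg b \<and> ev \<phi> b < 0}" arbitrary: \<phi> rule: less_induct)
  case less
  let ?N = "\<lambda>\<phi>. {b. root b \<and> nonneg b \<and> ev \<phi> b < 0}"
  show ?case
  proof (cases "\<forall>s\<in>S. 0 \<le> ev \<phi> (\<alpha> s)")
    case True
    then show ?thesis by (intro bexI[of _ \<one>]) auto
  next
    case False
    then obtain s where s: "s \<in> S" "ev \<phi> (\<alpha> s) < 0" by auto
    define \<phi>' where "\<phi>' = pull \<phi> s"
    have ev': "ev \<phi>' x = ev \<phi> (refl (\<alpha> s) x)" if "x \<in> V" for x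
      using ev_pull[OF that] s by (simp add: \<phi>'_def gact_S)
    have d: "ev \<phi>' \<delta> = 1" using ev'[OF delta_V] less.prems by simp
    have sub: "refl (\<alpha> s) ` ?N \<phi>' \<subseteq> ?N \<phi> - {\<alpha> s}"
    proof
      fix c assume "c \<in> refl (\<alpha> s) ` ?N \<phi>'"
      then obtain b where b: "root b" "nonneg b" "ev \<phi>' b < 0" "c = refl (\<alpha> s) b" by blast
      have "b \<noteq> \<alpha> s"
        using b(3) s ev'[OF alpha_V[OF s(1)]] by (auto simp: refl_self B_alpha_self ev_minus)
      moreover have "c \<noteq> \<alpha> s"
      proof
        assume "c = \<alpha> s"
        then have "b = - \<alpha> s" using b(4) refl_refl[OF B_alpha_self[OF s(1)], of b] s by (simp add: refl_self B_alpha_self)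
        then have "b s = - 1" by (simp add: \<alpha>_def)
        then show False using b(2) unfolding nonneg_def by (metis neg_0_le_iff_le not_one_le_zero)
      qed
      ultimately show "c \<in> ?N \<phi> - {\<alpha> s}"
        using b simple_refl_nonneg s root_refl root_alpha ev' root_V by auto
    qed
    have inj: "inj_on (refl (\<alpha> s)) (?N \<phi>')" by (rule inj_on_inverseI[of _ "refl (\<alpha> s)"]) (rule refl_refl[OF B_alpha_self[OF s(1)]])
    have "card (?N \<phi>') = card (refl (\<alpha> s) ` ?N \<phi>')" using inj by (simp add: card_image)
    also have "\<dots> \<le> card (?N \<phi> - {\<alpha> s})" using sub finite_negative_roots[OF less.prems] by (intro card_mono) auto
    also have "\<dots> < card (?N \<phi>)"
    proof (rule card_Diff1_less[OF finite_negative_roots[OF less.prems]])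
      show "\<alpha> s \<in> ?N \<phi>" using s root_alpha by (auto simp: nonneg_def \<alpha>_def)
    qed
    finally obtain g where g: "g \<in> carrier W" "\<forall>t\<in>S. 0 \<le> ev \<phi>' (gact g (\<alpha> t))"
      using less.hyps[of \<phi>'] d by blast
    have "ev \<phi> (gact (s \<otimes> g) (\<alpha> t)) = ev \<phi>' (gact g (\<alpha> t))" if "t \<in> S" for t
      using that s g by (simp add: ev' gact_V alpha_V gact_mult S_carrier gact_S)
    then show ?thesis using g s by (intro bexI[of _ "s \<otimes> g"]) (auto simp: S_carrier)
  qed
qed

text \<open>Two roots with product strictly between -1 and 1 have a common zero among the
  functionals with value 1 at \<open>\<delta>\<close>. Moving this point into the closed alcove
  places both roots in \<open>supp_on I\<close> for a proper subset \<open>I\<close>, where only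
  finitely many roots exist.\<close>

lemma finite_elliptic_values: "finite {B b c | b c. root b \<and> root c \<and> \<bar>B b c\<bar> < 1}"
proof -
  let ?\<Phi> = "\<lambda>I. {b. root b \<and> b \<in> supp_on I}"
  have fin: "finite (\<Union>I\<in>{I. I \<subset> S}. (\<lambda>(b, c). B b c) ` (?\<Phi> I \<times> ?\<Phi> I))"
  proof (intro finite_UN_I finite_imageI finite_cartesian_product)
    show "finite {I. I \<subset> S}" by (rule finite_subset[of _ "Pow S"]) (use finite_S in auto)
    show "finite (?\<Phi> I)" if "I \<in> {I. I \<subset> S}" for I
      using that by (intro finite_roots_supp_on posdef_supp_on) auto
    show "finite (?\<Phi> I)" if "I \<in> {I. I \<subset> S}" for I
      using that by (intro finite_roots_supp_on posdef_supp_on) auto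
  qed
  have "B b c \<in> (\<Union>I\<in>{I. I \<subset> S}. (\<lambda>(b, c). B b c) ` (?\<Phi> I \<times> ?\<Phi> I))"
    if b: "root b" and c: "root c" and lt: "\<bar>B b c\<bar> < 1" for b c
  proof -
    define \<beta> where "\<beta> = B b c"
    define D where "D = 1 - \<beta>\<^sup>2"
    have D: "D \<noteq> 0" using lt unfolding D_def \<beta>_def[symmetric] by (auto simp: abs_square_eq_1 power2_eq_1_iff)
    \<comment> \<open>\<open>u\<close> and \<open>w\<close> solve the equations
      \<open>f b = 0\<close> and \<open>f c = 0\<close>; \<open>D\<close> is the Gram determinant of
      \<open>b\<close> and \<open>c\<close>.\<close>
    define u where "u = (\<beta> * h0 c - h0 b) / D"
    define w where "w = (\<beta> * h0 b - h0 c) / D"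
    define z where "z = u *\<^sub>R b + w *\<^sub>R c"
    define f where "f x = h0 x + B x z" for x
    define \<phi> where "\<phi> = (\<lambda>s. f (\<alpha> s))"
    have f_lin: "f (x + y) = f x + f y" "f (k *\<^sub>R x) = k * f x" for x y k
      by (simp_all add: f_def h0_add h0_scale algebra_simps)
    have ev: "ev \<phi> x = f x" if "x \<in> V" for x
      unfolding \<phi>_def by (rule ev_linear_ext[OF f_lin that])
    have "B c b = \<beta>" by (simp add: \<beta>_def B_sym[of c b])
    then have fbz: "f b = h0 b + u + w * \<beta>" "f c = h0 c + u * \<beta> + w"
      using root_norm b c by (simp_all add: f_def z_def \<beta>_def)
    have uw: "u * D = \<beta> * h0 c - h0 b" "w * D = \<beta> * h0 b - h0 c" using D by (simp_all add: u_def w_def)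
    have "f b * D = h0 b * D + u * D + w * D * \<beta>" by (simp only: fbz distrib_right mult.assoc mult.commute[of \<beta> D])
    also have "\<dots> = 0" unfolding uw unfolding D_def by (simp add: algebra_simps power2_eq_square)
    finally have 1: "f b * D = 0" .
    have "f c * D = h0 c * D + u * D * \<beta> + w * D" by (simp only: fbz distrib_right mult.assoc mult.commute[of \<beta> D])
    also have "\<dots> = 0" unfolding uw unfolding D_def by (simp add: algebra_simps power2_eq_square)
    finally have 2: "f c * D = 0" .
    from 1 2 have f0: "f b = 0" "f c = 0" using D by auto
    have "ev \<phi> \<delta> = 1" using ev[OF delta_V] by (simp add: f_def h0_delta)
    from move_into_alcove[OF this] obtain g where g: "g \<in> carrier W" "\<forall>s\<in>S. 0 \<le> ev \<phi> (gact g (\<alpha> s))" by blast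
    define \<psi> where "\<psi> = pull \<phi> g"
    have psi: "\<And>s. s \<in> S \<Longrightarrow> 0 \<le> \<psi> s" using g(2) by (simp add: \<psi>_def pull_def)
    have ev_psi: "ev \<psi> x = ev \<phi> (gact g x)" if "x \<in> V" for x unfolding \<psi>_def by (rule ev_pull[OF that])
    define I where "I = {s \<in> S. \<psi> s = 0}"
    have "ev \<psi> \<delta> = 1" using ev_psi[OF delta_V] g(1) \<open>ev \<phi> \<delta> = 1\<close> by simp
    \<comment> \<open>If \<open>\<psi>\<close> vanished on all of \<open>S\<close>, it would vanish
      at \<open>\<delta>\<close>.\<close>
    then have "I \<subset> S" unfolding I_def ev_def by (auto intro!: psubsetI) (metis (mono_tags, lifting) mem_Collect_eq mult_zero_left sum.neutral zero_neq_one)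
    have supp: "gact (inv g) e \<in> supp_on I" if e: "root e" "f e = 0" for e
    proof -
      define x where "x = gact (inv g) e"
      have x: "root x" "x \<in> V" using e g root_gact root_V by (auto simp: x_def)
      have "ev \<psi> x = 0" using ev_psi[OF x(2)] g e ev[OF root_V[OF e(1)]] by (simp add: x_def gact_inv)
      then have sum0: "(\<Sum>s\<in>S. \<psi> s * x s) = 0" by (simp add: ev_def)
      have "\<psi> s * x s = 0" if "s \<in> S" for s
        using root_sign[OF x(1)]
      proof
        assume "nonneg x"
        then have "\<And>s. s \<in> S \<Longrightarrow> 0 \<le> \<psi> s * x s" using psi by (simp add: nonneg_def)
        then show ?thesis using sum0 that finite_S by (simp add: sum_nonneg_eq_0_iff)
      next
        assume "nonneg (- x)"
        then have "\<And>s. s \<in> S \<Longrightarrow> 0 \<le> - (\<psi> s * x s)" using psi by (simp add: nonneg_def mult_nonneg_nonpos)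
        moreover have "(\<Sum>s\<in>S. - (\<psi> s * x s)) = 0" using sum0 by (simp add: sum_negf)
        ultimately have "- (\<psi> s * x s) = 0" using that finite_S sum_nonneg_eq_0_iff[of S "\<lambda>s. - (\<psi> s * x s)"] by blast
        then show ?thesis by simp
      qed
      then have "x s = 0" if "s \<notin> I" for s using that x(2) by (cases "s \<in> S") (auto simp: I_def V_def)
      then show ?thesis by (simp add: x_def supp_on_def)
    qed
    have "B b c = B (gact (inv g) b) (gact (inv g) c)" using g by (simp add: B_gact)
    moreover have "gact (inv g) b \<in> ?\<Phi> I" "gact (inv g) c \<in> ?\<Phi> I"
      using supp b c f0 root_gact g by auto
    ultimately show ?thesis using \<open>I \<subset> S\<close> by (intro UN_I[of I]) auto
  qed
  then have "{B b c | b c. root b \<and> root c \<and> \<bar>B b c\<bar> < 1}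
    \<subseteq> (\<Union>I\<in>{I. I \<subset> S}. (\<lambda>(b, c). B b c) ` (?\<Phi> I \<times> ?\<Phi> I))" by blast
  then show ?thesis using fin finite_subset by blast
qed

lemma hat_diff_pos:
  assumes "x \<in> V" "y \<in> V" "hat x \<noteq> hat y"
  shows "0 < B (x - y) (x - y)"
proof -
  have "hat x - hat y \<in> supp_on (S - {s1})" using hat_supp[OF assms(1)] hat_supp[OF assms(2)] by (auto simp: supp_on_def)
  moreover have "hat x - hat y \<noteq> 0" using assms(3) by simp
  ultimately have "0 < B (hat x - hat y) (hat x - hat y)" by (rule posdef_supp_on[OF S1_proper])
  then show ?thesis by simp
qed

text \<open>By finiteness of the values between -1 and 1, roots of different directions have product
  at most some \<open>m < 1\<close>. Their directions are thus separated in the definite form, and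
  they are bounded.\<close>

lemma finite_hat_roots: "finite (hat ` {b. root b})"
proof (rule ccontr)
  assume inf: "infinite (hat ` {b. root b})"
  define F where "F = {B b c | b c. root b \<and> root c \<and> \<bar>B b c\<bar> < 1}"
  define m where "m = Max (insert 0 F)"
  have F: "finite F" unfolding F_def by (rule finite_elliptic_values)
  have "\<And>f. f \<in> insert 0 F \<Longrightarrow> f < 1" by (auto simp: F_def)
  moreover have "m \<in> insert 0 F" unfolding m_def using F by (intro Max_in) auto
  ultimately have m: "m < 1" by blast
  have m0: "0 \<le> m" unfolding m_def using F by (intro Max_ge) auto
  define K where "K = (real (card S))\<^sup>2 + 1"
  \<comment> \<open>Keeps \<open>K * e\<^sup>2\<close> below or at \<open>1 - m\<close>, half of the
    separation \<open>2 * (1 - m)\<close>.\<close>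
  define e where "e = min 1 ((1 - m) / K)"
  have K: "1 \<le> K" by (simp add: K_def)
  have e: "0 < e" "e \<le> 1" "e * K \<le> 1 - m"
    using m K by (auto simp: e_def min_def field_simps)
  obtain M where M: "0 < M" "\<And>b s. root b \<Longrightarrow> s \<in> S \<Longrightarrow> \<bar>hat b s\<bar> \<le> M" using hat_root_bounded by blast
  have "\<exists>x\<in>hat ` {b. root b}. \<exists>y\<in>hat ` {b. root b}. x \<noteq> y \<and> (\<forall>s\<in>S. \<bar>x s - y s\<bar> < e)"
    by (rule infinite_bounded_close[OF finite_S inf _ e(1), of M]) (use M in auto)
  then obtain b c where bc: "root b" "root c" "hat b \<noteq> hat c" "\<forall>s\<in>S. \<bar>hat b s - hat c s\<bar> < e" by blast
  have bV: "b \<in> V" "c \<in> V" using bc root_V by auto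
  have "B (b - c) (b - c) = 2 - 2 * B b c" using bc root_norm by (simp add: B_sym[of c b])
  moreover have "0 < B (b - c) (b - c)" by (rule hat_diff_pos[OF bV bc(3)])
  ultimately have lt1: "B b c < 1" and eq: "B (hat b - hat c) (hat b - hat c) = 2 - 2 * B b c" by simp_all
  have "B (b + c) (b + c) = 2 + 2 * B b c" using bc root_norm by (simp add: B_sym[of c b])
  then have ge: "- 1 \<le> B b c" using psd[OF V_add[OF bV]] by simp
  have "B b c \<le> m"
  proof (cases "B b c = - 1")
    case True then show ?thesis using m0 by simp
  next
    case False
    then have "B b c \<in> F" unfolding F_def using ge lt1 bc by fastforce
    then show ?thesis unfolding m_def using F by (intro Max_ge) auto
  qed
  then have "2 * (1 - m) \<le> \<bar>B (hat b - hat c) (hat b - hat c)\<bar>" unfolding eq by simp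
  also have "\<dots> \<le> (real (card S))\<^sup>2 * (e * e)" using bc(4) e by (intro B_bound) (auto simp: less_imp_le)
  also have "\<dots> \<le> K * (e * 1)" using e by (intro mult_mono) (auto simp: K_def)
  also have "\<dots> \<le> 1 - m" using e(3) by (simp add: mult.commute)
  finally show False using m by simp
qed

text \<open>The product of the reflections in two parallel roots shifts along
  \<open>\<delta>\<close>.\<close>

lemma translation_root:
  assumes b: "root b" "root (b + k *\<^sub>R \<delta>)" and c: "root c"
  shows "root (c + (2 * k * B c b) *\<^sub>R \<delta>)"
proof -
  have "refl (b + k *\<^sub>R \<delta>) (refl b c) = c + (2 * k * B c b) *\<^sub>R \<delta>"
    by (rule ext) (simp add: refl_def root_norm[OF b(1)] algebra_simps)
  then show ?thesis using root_refl[OF b(2) root_refl[OF b(1) c]] by simp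
qed

text \<open>Infinitely many roots in finitely many directions force two parallel ones. By
  \<open>translation_root\<close> a period of one root passes to every root not orthogonal to it,
  and so along the Coxeter graph.\<close>

lemma root_period_exists:
  assumes c: "root c"
  shows "\<exists>k. k \<noteq> 0 \<and> root (c + k *\<^sub>R \<delta>)"
proof -
  define good where "good c \<longleftrightarrow> (\<exists>k. k \<noteq> 0 \<and> root (c + k *\<^sub>R \<delta>))" for c
  have step: "good c" if "root b" "good b" "root c" "B c b \<noteq> 0" for b c
    using that translation_root unfolding good_def by (metis mult_eq_0_iff zero_neq_numeral)
  have "infinite {b. root b}" using finite_roots_imp_finite infinite_W by blast
  then have "\<not> inj_on hat {b. root b}" using finite_hat_roots finite_imageD by blast
  then obtain b b' where b: "root b" "root b'" "b \<noteq> b'" "hat b = hat b'" by (auto simp: inj_on_def)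
  then obtain k where "b' = b + k *\<^sub>R \<delta>" using hat_eq_iff by blast
  then have "good b" using b unfolding good_def by (intro exI[of _ k]) auto
  have "\<exists>s\<in>S. B (\<alpha> s) b \<noteq> 0"
  proof (rule ccontr)
    assume "\<not> ?thesis"
    then have "B b b = 0" by (subst B_expand_left) simp
    then show False using root_norm b by simp
  qed
  then obtain s where s: "s \<in> S" "B (\<alpha> s) b \<noteq> 0" by blast
  have gs: "good (\<alpha> s)" using step[OF b(1) \<open>good b\<close> root_alpha[OF s(1)] s(2)] .
  have "good (\<alpha> t)" if "t \<in> S" for t
  proof (rule connected_induct[of s "\<lambda>t. good (\<alpha> t)"])
    fix u v assume uv: "u \<in> S" "v \<in> S" "bcoef u v < 0" "good (\<alpha> u)"
    then have "B (\<alpha> v) (\<alpha> u) \<noteq> 0" using bcoef_sym[of u v] by (simp add: B_alpha)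
    then show "good (\<alpha> v)" using step[OF root_alpha[OF uv(1)] uv(4) root_alpha[OF uv(2)]] by blast
  qed (use s gs that in auto)
  moreover obtain g t where g: "g \<in> carrier W" "t \<in> S" "c = gact g (\<alpha> t)" using c root_def by blast
  ultimately obtain k where k: "k \<noteq> 0" "root (\<alpha> t + k *\<^sub>R \<delta>)" unfolding good_def by blast
  then have "root (c + k *\<^sub>R \<delta>)" using root_gact[OF k(2) g(1)] g by (simp add: gact_add gact_scale)
  then show ?thesis using k(1) by blast
qed

definition periods :: "('a \<Rightarrow> real) \<Rightarrow> real set" where
  "periods b = {k. root (b + k *\<^sub>R \<delta>)}"

lemma periods_refl:
  assumes "k \<in> periods b" "l \<in> periods b" "root b"
  shows "2 * l - k \<in> periods b"
proof -
  have "refl (b + l *\<^sub>R \<delta>) (b + k *\<^sub>R \<delta>) = - (b + (2 * l - k) *\<^sub>R \<delta>)"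
    by (rule ext) (simp add: refl_def root_norm[OF assms(3)] algebra_simps)
  then show ?thesis using assms root_refl root_minus unfolding periods_def by (metis minus_minus mem_Collect_eq)
qed

lemma finite_periods: "finite {k \<in> periods b. \<bar>k\<bar> \<le> M}"
proof -
  let ?f = "\<lambda>k. b + k *\<^sub>R \<delta>"
  define C where "C = (\<Sum>s\<in>S. \<bar>b s\<bar> + \<bar>M\<bar> * \<delta> s)"
  have "?f ` {k \<in> periods b. \<bar>k\<bar> \<le> M} \<subseteq> {b. root b \<and> (\<forall>s\<in>S. \<bar>b s\<bar> \<le> C)}"
  proof
    fix x assume "x \<in> ?f ` {k \<in> periods b. \<bar>k\<bar> \<le> M}"
    then obtain k where k: "root x" "\<bar>k\<bar> \<le> M" "x = b + k *\<^sub>R \<delta>" by (auto simp: periods_def)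
    have "\<bar>x s\<bar> \<le> C" if s: "s \<in> S" for s
    proof -
      have "\<bar>k * \<delta> s\<bar> \<le> \<bar>M\<bar> * \<delta> s" using k(2) delta_pos[OF s] by (simp add: abs_mult mult_right_mono)
      then have "\<bar>x s\<bar> \<le> \<bar>b s\<bar> + \<bar>M\<bar> * \<delta> s" using abs_triangle_ineq[of "b s" "k * \<delta> s"] by (simp add: k(3))
      also have "\<dots> \<le> C" unfolding C_def using s finite_S delta_pos
        by (intro member_le_sum) (auto simp: less_imp_le)
      finally show ?thesis .
    qed
    then show "x \<in> {b. root b \<and> (\<forall>s\<in>S. \<bar>b s\<bar> \<le> C)}" using k by simp
  qed
  then have "finite (?f ` {k \<in> periods b. \<bar>k\<bar> \<le> M})" using finite_bounded_roots finite_subset by blast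
  moreover have "inj_on ?f A" for A
  proof (rule inj_onI)
    fix k l assume "b + k *\<^sub>R \<delta> = b + l *\<^sub>R \<delta>"
    then have "(b + k *\<^sub>R \<delta>) s1 = (b + l *\<^sub>R \<delta>) s1" by (rule fun_cong)
    then show "k = l" using delta_pos[OF s1] by simp
  qed
  ultimately show ?thesis using finite_imageD by blast
qed

lemma periods_lattice: "root b \<Longrightarrow> \<exists>c>0. periods b = {c * of_int m | m. True}"
proof (rule reflection_closed_discrete)
  assume b: "root b"
  show "0 \<in> periods b" using b by (simp add: periods_def)
  show "2 * l - k \<in> periods b" if "k \<in> periods b" "l \<in> periods b" for k l using periods_refl that b by blast
  show "finite {k \<in> periods b. \<bar>k\<bar> \<le> M}" for M by (rule finite_periods)
  show "\<exists>k\<in>periods b. k \<noteq> 0" using root_period_exists[OF b] by (auto simp: periods_def)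
qed

end

section \<open>Periods and rescaled roots\<close>

context affine_coxeter
begin

lemma hat_add: "hat (x + y) = hat x + hat y" and hat_scale: "hat (c *\<^sub>R x) = c *\<^sub>R hat x"
  and hat_delta [simp]: "hat \<delta> = 0"
  by (simp_all add: hat_def h0_add h0_scale h0_delta algebra_simps)

lemma hat_minus: "hat (- x) = - hat x" and hat_diff: "hat (x - y) = hat x - hat y"
  using hat_scale[of "- 1" x] hat_add[of x "- 1 *\<^sub>R y"] hat_scale[of "- 1" y] by simp_all

text \<open>The spacing of the roots parallel to \<open>b\<close>, in units of
  \<open>\<delta>\<close>.\<close>

definition cc :: "('a \<Rightarrow> real) \<Rightarrow> real" where
  "cc b = (SOME c. 0 < c \<and> periods b = {c * of_int m | m. True})"

lemma cc:
  assumes "root b"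
  shows "0 < cc b" "periods b = {cc b * of_int m | m. True}"
proof -
  have "\<exists>c. 0 < c \<and> periods b = {c * of_int m | m. True}" using periods_lattice[OF assms] by blast
  from someI_ex[OF this] show "0 < cc b" "periods b = {cc b * of_int m | m. True}"
    unfolding cc_def by blast+
qed

lemma root_cc_shift: "root b \<Longrightarrow> root (b + (cc b * of_int m) *\<^sub>R \<delta>)"
  using cc(2)[of b] unfolding periods_def by blast

lemma cc_shift:
  assumes "root b" "root (b + k *\<^sub>R \<delta>)"
  shows "cc (b + k *\<^sub>R \<delta>) = cc b" "\<exists>m. k = cc b * of_int m"
proof -
  have "k \<in> periods b" using assms(2) by (simp add: periods_def)
  then show ex: "\<exists>m. k = cc b * of_int m" using cc(2)[OF assms(1)] by blast
  then obtain m where m: "k = cc b * of_int m" by blast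
  have "l \<in> periods (b + k *\<^sub>R \<delta>) \<longleftrightarrow> l \<in> periods b" for l
  proof -
    have "l \<in> periods (b + k *\<^sub>R \<delta>) \<longleftrightarrow> k + l \<in> periods b"
      by (simp add: periods_def scaleR_add_left add.assoc)
    also have "\<dots> \<longleftrightarrow> l \<in> periods b"
    proof
      assume "k + l \<in> periods b"
      then obtain j where "k + l = cc b * of_int j" using cc(2)[OF assms(1)] by blast
      then have "l = cc b * of_int (j - m)" by (simp add: m algebra_simps)
      then show "l \<in> periods b" using cc(2)[OF assms(1)] by blast
    next
      assume "l \<in> periods b"
      then obtain j where "l = cc b * of_int j" using cc(2)[OF assms(1)] by blast
      then have "k + l = cc b * of_int (m + j)" by (simp add: m algebra_simps)
      then show "k + l \<in> periods b" using cc(2)[OF assms(1)] by blast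
    qed
    finally show ?thesis .
  qed
  then have "periods (b + k *\<^sub>R \<delta>) = periods b" by blast
  then show "cc (b + k *\<^sub>R \<delta>) = cc b" by (simp add: cc_def)
qed

lemma root_gact_iff: "g \<in> carrier W \<Longrightarrow> root (gact g b) \<longleftrightarrow> root b"
  using root_gact[of b g] root_gact[of "gact g b" "inv g"] by (auto simp: gact_inv)

lemma cc_gact: "g \<in> carrier W \<Longrightarrow> cc (gact g b) = cc b"
proof -
  assume g: "g \<in> carrier W"
  have "gact g b + k *\<^sub>R \<delta> = gact g (b + k *\<^sub>R \<delta>)" for k using g by (simp add: gact_add gact_scale)
  then have "periods (gact g b) = periods b" using g by (simp add: periods_def root_gact_iff)
  then show ?thesis by (simp add: cc_def)
qed

lemma cc_minus: "root b \<Longrightarrow> cc (- b) = cc b"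
proof -
  assume b: "root b"
  obtain r where r: "r \<in> carrier W" "\<forall>x. gact r x = refl b x" using root_reflection[OF b] by blast
  have "gact r b = - b" using r(2) refl_self[OF root_norm[OF b]] by simp
  then show ?thesis using cc_gact[OF r(1), of b] by simp
qed

text \<open>Division by the spacing makes parallel rescaled roots differ by integral multiples of
  \<open>\<delta>\<close>, up to sign. This is the length at which the Cartan numbers become
  integers.\<close>

definition sroot :: "('a \<Rightarrow> real) \<Rightarrow> bool" where
  "sroot x \<longleftrightarrow> (\<exists>b. root b \<and> x = (1 / cc b) *\<^sub>R b)"

lemma sroot_V: "sroot x \<Longrightarrow> x \<in> V"
  unfolding sroot_def using V_scale root_V by blast

lemma sroot_norm: "sroot x \<Longrightarrow> 0 < B x x"
  unfolding sroot_def using cc(1) root_norm by fastforce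

lemma sroot_gact: "sroot x \<Longrightarrow> g \<in> carrier W \<Longrightarrow> sroot (gact g x)"
  unfolding sroot_def by (metis cc_gact gact_scale root_gact)

lemma sroot_minus: "sroot x \<Longrightarrow> sroot (- x)"
  unfolding sroot_def by (metis cc_minus root_minus scaleR_minus_right)

lemma sroot_shift:
  assumes "sroot x"
  shows "sroot (x + of_int m *\<^sub>R \<delta>)"
proof -
  obtain b where b: "root b" "x = (1 / cc b) *\<^sub>R b" using assms sroot_def by blast
  let ?b = "b + (cc b * of_int m) *\<^sub>R \<delta>"
  have r: "root ?b" by (rule root_cc_shift[OF b(1)])
  have "x + of_int m *\<^sub>R \<delta> = (1 / cc ?b) *\<^sub>R ?b"
    unfolding cc_shift(1)[OF b(1) r] using cc(1)[OF b(1)] by (simp add: b(2) scaleR_add_right)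
  then show ?thesis unfolding sroot_def using r by blast
qed

text \<open>Undoing the two scalings leaves unit vectors, so the factor \<open>u\<close> between the
  roots is 1 or -1. Hence the spacings agree and the remaining shift is a period.\<close>

lemma sroot_parallel:
  assumes x: "sroot x" and y: "sroot y" and eq: "y = r *\<^sub>R x + k *\<^sub>R \<delta>"
  shows "r = 1 \<or> r = - 1" "k \<in> \<int>"
proof -
  obtain b where b: "root b" "x = (1 / cc b) *\<^sub>R b" using x sroot_def by blast
  obtain c where c: "root c" "y = (1 / cc c) *\<^sub>R c" using y sroot_def by blast
  have pos: "0 < cc b" "0 < cc c" using cc(1) b c by auto
  define u where "u = r * cc c / cc b"
  have "c = cc c *\<^sub>R y" using pos c(2) by simp
  also have "\<dots> = u *\<^sub>R b + (k * cc c) *\<^sub>R \<delta>" unfolding eq b(2) u_def by (simp add: scaleR_add_right mult_ac)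
  finally have c_eq: "c = u *\<^sub>R b + (k * cc c) *\<^sub>R \<delta>" .
  have "B c c = u * u" by (subst c_eq, subst (2) c_eq) (simp add: root_norm[OF b(1)])
  then have "u\<^sup>2 = 1" using root_norm[OF c(1)] by (simp add: power2_eq_square)
  then have u: "u = 1 \<or> u = - 1" by (rule power2_eq_1_iff[THEN iffD1])
  have ub: "root (u *\<^sub>R b)" "cc (u *\<^sub>R b) = cc b" using u b root_minus cc_minus by auto
  have rc: "root (u *\<^sub>R b + (k * cc c) *\<^sub>R \<delta>)" using c(1) c_eq by simp
  have ccc: "cc c = cc b" using cc_shift(1)[OF ub(1) rc] c_eq ub(2) by simp
  obtain m where "k * cc c = cc b * of_int m" using cc_shift(2)[OF ub(1) rc] ub(2) by auto
  then show "k \<in> \<int>" using pos ccc by simp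
  show "r = 1 \<or> r = - 1" using u pos ccc by (simp add: u_def)
qed

lemma sroot_hat_nonzero: "sroot x \<Longrightarrow> hat x \<noteq> 0"
  using sroot_norm[of x] B_hat(1)[of x x] by force

lemma sroot_refl:
  assumes x: "sroot x" and y: "sroot y"
  shows "sroot (y - (2 * B y x / B x x) *\<^sub>R x)"
proof -
  obtain b where b: "root b" "x = (1 / cc b) *\<^sub>R b" using x sroot_def by blast
  obtain r where r: "r \<in> carrier W" "\<forall>x. gact r x = refl b x" using root_reflection[OF b(1)] by blast
  have "y - (2 * B y x / B x x) *\<^sub>R x = refl b y"
    using cc(1)[OF b(1)] root_norm[OF b(1)] by (simp add: b(2) refl_def)
  then show ?thesis using sroot_gact[OF y r(1)] r(2) by simp
qed

text \<open>By \<open>translation_root\<close> the number \<open>2 * cc b * B c b\<close> is a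
  period of \<open>c\<close>; divided by the spacing \<open>cc c\<close> it is the Cartan
  number.\<close>

lemma sroot_cartan:
  assumes x: "sroot x" and y: "sroot y"
  shows "2 * B y x / B x x \<in> \<int>"
proof -
  obtain b where b: "root b" "x = (1 / cc b) *\<^sub>R b" using x sroot_def by blast
  obtain c where c: "root c" "y = (1 / cc c) *\<^sub>R c" using y sroot_def by blast
  have pos: "0 < cc b" "0 < cc c" using cc(1) b c by auto
  have "root (c + (2 * cc b * B c b) *\<^sub>R \<delta>)"
    using translation_root[OF b(1) _ c(1), of "cc b"] root_cc_shift[OF b(1), of 1] by simp
  from cc_shift(2)[OF c(1) this] obtain m where "2 * cc b * B c b = cc c * of_int m" by blast
  moreover have "2 * B y x / B x x = 2 * cc b * B c b / cc c"
    using pos root_norm[OF b(1)] by (simp add: b(2) c(2))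
  ultimately show ?thesis using pos by simp
qed

text \<open>Both Cartan integers are positive and their product is below 4, so one of them is 1 and
  a reflection yields the difference up to sign.\<close>

lemma sroot_diff:
  assumes x: "sroot x" and y: "sroot y" and pos: "0 < B x y" and ne: "hat x \<noteq> hat y"
  shows "sroot (x - y)"
proof -
  define p where "p = 2 * B y x / B x x"
  define q where "q = 2 * B x y / B y y"
  have xx: "0 < B x x" "0 < B y y" using sroot_norm x y by auto
  obtain i j where ij: "p = of_int i" "q = of_int j"
    using sroot_cartan[OF x y] sroot_cartan[OF y x] unfolding p_def q_def by (metis Ints_cases)
  have "0 < p" "0 < q" using pos xx B_sym[of x y] by (auto simp: p_def q_def)
  then have ij1: "1 \<le> i" "1 \<le> j" using ij by auto
  \<comment> \<open>\<open>B z z\<close> is \<open>B x x\<close> times the Gram determinant of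
    \<open>x\<close> and \<open>y\<close>, so Cauchy-Schwarz is strict unless \<open>z\<close> lies
    in the radical.\<close>
  define z where "z = B x x *\<^sub>R y - B x y *\<^sub>R x"
  have zV: "z \<in> V" unfolding z_def by (intro V_diff V_scale sroot_V x y)
  have zz: "B z z = B x x * (B x x * B y y - (B x y)\<^sup>2)"
    by (simp add: z_def B_sym[of y x] algebra_simps power2_eq_square)
  have "B z z \<noteq> 0"
  proof
    assume "B z z = 0"
    then obtain c where "z = c *\<^sub>R \<delta>" using kernel[OF zV] by blast
    then have "(1 / B x x) *\<^sub>R (z + B x y *\<^sub>R x) = (1 / B x x) *\<^sub>R (c *\<^sub>R \<delta> + B x y *\<^sub>R x)" by simp
    then have y_eq: "y = (B x y / B x x) *\<^sub>R x + (c / B x x) *\<^sub>R \<delta>"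
      using xx by (simp add: z_def scaleR_add_right add.commute)
    have "B x y / B x x = 1 \<or> B x y / B x x = - 1" using sroot_parallel(1)[OF x y y_eq] .
    moreover have "0 < B x y / B x x" using pos xx by simp
    ultimately have "B x y / B x x = 1" by linarith
    then have "hat y = hat x" using y_eq by (metis hat_add hat_scale hat_delta scaleR_one scaleR_zero_right add_0_right)
    then show False using ne by simp
  qed
  then have "0 < B z z" using psd[OF zV] by simp
  then have "(B x y)\<^sup>2 < B x x * B y y" unfolding zz using xx by (simp add: zero_less_mult_iff)
  moreover have "p * q = 4 * (B x y)\<^sup>2 / (B x x * B y y)"
    by (simp add: p_def q_def B_sym[of y x] power2_eq_square)
  ultimately have "p * q < 4" using xx by (simp add: divide_less_eq)
  then have "real_of_int (i * j) < of_int 4" using ij by simp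
  then have "i * j < 4" by (simp only: of_int_less_iff)
  moreover have "4 \<le> i * j" if "2 \<le> i" "2 \<le> j" using mult_mono[OF that] that by simp
  ultimately have "i = 1 \<or> j = 1" using ij1 by linarith
  then show ?thesis
  proof
    assume "i = 1"
    then have "sroot (y - x)" using sroot_refl[OF x y] ij by (simp add: p_def)
    then show ?thesis using sroot_minus by fastforce
  next
    assume "j = 1"
    then show ?thesis using sroot_refl[OF y x] ij by (simp add: q_def)
  qed
qed

text \<open>If \<open>B y z < 0\<close>, then \<open>y + z\<close> is itself a rescaled root,
  parallel to the given one. Otherwise the given one minus \<open>y\<close> is a rescaled root
  parallel to \<open>z\<close>. Either way \<open>sroot_parallel\<close> applies.\<close>

lemma sroot_sum_integral:
  assumes y: "sroot y" and z: "sroot z" and yz: "sroot (y + z + k *\<^sub>R \<delta>)"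
  shows "k \<in> \<int>"
proof (cases "B y z < 0")
  case True
  have "hat y \<noteq> hat (- z)"
  proof
    assume "hat y = hat (- z)"
    then have "hat (y + z + k *\<^sub>R \<delta>) = 0" by (simp add: hat_add hat_scale hat_minus)
    then show False using sroot_hat_nonzero[OF yz] by simp
  qed
  then have "sroot (y - (- z))" using True by (intro sroot_diff y sroot_minus z) simp_all
  then have "sroot (y + z)" by simp
  from sroot_parallel(2)[OF this yz, of 1] show ?thesis by simp
next
  case False
  let ?x = "y + z + k *\<^sub>R \<delta>"
  have "0 < B ?x y" using False sroot_norm[OF y] B_sym[of z y] by simp
  moreover have "hat ?x \<noteq> hat y" using sroot_hat_nonzero[OF z] by (simp add: hat_add hat_scale)
  ultimately have s: "sroot (?x - y)" by (intro sroot_diff yz y)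
  have "?x - y = 1 *\<^sub>R z + k *\<^sub>R \<delta>" by simp
  from sroot_parallel(2)[OF z s this] show ?thesis .
qed

text \<open>The spacing depends on the direction of a root only, so rescaling is a function on the
  finite set of directions.\<close>

lemma finite_hat_sroots: "finite (hat ` {x. sroot x})"
proof -
  let ?f = "\<lambda>h. (1 / cc (SOME b. root b \<and> hat b = h)) *\<^sub>R h"
  have "hat x \<in> ?f ` hat ` {b. root b}" if x: "sroot x" for x
  proof -
    obtain b where b: "root b" "x = (1 / cc b) *\<^sub>R b" using x sroot_def by blast
    define b' where "b' = (SOME b'. root b' \<and> hat b' = hat b)"
    have b': "root b' \<and> hat b' = hat b" unfolding b'_def by (rule someI[of _ b]) (simp add: b)
    then obtain k where k: "b' = b + k *\<^sub>R \<delta>" using hat_eq_iff by metis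
    have "cc b' = cc b" using cc_shift(1)[OF b(1)] b' unfolding k by blast
    then have "hat x = ?f (hat b)" unfolding b'_def[symmetric] by (simp add: b(2) hat_scale)
    then show ?thesis using b(1) by blast
  qed
  then have "hat ` {x. sroot x} \<subseteq> ?f ` hat ` {b. root b}" by blast
  then show ?thesis using finite_hat_roots finite_subset by blast
qed

lemma ev_zero [simp]: "ev \<phi> 0 = 0"
  by (simp add: ev_def)

text \<open>Adding \<open>t\<close> times the new vector to a functional that works for the others
  goes wrong for finitely many \<open>t\<close> only.\<close>

lemma generic_functional:
  assumes "finite F" "F \<subseteq> V" "0 \<notin> F"
  shows "\<exists>\<psi>. \<forall>x\<in>F. ev \<psi> x \<noteq> 0"
  using assms
proof (induction F rule: finite_induct)
  case empty
  show ?case by simp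
next
  case (insert x F)
  then obtain \<psi> where psi: "\<forall>y\<in>F. ev \<psi> y \<noteq> 0" by auto
  have "ev x x = N x" by (simp add: ev_def N_def power2_eq_square)
  then have x: "ev x x \<noteq> 0" using N_eq_0[of x] insert.prems by auto
  have "finite (insert (- ev \<psi> x / ev x x) ((\<lambda>y. - ev \<psi> y / ev x y) ` F))" using insert.hyps by simp
  from ex_new_if_finite[OF infinite_UNIV_char_0 this] obtain t :: real where
    t: "t \<notin> insert (- ev \<psi> x / ev x x) ((\<lambda>y. - ev \<psi> y / ev x y) ` F)" by blast
  have e: "ev (\<psi> + t *\<^sub>R x) y = ev \<psi> y + t * ev x y" for y
    by (simp add: ev_def sum.distrib sum_distrib_left algebra_simps)
  have "ev (\<psi> + t *\<^sub>R x) y \<noteq> 0" if y: "y \<in> insert x F" for y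
  proof (cases "ev x y = 0")
    case True
    then show ?thesis using y psi x e by auto
  next
    case False
    then have "t \<noteq> - ev \<psi> y / ev x y" using t y by auto
    then show ?thesis using False unfolding e by (simp add: field_simps)
  qed
  then show ?case by blast
qed

text \<open>The positive and negative parts of a relation are one vector \<open>p = q\<close>.
  Obtuseness gives \<open>B p q \<le> 0\<close>, so it vanishes by definiteness, and evaluating
  \<open>\<psi>\<close> kills each coefficient.\<close>

lemma obtuse_independent:
  assumes fin: "finite D" and supp: "D \<subseteq> supp_on (S - {s1})"
    and obtuse: "\<And>d e. d \<in> D \<Longrightarrow> e \<in> D \<Longrightarrow> d \<noteq> e \<Longrightarrow> B d e \<le> 0"
    and pos: "\<And>d. d \<in> D \<Longrightarrow> 0 < ev \<psi> d"
  shows "independent D"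
proof (rule independent_if_scalars_zero[OF fin])
  fix u x assume sum0: "(\<Sum>d\<in>D. u d *\<^sub>R d) = 0" and x: "x \<in> D"
  have B_sum_l: "B (\<Sum>d\<in>D. f d *\<^sub>R d) y = (\<Sum>d\<in>D. f d * B d y)" for f y
    by (simp add: B_sum_left)
  have B_sum_r: "B y (\<Sum>d\<in>D. f d *\<^sub>R d) = (\<Sum>d\<in>D. f d * B y d)" for f y
    by (simp add: B_sum_right)
  define p where "p = (\<Sum>d\<in>D. max (u d) 0 *\<^sub>R d)"
  define q where "q = (\<Sum>d\<in>D. max (- u d) 0 *\<^sub>R d)"
  have "p - q = (\<Sum>d\<in>D. u d *\<^sub>R d)"
    unfolding p_def q_def sum_subtractf[symmetric] scaleR_left_diff_distrib[symmetric]
    by (intro sum.cong HOL.refl arg_cong2[where f = scaleR]) auto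
  then have pq: "p = q" using sum0 by simp
  have "B p q = (\<Sum>d\<in>D. \<Sum>e\<in>D. max (u d) 0 * (max (- u e) 0 * B d e))"
  proof -
    have "B p q = (\<Sum>d\<in>D. max (u d) 0 * B d q)" unfolding p_def by (rule B_sum_l)
    moreover have "B d q = (\<Sum>e\<in>D. max (- u e) 0 * B d e)" for d unfolding q_def by (rule B_sum_r)
    ultimately show ?thesis by (simp add: sum_distrib_left)
  qed
  also have "\<dots> \<le> 0"
  proof (intro sum_nonpos)
    fix d e assume de: "d \<in> D" "e \<in> D"
    show "max (u d) 0 * (max (- u e) 0 * B d e) \<le> 0"
    proof (cases "d = e")
      case True
      then show ?thesis by (auto simp: max_def)
    next
      case False
      then show ?thesis using obtuse[OF de] by (simp add: mult_nonneg_nonpos)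
    qed
  qed
  finally have "B p p \<le> 0" using pq by simp
  moreover have "p \<in> supp_on (S - {s1})"
    unfolding p_def using fin supp
  proof (induction D rule: finite_induct)
    case empty
    show ?case by (simp add: supp_on_def)
  next
    case (insert d D)
    have "max (u d) 0 *\<^sub>R d \<in> supp_on (S - {s1})" using insert.prems by (auto simp: supp_on_def)
    moreover have "(\<Sum>d\<in>D. max (u d) 0 *\<^sub>R d) \<in> supp_on (S - {s1})" using insert.IH insert.prems by blast
    ultimately have "max (u d) 0 *\<^sub>R d + (\<Sum>d\<in>D. max (u d) 0 *\<^sub>R d) \<in> supp_on (S - {s1})"
      unfolding supp_on_def mem_Collect_eq plus_fun_def by (metis add_0)
    then have "(\<Sum>d\<in>insert d D. max (u d) 0 *\<^sub>R d) \<in> supp_on (S - {s1})"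
      unfolding sum.insert[OF insert.hyps(1,2)] .
    then show ?case .
  qed
  ultimately have p0: "p = 0" using posdef_supp_on[OF S1_proper, of p] by fastforce
  have zero: "max (f d) 0 = 0" if "(\<Sum>d\<in>D. max (f d) 0 *\<^sub>R d) = 0" "d \<in> D" for f d
  proof -
    have "(\<Sum>d\<in>D. max (f d) 0 * ev \<psi> d) = ev \<psi> (\<Sum>d\<in>D. max (f d) 0 *\<^sub>R d)"
      by (simp add: ev_sum ev_scale)
    also have "\<dots> = 0" using that(1) by simp
    finally have s0: "(\<Sum>d\<in>D. max (f d) 0 * ev \<psi> d) = 0" .
    have "\<forall>d\<in>D. 0 \<le> max (f d) 0 * ev \<psi> d" using pos by (simp add: less_imp_le)
    then have "max (f d) 0 * ev \<psi> d = 0" using s0 fin that(2) sum_nonneg_eq_0_iff[of D "\<lambda>d. max (f d) 0 * ev \<psi> d"] by blast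
    then show ?thesis using pos[OF that(2)] by simp
  qed
  have "max (u x) 0 = 0" by (rule zero[of u]) (use p0 x in \<open>simp_all add: p_def\<close>)
  moreover have "max (- u x) 0 = 0" by (rule zero[of "\<lambda>d. - u d"]) (use p0 pq x in \<open>simp_all add: q_def\<close>)
  ultimately show "u x = 0" by (simp add: max_def split: if_splits)
qed

text \<open>A point lying on a reflection hyperplane of every direction: it is chosen on the
  hyperplanes of a base of the finite system of directions.\<close>
lemma special_functional: "\<exists>\<phi>. ev \<phi> \<delta> = 1 \<and> (\<forall>x. sroot x \<longrightarrow> ev \<phi> x \<in> \<int>)"
proof -
  define F where "F = hat ` {x. sroot x}"
  have finF: "finite F" unfolding F_def by (rule finite_hat_sroots)
  have "F \<subseteq> V" unfolding F_def using hat_V sroot_V by blast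
  moreover have "0 \<notin> F" unfolding F_def using sroot_hat_nonzero by (metis imageE mem_Collect_eq)
  ultimately obtain \<psi> where psi: "\<forall>x\<in>F. ev \<psi> x \<noteq> 0" using generic_functional[OF finF] by blast
  \<comment> \<open>The directions positive for the generic \<open>\<psi>\<close>; the
    indecomposable ones among them play the part of a base.\<close>
  define P where "P = {x \<in> F. 0 < ev \<psi> x}"
  define D where "D = {x \<in> P. \<not> (\<exists>y\<in>P. \<exists>z\<in>P. x = y + z)}"
  have DP: "D \<subseteq> P" and PF: "P \<subseteq> F" by (auto simp: D_def P_def)
  have diff: "B x y \<le> 0" if "x \<in> D" "y \<in> D" "x \<noteq> y" for x y
  proof (rule ccontr)
    assume "\<not> B x y \<le> 0"
    have "x \<in> F" "y \<in> F" using that DP PF by blast+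
    then obtain a b where a: "sroot a" "x = hat a" and b: "sroot b" "y = hat b" unfolding F_def by blast
    have "sroot (a - b)" by (rule sroot_diff) (use a b that \<open>\<not> B x y \<le> 0\<close> in auto)
    moreover from this have "sroot (b - a)" using sroot_minus[of "a - b"] by simp
    moreover have "x - y = hat (a - b)" "y - x = hat (b - a)" by (simp_all add: hat_diff a b)
    ultimately have ab: "x - y \<in> F" "y - x \<in> F" unfolding F_def by blast+
    show False
    proof (cases "0 < ev \<psi> (x - y)")
      case True
      then have "x - y \<in> P" using ab by (simp add: P_def)
      moreover have "x = y + (x - y)" by simp
      ultimately show False using that DP unfolding D_def by blast
    next
      case False
      have "ev \<psi> (x - y) \<noteq> 0" using psi ab by blast
      then have "y - x \<in> P" using ab False by (simp add: P_def ev_diff)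
      moreover have "y = x + (y - x)" by simp
      ultimately show False using that DP unfolding D_def by blast
    qed
  qed
  have "D \<subseteq> supp_on (S - {s1})" using DP PF hat_supp sroot_V unfolding F_def by blast
  then have ind: "independent D"
    by (rule obtuse_independent[of D \<psi>, OF finite_subset[OF DP finite_subset[OF PF finF]] _ diff]) (use DP in \<open>auto simp: P_def\<close>)
  define lift where "lift d = (SOME x. sroot x \<and> hat x = d)" for d
  have lift: "sroot (lift d) \<and> hat (lift d) = d" if "d \<in> F" for d
  proof -
    obtain x where "sroot x \<and> hat x = d" using \<open>d \<in> F\<close> F_def by blast
    then show ?thesis unfolding lift_def by (rule someI[of "\<lambda>x. sroot x \<and> hat x = d"])
  qed
  \<comment> \<open>Independence permits a functional that vanishes on one chosen lift of every
    indecomposable direction.\<close>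
  from linear_independent_extend[OF ind, of "\<lambda>d. h0 (lift d)"] obtain g where
    g: "linear g" "\<forall>d\<in>D. g d = h0 (lift d)" by blast
  define f where "f x = h0 x - g (hat x)" for x
  define \<phi> where "\<phi> = (\<lambda>s. f (\<alpha> s))"
  have f_lin: "f (x + y) = f x + f y" "f (c *\<^sub>R x) = c * f x" for x y c
    using linear_add[OF g(1)] linear_cmul[OF g(1)]
    by (simp_all add: f_def h0_add h0_scale hat_add hat_scale right_diff_distrib)
  have ev: "ev \<phi> x = f x" if "x \<in> V" for x unfolding \<phi>_def by (rule ev_linear_ext[OF f_lin that])
  have fd: "f \<delta> = 1" using linear_0[OF g(1)] by (simp add: f_def h0_delta)
  have f_diff: "f (x - y) = f x - f y" for x y using f_lin(1)[of x "- 1 *\<^sub>R y"] f_lin(2)[of "- 1" y] by simp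
  \<comment> \<open>A decomposable direction is a sum of two with smaller \<open>ev \<psi>\<close>,
    and \<open>sroot_sum_integral\<close> shows that the leftover multiple of
    \<open>\<delta>\<close> is integral.\<close>
  have intP: "f x \<in> \<int>" if "sroot x" "hat x \<in> P" for x
    using that
  proof (induction "card {y \<in> P. ev \<psi> y < ev \<psi> (hat x)}" arbitrary: x rule: less_induct)
    case less
    have finP: "finite P" using PF finF finite_subset by blast
    show "f x \<in> \<int>"
    proof (cases "hat x \<in> D")
      case True
      have l: "sroot (lift (hat x))" "hat (lift (hat x)) = hat x" using lift less.prems PF by auto
      obtain k where k: "x = lift (hat x) + k *\<^sub>R \<delta>" using hat_eq_iff l(2) by blast
      have "k \<in> \<int>" using sroot_parallel(2)[OF l(1) less.prems(1), of 1 k] k by simp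
      moreover have "f (lift (hat x)) = 0" using g(2) True l(2) by (simp add: f_def)
      ultimately show ?thesis using f_lin fd k by (metis add_0 mult.right_neutral)
    next
      case False
      then obtain y z where yz: "y \<in> P" "z \<in> P" "hat x = y + z" using less.prems D_def by blast
      have "y \<in> F" "z \<in> F" using yz PF by blast+
      then obtain a b where a: "sroot a" "y = hat a" and b: "sroot b" "z = hat b" unfolding F_def by blast
      have pos: "0 < ev \<psi> y" "0 < ev \<psi> z" using yz by (auto simp: P_def)
      have lt: "ev \<psi> y < ev \<psi> (hat x)" "ev \<psi> z < ev \<psi> (hat x)" using pos by (simp_all add: yz(3) ev_add)
      have smaller: "card {y \<in> P. ev \<psi> y < ev \<psi> w} < card {y \<in> P. ev \<psi> y < ev \<psi> (hat x)}"
        if "w \<in> P" "ev \<psi> w < ev \<psi> (hat x)" for w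
        using that finP by (intro psubset_card_mono) auto
      have "f a \<in> \<int>" using less.hyps[of a] smaller[of y] a yz lt by blast
      moreover have "f b \<in> \<int>" using less.hyps[of b] smaller[of z] b yz lt by blast
      moreover have "hat (a + b) = hat x" using a b yz by (simp add: hat_add)
      then obtain k where k: "x = a + b + k *\<^sub>R \<delta>" using hat_eq_iff by blast
      have "k \<in> \<int>" using sroot_sum_integral[OF a(1) b(1)] less.prems(1) k by blast
      ultimately show ?thesis unfolding k f_lin fd by simp
    qed
  qed
  have "ev \<phi> x \<in> \<int>" if x: "sroot x" for x
  proof (cases "0 < ev \<psi> (hat x)")
    case True
    then have "f x \<in> \<int>" using intP x by (simp add: P_def F_def)
    then show ?thesis using ev sroot_V[OF x] by simp
  next
    case False
    have "hat x \<in> F" using x F_def by blast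
    then have "0 < ev \<psi> (hat (- x))" using psi False by (force simp: hat_minus ev_minus)
    then have "f (- x) \<in> \<int>" using intP[of "- x"] sroot_minus[OF x] by (simp add: P_def F_def)
    moreover have "f (- x) = - f x" using f_lin(2)[of "- 1" x] by simp
    ultimately show ?thesis using ev sroot_V[OF x] by simp
  qed
  then show ?thesis using ev[OF delta_V] fd by auto
qed

section \<open>Integral coordinates and a special node\<close>

definition aa :: "'a \<Rightarrow> ('a \<Rightarrow> real)" where
  "aa s = (1 / cc (\<alpha> s)) *\<^sub>R \<alpha> s"

definition coord :: "('a \<Rightarrow> real) \<Rightarrow> 'a \<Rightarrow> real" where
  "coord x s = x s * cc (\<alpha> s)"

lemma cc_alpha_pos: "s \<in> S \<Longrightarrow> 0 < cc (\<alpha> s)"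
  using cc(1) root_alpha by blast

lemma sroot_aa: "s \<in> S \<Longrightarrow> sroot (aa s)"
  unfolding sroot_def aa_def using root_alpha by blast

lemma coord_aa: "s \<in> S \<Longrightarrow> coord (aa s) t = (if s = t then 1 else 0)"
  using cc_alpha_pos[of s] by (auto simp: coord_def aa_def \<alpha>_def)

lemma coord_add: "coord (x + y) s = coord x s + coord y s" and coord_scale: "coord (c *\<^sub>R x) s = c * coord x s"
  and coord_diff: "coord (x - y) s = coord x s - coord y s" and coord_minus: "coord (- x) s = - coord x s"
  by (simp_all add: coord_def algebra_simps)

text \<open>A simple reflection changes the coordinates by Cartan integers, so they stay integral
  along a word applied to some \<open>aa t\<close>.\<close>

lemma coord_integral:
  assumes "sroot x" "s \<in> S"
  shows "coord x s \<in> \<int>"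
proof -
  have step: "sroot (gact (word_prod W w) (aa t)) \<and> coord (gact (word_prod W w) (aa t)) s \<in> \<int>"
    if "w \<in> lists S" "t \<in> S" for w t
    using that(1)
  proof (induction w)
    case Nil
    then show ?case using sroot_aa that(2) by (simp add: coord_aa)
  next
    case (Cons u w)
    define y where "y = gact (word_prod W w) (aa t)"
    have u: "u \<in> S" and w: "w \<in> lists S" and y: "sroot y" "coord y s \<in> \<int>" using Cons by (auto simp: y_def)
    have eq: "gact (word_prod W (u # w)) (aa t) = gact u y"
      using gact_mult[OF S_carrier[OF u] word_prod_closed[OF w], of "aa t"] by (simp add: y_def)
    have "gact u y = y - (2 * B y (aa u) / B (aa u) (aa u)) *\<^sub>R aa u"
      using cc_alpha_pos[OF u] u by (simp add: gact_S refl_def aa_def B_alpha_self)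
    then have "coord (gact u y) s = coord y s - (2 * B y (aa u) / B (aa u) (aa u)) * coord (aa u) s"
      by (simp add: coord_diff coord_scale)
    moreover have "2 * B y (aa u) / B (aa u) (aa u) \<in> \<int>" using sroot_cartan sroot_aa[OF u] y(1) by blast
    moreover have "coord (aa u) s \<in> \<int>" using u by (simp add: coord_aa)
    ultimately have "coord (gact u y) s \<in> \<int>" using y(2) by (metis Ints_diff Ints_mult)
    then show ?case unfolding eq using sroot_gact[OF y(1)] u S_carrier by blast
  qed
  obtain b where b: "root b" "x = (1 / cc b) *\<^sub>R b" using assms sroot_def by blast
  obtain g t where g: "g \<in> carrier W" "t \<in> S" "b = gact g (\<alpha> t)" using b root_def by blast
  obtain w where w: "w \<in> lists S" "word_prod W w = g" using ex_word[OF g(1)] by blast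
  have "x = gact g (aa t)" using g by (simp add: b(2) aa_def gact_scale cc_gact)
  then show ?thesis using step[OF w(1) g(2)] w by simp
qed

lemma coord_sign:
  assumes "sroot x"
  shows "(\<forall>s\<in>S. 0 \<le> coord x s) \<or> (\<forall>s\<in>S. coord x s \<le> 0)"
proof -
  obtain b where b: "root b" "x = (1 / cc b) *\<^sub>R b" using assms sroot_def by blast
  have c: "0 < cc b" using cc(1) b by blast
  show ?thesis
    using root_sign[OF b(1)]
  proof
    assume "nonneg b"
    then have "\<forall>s\<in>S. 0 \<le> coord x s" using c cc_alpha_pos by (simp add: b(2) coord_def nonneg_def less_imp_le)
    then show ?thesis ..
  next
    assume "nonneg (- b)"
    then have "\<forall>s\<in>S. coord x s \<le> 0" using c cc_alpha_pos
      by (simp add: b(2) coord_def nonneg_def less_imp_le mult_nonpos_nonneg divide_nonpos_pos)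
    then show ?thesis ..
  qed
qed

text \<open>\<open>aa s\<close> and \<open>aa s + \<delta>\<close> are both rescaled roots, so the
  coordinate of \<open>\<delta>\<close> is a difference of integers.\<close>

lemma coord_delta:
  assumes "s \<in> S"
  shows "coord \<delta> s \<in> \<int>" "0 < coord \<delta> s"
proof -
  have "coord (aa s + of_int 1 *\<^sub>R \<delta>) s \<in> \<int>" using coord_integral[OF sroot_shift[OF sroot_aa] assms] assms by blast
  then have "coord (aa s) s + coord \<delta> s \<in> \<int>" by (simp add: coord_add)
  then have "coord (aa s) s + coord \<delta> s - coord (aa s) s \<in> \<int>" using coord_integral[OF sroot_aa[OF assms] assms] Ints_diff by blast
  then show "coord \<delta> s \<in> \<int>" by simp
  show "0 < coord \<delta> s" using delta_pos cc_alpha_pos assms by (simp add: coord_def)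
qed

lemma V_expand_aa: "x \<in> V \<Longrightarrow> x = (\<Sum>s\<in>S. coord x s *\<^sub>R aa s)"
proof -
  assume "x \<in> V"
  have "(\<Sum>s\<in>S. coord x s *\<^sub>R aa s) = (\<Sum>s\<in>S. x s *\<^sub>R \<alpha> s)"
    using cc_alpha_pos by (intro sum.cong HOL.refl) (force simp: coord_def aa_def)
  then show ?thesis using V_expand[OF \<open>x \<in> V\<close>] by simp
qed

text \<open>At a special point moved into the alcove the rescaled simple roots take nonnegative
  integral values \<open>q s\<close>. Evaluating \<open>\<delta>\<close> writes 1 as the sum of the
  terms \<open>coord \<delta> s * q s\<close>, so one of these is 1 times 1.\<close>

lemma special_node: "\<exists>s\<in>S. coord \<delta> s = 1"
proof -
  obtain \<phi> where phi: "ev \<phi> \<delta> = 1" "\<And>x. sroot x \<Longrightarrow> ev \<phi> x \<in> \<int>" using special_functional by blast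
  from move_into_alcove[OF phi(1)] obtain g where g: "g \<in> carrier W" "\<forall>s\<in>S. 0 \<le> ev \<phi> (gact g (\<alpha> s))" by blast
  define q where "q s = ev \<phi> (gact g (aa s))" for s
  have q: "q s \<in> \<int>" "0 \<le> q s" if "s \<in> S" for s
    using that phi(2)[OF sroot_gact[OF sroot_aa g(1)], of s] g(2) cc_alpha_pos[of s]
    by (auto simp: q_def aa_def gact_scale ev_scale less_imp_le)
  have "1 = ev \<phi> (gact g \<delta>)" using phi(1) g by simp
  also have "\<dots> = ev \<phi> (gact g (\<Sum>s\<in>S. coord \<delta> s *\<^sub>R aa s))" using V_expand_aa[OF delta_V] by simp
  also have "\<dots> = (\<Sum>s\<in>S. coord \<delta> s * q s)" unfolding gact_sum ev_sum gact_scale ev_scale q_def ..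
  finally have sum1: "(\<Sum>s\<in>S. coord \<delta> s * q s) = 1" by simp
  then have "\<exists>s\<in>S. q s \<noteq> 0" by (metis (mono_tags, lifting) mult_zero_right sum.neutral zero_neq_one)
  then obtain s where s: "s \<in> S" "q s \<noteq> 0" by blast
  have "coord \<delta> s * q s \<le> 1"
    unfolding sum1[symmetric] using s finite_S q coord_delta by (intro member_le_sum) (auto simp: less_imp_le)
  moreover have ge1: "1 \<le> q s" "1 \<le> coord \<delta> s"
    using q[OF s(1)] s(2) coord_delta[OF s(1)] by (auto elim!: Ints_cases)
  moreover have "coord \<delta> s * 1 \<le> coord \<delta> s * q s" using ge1 by (intro mult_left_mono) auto
  ultimately have "coord \<delta> s = 1" by linarith
  then show ?thesis using s by blast
qed

end

section \<open>Affine reflections as elements of the group of bijections of Euclidean space\<close>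

lemma aff_refl_apply:
  "x \<in> carrier_vec n \<Longrightarrow>
    aff_refl n a k x = x - (2 * (scalar_prod x a - of_int k) / scalar_prod a a) \<cdot>\<^sub>v a"
  by (simp add: aff_refl_def)

lemma aff_refl_closed: "a \<in> carrier_vec n \<Longrightarrow> x \<in> carrier_vec n \<Longrightarrow> aff_refl n a k x \<in> carrier_vec n"
  by (simp add: aff_refl_apply)

lemma scalar_prod_self_pos:
  assumes "(a :: real vec) \<in> carrier_vec n" "a \<noteq> 0\<^sub>v n"
  shows "0 < scalar_prod a a"
proof -
  obtain i where i: "i < n" "a $ i \<noteq> 0" using assms by (metis carrier_vecD eq_vecI index_zero_vec)
  have "0 < (a $ i)\<^sup>2" using i by simp
  also have "\<dots> \<le> (\<Sum>i = 0..<n. (a $ i)\<^sup>2)" using i by (intro member_le_sum) auto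
  also have "\<dots> = scalar_prod a a" using assms by (simp add: scalar_prod_def power2_eq_square)
  finally show ?thesis .
qed

lemma aff_refl_involution:
  assumes "a \<in> carrier_vec n" "a \<noteq> 0\<^sub>v n" "x \<in> carrier_vec n"
  shows "aff_refl n a k (aff_refl n a k x) = x"
proof -
  define q where "q = scalar_prod a a"
  define c where "c = 2 * (scalar_prod x a - of_int k) / q"
  have q: "0 < q" using scalar_prod_self_pos assms by (simp add: q_def)
  have 1: "aff_refl n a k x = x - c \<cdot>\<^sub>v a" using assms by (simp add: aff_refl_apply c_def q_def)
  have "scalar_prod (x - c \<cdot>\<^sub>v a) a = scalar_prod x a - c * q"
    using assms by (simp add: minus_scalar_prod_distrib[of _ n] q_def)
  then have "2 * (scalar_prod (x - c \<cdot>\<^sub>v a) a - of_int k) / q = - c"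
    using q by (simp add: c_def field_simps)
  then have "aff_refl n a k (x - c \<cdot>\<^sub>v a) = (x - c \<cdot>\<^sub>v a) - (- c) \<cdot>\<^sub>v a"
    using assms by (simp add: aff_refl_apply q_def)
  also have "\<dots> = x" using assms by (intro eq_vecI) auto
  finally show ?thesis by (simp add: 1)
qed

lemma aff_refl_Bij:
  assumes "a \<in> carrier_vec n" "a \<noteq> 0\<^sub>v n"
  shows "aff_refl n a k \<in> Bij (carrier_vec n)"
proof -
  have "aff_refl n a k \<in> extensional (carrier_vec n)" by (simp add: aff_refl_def)
  moreover have "bij_betw (aff_refl n a k) (carrier_vec n) (carrier_vec n)"
    by (rule bij_betw_byWitness[where f' = "aff_refl n a k"])
      (use assms in \<open>auto simp: aff_refl_involution aff_refl_closed\<close>)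
  ultimately show ?thesis by (simp add: Bij_def)
qed

lemma carrier_BijGroup [simp]: "carrier (BijGroup X) = Bij X"
  and one_BijGroup: "\<one>\<^bsub>BijGroup X\<^esub> = (\<lambda>x\<in>X. x)"
  by (simp_all add: BijGroup_def)

lemma BijGroup_mult_apply: "g \<in> Bij X \<Longrightarrow> h \<in> Bij X \<Longrightarrow> x \<in> X \<Longrightarrow> (g \<otimes>\<^bsub>BijGroup X\<^esub> h) x = g (h x)"
  by (simp add: BijGroup_def compose_eq)

lemma Bij_eqI: "g \<in> Bij X \<Longrightarrow> h \<in> Bij X \<Longrightarrow> (\<And>x. x \<in> X \<Longrightarrow> g x = h x) \<Longrightarrow> g = h"
  by (auto simp: Bij_def intro: extensionalityI)

lemma Bij_apply: "g \<in> Bij X \<Longrightarrow> x \<in> X \<Longrightarrow> g x \<in> X"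
  using Bij_imp_funcset by blast

lemma vec_basisI:
  fixes D :: "real vec set"
  assumes D: "D \<subseteq> carrier_vec n" "finite D" "card D \<le> n"
    and gen: "\<And>p. p \<in> carrier_vec n \<Longrightarrow> \<exists>c. p = LinearCombinations.module.lincomb (module_vec TYPE(real) n) c D"
  shows "vectorspace.basis class_ring (module_vec TYPE(real) n) D"
    "D \<subseteq> R \<Longrightarrow> R \<subseteq> carrier_vec n \<Longrightarrow>
      LinearCombinations.module.span class_ring (module_vec TYPE(real) n) R = carrier_vec n"
proof -
  interpret VS: vec_space "TYPE(real)" n .
  have span_R: "VS.span R = carrier_vec n" if "D \<subseteq> R" "R \<subseteq> carrier_vec n" for R
  proof
    show "VS.span R \<subseteq> carrier_vec n" using that(2) by (rule VS.span_is_subset2)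
    show "carrier_vec n \<subseteq> VS.span R"
    proof
      fix p :: "real vec" assume "p \<in> carrier_vec n"
      then obtain c where "p = VS.lincomb c D" using gen by blast
      then show "p \<in> VS.span R" unfolding VS.span_def using D(2) that(1) by auto
    qed
  qed
  then show "D \<subseteq> R \<Longrightarrow> R \<subseteq> carrier_vec n \<Longrightarrow>
      LinearCombinations.module.span class_ring (module_vec TYPE(real) n) R = carrier_vec n" .
  show "vectorspace.basis class_ring (module_vec TYPE(real) n) D"
    by (rule VS.dim_gen_is_basis) (use D span_R[OF subset_refl D(1)] in \<open>auto simp: VS.dim_is_n\<close>)
qed

context coxeter_system
begin

lemma supp_on_add: "x \<in> supp_on I \<Longrightarrow> y \<in> supp_on I \<Longrightarrow> x + y \<in> supp_on I"
  and supp_on_diff: "x \<in> supp_on I \<Longrightarrow> y \<in> supp_on I \<Longrightarrow> x - y \<in> supp_on I"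
  and supp_on_scale: "x \<in> supp_on I \<Longrightarrow> c *\<^sub>R x \<in> supp_on I"
  and supp_on_zero: "0 \<in> supp_on I"
  by (simp_all add: supp_on_def)

lemma supp_on_sum: "(\<And>i. i \<in> A \<Longrightarrow> f i \<in> supp_on I) \<Longrightarrow> sum f A \<in> supp_on I"
proof (induction A rule: infinite_finite_induct)
  case (insert i A)
  then have "f i + sum f A \<in> supp_on I" by (intro supp_on_add) auto
  then have "sum f (insert i A) \<in> supp_on I" unfolding sum.insert[OF insert.hyps(1,2)] .
  then show ?case .
next
  case (infinite A)
  then have "sum f A \<in> supp_on I" using supp_on_zero by simp
  then show ?case .
next
  case empty
  have "sum f {} \<in> supp_on I" using supp_on_zero by simp
  then show ?case .
qed

definition orthonormal_on :: "'w set \<Rightarrow> (nat \<Rightarrow> 'w \<Rightarrow> real) \<Rightarrow> bool" where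
  "orthonormal_on I e \<longleftrightarrow> (\<forall>i<card I. e i \<in> supp_on I) \<and>
    (\<forall>i<card I. \<forall>j<card I. B (e i) (e j) = (if i = j then 1 else 0)) \<and>
    (\<forall>x\<in>supp_on I. x = (\<Sum>i<card I. B x (e i) *\<^sub>R e i))"

text \<open>Gram-Schmidt for \<open>B\<close>, one node at a time; numbering by
  \<open>card I\<close> makes the frame usable as coordinates of vectors.\<close>

lemma ex_orthonormal_on:
  assumes "finite I" "I \<subseteq> S" "\<And>x. x \<in> supp_on I \<Longrightarrow> x \<noteq> 0 \<Longrightarrow> 0 < B x x"
  shows "\<exists>e. orthonormal_on I e"
  using assms
proof (induction I rule: finite_induct)
  case empty
  have "x = (\<Sum>i<card {}. B x (e i) *\<^sub>R e i)" if "x \<in> supp_on {}" for x :: "'w \<Rightarrow> real" and e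
    using that by (auto simp: supp_on_def)
  then show ?case by (simp add: orthonormal_on_def)
next
  case (insert s I)
  have mono: "x \<in> supp_on (insert s I)" if "x \<in> supp_on I" for x using that by (auto simp: supp_on_def)
  obtain e where "orthonormal_on I e" using insert.IH insert.prems mono by auto
  then have e: "\<And>i. i < card I \<Longrightarrow> e i \<in> supp_on I"
    "\<And>i j. i < card I \<Longrightarrow> j < card I \<Longrightarrow> B (e i) (e j) = (if i = j then 1 else 0)"
    "\<And>x. x \<in> supp_on I \<Longrightarrow> x = (\<Sum>i<card I. B x (e i) *\<^sub>R e i)"
    unfolding orthonormal_on_def by blast+
  define n where "n = card I"
  define y where "y = (\<Sum>i<n. B (\<alpha> s) (e i) *\<^sub>R e i)"
  define z where "z = \<alpha> s - y"
  have y: "y \<in> supp_on I" unfolding y_def by (intro supp_on_sum supp_on_scale e(1)) (simp add: n_def)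
  then have "y s = 0" using insert.hyps(2) by (simp add: supp_on_def)
  then have zs: "z s = 1" by (simp add: z_def \<alpha>_def)
  have "\<alpha> s \<in> supp_on (insert s I)" by (auto simp: supp_on_def \<alpha>_def)
  then have z: "z \<in> supp_on (insert s I)" unfolding z_def by (rule supp_on_diff[OF _ mono[OF y]])
  have zz: "0 < B z z" by (rule insert.prems(2)[OF z]) (use zs in auto)
  have ze: "B z (e j) = 0" if "j < n" for j
  proof -
    have "B y (e j) = (\<Sum>i<n. B (\<alpha> s) (e i) * B (e i) (e j))" by (simp add: y_def B_sum_left)
    also have "\<dots> = (\<Sum>i<n. if i = j then B (\<alpha> s) (e i) else 0)"
      using that by (intro sum.cong) (auto simp: e(2) n_def)
    finally show ?thesis using that by (simp add: z_def)
  qed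
  define r where "r = 1 / sqrt (B z z)"
  have r: "r * (r * B z z) = 1" "r * r = 1 / B z z" using zz by (simp_all add: r_def field_simps)
  define e' where "e' = e(n := r *\<^sub>R z)"
  have card: "card (insert s I) = Suc n" using insert.hyps by (simp add: n_def)
  have "orthonormal_on (insert s I) e'"
    unfolding orthonormal_on_def card
  proof (intro conjI allI impI ballI)
    show "e' i \<in> supp_on (insert s I)" if "i < Suc n" for i
      using that e(1)[of i] mono supp_on_scale[OF z] by (auto simp: e'_def n_def less_Suc_eq)
    show "B (e' i) (e' j) = (if i = j then 1 else 0)" if "i < Suc n" "j < Suc n" for i j
      using that e(2)[of i j] ze r(1) B_sym[of "e i" z] by (auto simp: e'_def n_def less_Suc_eq)
    fix x assume x: "x \<in> supp_on (insert s I)"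
    define w where "w = x - x s *\<^sub>R z"
    have "w s = 0" by (simp add: w_def zs)
    moreover have "w \<in> supp_on (insert s I)" unfolding w_def by (intro supp_on_diff supp_on_scale x z)
    ultimately have w: "w \<in> supp_on I" by (auto simp: supp_on_def)
    have we: "B w (e i) = B x (e i)" if "i < n" for i using ze[OF that] by (simp add: w_def)
    have w_eq: "w = (\<Sum>i<n. B x (e i) *\<^sub>R e i)"
      using e(3)[OF w] we unfolding n_def by (metis (no_types, lifting) lessThan_iff sum.cong)
    have "B w z = (\<Sum>i<n. B x (e i) * B (e i) z)" by (subst w_eq) (simp add: B_sum_left)
    also have "\<dots> = 0" using ze B_sym by (intro sum.neutral) (metis lessThan_iff mult_zero_right)
    finally have "B x z = x s * B z z" by (simp add: w_def)
    then have last: "B x (r *\<^sub>R z) *\<^sub>R (r *\<^sub>R z) = x s *\<^sub>R z"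
    proof -
      have "r * (x s * B z z) * r = x s" using r(1) by (simp add: mult_ac)
      then show ?thesis using \<open>B x z = x s * B z z\<close> by (simp del: scaleR_fun_apply)
    qed
    have "(\<Sum>i<Suc n. B x (e' i) *\<^sub>R e' i) = (\<Sum>i<n. B x (e' i) *\<^sub>R e' i) + B x (e' n) *\<^sub>R e' n"
      by (rule sum.lessThan_Suc)
    also have "(\<Sum>i<n. B x (e' i) *\<^sub>R e' i) = w"
      unfolding w_eq by (intro sum.cong) (auto simp: e'_def)
    also have "B x (e' n) *\<^sub>R e' n = x s *\<^sub>R z" using last by (simp add: e'_def)
    also have "w + x s *\<^sub>R z = x" by (simp add: w_def)
    finally show "x = (\<Sum>i<Suc n. B x (e' i) *\<^sub>R e' i)" ..
  qed
  then show ?case by blast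
qed

end

text \<open>\<open>s0\<close> is the affine node. Its coefficient one in \<open>\<delta>\<close>
  makes clearing the \<open>s0\<close>-coordinate an integral shift, so that the finite root system
  has the remaining nodes as a base.\<close>

locale special_affine_coxeter = affine_coxeter +
  fixes s0
  assumes s0: "s0 \<in> S" and coord_delta_s0: "coord \<delta> s0 = 1"
begin

abbreviation "I0 \<equiv> S - {s0}"

definition "dm = card I0"

definition "frame = (SOME e. orthonormal_on I0 e)"

lemma I0_proper: "I0 \<subset> S"
  using s0 by blast

lemma frame: "orthonormal_on I0 frame"
proof -
  have "\<exists>e. orthonormal_on I0 e"
    using finite_S posdef_supp_on[OF I0_proper] by (intro ex_orthonormal_on) auto
  then show ?thesis unfolding frame_def by (rule someI_ex)
qed

lemma frame_supp: "i < dm \<Longrightarrow> frame i \<in> supp_on I0"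
  and frame_B: "i < dm \<Longrightarrow> j < dm \<Longrightarrow> B (frame i) (frame j) = (if i = j then 1 else 0)"
  and frame_expand: "x \<in> supp_on I0 \<Longrightarrow> x = (\<Sum>i<dm. B x (frame i) *\<^sub>R frame i)"
  using frame unfolding orthonormal_on_def dm_def by blast+

lemma supp_I0_V: "x \<in> supp_on I0 \<Longrightarrow> x \<in> V"
  by (simp add: supp_on_def V_def)

lemma frame_V: "i < dm \<Longrightarrow> frame i \<in> V"
  using frame_supp supp_I0_V by blast

lemma frame_coord: "i < dm \<Longrightarrow> coord (frame i) s0 = 0"
  using frame_supp by (simp add: coord_def supp_on_def)

definition "flat x = x - coord x s0 *\<^sub>R \<delta>"

lemma flat_supp: "x \<in> V \<Longrightarrow> flat x \<in> supp_on I0"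
proof -
  assume x: "x \<in> V"
  have "coord (flat x) s0 = 0" by (simp add: flat_def coord_diff coord_scale coord_delta_s0)
  then have "flat x s0 = 0" using cc_alpha_pos[OF s0] by (simp add: coord_def)
  moreover have "flat x \<in> V" unfolding flat_def by (intro V_diff V_scale x delta_V)
  ultimately show ?thesis by (auto simp: supp_on_def V_def)
qed

lemma B_flat [simp]: "B (flat x) y = B x y" "B x (flat y) = B x y"
  by (simp_all add: flat_def)

lemma flat_expand: "x \<in> V \<Longrightarrow> flat x = (\<Sum>i<dm. B x (frame i) *\<^sub>R frame i)"
  using frame_expand[OF flat_supp] by simp

text \<open>\<open>prj\<close> and \<open>emb\<close> identify \<open>V\<close> modulo
  \<open>\<delta>\<close> with Euclidean space, turning \<open>B\<close> into the scalar
  product.\<close>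

definition prj :: "('a \<Rightarrow> real) \<Rightarrow> real vec" where
  "prj x = vec dm (\<lambda>i. B x (frame i))"

definition emb :: "real vec \<Rightarrow> ('a \<Rightarrow> real)" where
  "emb p = (\<Sum>i<dm. p $ i *\<^sub>R frame i)"

lemma prj_carrier [simp]: "prj x \<in> carrier_vec dm" "dim_vec (prj x) = dm"
  and prj_index [simp]: "i < dm \<Longrightarrow> prj x $ i = B x (frame i)"
  by (simp_all add: prj_def)

lemma prj_diff: "prj (x - y) = prj x - prj y"
  and prj_scale: "prj (c *\<^sub>R x) = c \<cdot>\<^sub>v prj x" and prj_delta: "prj \<delta> = 0\<^sub>v dm"
  by (rule eq_vecI; simp)+

lemma emb_supp: "emb p \<in> supp_on I0"
  unfolding emb_def by (intro supp_on_sum supp_on_scale frame_supp) simp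

lemma emb_V: "emb p \<in> V"
  using emb_supp supp_I0_V by blast

lemma emb_prj: "x \<in> V \<Longrightarrow> emb (prj x) = flat x"
  unfolding flat_expand emb_def by (intro sum.cong) auto

lemma B_emb: "B (emb p) x = (\<Sum>i<dm. p $ i * B (frame i) x)"
  by (simp add: emb_def B_sum_left)

lemma B_emb_frame:
  assumes "i < dm"
  shows "B (emb p) (frame i) = p $ i"
proof -
  have "B (emb p) (frame i) = (\<Sum>j<dm. if j = i then p $ j else 0)"
    unfolding B_emb using assms by (intro sum.cong) (auto simp: frame_B)
  then show ?thesis using assms by simp
qed

lemma prj_emb: "p \<in> carrier_vec dm \<Longrightarrow> prj (emb p) = p"
  by (rule eq_vecI) (auto simp: B_emb_frame)

lemma scalar_prod_prj: "p \<in> carrier_vec dm \<Longrightarrow> scalar_prod p (prj x) = B (emb p) x"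
  by (simp add: scalar_prod_def B_emb lessThan_atLeast0 B_sym[of x])

lemma scalar_prod_prj_prj: "x \<in> V \<Longrightarrow> scalar_prod (prj x) (prj y) = B x y"
  by (simp add: scalar_prod_prj emb_prj)

lemma prj_eq_imp: "x \<in> V \<Longrightarrow> y \<in> V \<Longrightarrow> prj x = prj y \<Longrightarrow> flat x = flat y"
  using emb_prj by metis

definition "roots = prj ` {x. sroot x}"
definition "simples = (\<lambda>s. prj (aa s)) ` I0"
text \<open>As \<open>prj\<close> kills \<open>\<delta>\<close>, this is the image of
  \<open>\<delta> - aa s0\<close>, a combination of the other simple roots.\<close>

definition "highest = prj (- aa s0)"

lemma prj_shift: "prj (x + c *\<^sub>R \<delta>) = prj x"
  by (rule eq_vecI) auto

lemma finite_roots: "finite roots"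
proof -
  have "prj x = prj (hat x)" for x by (rule eq_vecI) auto
  then have "roots \<subseteq> prj ` hat ` {x. sroot x}" unfolding roots_def by auto
  then show ?thesis using finite_hat_sroots finite_subset by blast
qed

lemma scalar_prod_root_pos: "sroot x \<Longrightarrow> 0 < scalar_prod (prj x) (prj x)"
  using sroot_norm sroot_V by (simp add: scalar_prod_prj_prj)

lemma aff_refl_prj:
  assumes "x \<in> V" "y \<in> V"
  shows "aff_refl dm (prj x) 0 (prj y) = prj (y - (2 * B y x / B x x) *\<^sub>R x)"
  using assms by (simp add: aff_refl_apply scalar_prod_prj_prj prj_diff prj_scale)

lemma inj_prj_aa: "inj_on (\<lambda>s. prj (aa s)) I0"
proof (rule inj_onI)
  fix s t assume st: "s \<in> I0" "t \<in> I0" "prj (aa s) = prj (aa t)"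
  have c: "coord (aa s) s0 = 0" "coord (aa t) s0 = 0" using st by (auto simp: coord_aa)
  have "flat (aa s) = flat (aa t)" using st sroot_V sroot_aa by (intro prj_eq_imp) auto
  then have "aa s = aa t" using c by (simp add: flat_def)
  then have "coord (aa t) s = 1" using coord_aa[of s s] st by simp
  then show "s = t" using coord_aa[of t s] st by (auto split: if_splits)
qed

lemma simples_carrier: "simples \<subseteq> carrier_vec dm" and simples_roots: "simples \<subseteq> roots"
  and finite_simples: "finite simples"
  using sroot_aa finite_S by (auto simp: simples_def roots_def)

lemma card_simples: "card simples = dm"
  unfolding simples_def dm_def by (rule card_image[OF inj_prj_aa])

lemma lincomb_simples:
  assumes "\<And>s. s \<in> I0 \<Longrightarrow> c (prj (aa s)) = g s"
  shows "LinearCombinations.module.lincomb (module_vec TYPE(real) dm) c simples = prj (\<Sum>s\<in>I0. g s *\<^sub>R aa s)"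
proof -
  interpret VS: vec_space "TYPE(real)" dm .
  show ?thesis
  proof (rule eq_vecI)
    show "dim_vec (VS.lincomb c simples) = dim_vec (prj (\<Sum>s\<in>I0. g s *\<^sub>R aa s))"
      using VS.lincomb_dim[OF finite_simples simples_carrier] by simp
    fix i assume "i < dim_vec (prj (\<Sum>s\<in>I0. g s *\<^sub>R aa s))"
    then have i: "i < dm" by simp
    have "VS.lincomb c simples $ i = (\<Sum>p\<in>simples. c p * p $ i)" by (rule VS.lincomb_index[OF i simples_carrier])
    also have "\<dots> = (\<Sum>s\<in>I0. g s * B (aa s) (frame i))"
      unfolding simples_def using assms i by (subst sum.reindex[OF inj_prj_aa]) (intro sum.cong, auto)
    also have "\<dots> = prj (\<Sum>s\<in>I0. g s *\<^sub>R aa s) $ i" using i by (simp add: B_sum_left)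
    finally show "VS.lincomb c simples $ i = prj (\<Sum>s\<in>I0. g s *\<^sub>R aa s) $ i" .
  qed
qed

definition "node = inv_into I0 (\<lambda>s. prj (aa s))"

lemma node: "s \<in> I0 \<Longrightarrow> node (prj (aa s)) = s"
  unfolding node_def by (rule inv_into_f_f[OF inj_prj_aa])

lemma prj_expand:
  assumes x: "x \<in> V" "coord x s0 = 0"
  shows "LinearCombinations.module.lincomb (module_vec TYPE(real) dm) (\<lambda>p. coord x (node p)) simples = prj x"
proof -
  have "x = (\<Sum>s\<in>S. coord x s *\<^sub>R aa s)" by (rule V_expand_aa[OF x(1)])
  also have "\<dots> = coord x s0 *\<^sub>R aa s0 + (\<Sum>s\<in>I0. coord x s *\<^sub>R aa s)" by (rule sum.remove[OF finite_S s0])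
  finally have "x = (\<Sum>s\<in>I0. coord x s *\<^sub>R aa s)" using x(2) by simp
  then show ?thesis using lincomb_simples[of "\<lambda>p. coord x (node p)" "coord x"] node by simp
qed

lemma prj_flat: "prj (flat x) = prj x"
  by (rule eq_vecI) auto

lemma coord_flat: "coord (flat x) s0 = 0"
  by (simp add: flat_def coord_diff coord_scale coord_delta_s0)

lemma gen_simples:
  assumes "p \<in> carrier_vec dm"
  shows "\<exists>c. p = LinearCombinations.module.lincomb (module_vec TYPE(real) dm) c simples"
proof -
  have "coord (emb p) s0 = 0" using emb_supp[of p] by (simp add: coord_def supp_on_def)
  from prj_expand[OF emb_V this] show ?thesis using prj_emb[OF assms] by metis
qed

lemma roots_carrier: "roots \<subseteq> carrier_vec dm"
  by (auto simp: roots_def)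

lemma roots_scale:
  assumes "a \<in> roots"
  shows "c \<cdot>\<^sub>v a \<in> roots \<longleftrightarrow> c = 1 \<or> c = - 1"
proof -
  obtain x where x: "sroot x" "a = prj x" using assms roots_def by auto
  show ?thesis
  proof
    assume "c \<cdot>\<^sub>v a \<in> roots"
    then obtain y where y: "sroot y" "c \<cdot>\<^sub>v a = prj y" using roots_def by auto
    have "prj y = prj (c *\<^sub>R x)" using x y by (simp add: prj_scale)
    then have fl: "flat y = flat (c *\<^sub>R x)" using prj_eq_imp sroot_V V_scale x y by blast
    have "y = flat y + coord y s0 *\<^sub>R \<delta>" by (simp add: flat_def)
    also have "\<dots> = c *\<^sub>R x + (coord y s0 - coord (c *\<^sub>R x) s0) *\<^sub>R \<delta>"
      unfolding fl by (simp add: flat_def scaleR_left_diff_distrib)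
    finally show "c = 1 \<or> c = - 1" by (rule sroot_parallel(1)[OF x(1) y(1)])
  next
    assume "c = 1 \<or> c = - 1"
    then have "c \<cdot>\<^sub>v a = prj (c *\<^sub>R x)" "sroot (c *\<^sub>R x)" using x sroot_minus by (auto simp: prj_scale)
    then show "c \<cdot>\<^sub>v a \<in> roots" unfolding roots_def by blast
  qed
qed

lemma roots_root_system: "root_system dm roots"
  unfolding root_system_def
proof (intro conjI ballI allI)
  show "finite roots" by (rule finite_roots)
  show "roots \<subseteq> carrier_vec dm" by (rule roots_carrier)
  show "0\<^sub>v dm \<notin> roots"
  proof
    assume "0\<^sub>v dm \<in> roots"
    then obtain x where x: "sroot x" "prj x = 0\<^sub>v dm" unfolding roots_def by force
    show False using scalar_prod_root_pos[OF x(1)] unfolding x(2) by simp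
  qed
  show "LinearCombinations.module.span class_ring (module_vec TYPE(real) dm) roots = carrier_vec dm"
    by (rule vec_basisI(2)[OF simples_carrier finite_simples _ gen_simples simples_roots roots_carrier])
      (simp add: card_simples)
  show "c \<cdot>\<^sub>v a \<in> roots \<longleftrightarrow> c = 1 \<or> c = - 1" if "a \<in> roots" for a c using roots_scale[OF that] .
  fix a b assume "a \<in> roots" "b \<in> roots"
  then obtain x y where x: "sroot x" "a = prj x" and y: "sroot y" "b = prj y" unfolding roots_def by blast
  show "aff_refl dm a 0 b \<in> roots"
    using sroot_refl[OF x(1) y(1)] sroot_V x y by (auto simp: aff_refl_prj roots_def)
  show "2 * scalar_prod b a / scalar_prod a a \<in> \<int>"
    using sroot_cartan[OF x(1) y(1)] sroot_V x y by (simp add: scalar_prod_prj_prj)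
qed

text \<open>Neighbours in the Coxeter graph are not orthogonal, so the part containing one simple
  direction contains all of them, and a root in the other part would be orthogonal to
  everything.\<close>

lemma roots_connected:
  assumes AB: "A \<union> C = roots" "\<And>a c. a \<in> A \<Longrightarrow> c \<in> C \<Longrightarrow> scalar_prod a c = 0" and A: "prj (aa s0) \<in> A"
  shows "C = {}"
proof (rule ccontr)
  assume "C \<noteq> {}"
  then obtain c where c: "c \<in> C" by blast
  then obtain x where x: "sroot x" "c = prj x" using AB(1) unfolding roots_def by blast
  have all: "prj (aa s) \<in> A" if "s \<in> S" for s
  proof (rule connected_induct[of s0 "\<lambda>s. prj (aa s) \<in> A"])
    fix s t assume st: "s \<in> S" "t \<in> S" "bcoef s t < 0" "prj (aa s) \<in> A"
    have "prj (aa t) \<in> roots" using sroot_aa[OF st(2)] by (auto simp: roots_def)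
    moreover have "scalar_prod (prj (aa s)) (prj (aa t)) = bcoef s t / (cc (\<alpha> s) * cc (\<alpha> t))"
      using st sroot_V[OF sroot_aa] by (simp add: scalar_prod_prj_prj aa_def B_alpha)
    then have "scalar_prod (prj (aa s)) (prj (aa t)) \<noteq> 0"
      using st cc_alpha_pos[OF st(1)] cc_alpha_pos[OF st(2)] by simp
    ultimately show "prj (aa t) \<in> A" using AB st(4) by blast
  qed (use s0 A that in auto)
  have "B (aa s) x = 0" if "s \<in> S" for s
    using AB(2)[OF all[OF that] c] sroot_V[OF sroot_aa[OF that]] by (simp add: x scalar_prod_prj_prj)
  then have "B (\<alpha> s) x = 0" if "s \<in> S" for s using that cc_alpha_pos[OF that] by (force simp: aa_def)
  then have "B x x = 0" by (subst B_expand_left) simp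
  then show False using sroot_norm[OF x(1)] by simp
qed

lemma roots_irreducible: "irreducible_root_system dm roots"
  unfolding irreducible_root_system_def
proof (intro conjI notI)
  have r: "prj (aa s0) \<in> roots" using sroot_aa[OF s0] by (auto simp: roots_def)
  show "root_system dm roots" by (rule roots_root_system)
  show "roots = {} \<Longrightarrow> False" using r by simp
  assume "\<exists>A C. A \<noteq> {} \<and> C \<noteq> {} \<and> A \<union> C = roots \<and> (\<forall>a\<in>A. \<forall>c\<in>C. scalar_prod a c = 0)"
  then obtain A C where "A \<noteq> {} \<and> C \<noteq> {} \<and> A \<union> C = roots \<and> (\<forall>a\<in>A. \<forall>c\<in>C. scalar_prod a c = 0)"
    by (elim exE)
  then have AC: "A \<noteq> {}" "C \<noteq> {}" "A \<union> C = roots" "\<And>a c. a \<in> A \<Longrightarrow> c \<in> C \<Longrightarrow> scalar_prod a c = 0"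
    by simp_all
  have CA: "C \<union> A = roots" using AC(3) by blast
  have orth: "scalar_prod a c = 0" if ac: "a \<in> C" "c \<in> A" for a c
  proof -
    have "a \<in> carrier_vec dm" "c \<in> carrier_vec dm" using ac AC(3) roots_carrier by blast+
    then show ?thesis using AC(4)[OF ac(2,1)] comm_scalar_prod[of a dm c] by simp
  qed
  have "prj (aa s0) \<in> A \<or> prj (aa s0) \<in> C" using r unfolding AC(3)[symmetric] by blast
  then show False
  proof
    assume "prj (aa s0) \<in> A"
    from roots_connected[OF AC(3,4) this] AC(2) show False by simp
  next
    assume "prj (aa s0) \<in> C"
    from roots_connected[OF CA orth this] AC(1) show False by simp
  qed
qed

text \<open>The \<open>s0\<close>-coordinate is an integer and \<open>\<delta>\<close> has
  coefficient one there, so \<open>flat\<close> shifts by an integral multiple of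
  \<open>\<delta>\<close>.\<close>

lemma sroot_flat: "sroot x \<Longrightarrow> sroot (flat x)"
proof -
  assume x: "sroot x"
  then obtain m where "coord x s0 = of_int m" using coord_integral s0 by (metis Ints_cases)
  then have "flat x = x + of_int (- m) *\<^sub>R \<delta>" by (simp add: flat_def)
  then show ?thesis using sroot_shift[OF x, of "- m"] by simp
qed

lemma node_I0: "p \<in> simples \<Longrightarrow> node p \<in> I0"
  unfolding simples_def using node by auto

lemma lincomb_cong_simples:
  "(\<And>p. p \<in> simples \<Longrightarrow> c p = d p) \<Longrightarrow>
    LinearCombinations.module.lincomb (module_vec TYPE(real) dm) c simples =
    LinearCombinations.module.lincomb (module_vec TYPE(real) dm) d simples"
  using lincomb_simples[of c "\<lambda>s. d (prj (aa s))"] lincomb_simples[of d "\<lambda>s. d (prj (aa s))"]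
  by (simp add: simples_def)

lemma simples_simple_roots: "simple_roots dm roots simples"
  unfolding simple_roots_def
proof (intro conjI ballI)
  show "simples \<subseteq> roots" by (rule simples_roots)
  show "vectorspace.basis class_ring (module_vec TYPE(real) dm) simples"
    by (rule vec_basisI(1)[OF simples_carrier finite_simples _ gen_simples]) (simp add: card_simples)
  fix b assume "b \<in> roots"
  then obtain x where x: "sroot x" "b = prj x" unfolding roots_def by blast
  define y where "y = flat x"
  have y: "sroot y" "b = prj y" "coord y s0 = 0"
    using x sroot_flat prj_flat coord_flat by (simp_all add: y_def)
  define c where "c p = \<lfloor>coord y (node p)\<rfloor>" for p
  have c: "of_int (c p) = coord y (node p)" if "p \<in> simples" for p
    using coord_integral[OF y(1), of "node p"] node_I0[OF that] by (auto simp: c_def elim!: Ints_cases)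
  have "b = LinearCombinations.module.lincomb (module_vec TYPE(real) dm) (\<lambda>p. of_int (c p)) simples"
    using lincomb_cong_simples[of "\<lambda>p. of_int (c p)" "\<lambda>p. coord y (node p)"] c
      prj_expand[OF sroot_V[OF y(1)] y(3)] y(2) by simp
  moreover have "(\<forall>p\<in>simples. 0 \<le> c p) \<or> (\<forall>p\<in>simples. c p \<le> 0)"
    using coord_sign[OF y(1)]
  proof
    assume "\<forall>s\<in>S. 0 \<le> coord y s"
    then have "\<forall>p\<in>simples. 0 \<le> c p" using node_I0 by (auto simp: c_def)
    then show ?thesis ..
  next
    assume "\<forall>s\<in>S. coord y s \<le> 0"
    then have "\<forall>p\<in>simples. (of_int (c p) :: real) \<le> 0" using node_I0 c by auto
    then show ?thesis by simp
  qed
  ultimately show "\<exists>c :: real vec \<Rightarrow> int. ((\<forall>a\<in>simples. 0 \<le> c a) \<or> (\<forall>a\<in>simples. c a \<le> 0)) \<and>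
      b = LinearCombinations.module.lincomb (module_vec TYPE(real) dm) (\<lambda>a. of_int (c a)) simples"
    by blast
qed

text \<open>\<open>\<delta> - flat x\<close> is a rescaled root with \<open>s0\<close>-coordinate 1,
  hence all its coordinates are nonnegative. Taking away \<open>aa s0\<close> leaves a vector on the
  other nodes that projects to the highest root minus the given one.\<close>

lemma highest_highest: "highest_root dm roots simples highest"
  unfolding highest_root_def
proof (intro conjI ballI)
  show "highest \<in> roots" using sroot_minus[OF sroot_aa[OF s0]] by (auto simp: highest_def roots_def)
  fix b assume "b \<in> roots"
  then obtain x where x: "sroot x" "b = prj x" unfolding roots_def by blast
  define y where "y = \<delta> - flat x"
  have "y = - flat x + of_int 1 *\<^sub>R \<delta>" by (simp add: y_def)
  then have y: "sroot y" using sroot_shift[OF sroot_minus[OF sroot_flat[OF x(1)]], of 1] by simp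
  have "coord y s0 = 1" by (simp add: y_def coord_diff coord_delta_s0 coord_flat)
  then have y_nonneg: "0 \<le> coord y s" if "s \<in> S" for s using coord_sign[OF y] s0 that by force
  define z where "z = y - aa s0"
  have z: "z \<in> V" "coord z s0 = 0"
    using sroot_V[OF y] sroot_V[OF sroot_aa[OF s0]] \<open>coord y s0 = 1\<close> s0
    by (simp_all add: z_def V_diff coord_diff coord_aa)
  have zc: "coord z s = coord y s" if "s \<in> I0" for s using that s0 by (auto simp: z_def coord_diff coord_aa)
  define c where "c p = nat \<lfloor>coord z (node p)\<rfloor>" for p
  have c: "of_nat (c p) = coord z (node p)" if "p \<in> simples" for p
    using coord_integral[OF y, of "node p"] node_I0[OF that] zc[of "node p"] y_nonneg[of "node p"]
    by (auto simp: c_def elim!: Ints_cases)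
  have "highest - b = prj z"
    unfolding highest_def x(2) z_def y_def by (rule eq_vecI) (auto simp: prj_flat)
  then have "highest - b = LinearCombinations.module.lincomb (module_vec TYPE(real) dm) (\<lambda>p. of_nat (c p)) simples"
    using lincomb_cong_simples[of "\<lambda>p. of_nat (c p)" "\<lambda>p. coord z (node p)"] c prj_expand[OF z] by simp
  then show "\<exists>c :: real vec \<Rightarrow> nat. highest - b =
      LinearCombinations.module.lincomb (module_vec TYPE(real) dm) (\<lambda>a. of_nat (c a)) simples" by blast
qed

text \<open>The point \<open>p\<close> of the Euclidean space is identified with a functional on \<open>V\<close> that
  takes the value \<open>1\<close> at \<open>\<delta>\<close>; the group acts on these functionals by affine maps.\<close>
definition pt :: "real vec \<Rightarrow> ('a \<Rightarrow> real) \<Rightarrow> real" where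
  "pt p v = B (emb p) v + coord v s0"

lemma pt_add: "pt p (v + w) = pt p v + pt p w" and pt_scale: "pt p (c *\<^sub>R v) = c * pt p v"
  and pt_diff: "pt p (v - w) = pt p v - pt p w" and pt_delta: "pt p \<delta> = 1"
  by (simp_all add: pt_def coord_add coord_scale coord_diff coord_delta_s0 algebra_simps)

lemma pt_sum: "pt p (sum f A) = (\<Sum>i\<in>A. pt p (f i))"
proof (induction A rule: infinite_finite_induct)
  case (insert i A)
  have "pt p (sum f (insert i A)) = (\<Sum>i\<in>insert i A. pt p (f i))" using insert by (simp add: pt_add)
  then show ?case .
next
  case (infinite A)
  then have "pt p (sum f A) = (\<Sum>i\<in>A. pt p (f i))" by (simp add: pt_def coord_def)
  then show ?case .
next
  case empty
  have "pt p (sum f {}) = (\<Sum>i\<in>{}. pt p (f i))" by (simp add: pt_def coord_def)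
  then show ?case .
qed

lemma pt_frame: "i < dm \<Longrightarrow> pt p (frame i) = p $ i"
  by (simp add: pt_def B_emb_frame frame_coord)

text \<open>The contragredient action in coordinates; a point is recovered from its values on the
  frame by \<open>pt_frame\<close>.\<close>

definition aff :: "'a \<Rightarrow> real vec \<Rightarrow> real vec" where
  "aff g = (\<lambda>p\<in>carrier_vec dm. vec dm (\<lambda>i. pt p (gact (inv g) (frame i))))"

lemma aff_closed: "p \<in> carrier_vec dm \<Longrightarrow> aff g p \<in> carrier_vec dm"
  by (simp add: aff_def)

lemma aff_index: "p \<in> carrier_vec dm \<Longrightarrow> i < dm \<Longrightarrow> aff g p $ i = pt p (gact (inv g) (frame i))"
  by (simp add: aff_def)

lemma pt_aff:
  assumes p: "p \<in> carrier_vec dm" and v: "v \<in> V" and g: "g \<in> carrier W"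
  shows "pt (aff g p) v = pt p (gact (inv g) v)"
proof -
  have "v = flat v + coord v s0 *\<^sub>R \<delta>" by (simp add: flat_def)
  also have "\<dots> = (\<Sum>i<dm. B v (frame i) *\<^sub>R frame i) + coord v s0 *\<^sub>R \<delta>" unfolding flat_expand[OF v] ..
  finally have "pt p (gact (inv g) v) = pt p (gact (inv g) ((\<Sum>i<dm. B v (frame i) *\<^sub>R frame i) + coord v s0 *\<^sub>R \<delta>))" by simp
  also have "\<dots> = (\<Sum>i<dm. B v (frame i) * pt p (gact (inv g) (frame i))) + coord v s0"
    unfolding gact_add gact_sum gact_scale pt_add pt_sum pt_scale using g by (simp add: pt_delta)
  also have "\<dots> = pt (aff g p) v" using p by (simp add: pt_def[of "aff g p"] B_emb aff_index B_sym[of v] mult.commute)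
  finally show ?thesis by simp
qed

lemma aff_mult:
  assumes "p \<in> carrier_vec dm" "g \<in> carrier W" "h \<in> carrier W"
  shows "aff (g \<otimes> h) p = aff g (aff h p)"
proof (rule eq_vecI)
  fix i assume "i < dim_vec (aff g (aff h p))"
  then have i: "i < dm" using aff_closed[OF aff_closed[OF assms(1), of h], of g] by auto
  have "aff g (aff h p) $ i = pt (aff h p) (gact (inv g) (frame i))" using i assms aff_closed by (simp add: aff_index)
  also have "\<dots> = pt p (gact (inv h) (gact (inv g) (frame i)))"
    using assms gact_V frame_V[OF i] by (intro pt_aff) auto
  also have "\<dots> = aff (g \<otimes> h) p $ i" using i assms by (simp add: aff_index inv_mult_group gact_mult)
  finally show "aff (g \<otimes> h) p $ i = aff g (aff h p) $ i" by simp
qed (use assms aff_closed in \<open>metis carrier_vecD\<close>)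

lemma aff_one: "p \<in> carrier_vec dm \<Longrightarrow> aff \<one> p = p"
  by (rule eq_vecI) (auto simp: aff_index pt_frame aff_def)

lemma aff_Bij: "g \<in> carrier W \<Longrightarrow> aff g \<in> Bij (carrier_vec dm)"
proof -
  assume g: "g \<in> carrier W"
  have "bij_betw (aff g) (carrier_vec dm) (carrier_vec dm)"
    by (rule bij_betw_byWitness[where f' = "aff (inv g)"])
      (use g aff_closed in \<open>auto simp: aff_mult[symmetric] aff_one\<close>)
  then show ?thesis by (simp add: Bij_def aff_def)
qed

text \<open>Points separate the vectors of \<open>V\<close>, so an element acting trivially on
  points fixes the simple roots, and the geometric representation is faithful.\<close>

lemma aff_inj:
  assumes g: "g \<in> carrier W" "h \<in> carrier W" and eq: "aff g = aff h"
  shows "g = h"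
proof (rule gact_faithful[OF g])
  fix s assume s: "s \<in> S"
  define k where "k = inv h \<otimes> g"
  have k: "k \<in> carrier W" using g by (simp add: k_def)
  have id: "aff k p = p" if "p \<in> carrier_vec dm" for p
    using that g by (simp add: k_def aff_mult eq) (simp add: aff_mult[symmetric] aff_one)
  have "gact (inv k) v = v" if v: "v \<in> V" for v
  proof -
    define w where "w = gact (inv k) v - v"
    have wV: "w \<in> V" unfolding w_def using k v by (intro V_diff gact_V) auto
    have pt0: "pt p w = 0" if "p \<in> carrier_vec dm" for p
      using pt_aff[OF that v k] id[OF that] by (simp add: w_def pt_diff)
    have "emb (0\<^sub>v dm) = 0" unfolding emb_def by (rule sum.neutral) auto
    then have c: "coord w s0 = 0" using pt0[of "0\<^sub>v dm"] by (simp add: pt_def)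
    then have w: "flat w = w" by (simp add: flat_def)
    have "B (emb p) w = 0" if "p \<in> carrier_vec dm" for p using pt0[OF that] c by (simp add: pt_def)
    from this[of "prj w"] have "B w w = 0" using emb_prj[OF wV] w by simp
    moreover have "w \<in> supp_on I0" using flat_supp[OF wV] w by simp
    ultimately have "w = 0" using posdef_supp_on[OF I0_proper, of w] by fastforce
    then show ?thesis by (simp add: w_def)
  qed
  from this[OF gact_V[OF k alpha_V[OF s]]] have "gact k (\<alpha> s) = \<alpha> s" using k by (simp add: gact_inv)
  then have "gact h (gact k (\<alpha> s)) = gact h (\<alpha> s)" by simp
  then show "gact g (\<alpha> s) = gact h (\<alpha> s)" using g by (simp add: k_def gact_mult gact_inv)
qed

text \<open>\<open>pt p x\<close> is the scalar product of \<open>p\<close> and \<open>prj x\<close>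
  minus \<open>k\<close>, so its zero set is the hyperplane of level \<open>k\<close>.\<close>

lemma aff_reflection:
  assumes r: "r \<in> carrier W" "\<And>v. gact r v = v - (2 * B v x / B x x) *\<^sub>R x"
    and x: "sroot x" "coord x s0 = - of_int k"
  shows "aff r = aff_refl dm (prj x) k"
proof (rule Bij_eqI[OF aff_Bij[OF r(1)]])
  have nz: "prj x \<noteq> 0\<^sub>v dm" using scalar_prod_root_pos[OF x(1)] by auto
  show "aff_refl dm (prj x) k \<in> Bij (carrier_vec dm)" by (rule aff_refl_Bij) (use nz in simp_all)
  fix p :: "real vec" assume p: "p \<in> carrier_vec dm"
  have xx: "B x x \<noteq> 0" using sroot_norm[OF x(1)] by simp
  have "gact r (gact r v) = v" for v
    using xx by (intro ext) (simp add: r(2) diff_divide_distrib algebra_simps)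
  then have inv: "gact (inv r) v = gact r v" for v using gact_inv(1)[OF r(1)] by metis
  show "aff r p = aff_refl dm (prj x) k p"
  proof (rule eq_vecI)
    show "dim_vec (aff r p) = dim_vec (aff_refl dm (prj x) k p)"
      using p aff_closed[OF p] aff_refl_closed[OF prj_carrier(1) p] by (metis carrier_vecD)
    fix i assume "i < dim_vec (aff_refl dm (prj x) k p)"
    then have i: "i < dm" using aff_refl_closed[OF prj_carrier(1) p] by (metis carrier_vecD)
    have "aff r p $ i = p $ i - (2 * B (frame i) x / B x x) * pt p x"
      using i p by (simp add: aff_index inv r(2) pt_diff pt_scale pt_frame)
    also have "\<dots> = aff_refl dm (prj x) k p $ i"
      using i p x sroot_V[OF x(1)]
      by (simp add: aff_refl_apply scalar_prod_prj scalar_prod_prj_prj pt_def emb_prj B_sym[of "frame i"])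
    finally show "aff r p $ i = aff_refl dm (prj x) k p $ i" .
  qed
qed

lemma sroot_reflection:
  assumes "sroot x"
  shows "\<exists>r\<in>carrier W. \<forall>v. gact r v = v - (2 * B v x / B x x) *\<^sub>R x"
proof -
  obtain b where b: "root b" "x = (1 / cc b) *\<^sub>R b" using assms sroot_def by blast
  obtain r where r: "r \<in> carrier W" "\<forall>x. gact r x = refl b x" using root_reflection[OF b(1)] by blast
  have "v - (2 * B v x / B x x) *\<^sub>R x = refl b v" for v
    using cc(1)[OF b(1)] root_norm[OF b(1)] by (simp add: b(2) refl_def)
  then show ?thesis using r by metis
qed

lemma gact_S_aa: "s \<in> S \<Longrightarrow> gact s v = v - (2 * B v (aa s) / B (aa s) (aa s)) *\<^sub>R aa s"
  using cc_alpha_pos[of s] by (simp add: gact_S refl_def aa_def B_alpha_self)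

text \<open>The level 1 of the highest root comes from the \<open>s0\<close>-coordinate -1 of
  \<open>- aa s0\<close>.\<close>

lemma aff_S: "s \<in> I0 \<Longrightarrow> aff s = aff_refl dm (prj (aa s)) 0" and aff_s0: "aff s0 = aff_refl dm highest 1"
proof -
  show "aff s = aff_refl dm (prj (aa s)) 0" if "s \<in> I0"
    using that gact_S_aa S_carrier sroot_aa by (intro aff_reflection) (auto simp: coord_aa)
  show "aff s0 = aff_refl dm highest 1"
    unfolding highest_def using s0 gact_S_aa S_carrier sroot_aa
    by (intro aff_reflection) (auto simp: coord_aa coord_minus sroot_minus)
qed

lemma aff_hom:
  assumes "g \<in> carrier W" "h \<in> carrier W"
  shows "aff (g \<otimes> h) = aff g \<otimes>\<^bsub>BijGroup (carrier_vec dm)\<^esub> aff h"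
proof -
  interpret BG: group "BijGroup (carrier_vec dm :: real vec set)" by (rule group_BijGroup)
  have "aff g \<otimes>\<^bsub>BijGroup (carrier_vec dm)\<^esub> aff h \<in> Bij (carrier_vec dm)"
    using BG.m_closed aff_Bij assms by simp
  moreover have "aff (g \<otimes> h) p = (aff g \<otimes>\<^bsub>BijGroup (carrier_vec dm)\<^esub> aff h) p" if "p \<in> carrier_vec dm" for p
    unfolding BijGroup_mult_apply[OF aff_Bij[OF assms(1)] aff_Bij[OF assms(2)] that] by (rule aff_mult[OF that assms])
  ultimately show ?thesis using Bij_eqI[OF aff_Bij[OF m_closed[OF assms]]] by blast
qed

lemma aff_image:
  "aff ` carrier W = generate (BijGroup (carrier_vec dm)) {aff_refl dm a k | a k. a \<in> roots}"
    (is "_ = generate ?BG ?gens")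
proof
  interpret BG: group ?BG by (rule group_BijGroup)
  have aff1: "aff \<one> = \<one>\<^bsub>?BG\<^esub>"
    using BG.l_cancel_one[of "aff \<one>" "aff \<one>"] aff_hom[of \<one> \<one>] aff_Bij[of \<one>] by simp
  show "aff ` carrier W \<subseteq> generate ?BG ?gens"
  proof (rule image_subsetI)
    fix g assume "g \<in> carrier W"
    then obtain w where w: "w \<in> lists S" "word_prod W w = g" using ex_word by blast
    have "aff (word_prod W w) \<in> generate ?BG ?gens"
      using w(1)
    proof (induction w)
      case Nil
      then show ?case by (simp add: aff1 generate.one)
    next
      case (Cons s w)
      then have s: "s \<in> S" and w: "w \<in> lists S" by auto
      have "aff s \<in> ?gens"
      proof (cases "s = s0")
        case True
        then show ?thesis using aff_s0 highest_highest unfolding highest_root_def by blast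
      next
        case False
        then show ?thesis using aff_S[of s] s sroot_aa[OF s] by (force simp: roots_def)
      qed
      then have "aff s \<otimes>\<^bsub>?BG\<^esub> aff (word_prod W w) \<in> generate ?BG ?gens"
        by (rule generate.eng[OF generate.incl Cons.IH])
      then show ?case using s w by (simp add: aff_hom S_carrier)
    qed
    then show "aff g \<in> generate ?BG ?gens" using w by simp
  qed
  have gen: "h \<in> aff ` carrier W" if h: "h \<in> ?gens" for h
  proof -
    obtain x k where x: "sroot x" "h = aff_refl dm (prj x) k" using h by (auto simp: roots_def)
    obtain m where m: "coord x s0 = of_int m" using coord_integral[OF x(1) s0] by (metis Ints_cases)
    \<comment> \<open>Integral shifts along \<open>\<delta>\<close> keep the projection and reach
      every level, so each generator is the image of a reflection in \<open>W\<close>.\<close>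
    define y where "y = x + of_int (- k - m) *\<^sub>R \<delta>"
    have y: "sroot y" "coord y s0 = - of_int k" "prj y = prj x"
      using sroot_shift[OF x(1), of "- k - m"] m by (simp_all add: y_def coord_add coord_scale coord_delta_s0 prj_shift)
    obtain r where r: "r \<in> carrier W" "\<And>v. gact r v = v - (2 * B v y / B y y) *\<^sub>R y"
      using sroot_reflection[OF y(1)] by blast
    have "aff r = h" using aff_reflection[OF r y(1,2)] x y by simp
    then show ?thesis using r by blast
  qed
  show "generate ?BG ?gens \<subseteq> aff ` carrier W"
  proof
    fix h assume "h \<in> generate ?BG ?gens"
    then show "h \<in> aff ` carrier W"
    proof (induction h rule: generate.induct)
      case one
      then show ?case using aff1 by (metis image_eqI one_closed)
    next
      case (incl h)
      then show ?case by (rule gen)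
    next
      case (inv h)
      then obtain g where g: "g \<in> carrier W" "h = aff g" using gen by blast
      have "aff (inv g) \<otimes>\<^bsub>?BG\<^esub> aff g = \<one>\<^bsub>?BG\<^esub>" using g aff_hom[of "inv g" g] aff1 by simp
      then have "inv\<^bsub>?BG\<^esub> h = aff (inv g)" using g aff_Bij by (intro BG.inv_equality) auto
      then show ?case using g by blast
    next
      case (eng h1 h2)
      then obtain g1 g2 where "g1 \<in> carrier W" "h1 = aff g1" "g2 \<in> carrier W" "h2 = aff g2" by blast
      then show ?case using aff_hom by (metis image_eqI m_closed)
    qed
  qed
qed

lemma affine_weyl: "affine_weyl W S"
proof -
  let ?H = "affine_weyl_group_of dm roots"
  have "aff \<in> hom W ?H"
    unfolding hom_def affine_weyl_group_of_def using aff_hom aff_image by auto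
  moreover have "bij_betw aff (carrier W) (carrier ?H)"
    unfolding bij_betw_def affine_weyl_group_of_def using aff_inj aff_image by (auto intro: inj_onI)
  ultimately have iso: "aff \<in> iso W ?H" by (simp add: iso_def)
  have "S = insert s0 I0" using s0 by blast
  then have "aff ` S = insert (aff s0) (aff ` I0)" by (metis image_insert)
  also have "aff ` I0 = (\<lambda>a. aff_refl dm a 0) ` simples"
    unfolding simples_def image_image by (intro image_cong HOL.refl aff_S)
  finally have "aff ` S = affine_simple_reflections dm simples highest"
    unfolding affine_simple_reflections_def aff_s0 .
  then show ?thesis
    unfolding affine_weyl_def
    using roots_irreducible simples_simple_roots highest_highest iso by blast
qed

end

lemma (in affine_coxeter) affine_weyl: "affine_weyl W S"
proof -
  obtain s0 where "s0 \<in> S" "coord \<delta> s0 = 1" using special_node by blast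
  then interpret special_affine_coxeter W S \<delta> s0 by unfold_locales
  show ?thesis by (rule affine_weyl)
qed

section \<open>Virtually abelian groups\<close>

context vector_space
begin

text \<open>A vector of the span lies in the span of a finite subset of \<open>T\<close>. There are
  countably many such subsets, and each spans finitely many members of an independent set.\<close>

lemma countable_independent:
  assumes T: "countable T" and X: "independent X" "X \<subseteq> span T"
  shows "countable X"
proof -
  have "X \<subseteq> (\<Union>A\<in>{A. A \<subseteq> T \<and> finite A}. X \<inter> span A)"
  proof
    fix x assume x: "x \<in> X"
    then obtain A r where "finite A" "A \<subseteq> T" "x = (\<Sum>a\<in>A. r a *s a)"
      using X(2) unfolding span_explicit by blast
    moreover then have "x \<in> span A" by (auto intro: span_sum span_scale span_base)
    ultimately show "x \<in> (\<Union>A\<in>{A. A \<subseteq> T \<and> finite A}. X \<inter> span A)" using x by blast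
  qed
  moreover have "countable (\<Union>A\<in>{A. A \<subseteq> T \<and> finite A}. X \<inter> span A)"
  proof (rule countable_UN)
    show "countable {A. A \<subseteq> T \<and> finite A}" using countable_Collect_finite_subset[OF T] by (simp add: conj_commute)
    fix A assume "A \<in> {A. A \<subseteq> T \<and> finite A}"
    then have "finite (X \<inter> span A)"
      using independent_span_bound[of A "X \<inter> span A"] independent_mono[OF X(1)] by auto
    then show "countable (X \<inter> span A)" by (rule countable_finite)
  qed
  ultimately show ?thesis by (rule countable_subset)
qed

end

locale countable_operators = vector_space scale for scale :: "complex \<Rightarrow> 'v::ab_group_add \<Rightarrow> 'v" +
  fixes V T :: "'v set"
  assumes V_sub: "subspace V" and count: "countable T" and V_span: "V \<subseteq> span T"
begin

text \<open>Linearity is asked on \<open>V\<close> only, because a representation is unconstrained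
  outside its space.\<close>

definition op_on :: "('v \<Rightarrow> 'v) \<Rightarrow> bool" where
  "op_on f \<longleftrightarrow> (\<forall>x\<in>V. f x \<in> V) \<and> (\<forall>x\<in>V. \<forall>y\<in>V. f (x + y) = f x + f y)
     \<and> (\<forall>c. \<forall>x\<in>V. f (scale c x) = scale c (f x))"

lemma op_on_closed: "op_on f \<Longrightarrow> x \<in> V \<Longrightarrow> f x \<in> V"
  and op_on_add: "op_on f \<Longrightarrow> x \<in> V \<Longrightarrow> y \<in> V \<Longrightarrow> f (x + y) = f x + f y"
  and op_on_scale: "op_on f \<Longrightarrow> x \<in> V \<Longrightarrow> f (scale c x) = scale c (f x)"
  by (auto simp: op_on_def)

lemma op_on_0: "op_on f \<Longrightarrow> f 0 = 0"
  using op_on_scale[of f 0 0] subspace_0[OF V_sub] by simp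

lemma op_on_diff: "op_on f \<Longrightarrow> x \<in> V \<Longrightarrow> y \<in> V \<Longrightarrow> f (x - y) = f x - f y"
proof -
  assume f: "op_on f" and xy: "x \<in> V" "y \<in> V"
  have "f (x - y + y) = f (x - y) + f y" using xy by (intro op_on_add f subspace_diff V_sub)
  then show ?thesis by simp
qed

lemma op_on_sum: "op_on f \<Longrightarrow> (\<And>i. i \<in> A \<Longrightarrow> g i \<in> V) \<Longrightarrow> f (sum g A) = (\<Sum>i\<in>A. f (g i))"
  by (induction A rule: infinite_finite_induct) (auto simp: op_on_0 op_on_add subspace_sum[OF V_sub])

lemma eigenvectors_independent:
  assumes f: "op_on f"
  shows "finite F \<Longrightarrow> (\<And>\<xi>. \<xi> \<in> F \<Longrightarrow> y \<xi> \<in> V \<and> f (y \<xi>) = scale \<xi> (y \<xi>)) \<Longrightarrow> (\<Sum>\<xi>\<in>F. y \<xi>) = 0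
    \<Longrightarrow> \<xi> \<in> F \<Longrightarrow> y \<xi> = 0"
proof (induction F arbitrary: y \<xi> rule: finite_induct)
  case (insert \<mu> F)
  have yV: "y \<nu> \<in> V" "f (y \<nu>) = scale \<nu> (y \<nu>)" if "\<nu> \<in> insert \<mu> F" for \<nu> using insert.prems(1) that by auto
  have sum0: "y \<mu> + (\<Sum>\<nu>\<in>F. y \<nu>) = 0" using insert by simp
  have "0 = f (y \<mu> + (\<Sum>\<nu>\<in>F. y \<nu>)) - scale \<mu> (y \<mu> + (\<Sum>\<nu>\<in>F. y \<nu>))"
    unfolding sum0 by (simp add: op_on_0[OF f])
  also have "f (y \<mu> + (\<Sum>\<nu>\<in>F. y \<nu>)) = scale \<mu> (y \<mu>) + (\<Sum>\<nu>\<in>F. scale \<nu> (y \<nu>))"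
    using yV by (simp add: op_on_add[OF f] op_on_sum[OF f] subspace_sum[OF V_sub])
  also have "\<dots> - scale \<mu> (y \<mu> + (\<Sum>\<nu>\<in>F. y \<nu>)) = (\<Sum>\<nu>\<in>F. scale (\<nu> - \<mu>) (y \<nu>))"
    by (simp add: scale_right_distrib scale_sum_right scale_left_diff_distrib sum_subtractf)
  finally have "(\<Sum>\<nu>\<in>F. scale (\<nu> - \<mu>) (y \<nu>)) = 0" by simp
  then have "scale (\<nu> - \<mu>) (y \<nu>) = 0" if "\<nu> \<in> F" for \<nu>
    using insert.IH[of "\<lambda>\<nu>. scale (\<nu> - \<mu>) (y \<nu>)" \<nu>] that yV
    by (auto simp: subspace_scale[OF V_sub] op_on_scale[OF f] mult.commute)
  then have F: "y \<nu> = 0" if "\<nu> \<in> F" for \<nu> using that insert.hyps(2) by auto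
  then have "y \<mu> = 0" using sum0 by simp
  then show ?case using F insert.prems by auto
qed auto

text \<open>Eigenvectors for different eigenvalues are independent, and the dimension is
  countable.\<close>

lemma countable_eigenvalues:
  assumes f: "op_on f"
  shows "countable {\<xi>. \<exists>x\<in>V. x \<noteq> 0 \<and> f x = scale \<xi> x}"
proof -
  define E where "E = {\<xi>. \<exists>x\<in>V. x \<noteq> 0 \<and> f x = scale \<xi> x}"
  have "\<exists>e. \<forall>\<xi>\<in>E. e \<xi> \<in> V \<and> e \<xi> \<noteq> 0 \<and> f (e \<xi>) = scale \<xi> (e \<xi>)"
    unfolding E_def by (intro bchoice) blast
  then obtain e where e: "\<And>\<xi>. \<xi> \<in> E \<Longrightarrow> e \<xi> \<in> V \<and> e \<xi> \<noteq> 0 \<and> f (e \<xi>) = scale \<xi> (e \<xi>)" by blast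
  have inj: "inj_on e E"
  proof (rule inj_onI)
    fix \<xi> \<mu> assume "\<xi> \<in> E" "\<mu> \<in> E" "e \<xi> = e \<mu>"
    then have "scale \<xi> (e \<xi>) = scale \<mu> (e \<xi>)" using e by metis
    then show "\<xi> = \<mu>" using e \<open>\<xi> \<in> E\<close> by simp
  qed
  have "independent (e ` E)"
  proof
    assume "dependent (e ` E)"
    then obtain t u where t: "finite t" "t \<subseteq> e ` E" "(\<Sum>v\<in>t. scale (u v) v) = 0" "\<exists>v\<in>t. u v \<noteq> 0"
      unfolding dependent_explicit by blast
    obtain F where F: "F \<subseteq> E" "t = e ` F" using t(2) by (meson subset_imageE)
    have inj': "inj_on e F" using inj F(1) inj_on_subset by blast
    have finF: "finite F" using t(1) F(2) inj' finite_imageD by blast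
    have sum: "(\<Sum>\<xi>\<in>F. scale (u (e \<xi>)) (e \<xi>)) = 0" using t(3) F(2) inj' by (simp add: sum.reindex)
    obtain \<xi> where l: "\<xi> \<in> F" "u (e \<xi>) \<noteq> 0" using t(4) F(2) by auto
    have "scale (u (e \<xi>)) (e \<xi>) = 0"
    proof (rule eigenvectors_independent[OF f finF _ sum l(1)])
      fix \<nu> assume "\<nu> \<in> F"
      then have "e \<nu> \<in> V" "f (e \<nu>) = scale \<nu> (e \<nu>)" using e F(1) by auto
      then show "scale (u (e \<nu>)) (e \<nu>) \<in> V \<and> f (scale (u (e \<nu>)) (e \<nu>)) = scale \<nu> (scale (u (e \<nu>)) (e \<nu>))"
        by (simp add: op_on_scale[OF f] subspace_scale[OF V_sub] mult.commute)
    qed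
    then show False using l e F(1) by auto
  qed
  moreover have "e ` E \<subseteq> span T" using e V_span by blast
  ultimately have "countable (e ` E)" using countable_independent count by blast
  then show ?thesis using inj countable_image_inj_on E_def by blast
qed

definition poly_op :: "('v \<Rightarrow> 'v) \<Rightarrow> complex poly \<Rightarrow> 'v \<Rightarrow> 'v" where
  "poly_op f p x = (\<Sum>i\<le>degree p. scale (coeff p i) ((f ^^ i) x))"

lemma poly_op_le: "degree p \<le> n \<Longrightarrow> poly_op f p x = (\<Sum>i\<le>n. scale (coeff p i) ((f ^^ i) x))"
  unfolding poly_op_def by (intro sum.mono_neutral_left) (auto simp: coeff_eq_0)

lemma poly_op_add: "poly_op f (p + q) x = poly_op f p x + poly_op f q x"
proof -
  define n where "n = max (degree p) (degree q)"
  have "degree p \<le> n" "degree q \<le> n" "degree (p + q) \<le> n" by (auto simp: n_def degree_add_le)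
  then show ?thesis by (simp add: poly_op_le[of _ n] sum.distrib scale_left_distrib)
qed

lemma poly_op_smult: "poly_op f (smult c p) x = scale c (poly_op f p x)"
  using poly_op_le[OF degree_smult_le[of c p], of f x]
  by (simp add: poly_op_def scale_sum_right)

lemma poly_op_sum: "poly_op f (sum p A) x = (\<Sum>i\<in>A. poly_op f (p i) x)"
  by (induction A rule: infinite_finite_induct) (simp_all add: poly_op_add, simp_all add: poly_op_def)

lemma funpow_V: "op_on f \<Longrightarrow> x \<in> V \<Longrightarrow> (f ^^ i) x \<in> V"
  by (induction i) (auto simp: op_on_closed)

lemma poly_op_diff_right: "op_on f \<Longrightarrow> x \<in> V \<Longrightarrow> y \<in> V \<Longrightarrow> poly_op f p (x - y) = poly_op f p x - poly_op f p y"
proof -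
  assume f: "op_on f" and xy: "x \<in> V" "y \<in> V"
  have "(f ^^ i) (x - y) = (f ^^ i) x - (f ^^ i) y" for i
    by (induction i) (auto simp: op_on_diff[OF f] funpow_V[OF f] xy)
  then show ?thesis by (simp add: poly_op_def scale_right_diff_distrib sum_subtractf)
qed

lemma poly_op_scale_right: "op_on f \<Longrightarrow> x \<in> V \<Longrightarrow> poly_op f p (scale c x) = scale c (poly_op f p x)"
proof -
  assume f: "op_on f" and x: "x \<in> V"
  have "(f ^^ i) (scale c x) = scale c ((f ^^ i) x)" for i
    by (induction i) (auto simp: op_on_scale[OF f] funpow_V[OF f] x)
  then show ?thesis by (simp add: poly_op_def scale_sum_right mult.commute)
qed

lemma poly_op_shift: "op_on f \<Longrightarrow> x \<in> V \<Longrightarrow> poly_op f (pCons 0 p) x = f (poly_op f p x)"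
proof -
  assume f: "op_on f" and x: "x \<in> V"
  have "poly_op f (pCons 0 p) x = (\<Sum>i\<le>Suc (degree p). scale (coeff (pCons 0 p) i) ((f ^^ i) x))"
    by (rule poly_op_le) (simp add: degree_pCons_le)
  also have "\<dots> = (\<Sum>i\<le>degree p. scale (coeff p i) (f ((f ^^ i) x)))"
    by (subst sum.atMost_Suc_shift) simp
  also have "\<dots> = f (poly_op f p x)"
    unfolding poly_op_def
    by (subst op_on_sum[OF f]) (auto simp: op_on_scale[OF f] subspace_scale[OF V_sub] funpow_V[OF f] x)
  finally show ?thesis .
qed

lemma poly_op_linear_factor:
  assumes "op_on f" "x \<in> V"
  shows "poly_op f ([:- \<nu>, 1:] * p) x = f (poly_op f p x) - scale \<nu> (poly_op f p x)"
proof -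
  have "[:- \<nu>, 1:] * p = smult (- \<nu>) p + pCons 0 p" by simp
  then show ?thesis using poly_op_shift[OF assms] by (simp only: poly_op_add poly_op_smult) simp
qed

lemma poly_op_commute: "op_on f \<Longrightarrow> x \<in> V \<Longrightarrow> f (poly_op f p x) = poly_op f p (f x)"
proof -
  assume f: "op_on f" and x: "x \<in> V"
  have "f (poly_op f p x) = (\<Sum>i\<le>degree p. scale (coeff p i) (f ((f ^^ i) x)))"
    unfolding poly_op_def
    by (subst op_on_sum[OF f]) (auto simp: op_on_scale[OF f] subspace_scale[OF V_sub] funpow_V[OF f] x)
  also have "\<dots> = poly_op f p (f x)" by (simp add: poly_op_def funpow_swap1)
  finally show ?thesis .
qed

text \<open>Over the complex numbers \<open>p\<close> splits into linear factors, and each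
  \<open>f - \<nu>\<close> is injective on \<open>U\<close> as long as \<open>U\<close> contains no
  eigenvector.\<close>

lemma poly_op_eq_0_imp:
  assumes f: "op_on f" and U: "subspace U" "U \<subseteq> V" "\<And>x. x \<in> U \<Longrightarrow> f x \<in> U"
    and inj: "\<And>\<nu> x. x \<in> U \<Longrightarrow> f x = scale \<nu> x \<Longrightarrow> x = 0"
    and x: "x \<in> U"
  shows "p \<noteq> 0 \<Longrightarrow> poly_op f p x = 0 \<Longrightarrow> x = 0"
proof (induction "degree p" arbitrary: p rule: less_induct)
  case less
  have xV: "x \<in> V" using x U by blast
  show ?case
  proof (cases "degree p = 0")
    case True
    then obtain c where "p = [:c:]" using degree_eq_zeroE by blast
    then show ?thesis using less.prems by (simp add: poly_op_def)
  next
    case False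
    then have "\<not> constant (poly p)" by (simp add: constant_degree)
    then obtain \<nu> where "poly p \<nu> = 0" using fundamental_theorem_of_algebra by blast
    then obtain q where q: "p = [:- \<nu>, 1:] * q" using poly_eq_0_iff_dvd by (metis dvdE)
    have qn: "q \<noteq> 0" using less.prems(1) q by auto
    have "degree p = Suc (degree q)" using qn unfolding q by (subst degree_mult_eq) auto
    moreover have "poly_op f q x \<in> U"
    proof -
      have "(f ^^ i) x \<in> U" for i by (induction i) (auto simp: x U(3))
      then show ?thesis unfolding poly_op_def using U(1) by (intro subspace_sum subspace_scale)
    qed
    moreover have "f (poly_op f q x) = scale \<nu> (poly_op f q x)"
      using less.prems(2) poly_op_linear_factor[OF f xV, of \<nu> q] q by simp
    ultimately have "degree q < degree p" "poly_op f q x = 0" using inj[of "poly_op f q x" \<nu>] by auto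
    then show ?thesis using less.hyps[of q] qn by blast
  qed
qed

text \<open>Dixmier's argument: if the resolvent vectors (f - l)^{-1} x exist for uncountably many l,
  they are linearly dependent, and clearing denominators gives a polynomial annihilating x.\<close>
lemma eigenvector_exists:
  assumes f: "op_on f" and U: "subspace U" "U \<subseteq> V" "\<And>x. x \<in> U \<Longrightarrow> f x \<in> U"
    and x: "x \<in> U" "x \<noteq> 0" and \<Lambda>: "countable \<Lambda>"
    and res: "\<And>\<xi>. \<xi> \<notin> \<Lambda> \<Longrightarrow> \<exists>y\<in>V. f y - scale \<xi> y = x"
  shows "\<exists>\<nu>. \<exists>z\<in>U. z \<noteq> 0 \<and> f z = scale \<nu> z"
proof (rule ccontr)
  assume "\<not> ?thesis"
  then have inj: "z = 0" if "z \<in> U" "f z = scale \<nu> z" for \<nu> z using that by blast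
  have "\<exists>y. \<forall>\<xi>\<in>- \<Lambda>. y \<xi> \<in> V \<and> f (y \<xi>) - scale \<xi> (y \<xi>) = x"
    using res by (intro bchoice) blast
  then obtain y where y: "\<And>\<xi>. \<xi> \<notin> \<Lambda> \<Longrightarrow> y \<xi> \<in> V \<and> f (y \<xi>) - scale \<xi> (y \<xi>) = x" by auto
  have inj_y: "inj_on y (- \<Lambda>)"
  proof (rule inj_onI)
    fix \<xi> \<mu> assume *: "\<xi> \<in> - \<Lambda>" "\<mu> \<in> - \<Lambda>" "y \<xi> = y \<mu>"
    then have "f (y \<xi>) - scale \<xi> (y \<xi>) = f (y \<xi>) - scale \<mu> (y \<xi>)" using y by (metis ComplD)
    then have "scale (\<xi> - \<mu>) (y \<xi>) = 0" by (simp add: scale_left_diff_distrib)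
    moreover have "y \<xi> \<noteq> 0" using y[of \<xi>] * x op_on_0[OF f] by auto
    ultimately show "\<xi> = \<mu>" by simp
  qed
  \<comment> \<open>Uncountably many resolvent vectors in a space of countable dimension must be
    dependent.\<close>
  have "uncountable (- \<Lambda>)"
  proof
    assume "countable (- \<Lambda>)"
    then have "countable (\<Lambda> \<union> - \<Lambda>)" using \<Lambda> by blast
    then show False using uncountable_UNIV_complex by simp
  qed
  then have "uncountable (y ` (- \<Lambda>))" using countable_image_inj_on[OF _ inj_y] by blast
  moreover have "y ` (- \<Lambda>) \<subseteq> span T" using y V_span by blast
  ultimately have "dependent (y ` (- \<Lambda>))" using countable_independent[OF count] by blast
  then obtain t u where t: "finite t" "t \<subseteq> y ` (- \<Lambda>)" "(\<Sum>v\<in>t. scale (u v) v) = 0" "\<exists>v\<in>t. u v \<noteq> 0"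
    unfolding dependent_explicit by blast
  obtain F where F: "F \<subseteq> - \<Lambda>" "t = y ` F" using t(2) by (meson subset_imageE)
  have inj': "inj_on y F" using inj_y F(1) inj_on_subset by blast
  have finF: "finite F" using t(1) F(2) inj' finite_imageD by blast
  define c where "c \<xi> = u (y \<xi>)" for \<xi>
  have sum: "(\<Sum>\<xi>\<in>F. scale (c \<xi>) (y \<xi>)) = 0" using t(3) F(2) inj' by (simp add: sum.reindex c_def)
  obtain \<kappa> where k: "\<kappa> \<in> F" "c \<kappa> \<noteq> 0" using t(4) F(2) by (auto simp: c_def)
  \<comment> \<open>\<open>P F\<close> is the common denominator of the resolvents: applied to
    \<open>y \<xi>\<close>, its factor for \<open>\<xi>\<close> gives back \<open>x\<close>.\<close>
  define P where "P A = (\<Prod>\<mu>\<in>A. [:- \<mu>, 1:])" for A :: "complex set"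
  have PF: "P F = [:- \<xi>, 1:] * P (F - {\<xi>})" if "\<xi> \<in> F" for \<xi>
    unfolding P_def using finF that by (rule prod.remove)
  have yF: "y \<xi> \<in> V" "f (y \<xi>) - scale \<xi> (y \<xi>) = x" if "\<xi> \<in> F" for \<xi> using y that F(1) by auto
  have P_y: "poly_op f (P F) (y \<xi>) = poly_op f (P (F - {\<xi>})) x" if "\<xi> \<in> F" for \<xi>
  proof -
    let ?q = "P (F - {\<xi>})"
    have "poly_op f (P F) (y \<xi>) = f (poly_op f ?q (y \<xi>)) - scale \<xi> (poly_op f ?q (y \<xi>))"
      unfolding PF[OF that] by (rule poly_op_linear_factor[OF f yF(1)[OF that]])
    also have "\<dots> = poly_op f ?q (f (y \<xi>)) - poly_op f ?q (scale \<xi> (y \<xi>))"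
      using yF(1)[OF that] by (simp add: poly_op_commute[OF f] poly_op_scale_right[OF f])
    also have "\<dots> = poly_op f ?q (f (y \<xi>) - scale \<xi> (y \<xi>))"
      using yF(1)[OF that] by (simp add: poly_op_diff_right[OF f] op_on_closed[OF f] subspace_scale[OF V_sub])
    finally show ?thesis using yF(2)[OF that] by simp
  qed
  define q where "q = (\<Sum>\<xi>\<in>F. smult (c \<xi>) (P (F - {\<xi>})))"
  have lin_sum: "poly_op f p (\<Sum>\<xi>\<in>A. scale (c \<xi>) (y \<xi>)) = (\<Sum>\<xi>\<in>A. scale (c \<xi>) (poly_op f p (y \<xi>)))"
    if "finite A" "A \<subseteq> F" for p A
    using that
  proof (induction A rule: finite_induct)
    case empty
    then show ?case using poly_op_scale_right[OF f subspace_0[OF V_sub], of p 0] by simp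
  next
    case (insert \<xi> A)
    have V': "scale (c \<xi>) (y \<xi>) \<in> V" "(\<Sum>\<xi>\<in>A. scale (c \<xi>) (y \<xi>)) \<in> V"
      using insert.prems yF by (auto intro!: subspace_sum[OF V_sub] subspace_scale[OF V_sub])
    have "poly_op f p (a + b) = poly_op f p a + poly_op f p b" if "a \<in> V" "b \<in> V" for a b
      using poly_op_diff_right[OF f, of "a + b" b p] that by (simp add: subspace_add[OF V_sub] algebra_simps)
    then show ?case using insert V' yF(1) by (simp add: poly_op_scale_right[OF f])
  qed
  have "poly_op f q x = (\<Sum>\<xi>\<in>F. scale (c \<xi>) (poly_op f (P F) (y \<xi>)))"
    unfolding q_def poly_op_sum poly_op_smult by (intro sum.cong) (auto simp: P_y)
  also have "\<dots> = 0"
    using lin_sum[OF finF subset_refl, of "P F"] poly_op_scale_right[OF f subspace_0[OF V_sub], of "P F" 0] by (simp add: sum)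
  finally have q0: "poly_op f q x = 0" .
  \<comment> \<open>At \<open>\<kappa>\<close> all summands but one have a zero, so \<open>q\<close>
    is not the zero polynomial.\<close>
  have "poly q \<kappa> = (\<Sum>\<xi>\<in>F. c \<xi> * poly (P (F - {\<xi>})) \<kappa>)" by (simp add: q_def poly_sum)
  also have "\<dots> = (\<Sum>\<xi>\<in>F. if \<xi> = \<kappa> then c \<kappa> * poly (P (F - {\<kappa>})) \<kappa> else 0)"
  proof (rule sum.cong[OF HOL.refl])
    fix \<xi> assume "\<xi> \<in> F"
    show "c \<xi> * poly (P (F - {\<xi>})) \<kappa> = (if \<xi> = \<kappa> then c \<kappa> * poly (P (F - {\<kappa>})) \<kappa> else 0)"
    proof (cases "\<xi> = \<kappa>")
      case False
      then have "poly (P (F - {\<xi>})) \<kappa> = 0" using k finF by (auto simp: P_def poly_prod)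
      then show ?thesis using False by simp
    qed simp
  qed
  also have "\<dots> = c \<kappa> * poly (P (F - {\<kappa>})) \<kappa>" using k finF by simp
  also have "\<dots> \<noteq> 0" using k finF by (auto simp: P_def poly_prod)
  finally have "q \<noteq> 0" by auto
  moreover have "\<And>x. x \<in> U \<Longrightarrow> f x \<in> U" by (rule U(3))
  ultimately have "x = 0" using poly_op_eq_0_imp[of f U x q] f U(1,2) inj x(1) q0 by blast
  then show False using x(2) by simp
qed

end

text \<open>\<open>A\<close> generates a normal abelian part and \<open>C\<close> supplies the
  cosets. Since conjugation permutes the finite set \<open>A\<close>, the product of the operators
  \<open>b - \<xi>\<close> over \<open>A\<close> commutes with the group, which provides the
  resolvents for Dixmier's argument. The group carries a common eigenvector \<open>u\<close> of
  \<open>A\<close> into the span of the finitely many vectors \<open>\<rho> c u\<close>.\<close>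

lemma finite_dim_if_virtually_abelian:
  fixes G (structure) and scale :: "complex \<Rightarrow> 'v::ab_group_add \<Rightarrow> 'v"
  assumes grp: "group G" and vs: "vector_space scale"
    and A: "finite A" "A \<subseteq> carrier G"
    and comm: "\<And>a b. a \<in> A \<Longrightarrow> b \<in> A \<Longrightarrow> a \<otimes> b = b \<otimes> a"
    and conj: "\<And>g a. g \<in> carrier G \<Longrightarrow> a \<in> A \<Longrightarrow> g \<otimes> a \<otimes> inv g \<in> A"
    and C: "finite C" "C \<subseteq> carrier G"
    and decomp: "\<And>g. g \<in> carrier G \<Longrightarrow> \<exists>as\<in>lists A. \<exists>c\<in>C. g = foldr (\<lambda>x y. x \<otimes> y) as \<one> \<otimes> c"
    and irr: "irreducible_representation G scale V \<rho>"
  shows "finite_dim scale V"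
proof -
  interpret group G by (rule grp)
  interpret Sp: vector_space scale by (rule vs)
  have V_sub: "Sp.subspace V" and rV: "\<And>g x. g \<in> carrier G \<Longrightarrow> x \<in> V \<Longrightarrow> \<rho> g x \<in> V"
    and r_add: "\<And>g x y. g \<in> carrier G \<Longrightarrow> x \<in> V \<Longrightarrow> y \<in> V \<Longrightarrow> \<rho> g (x + y) = \<rho> g x + \<rho> g y"
    and r_scale: "\<And>g c x. g \<in> carrier G \<Longrightarrow> x \<in> V \<Longrightarrow> \<rho> g (scale c x) = scale c (\<rho> g x)"
    and r_one: "\<And>x. x \<in> V \<Longrightarrow> \<rho> \<one> x = x"
    and r_mult: "\<And>g h x. g \<in> carrier G \<Longrightarrow> h \<in> carrier G \<Longrightarrow> x \<in> V \<Longrightarrow> \<rho> (g \<otimes> h) x = \<rho> g (\<rho> h x)"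
    and V_nz: "V \<noteq> {0}"
    and V_irr: "\<And>U. U \<subseteq> V \<Longrightarrow> Sp.subspace U \<Longrightarrow> (\<And>g x. g \<in> carrier G \<Longrightarrow> x \<in> U \<Longrightarrow> \<rho> g x \<in> U) \<Longrightarrow> U = {0} \<or> U = V"
  proof -
    note irr = irr[unfolded irreducible_representation_def representation_def]
    show "Sp.subspace V" using irr by (elim conjE)
    show "\<rho> g x \<in> V" if "g \<in> carrier G" "x \<in> V" for g x
      using irr that by simp
    show "\<rho> g (x + y) = \<rho> g x + \<rho> g y" if "g \<in> carrier G" "x \<in> V" "y \<in> V" for g x y
      using irr that by simp
    show "\<rho> g (scale c x) = scale c (\<rho> g x)" if "g \<in> carrier G" "x \<in> V" for g c x
      using irr that by simp
    show "\<rho> \<one> x = x" if "x \<in> V" for x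
      using irr that by simp
    show "\<rho> (g \<otimes> h) x = \<rho> g (\<rho> h x)" if "g \<in> carrier G" "h \<in> carrier G" "x \<in> V" for g h x
      using irr that by simp
    show "V \<noteq> {0}" using irr by (elim conjE)
    show "U = {0} \<or> U = V" if "U \<subseteq> V" "Sp.subspace U" "\<And>g x. g \<in> carrier G \<Longrightarrow> x \<in> U \<Longrightarrow> \<rho> g x \<in> U" for U
      using irr that by (elim conjE) (elim allE[of _ U], simp)
  qed
  have r_0: "\<rho> g 0 = 0" if "g \<in> carrier G" for g
    using r_scale[OF that Sp.subspace_0[OF V_sub], of 0] by simp
  have cyclic: "V \<subseteq> Sp.span T"
    if T: "T \<subseteq> V" "\<And>g x. g \<in> carrier G \<Longrightarrow> x \<in> T \<Longrightarrow> \<rho> g x \<in> Sp.span T" and x: "x \<in> T" "x \<noteq> 0" for T x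
  proof -
    have TV: "Sp.span T \<subseteq> V" using T(1) V_sub by (rule Sp.span_minimal)
    have "\<rho> g y \<in> Sp.span T" if g: "g \<in> carrier G" and y: "y \<in> Sp.span T" for g y
    proof -
      have "y \<in> V \<and> \<rho> g y \<in> Sp.span T" using y
      proof (induction rule: Sp.span_induct_alt)
        case base
        then show ?case using r_0[OF g] Sp.subspace_0[OF V_sub] by (simp add: Sp.span_zero)
      next
        case (step c u w)
        then have "u \<in> V" "scale c u \<in> V" using T(1) Sp.subspace_scale[OF V_sub] by auto
        then show ?case using step T(2)[OF g step(1)]
          by (simp add: r_add[OF g] r_scale[OF g] Sp.subspace_add[OF V_sub] Sp.span_add Sp.span_scale)
      qed
      then show ?thesis ..
    qed
    then have "Sp.span T = {0} \<or> Sp.span T = V" using V_irr TV by simp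
    then show ?thesis using Sp.span_base[OF x(1)] x(2) by auto
  qed
  obtain x0 where x0: "x0 \<in> V" "x0 \<noteq> 0" using V_nz Sp.subspace_0[OF V_sub] by blast
  define word where "word as = foldr (\<lambda>x y. x \<otimes> y) as \<one>" for as
  have word_closed: "word as \<in> carrier G" if "as \<in> lists A" for as
    using that A(2) by (induction as) (auto simp: word_def)
  define T where "T = (\<lambda>(as, c). \<rho> (word as \<otimes> c) x0) ` (lists A \<times> C)"
  have T_eq: "\<rho> g x0 \<in> T" if g: "g \<in> carrier G" for g
  proof -
    obtain as c where ac: "as \<in> lists A" "c \<in> C" "g = word as \<otimes> c"
      using decomp[OF g] unfolding word_def by blast
    show ?thesis unfolding T_def by (rule image_eqI[of _ _ "(as, c)"]) (use ac in simp_all)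
  qed
  have T_V: "T \<subseteq> V"
  proof
    fix y assume "y \<in> T"
    then obtain as c where y: "as \<in> lists A" "c \<in> C" "y = \<rho> (word as \<otimes> c) x0" by (auto simp: T_def)
    then have "word as \<otimes> c \<in> carrier G" using word_closed[OF y(1)] C(2) by blast
    then show "y \<in> V" using rV x0(1) y(3) by simp
  qed
  have count: "countable T"
    unfolding T_def using A(1) C(1)
    by (intro countable_image countable_SIGMA countable_lists countable_finite)
  have "V \<subseteq> Sp.span T"
  proof (rule cyclic[OF T_V])
    show "x0 \<in> T" using T_eq[of \<one>] x0 r_one by simp
    fix g x assume g: "g \<in> carrier G" and "x \<in> T"
    then obtain as c where ac: "as \<in> lists A" "c \<in> C" "x = \<rho> (word as \<otimes> c) x0" by (auto simp: T_def)
    then have w: "word as \<otimes> c \<in> carrier G" using word_closed[OF ac(1)] C(2) by blast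
    then have "\<rho> g x = \<rho> (g \<otimes> (word as \<otimes> c)) x0" unfolding ac(3) using g x0 by (subst r_mult) auto
    then show "\<rho> g x \<in> Sp.span T" using T_eq[of "g \<otimes> (word as \<otimes> c)"] g w Sp.span_base by simp
  qed (rule x0(2))
  interpret countable_operators scale V T by unfold_locales fact+
  have op: "op_on (\<rho> g)" if "g \<in> carrier G" for g
    using that rV r_add r_scale by (auto simp: op_on_def)
  \<comment> \<open>Outside these countably many values every \<open>a - \<xi>\<close> is injective;
    next it is shown to be onto.\<close>
  define \<Lambda> where "\<Lambda> = (\<Union>a\<in>A. {\<xi>. \<exists>x\<in>V. x \<noteq> 0 \<and> \<rho> a x = scale \<xi> x})"
  have L_count: "countable \<Lambda>" unfolding \<Lambda>_def
    using A op by (intro countable_UN countable_finite countable_eigenvalues) auto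
  have resolvent: "\<exists>y\<in>V. \<rho> a y - scale \<xi> y = x" if l: "\<xi> \<notin> \<Lambda>" and a: "a \<in> A" and x: "x \<in> V" for \<xi> a x
  proof -
    \<comment> \<open>The identity outside \<open>V\<close> makes the factors commute as functions,
      so that reordering a \<open>fold\<close> is an equality of functions.\<close>
    define D where "D b z = (if z \<in> V then \<rho> b z - scale \<xi> z else z)" for b z
    have D_V: "D b z \<in> V" if "b \<in> A" "z \<in> V" for b z
      using that A(2) rV by (auto simp: D_def intro!: Sp.subspace_diff[OF V_sub] Sp.subspace_scale[OF V_sub])
    have D_inj: "z = 0" if "b \<in> A" "z \<in> V" "D b z = 0" for b z
      using that l unfolding \<Lambda>_def D_def by auto
    have D_comm: "D b (D c z) = D c (D b z)" if bc: "b \<in> A" "c \<in> A" for b c z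
    proof (cases "z \<in> V")
      case True
      have car: "b \<in> carrier G" "c \<in> carrier G" using bc A(2) by auto
      have "\<rho> b (\<rho> c z) = \<rho> c (\<rho> b z)" using comm[OF bc] r_mult car True by metis
      then show ?thesis using True D_V[OF bc(1) True] D_V[OF bc(2) True] car
        by (simp add: D_def op_on_diff[OF op] op_on_scale[OF op] rV Sp.subspace_scale[OF V_sub]
            Sp.scale_right_diff_distrib algebra_simps)
    qed (simp add: D_def)
    have D_add: "D b (y + z) = D b y + D b z" if "b \<in> A" "y \<in> V" "z \<in> V" for b y z
      using that A(2) by (auto simp: D_def r_add Sp.subspace_add[OF V_sub] Sp.scale_right_distrib subset_iff)
    have D_scale: "D b (scale k z) = scale k (D b z)" if "b \<in> A" "z \<in> V" for b k z
      using that A(2) by (auto simp: D_def r_scale Sp.subspace_scale[OF V_sub] Sp.scale_right_diff_distrib mult.commute subset_iff)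
    have F_V: "fold D bs z \<in> V" if "set bs \<subseteq> A" "z \<in> V" for bs z
      using that by (induction bs arbitrary: z) (auto simp: D_V)
    have F_inj: "fold D bs z = 0 \<Longrightarrow> z = 0" if "set bs \<subseteq> A" "z \<in> V" for bs z
      using that
    proof (induction bs arbitrary: z)
      case (Cons b bs)
      then have "D b z = 0" using Cons.IH[of "D b z"] D_V by simp
      then show ?case using D_inj[of b z] Cons.prems by simp
    qed simp
    have F_add: "fold D bs (y + z) = fold D bs y + fold D bs z" if "set bs \<subseteq> A" "y \<in> V" "z \<in> V" for bs y z
      using that by (induction bs arbitrary: y z) (auto simp: D_V D_add)
    have F_scale: "fold D bs (scale k z) = scale k (fold D bs z)" if "set bs \<subseteq> A" "z \<in> V" for bs k z
      using that by (induction bs arbitrary: z) (auto simp: D_V D_scale)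
    have F_equiv: "fold D bs = fold D cs" if "mset bs = mset cs" "set bs \<subseteq> A" for bs cs
    proof (rule fold_multiset_equiv[OF _ that(1)])
      fix b c assume "b \<in> set bs" "c \<in> set bs"
      then have "b \<in> A" "c \<in> A" using that(2) by auto
      then show "D b \<circ> D c = D c \<circ> D b" by (intro ext) (simp only: o_apply D_comm[of b c])
    qed
    obtain bs where bs: "set bs = A" "distinct bs" using finite_distinct_list[OF A(1)] by blast
    have equivariant: "\<rho> g (fold D bs z) = fold D bs (\<rho> g z)" if g: "g \<in> carrier G" and z: "z \<in> V" for g z
    proof -
      define k where "k b = g \<otimes> b \<otimes> inv g" for b
      have D_g: "\<rho> g (D b z) = D (k b) (\<rho> g z)" if b: "b \<in> A" and z: "z \<in> V" for b z
      proof -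
        have bc: "b \<in> carrier G" using b A(2) by auto
        have "\<rho> (k b) (\<rho> g z) = \<rho> (k b \<otimes> g) z" using bc g z by (simp add: r_mult k_def)
        also have "k b \<otimes> g = g \<otimes> b" using bc g by (simp add: k_def m_assoc)
        finally have "\<rho> (k b) (\<rho> g z) = \<rho> g (\<rho> b z)" using bc g z by (simp add: r_mult)
        then show ?thesis using bc g z
          by (simp add: D_def rV op_on_diff[OF op] op_on_scale[OF op] Sp.subspace_scale[OF V_sub])
      qed
      have "\<rho> g (fold D cs z) = fold D (map k cs) (\<rho> g z)" if "set cs \<subseteq> A" "z \<in> V" for cs z
        using that by (induction cs arbitrary: z) (auto simp: D_V D_g)
      then have "\<rho> g (fold D bs z) = fold D (map k bs) (\<rho> g z)" using bs z by simp
      moreover have inj: "inj_on k A"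
      proof (rule inj_onI)
        fix b c assume "b \<in> A" "c \<in> A" "k b = k c"
        moreover then have "b \<in> carrier G" "c \<in> carrier G" using A(2) by auto
        ultimately show "b = c" using g by (simp add: k_def)
      qed
      have "k ` A = A" using conj[OF g] by (intro endo_inj_surj[OF A(1) _ inj]) (auto simp: k_def)
      then have "mset (map k bs) = mset bs"
        using bs inj by (subst set_eq_iff_mset_eq_distinct[symmetric]) (auto simp: distinct_map)
      ultimately show ?thesis using F_equiv[of "map k bs" bs] bs \<open>k ` A = A\<close> by simp
    qed
    \<comment> \<open>The image of an operator that commutes with the group is a submodule, and it
      is not zero by injectivity.\<close>
    have "fold D bs ` V = {0} \<or> fold D bs ` V = V"
    proof (rule V_irr)
      show "fold D bs ` V \<subseteq> V" using F_V bs by blast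
      show "Sp.subspace (fold D bs ` V)"
      proof (rule Sp.subspaceI)
        show "0 \<in> fold D bs ` V"
          using F_scale[of bs 0 0] bs Sp.subspace_0[OF V_sub] by (intro image_eqI[of _ _ 0]) auto
        show "y + z \<in> fold D bs ` V" if "y \<in> fold D bs ` V" "z \<in> fold D bs ` V" for y z
          using that F_add bs Sp.subspace_add[OF V_sub] by (smt (verit, best) image_iff order_refl)
        show "scale k z \<in> fold D bs ` V" if "z \<in> fold D bs ` V" for k z
          using that F_scale bs Sp.subspace_scale[OF V_sub] by (smt (verit, best) image_iff order_refl)
      qed
      show "\<rho> g y \<in> fold D bs ` V" if "g \<in> carrier G" "y \<in> fold D bs ` V" for g y
        using that equivariant rV by auto
    qed
    moreover have "fold D bs ` V \<noteq> {0}" using F_inj[of bs x0] bs x0 by auto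
    ultimately have "x \<in> fold D bs ` V" using x by blast
    then obtain z where z: "z \<in> V" "x = fold D bs z" by blast
    \<comment> \<open>With the factor of \<open>a\<close> applied last, the rest of the product
      supplies a preimage of \<open>x\<close> under \<open>a - \<xi>\<close>.\<close>
    have "mset bs = mset (remove1 a bs @ [a])" using a bs by simp
    then have "fold D bs = fold D (remove1 a bs @ [a])" using F_equiv bs by blast
    then have "x = D a (fold D (remove1 a bs) z)" using z by simp
    moreover have "fold D (remove1 a bs) z \<in> V" using bs z set_remove1_subset[of a bs] by (intro F_V) auto
    ultimately show ?thesis by (auto simp: D_def)
  qed
  have joint: "\<exists>x\<in>V. x \<noteq> 0 \<and> (\<forall>b\<in>Q. \<exists>\<nu>. \<rho> b x = scale \<nu> x)" if "finite Q" "Q \<subseteq> A" for Q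
    using that
  proof (induction Q rule: finite_induct)
    case empty
    then show ?case using x0 by auto
  next
    case (insert a Q)
    then obtain x where x: "x \<in> V" "x \<noteq> 0" "\<forall>b\<in>Q. \<exists>\<nu>. \<rho> b x = scale \<nu> x" by auto
    then obtain \<chi> where \<chi>: "\<And>b. b \<in> Q \<Longrightarrow> \<rho> b x = scale (\<chi> b) x" by metis
    \<comment> \<open>The joint eigenspace is stable under \<open>a\<close> because \<open>A\<close>
      is commutative.\<close>
    define U where "U = {y \<in> V. \<forall>b\<in>Q. \<rho> b y = scale (\<chi> b) y}"
    have a: "a \<in> A" "a \<in> carrier G" using insert.prems A(2) by auto
    have Q: "b \<in> A" "b \<in> carrier G" if "b \<in> Q" for b using that insert.prems A(2) by auto
    have "\<exists>\<nu>. \<exists>z\<in>U. z \<noteq> 0 \<and> \<rho> a z = scale \<nu> z"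
    proof (rule eigenvector_exists[OF op[OF a(2)] _ _ _ _ x(2) L_count])
      show "Sp.subspace U"
        by (rule Sp.subspaceI)
          (auto simp: U_def Q r_0 r_add r_scale Sp.subspace_0[OF V_sub] Sp.subspace_add[OF V_sub]
            Sp.subspace_scale[OF V_sub] Sp.scale_right_distrib mult.commute)
      show "U \<subseteq> V" "x \<in> U" using x \<chi> by (auto simp: U_def)
      show "\<exists>y\<in>V. \<rho> a y - scale \<xi> y = x" if "\<xi> \<notin> \<Lambda>" for \<xi> using resolvent[OF that a(1) x(1)] .
      fix y assume y: "y \<in> U"
      have "\<rho> b (\<rho> a y) = scale (\<chi> b) (\<rho> a y)" if b: "b \<in> Q" for b
      proof -
        have "\<rho> b (\<rho> a y) = \<rho> a (\<rho> b y)"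
          using r_mult[of b a y] r_mult[of a b y] comm[OF a(1) Q(1)[OF b]] a Q[OF b] y by (simp add: U_def)
        then show ?thesis using y b a by (simp add: U_def r_scale)
      qed
      then show "\<rho> a y \<in> U" using y a rV by (simp add: U_def)
    qed
    then obtain \<nu> z where z: "z \<in> U" "z \<noteq> 0" "\<rho> a z = scale \<nu> z" by blast
    have "\<forall>b\<in>insert a Q. \<exists>\<nu>. \<rho> b z = scale \<nu> z" using z unfolding U_def by blast
    then show ?case using z unfolding U_def by blast
  qed
  obtain u where u: "u \<in> V" "u \<noteq> 0" "\<forall>b\<in>A. \<exists>\<nu>. \<rho> b u = scale \<nu> u" using joint[OF A(1) subset_refl] by blast
  then obtain \<chi> where \<chi>: "\<And>b. b \<in> A \<Longrightarrow> \<rho> b u = scale (\<chi> b) u" by metis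
  \<comment> \<open>The identity is inserted so that \<open>u\<close> itself belongs to the
    set.\<close>
  define T' where "T' = (\<lambda>c. \<rho> c u) ` (insert \<one> C)"
  have word_scalar: "\<exists>k. \<rho> (word as) (\<rho> c u) = scale k (\<rho> c u)" if "as \<in> lists A" "c \<in> carrier G" for as c
    using that(1)
  proof (induction as)
    case Nil
    have "\<rho> (word []) (\<rho> c u) = scale 1 (\<rho> c u)" using that u rV r_one by (simp add: word_def)
    then show ?case by blast
  next
    case (Cons a as)
    then obtain k where k: "\<rho> (word as) (\<rho> c u) = scale k (\<rho> c u)" by auto
    have a: "a \<in> A" "a \<in> carrier G" "as \<in> lists A" using Cons.hyps A(2) by auto
    \<comment> \<open>Moving \<open>a\<close> past \<open>c\<close> turns it into another element of
      \<open>A\<close>, for which \<open>u\<close> is again an eigenvector.\<close>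
    define a' where "a' = inv c \<otimes> a \<otimes> c"
    have a': "a' \<in> A" unfolding a'_def using conj[of "inv c" a] that a by simp
    have "a \<otimes> c = c \<otimes> a'" using that a by (simp add: a'_def m_assoc[symmetric])
    then have "\<rho> a (\<rho> c u) = \<rho> c (\<rho> a' u)"
      using a that u a' A(2) r_mult[of a c u] r_mult[of c a' u] by auto
    also have "\<dots> = scale (\<chi> a') (\<rho> c u)" using \<chi>[OF a'] that u by (simp add: r_scale)
    finally have *: "\<rho> a (\<rho> c u) = scale (\<chi> a') (\<rho> c u)" .
    have "\<rho> (word (a # as)) (\<rho> c u) = \<rho> a (\<rho> (word as) (\<rho> c u))"
      using a that u rV word_closed[OF a(3)] by (simp add: word_def r_mult)
    also have "\<dots> = scale (k * \<chi> a') (\<rho> c u)"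
      unfolding k using a that u rV by (simp add: r_scale *)
    finally show ?case by blast
  qed
  have "V \<subseteq> Sp.span T'"
  proof (rule cyclic)
    show "T' \<subseteq> V" using rV u C(2) by (auto simp: T'_def)
    show "u \<in> T'" using r_one u by (auto simp: T'_def)
    fix g x assume g: "g \<in> carrier G" and "x \<in> T'"
    then obtain c where c: "c \<in> carrier G" "x = \<rho> c u" using C(2) by (auto simp: T'_def)
    obtain as c' where d: "as \<in> lists A" "c' \<in> C" "g \<otimes> c = word as \<otimes> c'"
      using decomp[of "g \<otimes> c"] g c unfolding word_def by auto
    have c': "c' \<in> carrier G" using d C(2) by auto
    have "\<rho> g x = \<rho> (word as) (\<rho> c' u)"
      using r_mult[OF g c(1) u(1)] r_mult[OF word_closed[OF d(1)] c' u(1)] c d by simp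
    then obtain k where "\<rho> g x = scale k (\<rho> c' u)" using word_scalar[OF d(1) c'] by auto
    moreover have "\<rho> c' u \<in> T'" unfolding T'_def using d(2) by blast
    ultimately show "\<rho> g x \<in> Sp.span T'" using Sp.span_scale[OF Sp.span_base] by metis
  qed (rule u(2))
  moreover have "Sp.span T' \<subseteq> V" using rV u C(2) V_sub by (intro Sp.span_minimal) (auto simp: T'_def)
  moreover have "finite T'" using C(1) by (simp add: T'_def)
  ultimately show ?thesis unfolding finite_dim_def by blast
qed

text \<open>The case of an empty \<open>A\<close>, with the whole group as \<open>C\<close>.\<close>

lemma finite_dim_if_finite:
  fixes G (structure) and scale :: "complex \<Rightarrow> 'v::ab_group_add \<Rightarrow> 'v"
  assumes "group G" "vector_space scale" "finite (carrier G)" "irreducible_representation G scale V \<rho>"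
  shows "finite_dim scale V"
proof -
  interpret group G by fact
  show ?thesis
    by (rule finite_dim_if_virtually_abelian[OF assms(1,2), of "{}" "carrier G" V \<rho>]) (use assms in auto)
qed

section \<open>Affine Weyl groups are virtually abelian\<close>

definition transl :: "nat \<Rightarrow> real vec \<Rightarrow> real vec \<Rightarrow> real vec" where
  "transl n v = (\<lambda>x\<in>carrier_vec n. x + v)"

definition coroot :: "real vec \<Rightarrow> real vec" where
  "coroot a = (2 / scalar_prod a a) \<cdot>\<^sub>v a"

lemma transl_Bij: "v \<in> carrier_vec n \<Longrightarrow> transl n v \<in> Bij (carrier_vec n)"
proof -
  assume v: "v \<in> carrier_vec n"
  have "transl n v \<in> extensional (carrier_vec n)" by (simp add: transl_def)
  moreover have "bij_betw (transl n v) (carrier_vec n) (carrier_vec n)"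
    by (rule bij_betw_byWitness[where f' = "\<lambda>x. x - v"])
      (use v in \<open>auto simp: transl_def intro!: eq_vecI\<close>)
  ultimately show ?thesis by (simp add: Bij_def)
qed

lemma coroot_closed: "a \<in> carrier_vec n \<Longrightarrow> coroot a \<in> carrier_vec n"
  by (simp add: coroot_def)

context
  fixes n :: nat and R :: "real vec set"
  assumes rs: "root_system n R"
begin

lemma root_closed: "a \<in> R \<Longrightarrow> a \<in> carrier_vec n" and root_ne_0: "a \<in> R \<Longrightarrow> a \<noteq> 0\<^sub>v n"
  and finite_R: "finite R" and R_carrier: "R \<subseteq> carrier_vec n"
  and root_refl_closed: "a \<in> R \<Longrightarrow> b \<in> R \<Longrightarrow> aff_refl n a 0 b \<in> R"
  and R_span: "LinearCombinations.module.span class_ring (module_vec TYPE(real) n) R = carrier_vec n"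
  and root_uminus: "a \<in> R \<Longrightarrow> - 1 \<cdot>\<^sub>v a \<in> R"
  using rs unfolding root_system_def by blast+

abbreviation "BG \<equiv> BijGroup (carrier_vec n :: real vec set)"
abbreviation "gens \<equiv> {aff_refl n a k | a k. a \<in> R}"
abbreviation "lin_gens \<equiv> {aff_refl n a 0 | a. a \<in> R}"

interpretation BG: group BG by (rule group_BijGroup)

lemma refl_BG: "a \<in> R \<Longrightarrow> aff_refl n a k \<in> Bij (carrier_vec n)"
  using aff_refl_Bij root_closed root_ne_0 by blast

lemma gens_BG: "gens \<subseteq> carrier BG" "lin_gens \<subseteq> carrier BG"
  using refl_BG by auto

lemma generate_BG: "generate BG gens \<subseteq> Bij (carrier_vec n)" "generate BG lin_gens \<subseteq> Bij (carrier_vec n)"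
  using BG.generate_incl gens_BG by auto

lemma lin_gens_subset: "generate BG lin_gens \<subseteq> generate BG gens"
  by (rule BG.mono_generate) blast

lemma refl_square: "a \<in> R \<Longrightarrow> aff_refl n a k \<otimes>\<^bsub>BG\<^esub> aff_refl n a k = \<one>\<^bsub>BG\<^esub>"
  by (rule Bij_eqI[of _ "carrier_vec n"])
    (use refl_BG BG.m_closed[of "aff_refl n a k" "aff_refl n a k"] id_Bij in
      \<open>auto simp: BijGroup_mult_apply one_BijGroup aff_refl_involution root_closed root_ne_0\<close>)

lemma refl_inv: "a \<in> R \<Longrightarrow> inv\<^bsub>BG\<^esub> aff_refl n a k = aff_refl n a k"
  using BG.inv_equality[OF refl_square] refl_BG by simp

lemma transl_mult:
  "v \<in> carrier_vec n \<Longrightarrow> w \<in> carrier_vec n \<Longrightarrow> transl n v \<otimes>\<^bsub>BG\<^esub> transl n w = transl n (v + w)"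
  by (rule Bij_eqI[of _ "carrier_vec n"])
    (use transl_Bij BG.m_closed[of "transl n v" "transl n w"] in
      \<open>auto simp: BijGroup_mult_apply transl_def intro!: eq_vecI\<close>)

lemma refl_decomp:
  assumes a: "a \<in> R"
  shows "aff_refl n a k = transl n (of_int k \<cdot>\<^sub>v coroot a) \<otimes>\<^bsub>BG\<^esub> aff_refl n a 0"
proof (rule Bij_eqI)
  have v: "of_int k \<cdot>\<^sub>v coroot a \<in> carrier_vec n" using root_closed[OF a] by (simp add: coroot_closed)
  show "transl n (of_int k \<cdot>\<^sub>v coroot a) \<otimes>\<^bsub>BG\<^esub> aff_refl n a 0 \<in> Bij (carrier_vec n)"
    using BG.m_closed transl_Bij[OF v] refl_BG[OF a] by simp
  fix x :: "real vec" assume x: "x \<in> carrier_vec n"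
  then show "aff_refl n a k x = (transl n (of_int k \<cdot>\<^sub>v coroot a) \<otimes>\<^bsub>BG\<^esub> aff_refl n a 0) x"
    using root_closed[OF a] refl_BG[OF a] transl_Bij[OF v]
    by (intro eq_vecI) (auto simp: BijGroup_mult_apply transl_def aff_refl_apply coroot_def diff_divide_distrib algebra_simps)
qed (rule refl_BG[OF a])

lemma refl_transl:
  assumes a: "a \<in> R" and v: "v \<in> carrier_vec n"
  shows "aff_refl n a k \<otimes>\<^bsub>BG\<^esub> transl n v = transl n (aff_refl n a 0 v) \<otimes>\<^bsub>BG\<^esub> aff_refl n a k"
proof (rule Bij_eqI)
  have v': "aff_refl n a 0 v \<in> carrier_vec n" using aff_refl_closed root_closed a v by blast
  show "aff_refl n a k \<otimes>\<^bsub>BG\<^esub> transl n v \<in> Bij (carrier_vec n)"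
    "transl n (aff_refl n a 0 v) \<otimes>\<^bsub>BG\<^esub> aff_refl n a k \<in> Bij (carrier_vec n)"
    using BG.m_closed transl_Bij v v' refl_BG[OF a] by simp_all
  fix x :: "real vec" assume x: "x \<in> carrier_vec n"
  have "scalar_prod (x + v) a = scalar_prod x a + scalar_prod v a"
    using x v root_closed[OF a] by (intro add_scalar_prod_distrib)
  then show "(aff_refl n a k \<otimes>\<^bsub>BG\<^esub> transl n v) x = (transl n (aff_refl n a 0 v) \<otimes>\<^bsub>BG\<^esub> aff_refl n a k) x"
    using x v v' root_closed[OF a] refl_BG[OF a] transl_Bij[OF v] transl_Bij[OF v'] aff_refl_closed[OF root_closed[OF a] x]
    by (intro eq_vecI) (auto simp: BijGroup_mult_apply transl_def aff_refl_apply diff_divide_distrib add_divide_distrib algebra_simps)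
qed

lemma refl_coroot:
  assumes a: "a \<in> R" and b: "b \<in> R"
  shows "aff_refl n a 0 (coroot b) = coroot (aff_refl n a 0 b)"
proof -
  have c: "a \<in> carrier_vec n" "b \<in> carrier_vec n" using a b root_closed by auto
  define q where "q = scalar_prod a a"
  define r where "r = scalar_prod b a"
  define s where "s = scalar_prod b b"
  have q: "0 < q" using scalar_prod_self_pos c root_ne_0[OF a] by (simp add: q_def)
  define b' where "b' = aff_refl n a 0 b"
  have b': "b' = b - (2 * r / q) \<cdot>\<^sub>v a" using c by (simp add: b'_def aff_refl_apply r_def q_def)
  have "scalar_prod a b = r" using c comm_scalar_prod[of b n a] by (simp add: r_def)
  then have "scalar_prod b' b' = s - 2 * (2 * r / q) * r + (2 * r / q) * (2 * r / q) * q"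
    unfolding b' using c
    by (simp add: minus_scalar_prod_distrib[of _ n] scalar_prod_minus_distrib[of _ n] r_def[symmetric] s_def[symmetric]
        q_def[symmetric] algebra_simps)
  also have "\<dots> = s" using q by (simp add: field_simps)
  finally have "coroot b' = (2 / s) \<cdot>\<^sub>v b'" by (simp add: coroot_def)
  also have "\<dots> = aff_refl n a 0 (coroot b)"
    unfolding b' using c
    by (intro eq_vecI) (auto simp: aff_refl_apply coroot_def s_def[symmetric] r_def[symmetric] q_def[symmetric] algebra_simps)
  finally show ?thesis by (simp add: b'_def)
qed

text \<open>Finite, stable under conjugation by the group and under inversion, this set stands in
  for the coroot lattice that it generates.\<close>

definition "lattice_gens = {transl n (coroot a) | a. a \<in> R}"

lemma lattice_gens_BG: "lattice_gens \<subseteq> Bij (carrier_vec n)"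
  using transl_Bij coroot_closed root_closed by (auto simp: lattice_gens_def)

text \<open>A reflection of any level conjugates a translation through its linear part only, and
  linear reflections permute the coroots.\<close>

lemma lattice_gens_conj:
  assumes "g \<in> generate BG gens" "t \<in> lattice_gens"
  shows "\<exists>t'\<in>lattice_gens. g \<otimes>\<^bsub>BG\<^esub> t = t' \<otimes>\<^bsub>BG\<^esub> g"
  using assms
proof (induction arbitrary: t)
  case one
  then show ?case using lattice_gens_BG BG.r_one BG.l_one by (intro bexI[of _ t]) auto
next
  case (incl h)
  then obtain a k b where "a \<in> R" "h = aff_refl n a k" "b \<in> R" "t = transl n (coroot b)"
    by (auto simp: lattice_gens_def)
  then show ?case using refl_transl[of a "coroot b" k] refl_coroot[of a b] root_refl_closed coroot_closed root_closed
    by (auto simp: lattice_gens_def intro!: bexI[of _ "transl n (coroot (aff_refl n a 0 b))"])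
next
  case (inv h)
  then obtain a k b where "a \<in> R" "h = aff_refl n a k" "b \<in> R" "t = transl n (coroot b)"
    by (auto simp: lattice_gens_def)
  then show ?case using refl_transl[of a "coroot b" k] refl_coroot[of a b] root_refl_closed coroot_closed root_closed
    by (auto simp: lattice_gens_def refl_inv intro!: bexI[of _ "transl n (coroot (aff_refl n a 0 b))"])
next
  case (eng g h)
  then have car: "g \<in> carrier BG" "h \<in> carrier BG" "t \<in> carrier BG" using generate_BG lattice_gens_BG by auto
  obtain t' where t': "t' \<in> lattice_gens" "h \<otimes>\<^bsub>BG\<^esub> t = t' \<otimes>\<^bsub>BG\<^esub> h" using eng by blast
  obtain t'' where t'': "t'' \<in> lattice_gens" "g \<otimes>\<^bsub>BG\<^esub> t' = t'' \<otimes>\<^bsub>BG\<^esub> g" using eng t' by blast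
  have car': "t' \<in> carrier BG" "t'' \<in> carrier BG" using t' t'' lattice_gens_BG by auto
  have "(g \<otimes>\<^bsub>BG\<^esub> h) \<otimes>\<^bsub>BG\<^esub> t = g \<otimes>\<^bsub>BG\<^esub> (t' \<otimes>\<^bsub>BG\<^esub> h)"
    using BG.m_assoc car t' by metis
  also have "\<dots> = (t'' \<otimes>\<^bsub>BG\<^esub> g) \<otimes>\<^bsub>BG\<^esub> h" using BG.m_assoc car car' t'' by metis
  also have "\<dots> = t'' \<otimes>\<^bsub>BG\<^esub> (g \<otimes>\<^bsub>BG\<^esub> h)" using BG.m_assoc car car' by metis
  finally show ?case using t'' by blast
qed

lemma lattice_gens_subset: "lattice_gens \<subseteq> generate BG gens"
proof
  fix t assume "t \<in> lattice_gens"
  then obtain a where a: "a \<in> R" "t = transl n (coroot a)" by (auto simp: lattice_gens_def)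
  then have car: "t \<in> carrier BG" "aff_refl n a 0 \<in> carrier BG" using refl_BG transl_Bij coroot_closed root_closed by auto
  have "aff_refl n a 1 = t \<otimes>\<^bsub>BG\<^esub> aff_refl n a 0" using refl_decomp[OF a(1), of 1] a(2) by simp
  then have eq: "aff_refl n a 1 \<otimes>\<^bsub>BG\<^esub> aff_refl n a 0 = t"
    using BG.m_assoc car refl_square[OF a(1), of 0] BG.r_one by metis
  have "aff_refl n a 1 \<in> gens" "aff_refl n a 0 \<in> gens" using a(1) by blast+
  from this[THEN generate.incl] show "t \<in> generate BG gens" unfolding eq[symmetric] by (rule generate.eng)
qed

definition word :: "(real vec \<Rightarrow> real vec) list \<Rightarrow> real vec \<Rightarrow> real vec" where
  "word as = foldr (\<lambda>x y. x \<otimes>\<^bsub>BG\<^esub> y) as \<one>\<^bsub>BG\<^esub>"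

lemma word_Nil [simp]: "word [] = \<one>\<^bsub>BG\<^esub>"
  and word_Cons [simp]: "word (a # as) = a \<otimes>\<^bsub>BG\<^esub> word as"
  by (simp_all add: word_def)

lemma word_closed: "as \<in> lists lattice_gens \<Longrightarrow> word as \<in> carrier BG"
proof (induction as)
  case (Cons a as)
  then show ?case using BG.m_closed[of a "word as"] lattice_gens_BG by auto
qed (use id_Bij in \<open>simp add: one_BijGroup\<close>)

lemma word_append: "as \<in> lists lattice_gens \<Longrightarrow> bs \<in> lists lattice_gens \<Longrightarrow> word (as @ bs) = word as \<otimes>\<^bsub>BG\<^esub> word bs"
proof (induction as)
  case Nil
  then show ?case using BG.l_one[OF word_closed[of bs]] by simp
next
  case (Cons a as)
  then have "word as \<in> carrier BG" "word bs \<in> carrier BG" "a \<in> carrier BG"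
    using word_closed lattice_gens_BG by auto
  then show ?case using Cons BG.m_assoc[of a "word as" "word bs"] by (auto simp del: carrier_BijGroup)
qed

lemma word_conj:
  assumes g: "g \<in> generate BG gens"
  shows "as \<in> lists lattice_gens \<Longrightarrow> \<exists>bs\<in>lists lattice_gens. g \<otimes>\<^bsub>BG\<^esub> word as = word bs \<otimes>\<^bsub>BG\<^esub> g"
proof (induction as)
  case Nil
  have "g \<in> carrier BG" using g generate_BG by auto
  then have "g \<otimes>\<^bsub>BG\<^esub> \<one>\<^bsub>BG\<^esub> = \<one>\<^bsub>BG\<^esub> \<otimes>\<^bsub>BG\<^esub> g" using BG.l_one BG.r_one by simp
  then have "g \<otimes>\<^bsub>BG\<^esub> word [] = word [] \<otimes>\<^bsub>BG\<^esub> g" unfolding word_Nil .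
  show ?case by (rule bexI[of _ "[]"]) (fact, simp)
next
  case (Cons a as)
  have a: "a \<in> lattice_gens" "as \<in> lists lattice_gens" using Cons.prems by auto
  obtain bs where bs: "bs \<in> lists lattice_gens" "g \<otimes>\<^bsub>BG\<^esub> word as = word bs \<otimes>\<^bsub>BG\<^esub> g"
    using Cons.IH[OF a(2)] by (elim bexE)
  obtain b where b: "b \<in> lattice_gens" "g \<otimes>\<^bsub>BG\<^esub> a = b \<otimes>\<^bsub>BG\<^esub> g" using lattice_gens_conj[OF g a(1)] by blast
  have car: "g \<in> carrier BG" "a \<in> carrier BG" "b \<in> carrier BG" "word as \<in> carrier BG" "word bs \<in> carrier BG"
    using g generate_BG a b bs lattice_gens_BG word_closed[of as] word_closed[of bs] by auto
  have "g \<otimes>\<^bsub>BG\<^esub> word (a # as) = (g \<otimes>\<^bsub>BG\<^esub> a) \<otimes>\<^bsub>BG\<^esub> word as" using BG.m_assoc[OF car(1,2,4)] by simp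
  also have "\<dots> = b \<otimes>\<^bsub>BG\<^esub> (g \<otimes>\<^bsub>BG\<^esub> word as)" unfolding b(2) by (rule BG.m_assoc[OF car(3,1,4)])
  also have "\<dots> = word (b # bs) \<otimes>\<^bsub>BG\<^esub> g" unfolding bs(2) using BG.m_assoc[OF car(3,5,1)] by simp
  finally have "g \<otimes>\<^bsub>BG\<^esub> word (a # as) = word (b # bs) \<otimes>\<^bsub>BG\<^esub> g" .
  then show ?case using b(1) bs(1) by (intro bexI[of _ "b # bs"]) simp_all
qed

lemma transl_nat_word:
  assumes a: "a \<in> R"
  shows "transl n (of_nat m \<cdot>\<^sub>v coroot a) = word (replicate m (transl n (coroot a)))"
proof (induction m)
  case 0
  show ?case
    by (rule ext) (use coroot_closed[OF root_closed[OF a]] in \<open>auto simp: transl_def one_BijGroup restrict_def intro!: eq_vecI\<close>)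
next
  case (Suc m)
  have "real (Suc m) \<cdot>\<^sub>v coroot a = coroot a + real m \<cdot>\<^sub>v coroot a"
    by (intro eq_vecI) (auto simp: algebra_simps)
  moreover have "transl n (coroot a + real m \<cdot>\<^sub>v coroot a) = transl n (coroot a) \<otimes>\<^bsub>BG\<^esub> transl n (real m \<cdot>\<^sub>v coroot a)"
    using coroot_closed[OF root_closed[OF a]] by (simp add: transl_mult)
  ultimately show ?case using Suc by simp
qed

lemma transl_int_word:
  assumes a: "a \<in> R"
  shows "\<exists>as\<in>lists lattice_gens. transl n (of_int k \<cdot>\<^sub>v coroot a) = word as"
proof (cases "0 \<le> k")
  case True
  then have "of_int k \<cdot>\<^sub>v coroot a = real (nat k) \<cdot>\<^sub>v coroot a" by simp
  then show ?thesis using transl_nat_word[OF a, of "nat k"] a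
    by (intro bexI[of _ "replicate (nat k) (transl n (coroot a))"]) (auto simp: lattice_gens_def)
next
  case False
  \<comment> \<open>Words contain no inverses, so a negative multiple is taken along the opposite
    root.\<close>
  let ?b = "- 1 \<cdot>\<^sub>v a"
  have b: "?b \<in> R" using root_uminus a .
  have "scalar_prod ?b ?b = scalar_prod a a" using root_closed[OF a] by simp
  then have "of_int k \<cdot>\<^sub>v coroot a = real (nat (- k)) \<cdot>\<^sub>v coroot ?b"
    using False by (intro eq_vecI) (auto simp: coroot_def)
  then show ?thesis using transl_nat_word[OF b, of "nat (- k)"] b
    by (intro bexI[of _ "replicate (nat (- k)) (transl n (coroot ?b))"]) (auto simp: lattice_gens_def)
qed

text \<open>By \<open>refl_decomp\<close> each generator is a translation times a linear reflection;
  in a product the inner translations move to the left by \<open>word_conj\<close>.\<close>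

lemma affine_decomp:
  assumes "g \<in> generate BG gens"
  shows "\<exists>as\<in>lists lattice_gens. \<exists>c\<in>generate BG lin_gens. g = word as \<otimes>\<^bsub>BG\<^esub> c"
  using assms
proof induction
  case one
  have "\<one>\<^bsub>BG\<^esub> = word [] \<otimes>\<^bsub>BG\<^esub> \<one>\<^bsub>BG\<^esub>" using BG.l_one[OF BG.one_closed] by simp
  then show ?case using generate.one[of BG lin_gens] by blast
next
  case (incl h)
  then obtain a k where a: "a \<in> R" "h = aff_refl n a k" by blast
  then obtain as where as: "as \<in> lists lattice_gens" "transl n (of_int k \<cdot>\<^sub>v coroot a) = word as"
    using transl_int_word by blast
  have "aff_refl n a 0 \<in> lin_gens" using a(1) by blast
  then have "aff_refl n a 0 \<in> generate BG lin_gens" by (rule generate.incl)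
  moreover have "h = word as \<otimes>\<^bsub>BG\<^esub> aff_refl n a 0" unfolding a(2) as(2)[symmetric] by (rule refl_decomp[OF a(1)])
  ultimately show ?case using as(1) by blast
next
  case (inv h)
  then obtain a k where a: "a \<in> R" "h = aff_refl n a k" by blast
  then obtain as where as: "as \<in> lists lattice_gens" "transl n (of_int k \<cdot>\<^sub>v coroot a) = word as"
    using transl_int_word by blast
  have "aff_refl n a 0 \<in> lin_gens" using a(1) by blast
  then have "aff_refl n a 0 \<in> generate BG lin_gens" by (rule generate.incl)
  moreover have "inv\<^bsub>BG\<^esub> h = word as \<otimes>\<^bsub>BG\<^esub> aff_refl n a 0" unfolding a(2) refl_inv[OF a(1)] as(2)[symmetric] by (rule refl_decomp[OF a(1)])
  ultimately show ?case using as(1) by blast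
next
  case (eng g h)
  then obtain as c bs d where d: "as \<in> lists lattice_gens" "c \<in> generate BG lin_gens" "g = word as \<otimes>\<^bsub>BG\<^esub> c"
    "bs \<in> lists lattice_gens" "d \<in> generate BG lin_gens" "h = word bs \<otimes>\<^bsub>BG\<^esub> d" by blast
  obtain cs where cs: "cs \<in> lists lattice_gens" "c \<otimes>\<^bsub>BG\<^esub> word bs = word cs \<otimes>\<^bsub>BG\<^esub> c"
    using word_conj[OF _ d(4), of c] d(2) lin_gens_subset by blast
  have car: "c \<in> carrier BG" "d \<in> carrier BG" "word as \<in> carrier BG" "word bs \<in> carrier BG" "word cs \<in> carrier BG"
    using d cs generate_BG word_closed by auto
  have "g \<otimes>\<^bsub>BG\<^esub> h = word as \<otimes>\<^bsub>BG\<^esub> ((c \<otimes>\<^bsub>BG\<^esub> word bs) \<otimes>\<^bsub>BG\<^esub> d)"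
    unfolding d(3,6) using car by (simp add: BG.m_assoc del: carrier_BijGroup)
  also have "\<dots> = word (as @ cs) \<otimes>\<^bsub>BG\<^esub> (c \<otimes>\<^bsub>BG\<^esub> d)"
    unfolding cs word_append[OF d(1) cs(1)] using car by (simp add: BG.m_assoc del: carrier_BijGroup)
  finally have "g \<otimes>\<^bsub>BG\<^esub> h = word (as @ cs) \<otimes>\<^bsub>BG\<^esub> (c \<otimes>\<^bsub>BG\<^esub> d)" .
  moreover have "as @ cs \<in> lists lattice_gens" using d cs by simp
  moreover have "c \<otimes>\<^bsub>BG\<^esub> d \<in> generate BG lin_gens" using d by (intro generate.eng)
  ultimately show ?case by blast
qed

lemma lin_part:
  assumes "g \<in> generate BG lin_gens"
  shows "(\<forall>x\<in>carrier_vec n. \<forall>y\<in>carrier_vec n. g (x + y) = g x + g y) \<and>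
    (\<forall>c. \<forall>x\<in>carrier_vec n. g (c \<cdot>\<^sub>v x) = c \<cdot>\<^sub>v g x) \<and> g ` R \<subseteq> R"
  using assms
proof induction
  case one
  then show ?case using R_carrier by (auto simp: one_BijGroup)
next
  case (incl h)
  then obtain a where a: "a \<in> R" "h = aff_refl n a 0" by blast
  have "h (x + y) = h x + h y" if "x \<in> carrier_vec n" "y \<in> carrier_vec n" for x y
  proof -
    have "scalar_prod (x + y) a = scalar_prod x a + scalar_prod y a"
      using that root_closed[OF a(1)] by (intro add_scalar_prod_distrib)
    then show ?thesis using that root_closed[OF a(1)] a
      by (intro eq_vecI) (auto simp: aff_refl_apply add_divide_distrib algebra_simps)
  qed
  moreover have "h (c \<cdot>\<^sub>v x) = c \<cdot>\<^sub>v h x" if "x \<in> carrier_vec n" for c x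
    using that root_closed[OF a(1)] a by (intro eq_vecI) (auto simp: aff_refl_apply algebra_simps)
  ultimately show ?case using a root_refl_closed by auto
next
  case (inv h)
  then obtain a where a: "a \<in> R" "h = aff_refl n a 0" by blast
  have "h (x + y) = h x + h y" if "x \<in> carrier_vec n" "y \<in> carrier_vec n" for x y
  proof -
    have "scalar_prod (x + y) a = scalar_prod x a + scalar_prod y a"
      using that root_closed[OF a(1)] by (intro add_scalar_prod_distrib)
    then show ?thesis using that root_closed[OF a(1)] a
      by (intro eq_vecI) (auto simp: aff_refl_apply add_divide_distrib algebra_simps)
  qed
  moreover have "h (c \<cdot>\<^sub>v x) = c \<cdot>\<^sub>v h x" if "x \<in> carrier_vec n" for c x
    using that root_closed[OF a(1)] a by (intro eq_vecI) (auto simp: aff_refl_apply algebra_simps)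
  ultimately show ?case using a root_refl_closed refl_inv by auto
next
  case (eng g h)
  have car: "g \<in> Bij (carrier_vec n)" "h \<in> Bij (carrier_vec n)" using eng.hyps generate_BG by auto
  let ?gh = "g \<otimes>\<^bsub>BG\<^esub> h"
  note app = BijGroup_mult_apply[OF car]
  have hc: "h x \<in> carrier_vec n" if "x \<in> carrier_vec n" for x using Bij_apply[OF car(2) that] .
  have g: "g (x + y) = g x + g y" "g (c \<cdot>\<^sub>v x) = c \<cdot>\<^sub>v g x" if "x \<in> carrier_vec n" "y \<in> carrier_vec n" for x y c
    using eng.IH(1) that by blast+
  have h: "h (x + y) = h x + h y" "h (c \<cdot>\<^sub>v x) = c \<cdot>\<^sub>v h x" if "x \<in> carrier_vec n" "y \<in> carrier_vec n" for x y c
    using eng.IH(2) that by blast+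
  have "?gh (x + y) = ?gh x + ?gh y" if xy: "x \<in> carrier_vec n" "y \<in> carrier_vec n" for x y
  proof -
    have "?gh (x + y) = g (h (x + y))" using xy by (intro app) simp
    then show ?thesis using h(1)[OF xy] g(1)[OF hc hc, OF xy] app xy by simp
  qed
  moreover have "?gh (c \<cdot>\<^sub>v x) = c \<cdot>\<^sub>v ?gh x" if x: "x \<in> carrier_vec n" for c x
  proof -
    have "?gh (c \<cdot>\<^sub>v x) = g (h (c \<cdot>\<^sub>v x))" using x by (intro app) simp
    then show ?thesis using h(2)[OF x x] g(2)[OF hc hc, OF x x] app x by simp
  qed
  moreover have "?gh ` R \<subseteq> R"
  proof
    fix z assume "z \<in> ?gh ` R"
    then obtain x where x: "x \<in> R" "z = ?gh x" by blast
    then have "z = g (h x)" using app R_carrier by auto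
    then show "z \<in> R" using x eng.IH by blast
  qed
  ultimately show ?case by blast
qed

text \<open>Linear elements map the finite set \<open>R\<close> into itself, and agreement on
  \<open>R\<close> extends to its span, which is the whole space.\<close>

lemma finite_lin_gens: "finite (generate BG lin_gens)"
proof -
  let ?q = "\<lambda>g. restrict g R"
  interpret vec_space "TYPE(real)" n .
  have "?q ` generate BG lin_gens \<subseteq> R \<rightarrow>\<^sub>E R"
  proof
    fix f assume "f \<in> ?q ` generate BG lin_gens"
    then obtain g where "g \<in> generate BG lin_gens" "f = restrict g R" by blast
    then show "f \<in> R \<rightarrow>\<^sub>E R" using lin_part[of g] by auto
  qed
  then have "finite (?q ` generate BG lin_gens)" using finite_R by (meson finite_PiE finite_subset)
  moreover have "inj_on ?q (generate BG lin_gens)"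
  proof (rule inj_onI)
    fix g h assume g: "g \<in> generate BG lin_gens" and h: "h \<in> generate BG lin_gens" and eq: "?q g = ?q h"
    have bij: "g \<in> Bij (carrier_vec n)" "h \<in> Bij (carrier_vec n)" using g h generate_BG by auto
    define E where "E = {x \<in> carrier_vec n. g x = h x}"
    have "g x = h x" if "x \<in> R" for x using fun_cong[OF eq, of x] that by simp
    then have "R \<subseteq> E" using R_carrier unfolding E_def by blast
    moreover have "submodule class_ring E V"
    proof
      show "E \<subseteq> carrier V" by (auto simp: E_def)
      show "v \<oplus>\<^bsub>V\<^esub> w \<in> E" if "v \<in> E" "w \<in> E" for v w
        using that lin_part[OF g] lin_part[OF h] by (auto simp: E_def module_vec_simps)
      have zero: "f (0\<^sub>v n) = 0\<^sub>v n" if f: "f \<in> generate BG lin_gens" for f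
      proof -
        have "f (0 \<cdot>\<^sub>v 0\<^sub>v n) = 0 \<cdot>\<^sub>v f (0\<^sub>v n)" using lin_part[OF f] zero_carrier_vec by blast
        moreover have "0 \<cdot>\<^sub>v 0\<^sub>v n = (0\<^sub>v n :: real vec)" by (intro eq_vecI) auto
        moreover have "f \<in> Bij (carrier_vec n)" using f generate_BG by blast
        then have "f (0\<^sub>v n) \<in> carrier_vec n" by (rule Bij_apply) simp
        then have "0 \<cdot>\<^sub>v f (0\<^sub>v n) = 0\<^sub>v n" by (intro eq_vecI) auto
        ultimately show ?thesis by simp
      qed
      show "\<zero>\<^bsub>V\<^esub> \<in> E" using zero[OF g] zero[OF h] by (simp add: E_def module_vec_simps)
      show "c \<odot>\<^bsub>V\<^esub> v \<in> E" if "c \<in> carrier class_ring" "v \<in> E" for c v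
        using that lin_part[OF g] lin_part[OF h] by (auto simp: E_def module_vec_simps)
    qed
    ultimately have "span R \<subseteq> E" by (rule span_is_subset)
    then have "\<And>x. x \<in> carrier_vec n \<Longrightarrow> g x = h x" using R_span by (auto simp: E_def)
    then show "g = h" using Bij_eqI bij by blast
  qed
  ultimately show ?thesis using finite_imageD by blast
qed

lemma affine_weyl_group_finite_dim:
  fixes scale :: "complex \<Rightarrow> 'v::ab_group_add \<Rightarrow> 'v"
  assumes vs: "vector_space scale"
    and irr: "irreducible_representation (affine_weyl_group_of n R) scale V \<rho>"
  shows "finite_dim scale V"
proof -
  let ?G = "affine_weyl_group_of n R"
  have sub: "subgroup (generate BG gens) BG" using BG.generate_is_subgroup gens_BG by blast
  have G: "?G = BG\<lparr>carrier := generate BG gens\<rparr>" by (simp add: affine_weyl_group_of_def)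
  have grp: "group ?G" unfolding G using sub BG.subgroup_imp_group by blast
  have mult: "x \<otimes>\<^bsub>?G\<^esub> y = x \<otimes>\<^bsub>BG\<^esub> y" and one: "\<one>\<^bsub>?G\<^esub> = \<one>\<^bsub>BG\<^esub>" and car: "carrier ?G = generate BG gens" for x y
    by (simp_all add: G)
  interpret G: group ?G by (rule grp)
  show ?thesis
  proof (rule finite_dim_if_virtually_abelian[OF grp vs, of lattice_gens "generate BG lin_gens" V \<rho>])
    show "finite lattice_gens" using finite_R by (simp add: lattice_gens_def setcompr_eq_image)
    show "lattice_gens \<subseteq> carrier ?G" using lattice_gens_subset car by simp
    show "a \<otimes>\<^bsub>?G\<^esub> b = b \<otimes>\<^bsub>?G\<^esub> a" if ab: "a \<in> lattice_gens" "b \<in> lattice_gens" for a b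
    proof -
      obtain x y where "x \<in> R" "y \<in> R" "a = transl n (coroot x)" "b = transl n (coroot y)"
        using ab by (auto simp: lattice_gens_def)
      then show ?thesis unfolding mult
        using coroot_closed root_closed by (simp add: transl_mult comm_add_vec[of _ n])
    qed
    show "g \<otimes>\<^bsub>?G\<^esub> a \<otimes>\<^bsub>?G\<^esub> inv\<^bsub>?G\<^esub> g \<in> lattice_gens" if g: "g \<in> carrier ?G" and a: "a \<in> lattice_gens" for g a
    proof -
      obtain a' where a': "a' \<in> lattice_gens" "g \<otimes>\<^bsub>?G\<^esub> a = a' \<otimes>\<^bsub>?G\<^esub> g"
        using lattice_gens_conj[of g a] g a unfolding car mult by blast
      have "a' \<in> carrier ?G" using a' lattice_gens_subset car by auto
      then show ?thesis using a' g by (simp add: G.m_assoc)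
    qed
    show "finite (generate BG lin_gens)" by (rule finite_lin_gens)
    show "generate BG lin_gens \<subseteq> carrier ?G" using lin_gens_subset car by simp
    show "\<exists>as\<in>lists lattice_gens. \<exists>c\<in>generate BG lin_gens. g = foldr (\<lambda>x y. x \<otimes>\<^bsub>?G\<^esub> y) as \<one>\<^bsub>?G\<^esub> \<otimes>\<^bsub>?G\<^esub> c"
      if "g \<in> carrier ?G" for g
      using affine_decomp[of g] that unfolding car mult one word_def .
  qed (rule irr)
qed

end

lemma irreducible_representation_iso:
  fixes scale :: "complex \<Rightarrow> 'v::ab_group_add \<Rightarrow> 'v"
  assumes "group G" "group H" and f: "f \<in> iso G H" and irr: "irreducible_representation G scale V \<rho>"
  shows "irreducible_representation H scale V (\<lambda>h. \<rho> (inv_into (carrier G) f h))"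
proof -
  interpret G: group G by fact
  interpret H: group H by fact
  define k where "k = inv_into (carrier G) f"
  have k: "k \<in> iso H G" unfolding k_def using G.iso_set_sym[OF f] .
  then have kc: "\<And>h. h \<in> carrier H \<Longrightarrow> k h \<in> carrier G"
    and km: "\<And>g h. g \<in> carrier H \<Longrightarrow> h \<in> carrier H \<Longrightarrow> k (g \<otimes>\<^bsub>H\<^esub> h) = k g \<otimes>\<^bsub>G\<^esub> k h"
    and ks: "k ` carrier H = carrier G"
    by (auto simp: iso_def hom_def bij_betw_def)
  have k1: "k \<one>\<^bsub>H\<^esub> = \<one>\<^bsub>G\<^esub>" using k hom_one[of k H G] assms by (simp add: iso_def)
  have "(\<forall>g\<in>carrier H. \<forall>x\<in>U. \<rho> (k g) x \<in> U) \<longleftrightarrow> (\<forall>g\<in>carrier G. \<forall>x\<in>U. \<rho> g x \<in> U)" for U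
    unfolding ks[symmetric] by blast
  then show ?thesis
    using irr unfolding irreducible_representation_def representation_def k_def[symmetric]
    by (simp add: kc km k1)
qed

lemma affine_weyl_finite_dim:
  fixes scale :: "complex \<Rightarrow> 'v::ab_group_add \<Rightarrow> 'v"
  assumes "group W" "affine_weyl W S" "vector_space scale" "irreducible_representation W scale V \<rho>"
  shows "finite_dim scale V"
proof -
  obtain n R f where R: "root_system n R" and f: "f \<in> iso W (affine_weyl_group_of n R)"
    using assms(2) unfolding affine_weyl_def irreducible_root_system_def by blast
  have "group (affine_weyl_group_of n R)"
    unfolding affine_weyl_group_of_def
    using group.subgroup_imp_group[OF group_BijGroup group.generate_is_subgroup[OF group_BijGroup gens_BG(1)[OF R]]] .
  then show ?thesis
    using affine_weyl_group_finite_dim[OF R assms(3) irreducible_representation_iso[OF assms(1) _ f assms(4)]] by blast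
qed

section \<open>The classification\<close>

lemma (in irreducible_coxeter) trichotomy:
  assumes inf: "infinite (carrier W)" and not_affine: "\<not> affine_weyl W S"
  obtains \<mu> v where "indefinite_coxeter W S \<mu> v"
proof -
  have "S \<noteq> {}"
  proof
    assume "S = {}"
    then have "supp_on S = {0}" by (auto simp: supp_on_def)
    then have "finite (carrier W)" by (intro finite_if_positive_definite) (simp add: V_supp_on)
    then show False using inf by simp
  qed
  then obtain \<mu> v where v: "v \<in> V" "\<And>s. s \<in> S \<Longrightarrow> 0 < v s" "\<And>s. s \<in> S \<Longrightarrow> B v (\<alpha> s) = \<mu> * v s"
    and min: "\<And>x. x \<in> V \<Longrightarrow> \<mu> * N x \<le> B x x"
    and eq: "\<And>x. x \<in> V \<Longrightarrow> B x x = \<mu> * N x \<Longrightarrow> \<exists>c. x = c *\<^sub>R v"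
    by (rule perron_frobenius) blast
  consider "0 < \<mu>" | "\<mu> = 0" | "\<mu> < 0" by linarith
  then show ?thesis
  proof cases
    case 1
    have "0 < B x x" if "x \<in> V" "x \<noteq> 0" for x
    proof -
      have "0 < N x" using N_nonneg[of x] N_eq_0[OF that(1)] that(2) by linarith
      then have "0 < \<mu> * N x" using 1 by simp
      then show ?thesis using min[OF that(1)] by linarith
    qed
    then have "finite (carrier W)" by (rule finite_if_positive_definite)
    then show ?thesis using inf by simp
  next
    case 2
    interpret affine_coxeter W S v
      by unfold_locales (use v min eq inf 2 in \<open>simp_all\<close>)
    show ?thesis using affine_weyl not_affine by simp
  next
    case 3
    have "indefinite_coxeter W S \<mu> v"
      by unfold_locales (use v inf 3 in \<open>simp_all\<close>)
    then show ?thesis by (rule that)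
  qed
qed

theorem theorem1p1:
  fixes W :: "('w, 'b) monoid_scheme" and S :: "'w set"
    and scale :: "complex \<Rightarrow> 'v::ab_group_add \<Rightarrow> 'v"
  assumes "coxeter_group W S" and "irreducible_finite_rank W S"
    and "vector_space scale" and "\<not> finite_dim scale UNIV"
  shows "(\<forall>V \<rho>. irreducible_representation W scale V \<rho> \<longrightarrow> finite_dim scale V)
    \<longleftrightarrow> finite (carrier W) \<or> affine_weyl W S"
proof
  interpret irreducible_coxeter W S
    using assms(1,2) by unfold_locales (simp_all add: irreducible_finite_rank_def)
  show "finite (carrier W) \<or> affine_weyl W S"
    if fin: "\<forall>V \<rho>. irreducible_representation W scale V \<rho> \<longrightarrow> finite_dim scale V"
  proof (rule ccontr)
    assume "\<not> (finite (carrier W) \<or> affine_weyl W S)"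
    then obtain \<mu> v where "indefinite_coxeter W S \<mu> v" using trichotomy by blast
    from indefinite_coxeter.indefinite_irreducible_representation[OF this assms(3,4)] fin
    show False by blast
  qed
  have "group W" using assms(1) by (simp add: coxeter_group_def)
  then show "\<forall>V \<rho>. irreducible_representation W scale V \<rho> \<longrightarrow> finite_dim scale V"
    if "finite (carrier W) \<or> affine_weyl W S"
    using that finite_dim_if_finite affine_weyl_finite_dim assms(3) by blast
qed

end
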